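(* Let $\mu$ be a probability measure on $\mathbb R^n$ with finite second moment and finite Fisher information $I(\mu\mid\gamma)<\infty$. Then there exists a probability measure $\nu$ on $\mathbb R^n$ such that \[ \delta(\mu)\ge \frac1{15}\,\frac{\mathrm W_2^3(\mu,\nu*\gamma)}{\sqrt n}, \] and such that $\nu$ is a Dirac point mass whenever $\delta(\mu)=0$.
   Context: $\gamma$ is the standard Gaussian measure on $\mathbb R^n$, $\nu*\gamma$ the convolution. For $\mu$ with density $f=d\mu/d\gamma$: $I(\mu\mid\gamma)=\int|\nabla\log f|^2d\mu$, $H(\mu\mid\gamma)=\int\log f\,d\mu$, and $\delta(\mu)=\frac12 I(\mu\mid\gamma)-H(\mu\mid\gamma)$. $\mathrm W_2(\mu,\nu)=\inf\mathbb E[|X-Y|^2]^{1/2}$ over couplings $(X,Y)$ of $(\mu,\nu)$. *)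

theory Defs
  imports "HOL-Probability.Probability"
begin

definition gaussian :: "'a::euclidean_space measure" where
  "gaussian = density lborel
     (\<lambda>x. ennreal ((2 * pi) powr (- real DIM('a) / 2) * exp (- (norm x)\<^sup>2 / 2)))"

definition conv_measure :: "'a::euclidean_space measure \<Rightarrow> 'a measure \<Rightarrow> 'a measure" where
  "conv_measure M N = distr (M \<Otimes>\<^sub>M N) borel (\<lambda>(x, y). x + y)"

definition test_function :: "('a::euclidean_space \<Rightarrow> real) \<Rightarrow> bool" where
  "test_function \<phi> \<longleftrightarrow>
     (\<forall>x. \<phi> differentiable (at x)) \<and>
     (\<forall>b\<in>Basis. continuous_on UNIV (\<lambda>x. frechet_derivative \<phi> (at x) b)) \<and>
     compact (closure {x. \<phi> x \<noteq> 0})"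

definition weak_gradient :: "('a::euclidean_space \<Rightarrow> real) \<Rightarrow> ('a \<Rightarrow> 'a) \<Rightarrow> bool" where
  "weak_gradient f g \<longleftrightarrow>
     (\<forall>K. compact K \<longrightarrow> set_integrable lborel K f \<and> set_integrable lborel K g) \<and>
     (\<forall>\<phi>. test_function \<phi> \<longrightarrow> (\<forall>b\<in>Basis.
        (\<integral>x. f x * frechet_derivative \<phi> (at x) b \<partial>lborel) = - (\<integral>x. (g x \<bullet> b) * \<phi> x \<partial>lborel)))"

text \<open>Relative Fisher information I(mu|gamma) = int |grad log f|^2 dmu, f = dmu/dgamma,
  with grad f the weak gradient; +infinity if mu is not absolutely continuous w.r.t. gamma
  or f has no weak gradient.\<close>
definition fisher_information :: "'a::euclidean_space measure \<Rightarrow> ennreal" where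
  "fisher_information \<mu> =
     (if absolutely_continuous gaussian \<mu> \<and> sets \<mu> = sets borel then
        (INF g \<in> {g. weak_gradient (\<lambda>x. enn2real (RN_deriv gaussian \<mu> x)) g}.
           \<integral>\<^sup>+ x. ennreal ((norm (g x))\<^sup>2 / (enn2real (RN_deriv gaussian \<mu> x))\<^sup>2) \<partial>\<mu>)
      else \<top>)"

definition rel_entropy :: "'a::euclidean_space measure \<Rightarrow> real" where
  "rel_entropy \<mu> = KL_divergence (exp 1) gaussian \<mu>"

definition lsi_deficit :: "'a::euclidean_space measure \<Rightarrow> real" where
  "lsi_deficit \<mu> = enn2real (fisher_information \<mu>) / 2 - rel_entropy \<mu>"

definition couplings :: "'a::euclidean_space measure \<Rightarrow> 'a measure \<Rightarrow> ('a \<times> 'a) measure set" where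
  "couplings \<mu> \<nu> = {\<pi>. prob_space \<pi> \<and> sets \<pi> = sets (borel \<Otimes>\<^sub>M borel) \<and>
      distr \<pi> borel fst = \<mu> \<and> distr \<pi> borel snd = \<nu>}"

definition wasserstein2_sq :: "'a::euclidean_space measure \<Rightarrow> 'a measure \<Rightarrow> ennreal" where
  "wasserstein2_sq \<mu> \<nu> = (INF \<pi> \<in> couplings \<mu> \<nu>. \<integral>\<^sup>+ p. ennreal ((dist (fst p) (snd p))\<^sup>2) \<partial>\<pi>)"

end

(* Let f be the density of mu with respect to gamma, let (xi, z) be independent standard
   Gaussians, and fix c^2 + s^2 = 1; then y = c xi + s z is again standard Gaussian. Put
   K(xi, z) = f(c xi + s z), let u(xi) be the mean of K(xi, .) and m(xi) the mean of z under the
   probability density K(xi, .) / u(xi). The entropy splits as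
   H(mu) = E Ent(K(xi, .)) + Ent(u). The logarithmic Sobolev inequality bounds the first term by
   s^2/2 times the Fisher information; applied to u, whose gradient is (c/s) u m by Gaussian
   integration by parts, it bounds the second one by c^2/(2 s^2) E[u |m|^2]. Comparing
   K(xi, .) / u(xi) with the translated Gaussian N(m(xi), 1) instead of gamma saves exactly
   E[u |m|^2] / 2, so the mean relative entropy D of these conditional laws with respect to
   N(m(xi), 1) satisfies c^2 D <= s^2 delta(mu).
   By Talagrand's inequality (proved by a triangular, coordinatewise monotone transport)
   each conditional law is close to N(m(xi), 1), so mu is close to nu * gamma, where nu is the law
   of c xi + s m(xi) under u dgamma; the change of the noise from scale s to scale 1
   costs (1 - s)^2 n. The choice c^2 = (2 delta / n)^(1/3) gives the rate W^3 / sqrt n;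
   if delta >= n/2 then nu = mu already works. If delta = 0 then D = 0, and the conditional laws
   being Gaussian forces f to be an exponential function. *)
theory Submission
  imports Defs
begin

subsection \<open>The standard Gaussian measure\<close>

text \<open>The obstacle is regularity: \<open>f\<close> may vanish, has only a weak gradient, and
  no entropy is known to be finite in advance. Entropies are therefore \<open>ennreal\<close>
  integrals of a nonnegative integrand, and the Sobolev inequality is first proved for bounded
  functions with a quadratic Taylor bound, then carried over by cutoff, mollification and duality.
  The rotated mixture is chosen because the gradient of u is a mean of z: it needs no derivative of
  f, and the same mean measures the gain from recentring the conditional laws. After weighting the
  entropy splitting by s^2, the loss on u is c^2/2 times E[u |m|^2], exactly c^2 times that gain,
  and the two cancel. For the constant put t = c^2. The coupling costs at most 4 s^2 D + 2 (1 - s)^2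
  n, and D is at most s^2/t times the deficit. With t^3 = 2 delta/n both terms are of order n t^2;
  their sum is at most (1.6 sqrt(n) t)^2, and 1.6^3/15 is less than 1/2.\<close>

abbreviation std_normal :: "real measure" where
  "std_normal \<equiv> density lborel (\<lambda>x. ennreal (std_normal_density x))"

definition gauss_density :: "'a::euclidean_space \<Rightarrow> real" where
  "gauss_density x = (2 * pi) powr (- real DIM('a) / 2) * exp (- (norm x)\<^sup>2 / 2)"

lemma measurable_gauss_density [measurable]: "gauss_density \<in> borel_measurable borel"
  unfolding gauss_density_def by measurable

lemma gauss_density_pos: "gauss_density x > 0"
  by (simp add: gauss_density_def)

lemma gauss_density_nonneg [simp]: "0 \<le> gauss_density x"
  using gauss_density_pos[of x] by simp

lemma gaussian_eq: "gaussian = density lborel (\<lambda>x. ennreal (gauss_density x))"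
  by (simp add: gaussian_def gauss_density_def)

lemma sets_gaussian [simp, measurable_cong]: "sets (gaussian :: 'a::euclidean_space measure) = sets borel"
  by (simp add: gaussian_def)

lemma space_gaussian [simp]: "space (gaussian :: 'a::euclidean_space measure) = UNIV"
  by (simp add: gaussian_def)

lemma prob_space_std_normal: "prob_space std_normal"
  by (rule prob_space_normal_density) simp

lemma gauss_density_sum:
  "gauss_density (\<Sum>b\<in>Basis. f b *\<^sub>R b :: 'a::euclidean_space) = (\<Prod>b\<in>(Basis::'a set). std_normal_density (f b))"
proof -
  have n: "(norm (\<Sum>b\<in>Basis. f b *\<^sub>R b :: 'a))\<^sup>2 = (\<Sum>b\<in>(Basis::'a set). (f b)\<^sup>2)"
    by (subst power2_norm_eq_inner, subst euclidean_inner) (simp add: power2_eq_square)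
  have "(\<Prod>b\<in>(Basis::'a set). std_normal_density (f b)) = (1 / sqrt (2 * pi)) ^ DIM('a) * exp (\<Sum>b\<in>(Basis::'a set). - (f b)\<^sup>2 / 2)"
    unfolding std_normal_density_def prod.distrib exp_sum[OF finite_Basis] by simp
  also have "(1 / sqrt (2 * pi)) ^ DIM('a) = (2 * pi) powr (- real DIM('a) / 2)"
    by (simp add: powr_half_sqrt[symmetric] powr_minus_divide[symmetric] powr_powr powr_realpow[symmetric])
  also have "(\<Sum>b\<in>(Basis::'a set). - (f b)\<^sup>2 / 2) = - (norm (\<Sum>b\<in>Basis. f b *\<^sub>R b :: 'a))\<^sup>2 / 2"
    by (simp add: n sum_negf sum_divide_distrib)
  finally show ?thesis by (simp add: gauss_density_def)
qed

text \<open>The density factorises over coordinates. This form gives the marginals and moments, and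
  later lets a transport built one coordinate at a time act on the whole space.\<close>

lemma gaussian_eq_distr_PiM:
  "(gaussian :: 'a::euclidean_space measure) =
     distr (\<Pi>\<^sub>M b\<in>Basis. std_normal) borel (\<lambda>f. \<Sum>b\<in>Basis. f b *\<^sub>R b)"
proof -
  let ?Q = "\<Pi>\<^sub>M b\<in>(Basis::'a set). (lborel :: real measure)"
  let ?T = "\<lambda>f. \<Sum>b\<in>Basis. f b *\<^sub>R (b::'a)"
  interpret L: product_sigma_finite "\<lambda>b::'a. lborel :: real measure" ..
  interpret N: prob_space std_normal by (rule prob_space_std_normal)
  interpret S: product_sigma_finite "\<lambda>b::'a. std_normal" ..
  have dens: "density ?Q (\<lambda>f. ennreal (\<Prod>b\<in>Basis. std_normal_density (f b))) = (\<Pi>\<^sub>M b\<in>(Basis::'a set). std_normal)"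
  proof (rule S.PiM_eqI)
    show "finite (Basis::'a set)" by simp
    show "sets (density ?Q (\<lambda>f. ennreal (\<Prod>b\<in>Basis. std_normal_density (f b)))) = sets (\<Pi>\<^sub>M b\<in>(Basis::'a set). std_normal)"
      by (auto intro!: sets_PiM_cong)
  next
    fix A :: "'a \<Rightarrow> real set" assume A: "\<And>b. b \<in> Basis \<Longrightarrow> A b \<in> sets std_normal"
    then have [measurable]: "b \<in> Basis \<Longrightarrow> A b \<in> sets borel" for b by simp
    have "emeasure (density ?Q (\<lambda>f. ennreal (\<Prod>b\<in>Basis. std_normal_density (f b)))) (Pi\<^sub>E Basis A)
      = (\<integral>\<^sup>+ f. ennreal (\<Prod>b\<in>Basis. std_normal_density (f b)) * indicator (Pi\<^sub>E Basis A) f \<partial>?Q)"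
      by (subst emeasure_density) (auto intro!: sets_PiM_I_finite)
    also have "\<dots> = (\<integral>\<^sup>+ f. (\<Prod>b\<in>Basis. ennreal (std_normal_density (f b)) * indicator (A b) (f b)) \<partial>?Q)"
    proof (rule nn_integral_cong)
      fix f assume f: "f \<in> space ?Q"
      show "ennreal (\<Prod>b\<in>Basis. std_normal_density (f b)) * indicator (Pi\<^sub>E Basis A) f
        = (\<Prod>b\<in>Basis. ennreal (std_normal_density (f b)) * indicator (A b) (f b))"
      proof (cases "f \<in> Pi\<^sub>E Basis A")
        case True then show ?thesis by (auto simp: prod_ennreal[symmetric] PiE_iff intro!: prod.cong)
      next
        case False
        then obtain b where "b \<in> Basis" "f b \<notin> A b" using f by (auto simp: space_PiM PiE_iff)
        then show ?thesis using False by (auto intro!: prod_zero[symmetric] bexI[of _ b])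
      qed
    qed
    also have "\<dots> = (\<Prod>b\<in>Basis. \<integral>\<^sup>+ x. ennreal (std_normal_density x) * indicator (A b) x \<partial>lborel)"
      by (rule L.product_nn_integral_prod) auto
    also have "\<dots> = (\<Prod>b\<in>Basis. emeasure std_normal (A b))"
      by (intro prod.cong refl) (subst emeasure_density, auto)
    finally show "emeasure (density ?Q (\<lambda>f. ennreal (\<Prod>b\<in>Basis. std_normal_density (f b)))) (Pi\<^sub>E Basis A) = (\<Prod>b\<in>Basis. emeasure std_normal (A b))" .
  qed
  have "gaussian = density (distr ?Q borel ?T) (\<lambda>x. ennreal (gauss_density x))"
    unfolding gaussian_eq by (subst lborel_eq) simp
  also have "\<dots> = distr (density ?Q (\<lambda>f. ennreal (gauss_density (?T f)))) borel ?T"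
    by (rule density_distr) measurable
  also have "\<dots> = distr (\<Pi>\<^sub>M b\<in>Basis. std_normal) borel ?T"
    unfolding gauss_density_sum dens ..
  finally show ?thesis .
qed

lemma prob_space_gaussian: "prob_space (gaussian :: 'a::euclidean_space measure)"
proof -
  interpret N: prob_space std_normal by (rule prob_space_std_normal)
  interpret P: product_prob_space "\<lambda>b::'a. std_normal" "Basis :: 'a set" ..
  show ?thesis
    unfolding gaussian_eq_distr_PiM by (rule prob_space.prob_space_distr[OF P.prob_space_P]) auto
qed

interpretation gaussian: prob_space "gaussian :: 'a::euclidean_space measure"
  by (rule prob_space_gaussian)

interpretation gaussian_pair: pair_prob_space "gaussian :: 'a::euclidean_space measure" "gaussian :: 'a measure" ..

lemma emeasure_gaussian_UNIV [simp]: "emeasure (gaussian :: 'a::euclidean_space measure) UNIV = 1"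
  using gaussian.emeasure_space_1 by simp

lemma measure_gaussian_UNIV [simp]: "measure (gaussian :: 'a::euclidean_space measure) UNIV = 1"
  using gaussian.prob_space by simp

section \<open>Moments of the standard Gaussian\<close>

lemma gaussian_marginal:
  assumes "b \<in> (Basis::'a::euclidean_space set)"
  shows "distr (gaussian :: 'a measure) borel (\<lambda>x. x \<bullet> b) = std_normal"
proof -
  interpret N: prob_space std_normal by (rule prob_space_std_normal)
  interpret P: product_prob_space "\<lambda>b::'a. std_normal" "Basis :: 'a set" ..
  have "distr (gaussian :: 'a measure) borel (\<lambda>x. x \<bullet> b) = distr (\<Pi>\<^sub>M b\<in>(Basis::'a set). std_normal) borel (\<lambda>f. f b)"
    unfolding gaussian_eq_distr_PiM using assms
    by (subst distr_distr) (auto simp: comp_def inner_sum_left inner_Basis if_distrib sum.delta cong: if_cong intro!: distr_cong)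
  also have "\<dots> = distr (\<Pi>\<^sub>M b\<in>(Basis::'a set). std_normal) std_normal (\<lambda>f. f b)"
    by (intro distr_cong) auto
  also have "\<dots> = std_normal" using P.PiM_component[OF assms] by simp
  finally show ?thesis .
qed

lemma integrable_gaussian_coord_power:
  assumes "b \<in> (Basis::'a::euclidean_space set)"
  shows "integrable (gaussian :: 'a measure) (\<lambda>x. \<bar>x \<bullet> b\<bar> ^ k)"
proof -
  have "integrable std_normal (\<lambda>x. \<bar>x\<bar> ^ k)"
    using integrable_std_normal_moment_abs[of k]
    by (subst integrable_density) auto
  then have "integrable (distr (gaussian :: 'a measure) borel (\<lambda>x. x \<bullet> b)) (\<lambda>x. \<bar>x\<bar> ^ k)"
    by (simp only: gaussian_marginal[OF assms])
  then show ?thesis by (subst (asm) integrable_distr_eq) auto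
qed

lemma integrable_gaussian_norm_power: "integrable (gaussian :: 'a::euclidean_space measure) (\<lambda>x. norm x ^ k)"
proof (rule Bochner_Integration.integrable_bound)
  show "integrable (gaussian :: 'a measure) (\<lambda>x. real DIM('a) ^ k * (\<Sum>b\<in>Basis. \<bar>x \<bullet> b\<bar> ^ k))"
    by (auto intro!: integrable_gaussian_coord_power Bochner_Integration.integrable_sum)
  have "norm x ^ k \<le> real DIM('a) ^ k * (\<Sum>b\<in>Basis. \<bar>x \<bullet> b\<bar> ^ k)" for x :: 'a
  proof -
    \<comment> \<open>The l1 norm is at most the dimension times the largest coordinate, and the
      k-th power of that coordinate is one of the summands of the bound.\<close>
    define m where "m = Max ((\<lambda>b. \<bar>x \<bullet> b\<bar>) ` Basis)"
    have m: "\<bar>x \<bullet> b\<bar> \<le> m" if "b \<in> Basis" for b unfolding m_def using that by auto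
    have "m \<in> (\<lambda>b. \<bar>x \<bullet> b\<bar>) ` Basis" unfolding m_def by (intro Max_in) auto
    then obtain b where b: "b \<in> Basis" "m = \<bar>x \<bullet> b\<bar>" by auto
    have "norm x \<le> (\<Sum>b\<in>Basis. \<bar>x \<bullet> b\<bar>)" by (rule norm_le_l1)
    also have "\<dots> \<le> real DIM('a) * m" using sum_mono[of Basis "\<lambda>b. \<bar>x \<bullet> b\<bar>" "\<lambda>_. m"] m by simp
    finally have "norm x ^ k \<le> (real DIM('a) * m) ^ k" by (intro power_mono) auto
    also have "\<dots> = real DIM('a) ^ k * \<bar>x \<bullet> b\<bar> ^ k" using b by (simp add: power_mult_distrib)
    also have "\<dots> \<le> real DIM('a) ^ k * (\<Sum>b\<in>Basis. \<bar>x \<bullet> b\<bar> ^ k)"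
      using b by (intro mult_left_mono member_le_sum) auto
    finally show ?thesis .
  qed
  then show "AE x in gaussian. norm (norm (x::'a) ^ k) \<le> norm (real DIM('a) ^ k * (\<Sum>b\<in>Basis. \<bar>x \<bullet> b\<bar> ^ k))"
    by (auto simp: abs_mult sum_nonneg)
qed simp

lemma integral_gaussian_coord2:
  assumes bc: "b \<in> (Basis::'a::euclidean_space set)" "c \<in> Basis"
  shows "(\<integral>x. (x \<bullet> b) * (x \<bullet> c) \<partial>(gaussian :: 'a measure)) = (if b = c then 1 else 0)"
proof -
  interpret N: prob_space std_normal by (rule prob_space_std_normal)
  interpret P: product_prob_space "\<lambda>b::'a. std_normal" "Basis :: 'a set" ..
  have N1: "has_bochner_integral std_normal (\<lambda>x. x) 0"
    using std_normal_moment_odd[of 0] by (subst has_bochner_integral_density) auto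
  have N2: "has_bochner_integral std_normal (\<lambda>x. x^2) 1"
    using std_normal_moment_even[of 1] by (subst has_bochner_integral_density) (auto simp: numeral_eq_Suc)
  show ?thesis
  proof (cases "b = c")
    case True
    have "(\<integral>x. (x \<bullet> b)^2 \<partial>(gaussian :: 'a measure)) = (\<integral>x. x^2 \<partial>distr (gaussian :: 'a measure) borel (\<lambda>x. x \<bullet> b))"
      by (subst integral_distr) auto
    then show ?thesis using N2 True unfolding gaussian_marginal[OF bc(1)]
      by (simp add: has_bochner_integral_iff power2_eq_square)
  next
    case False
    \<comment> \<open>Written with the factor 1 at all other coordinates, the mixed moment becomes a
      full product, so it factorises and contains the vanishing mean at \<open>b\<close>.\<close>
    let ?f = "\<lambda>i::'a. if i = b \<or> i = c then (\<lambda>x::real. x) else (\<lambda>x. 1)"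
    have "(\<integral>x. (x \<bullet> b) * (x \<bullet> c) \<partial>(gaussian :: 'a measure)) = (\<integral>x. x b * x c \<partial>(\<Pi>\<^sub>M b\<in>(Basis::'a set). std_normal))"
      unfolding gaussian_eq_distr_PiM using bc
      by (subst integral_distr) (auto simp: inner_sum_left inner_Basis if_distrib sum.delta cong: if_cong)
    also have "\<dots> = (\<integral>x. (\<Prod>i\<in>Basis. ?f i (x i)) \<partial>(\<Pi>\<^sub>M b\<in>(Basis::'a set). std_normal))"
    proof (rule Bochner_Integration.integral_cong[OF refl])
      fix x :: "'a \<Rightarrow> real"
      have "(\<Prod>i\<in>Basis. ?f i (x i)) = (\<Prod>i\<in>{b,c}. ?f i (x i))"
        using bc by (intro prod.mono_neutral_right) auto
      also have "\<dots> = x b * x c" using False by auto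
      finally show "x b * x c = (\<Prod>i\<in>Basis. ?f i (x i))" by simp
    qed
    also have "\<dots> = (\<Prod>i\<in>Basis. \<integral>x. ?f i x \<partial>std_normal)"
      using N1 by (intro P.product_integral_prod) (auto simp: has_bochner_integral_iff)
    also have "\<dots> = 0" using N1 bc by (intro prod_zero) (auto simp: has_bochner_integral_iff)
    finally show ?thesis using False by simp
  qed
qed

lemma integrable_gaussian_coord2:
  "integrable (gaussian :: 'a::euclidean_space measure) (\<lambda>x. (x \<bullet> b) * (x \<bullet> c))"
proof (rule Bochner_Integration.integrable_bound)
  show "integrable (gaussian :: 'a measure) (\<lambda>x. norm b * norm c * norm x ^ 2)"
    by (intro integrable_mult_right integrable_gaussian_norm_power)
  have "\<bar>x \<bullet> b\<bar> * \<bar>x \<bullet> c\<bar> \<le> (norm x * norm b) * (norm x * norm c)" for x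
    by (intro mult_mono Cauchy_Schwarz_ineq2) auto
  then show "AE x in gaussian. norm ((x \<bullet> b) * (x \<bullet> c)) \<le> norm (norm b * norm c * norm x ^ 2)"
    by (auto simp: abs_mult power2_eq_square ac_simps)
qed simp

lemma integral_gaussian_inner_sq: "(\<integral>x. (w \<bullet> x)\<^sup>2 \<partial>(gaussian :: 'a::euclidean_space measure)) = (norm w)\<^sup>2"
proof -
  have "(\<integral>x. (w \<bullet> x)\<^sup>2 \<partial>(gaussian :: 'a measure)) = (\<integral>x. (\<Sum>b\<in>Basis. \<Sum>c\<in>Basis. (w \<bullet> b) * (w \<bullet> c) * ((x \<bullet> b) * (x \<bullet> c))) \<partial>(gaussian :: 'a measure))"
    by (intro Bochner_Integration.integral_cong refl)
      (subst euclidean_inner, simp add: power2_eq_square sum_product ac_simps)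
  also have "\<dots> = (\<Sum>b\<in>Basis. \<Sum>c\<in>Basis. (w \<bullet> b) * (w \<bullet> c) * (\<integral>x. (x \<bullet> b) * (x \<bullet> c) \<partial>(gaussian :: 'a measure)))"
    by (subst Bochner_Integration.integral_sum)
      (auto intro!: integrable_gaussian_coord2 sum.cong Bochner_Integration.integrable_sum simp: Bochner_Integration.integral_sum integrable_gaussian_coord2)
  also have "\<dots> = (\<Sum>b\<in>Basis. (w \<bullet> b) * (w \<bullet> b))"
    by (intro sum.cong refl) (simp add: integral_gaussian_coord2 sum.delta if_distrib cong: if_cong)
  also have "\<dots> = (norm w)\<^sup>2" by (simp add: power2_norm_eq_inner euclidean_inner[of w w])
  finally show ?thesis .
qed

lemma integral_gaussian_inner: "(\<integral>x. w \<bullet> x \<partial>(gaussian :: 'a::euclidean_space measure)) = 0"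
proof -
  have 1: "(\<integral>x. x \<bullet> b \<partial>(gaussian :: 'a measure)) = 0" if b: "b \<in> Basis" for b
  proof -
    have "(\<integral>x. x \<bullet> b \<partial>(gaussian :: 'a measure)) = (\<integral>x. x \<partial>distr (gaussian :: 'a measure) borel (\<lambda>x. x \<bullet> b))"
      by (subst integral_distr) auto
    also have "\<dots> = 0" unfolding gaussian_marginal[OF b]
      using std_normal_moment_odd[of 0] by (subst integral_density) (auto simp: has_bochner_integral_iff)
    finally show ?thesis .
  qed
  have i: "integrable (gaussian :: 'a measure) (\<lambda>x. x \<bullet> b)" if "b \<in> Basis" for b
    using integrable_gaussian_coord_power[OF that, of 1]
    by (subst (asm) power_one_right) (rule integrable_abs_cancel, auto)
  have "(\<integral>x. w \<bullet> x \<partial>(gaussian :: 'a measure)) = (\<integral>x. (\<Sum>b\<in>Basis. (w \<bullet> b) * (x \<bullet> b)) \<partial>(gaussian :: 'a measure))"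
    by (subst euclidean_inner) simp
  also have "\<dots> = 0" by (subst Bochner_Integration.integral_sum) (auto simp: i 1)
  finally show ?thesis .
qed

lemma integral_gaussian_norm_sq: "(\<integral>x. (norm x)\<^sup>2 \<partial>(gaussian :: 'a::euclidean_space measure)) = real DIM('a)"
proof -
  have "(\<integral>x. (norm x)\<^sup>2 \<partial>(gaussian :: 'a measure)) = (\<integral>x. (\<Sum>b\<in>Basis. (x \<bullet> b) * (x \<bullet> b)) \<partial>(gaussian :: 'a measure))"
    by (subst power2_norm_eq_inner, subst euclidean_inner) simp
  also have "\<dots> = (\<Sum>b\<in>(Basis::'a set). 1)"
    by (subst Bochner_Integration.integral_sum) (auto simp: integrable_gaussian_coord2 integral_gaussian_coord2)
  finally show ?thesis by simp
qed

subsection \<open>Rotation invariance\<close>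

lemma nn_integral_lborel_translate:
  assumes [measurable]: "f \<in> borel_measurable borel"
  shows "(\<integral>\<^sup>+ x. f (c + x) \<partial>lborel) = (\<integral>\<^sup>+ x. f x \<partial>(lborel :: 'a::euclidean_space measure))"
proof -
  have "(\<integral>\<^sup>+ x. f x \<partial>(lborel :: 'a measure)) = (\<integral>\<^sup>+ x. f x \<partial>distr lborel borel ((+) c))"
    by (simp only: lborel_distr_plus)
  also have "\<dots> = (\<integral>\<^sup>+ x. f (c + x) \<partial>lborel)" by (subst nn_integral_distr) auto
  finally show ?thesis by simp
qed

text \<open>A plane rotation is a composition of three shears. A shear moves one variable by a
  multiple of the other, so translation invariance on each slice and Fubini suffice, without
  determinants.\<close>

lemma nn_integral_lborel_shear:
  fixes H :: "'a::euclidean_space \<times> 'a \<Rightarrow> ennreal"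
  assumes [measurable]: "H \<in> borel_measurable (borel \<Otimes>\<^sub>M borel)"
  shows "(\<integral>\<^sup>+ x. \<integral>\<^sup>+ z. H (x + a *\<^sub>R z, z) \<partial>lborel \<partial>lborel) = (\<integral>\<^sup>+ x. \<integral>\<^sup>+ z. H (x, z) \<partial>lborel \<partial>lborel)"
    and "(\<integral>\<^sup>+ x. \<integral>\<^sup>+ z. H (x, z + a *\<^sub>R x) \<partial>lborel \<partial>lborel) = (\<integral>\<^sup>+ x. \<integral>\<^sup>+ z. H (x, z) \<partial>lborel \<partial>lborel)"
proof -
  have "(\<integral>\<^sup>+ x. \<integral>\<^sup>+ z. H (x + a *\<^sub>R z, z) \<partial>lborel \<partial>lborel) = (\<integral>\<^sup>+ z. \<integral>\<^sup>+ x. H (x + a *\<^sub>R z, z) \<partial>lborel \<partial>lborel)"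
    by (rule lborel_pair.Fubini') measurable
  also have "\<dots> = (\<integral>\<^sup>+ z. \<integral>\<^sup>+ x. H (x, z) \<partial>lborel \<partial>lborel)"
    using nn_integral_lborel_translate[of "\<lambda>x. H (x, z)" "a *\<^sub>R z" for z] by (simp add: add.commute)
  also have "\<dots> = (\<integral>\<^sup>+ x. \<integral>\<^sup>+ z. H (x, z) \<partial>lborel \<partial>lborel)"
    by (rule lborel_pair.Fubini'[symmetric]) measurable
  finally show "(\<integral>\<^sup>+ x. \<integral>\<^sup>+ z. H (x + a *\<^sub>R z, z) \<partial>lborel \<partial>lborel) = (\<integral>\<^sup>+ x. \<integral>\<^sup>+ z. H (x, z) \<partial>lborel \<partial>lborel)" .
  show "(\<integral>\<^sup>+ x. \<integral>\<^sup>+ z. H (x, z + a *\<^sub>R x) \<partial>lborel \<partial>lborel) = (\<integral>\<^sup>+ x. \<integral>\<^sup>+ z. H (x, z) \<partial>lborel \<partial>lborel)"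
    using nn_integral_lborel_translate[of "\<lambda>z. H (x, z)" "a *\<^sub>R x" for x] by (simp add: add.commute)
qed

lemma nn_integral_gaussian:
  assumes [measurable]: "f \<in> borel_measurable borel"
  shows "(\<integral>\<^sup>+ x. f x \<partial>gaussian) = (\<integral>\<^sup>+ x. ennreal (gauss_density x) * f x \<partial>(lborel :: 'a::euclidean_space measure))"
  unfolding gaussian_eq by (subst nn_integral_density) auto

lemma nn_integral_gaussian_pair:
  assumes [measurable]: "H \<in> borel_measurable (borel \<Otimes>\<^sub>M borel)"
  shows "(\<integral>\<^sup>+ x. \<integral>\<^sup>+ z. H (x, z) \<partial>gaussian \<partial>(gaussian :: 'a::euclidean_space measure)) =
    (\<integral>\<^sup>+ x. \<integral>\<^sup>+ z. ennreal (gauss_density x) * ennreal (gauss_density z) * H (x, z) \<partial>lborel \<partial>(lborel :: 'a::euclidean_space measure))"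
  by (simp add: nn_integral_gaussian nn_integral_cmult[symmetric] mult.assoc)

lemma nn_integral_gaussian_rotate:
  fixes H :: "'a::euclidean_space \<times> 'a \<Rightarrow> ennreal"
  assumes [measurable]: "H \<in> borel_measurable (borel \<Otimes>\<^sub>M borel)"
    and cs: "c\<^sup>2 + s\<^sup>2 = 1" "s \<noteq> 0"
  shows "(\<integral>\<^sup>+ x. \<integral>\<^sup>+ z. H (c *\<^sub>R x + s *\<^sub>R z, c *\<^sub>R z - s *\<^sub>R x) \<partial>gaussian \<partial>gaussian)
    = (\<integral>\<^sup>+ x. \<integral>\<^sup>+ z. H (x, z) \<partial>gaussian \<partial>gaussian)"
proof -
  define G where "G = (\<lambda>(x::'a, z::'a). ennreal (gauss_density x) * ennreal (gauss_density z) * H (x, z))"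
  have [measurable]: "G \<in> borel_measurable (borel \<Otimes>\<^sub>M borel)" unfolding G_def by measurable
  \<comment> \<open>This is the tangent of half the rotation angle: the rotation equals a shear by
    \<open>a\<close> in the first variable, one by \<open>- s\<close> in the second, and again one
    by \<open>a\<close> in the first.\<close>
  define a where "a = (1 - c) / s"
  have a1: "1 - a * s = c" and a2: "a + a * c = s"
    using cs by (auto simp: a_def field_simps power2_eq_square)
  have nr: "(norm (c *\<^sub>R x + s *\<^sub>R z))\<^sup>2 + (norm (c *\<^sub>R z - s *\<^sub>R x))\<^sup>2 = (norm x)\<^sup>2 + (norm z)\<^sup>2" for x z :: 'a
  proof -
    have "(norm (c *\<^sub>R x + s *\<^sub>R z))\<^sup>2 + (norm (c *\<^sub>R z - s *\<^sub>R x))\<^sup>2 = (c\<^sup>2 + s\<^sup>2) * (x \<bullet> x) + (c\<^sup>2 + s\<^sup>2) * (z \<bullet> z)"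
      unfolding power2_norm_eq_inner
      by (simp add: inner_add_left inner_add_right inner_diff_left inner_diff_right algebra_simps power2_eq_square inner_commute[of z x])
    then show ?thesis by (simp add: cs power2_norm_eq_inner)
  qed
  have gd: "gauss_density (c *\<^sub>R x + s *\<^sub>R z) * gauss_density (c *\<^sub>R z - s *\<^sub>R x) = gauss_density x * gauss_density z" for x z :: 'a
  proof -
    have e: "exp (- (norm x)\<^sup>2 / 2) * exp (- (norm z)\<^sup>2 / 2) = exp (- ((norm x)\<^sup>2 + (norm z)\<^sup>2) / 2)" for x z :: 'a
      by (simp add: mult_exp_exp field_simps)
    have "gauss_density x * gauss_density z = ((2 * pi) powr (- real DIM('a) / 2))\<^sup>2 * exp (- ((norm x)\<^sup>2 + (norm z)\<^sup>2) / 2)" for x z :: 'a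
      unfolding e[symmetric] by (simp add: gauss_density_def power2_eq_square)
    then show ?thesis by (simp only: nr)
  qed
  have "(\<integral>\<^sup>+ x. \<integral>\<^sup>+ z. H (c *\<^sub>R x + s *\<^sub>R z, c *\<^sub>R z - s *\<^sub>R x) \<partial>gaussian \<partial>gaussian)
    = (\<integral>\<^sup>+ x. \<integral>\<^sup>+ z. G (c *\<^sub>R x + s *\<^sub>R z, c *\<^sub>R z - s *\<^sub>R x) \<partial>lborel \<partial>lborel)"
    using nn_integral_gaussian_pair[of "\<lambda>(x, z). H (c *\<^sub>R x + s *\<^sub>R z, c *\<^sub>R z - s *\<^sub>R x)"]
    by (simp add: G_def ennreal_mult[symmetric] gd)
  also have "\<dots> = (\<integral>\<^sup>+ x. \<integral>\<^sup>+ z. (\<lambda>(x, z). G (c *\<^sub>R (x - a *\<^sub>R z) + s *\<^sub>R z, c *\<^sub>R z - s *\<^sub>R (x - a *\<^sub>R z))) (x + a *\<^sub>R z, z) \<partial>lborel \<partial>lborel)"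
    by simp
  also have "\<dots> = (\<integral>\<^sup>+ x. \<integral>\<^sup>+ z. (\<lambda>(x, z). G (c *\<^sub>R (x - a *\<^sub>R z) + s *\<^sub>R z, c *\<^sub>R z - s *\<^sub>R (x - a *\<^sub>R z))) (x, z) \<partial>lborel \<partial>lborel)"
    by (rule nn_integral_lborel_shear) measurable
  also have "\<dots> = (\<integral>\<^sup>+ x. \<integral>\<^sup>+ z. (\<lambda>(x, z). G (x + a *\<^sub>R z, z)) (x, z + (- s) *\<^sub>R x) \<partial>lborel \<partial>lborel)"
  proof (intro nn_integral_cong, simp)
    fix x z :: 'a
    have 1: "c *\<^sub>R (x - a *\<^sub>R z) + s *\<^sub>R z = x + a *\<^sub>R (z - s *\<^sub>R x)"
    proof -
      have "c *\<^sub>R (x - a *\<^sub>R z) + s *\<^sub>R z = c *\<^sub>R x + (s - a * c) *\<^sub>R z" by (simp add: algebra_simps)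
      also have "s - a * c = a" using a2 by simp
      also have "c *\<^sub>R x + a *\<^sub>R z = (1 - a * s) *\<^sub>R x + a *\<^sub>R z" by (simp only: a1)
      finally show ?thesis by (simp add: algebra_simps)
    qed
    have 2: "c *\<^sub>R z - s *\<^sub>R (x - a *\<^sub>R z) = z - s *\<^sub>R x"
    proof -
      have "c *\<^sub>R z - s *\<^sub>R (x - a *\<^sub>R z) = (c + a * s) *\<^sub>R z - s *\<^sub>R x" by (simp add: algebra_simps)
      also have "c + a * s = 1" using a1 by simp
      finally show ?thesis by simp
    qed
    show "G (c *\<^sub>R (x - a *\<^sub>R z) + s *\<^sub>R z, c *\<^sub>R z - s *\<^sub>R (x - a *\<^sub>R z)) = G (x + a *\<^sub>R (z - s *\<^sub>R x), z - s *\<^sub>R x)"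
      by (simp only: 1 2)
  qed
  also have "\<dots> = (\<integral>\<^sup>+ x. \<integral>\<^sup>+ z. (\<lambda>(x, z). G (x + a *\<^sub>R z, z)) (x, z) \<partial>lborel \<partial>lborel)"
    by (rule nn_integral_lborel_shear) measurable
  also have "\<dots> = (\<integral>\<^sup>+ x. \<integral>\<^sup>+ z. G (x, z) \<partial>lborel \<partial>lborel)"
    using nn_integral_lborel_shear(1)[of G a] by simp
  also have "\<dots> = (\<integral>\<^sup>+ x. \<integral>\<^sup>+ z. H (x, z) \<partial>gaussian \<partial>gaussian)"
    using nn_integral_gaussian_pair[of H] by (simp add: G_def)
  finally show ?thesis .
qed

lemma distr_gaussian_rotate:
  assumes cs: "c\<^sup>2 + s\<^sup>2 = 1" "s \<noteq> 0"
  shows "distr (gaussian \<Otimes>\<^sub>M gaussian) (borel \<Otimes>\<^sub>M borel) (\<lambda>(x, z). (c *\<^sub>R x + s *\<^sub>R z, c *\<^sub>R z - s *\<^sub>R x))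
    = (gaussian \<Otimes>\<^sub>M gaussian :: ('a::euclidean_space \<times> 'a) measure)"
proof (rule measure_eqI)
  show e: "sets (distr (gaussian \<Otimes>\<^sub>M gaussian) (borel \<Otimes>\<^sub>M borel) (\<lambda>(x, z). (c *\<^sub>R x + s *\<^sub>R z, c *\<^sub>R z - s *\<^sub>R x)))
    = sets (gaussian \<Otimes>\<^sub>M gaussian :: ('a \<times> 'a) measure)" by (simp cong: sets_pair_measure_cong)
  fix A assume "A \<in> sets (distr (gaussian \<Otimes>\<^sub>M gaussian) (borel \<Otimes>\<^sub>M borel) (\<lambda>(x, z). (c *\<^sub>R x + s *\<^sub>R z, c *\<^sub>R z - s *\<^sub>R x :: 'a)))"
  then have A[measurable]: "A \<in> sets (borel \<Otimes>\<^sub>M borel)" by simp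
  let ?R = "\<lambda>(x, z). (c *\<^sub>R x + s *\<^sub>R z, c *\<^sub>R z - s *\<^sub>R x :: 'a)"
  have "emeasure (distr (gaussian \<Otimes>\<^sub>M gaussian) (borel \<Otimes>\<^sub>M borel) ?R) A
    = (\<integral>\<^sup>+ p. indicator A p \<partial>distr (gaussian \<Otimes>\<^sub>M gaussian) (borel \<Otimes>\<^sub>M borel) ?R)" by simp
  also have "\<dots> = (\<integral>\<^sup>+ p. indicator A (?R p) \<partial>(gaussian \<Otimes>\<^sub>M gaussian))"
    by (subst nn_integral_distr) (auto simp: split_beta')
  also have "\<dots> = (\<integral>\<^sup>+ x. \<integral>\<^sup>+ z. indicator A (c *\<^sub>R x + s *\<^sub>R z, c *\<^sub>R z - s *\<^sub>R x) \<partial>gaussian \<partial>gaussian)"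
    by (subst gaussian.nn_integral_fst[symmetric]) (auto simp: split_beta')
  also have "\<dots> = (\<integral>\<^sup>+ x. \<integral>\<^sup>+ z. indicator A (x, z) \<partial>gaussian \<partial>gaussian)"
    by (rule nn_integral_gaussian_rotate) (use cs in auto)
  also have "\<dots> = emeasure (gaussian \<Otimes>\<^sub>M gaussian) A"
    by (subst gaussian.nn_integral_fst) (auto)
  finally show "emeasure (distr (gaussian \<Otimes>\<^sub>M gaussian) (borel \<Otimes>\<^sub>M borel) ?R) A = emeasure (gaussian \<Otimes>\<^sub>M gaussian) A" .
qed

lemma nn_integral_gaussian_conv:
  fixes h :: "'a::euclidean_space \<Rightarrow> ennreal"
  assumes [measurable]: "h \<in> borel_measurable borel" and cs: "c\<^sup>2 + s\<^sup>2 = 1"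
  shows "(\<integral>\<^sup>+ x. \<integral>\<^sup>+ z. h (c *\<^sub>R x + s *\<^sub>R z) \<partial>gaussian \<partial>gaussian) = (\<integral>\<^sup>+ x. h x \<partial>gaussian)"
proof (cases "s = 0")
  case False
  have "(\<integral>\<^sup>+ x. \<integral>\<^sup>+ z. h (c *\<^sub>R x + s *\<^sub>R z) \<partial>gaussian \<partial>gaussian) = (\<integral>\<^sup>+ x. \<integral>\<^sup>+ z. h x \<partial>(gaussian::'a measure) \<partial>gaussian)"
    using nn_integral_gaussian_rotate[of "\<lambda>(x, z). h x" c s] cs False by simp
  then show ?thesis by (simp add: gaussian.emeasure_space_1)
next
  case True
  \<comment> \<open>The shear parameter does not exist for \<open>s = 0\<close>, but then only the
    identity or the reflection remains, and the density is even.\<close>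
  then have "c = 1 \<or> c = -1" using cs by (simp add: power2_eq_1_iff)
  moreover have "(\<integral>\<^sup>+ x. h (- x) \<partial>gaussian) = (\<integral>\<^sup>+ x. h x \<partial>gaussian)"
  proof -
    have u: "distr lborel borel uminus = (lborel :: 'a measure)"
      using lborel_affine[of "- 1" "0 :: 'a"] by (simp add: density_1 fun_eq_iff[symmetric] cong: distr_cong)
    have "(\<integral>\<^sup>+ x. ennreal (gauss_density x) * h x \<partial>distr lborel borel uminus) = (\<integral>\<^sup>+ x. ennreal (gauss_density x) * h (- x) \<partial>lborel)"
      by (subst nn_integral_distr) (auto simp: gauss_density_def)
    then show ?thesis by (simp add: nn_integral_gaussian u)
  qed
  ultimately show ?thesis using True by (auto simp: gaussian.emeasure_space_1)
qed

lemma distr_gaussian_conv: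
  assumes cs: "c\<^sup>2 + s\<^sup>2 = 1"
  shows "distr (gaussian \<Otimes>\<^sub>M gaussian) borel (\<lambda>(x, z). c *\<^sub>R x + s *\<^sub>R z) = (gaussian :: 'a::euclidean_space measure)"
proof (rule measure_eqI)
  fix A assume "A \<in> sets (distr (gaussian \<Otimes>\<^sub>M gaussian) borel (\<lambda>(x, z). c *\<^sub>R x + s *\<^sub>R z :: 'a))"
  then have A[measurable]: "A \<in> sets borel" by simp
  let ?R = "\<lambda>(x, z). c *\<^sub>R x + s *\<^sub>R z :: 'a"
  have "emeasure (distr (gaussian \<Otimes>\<^sub>M gaussian) borel ?R) A
    = (\<integral>\<^sup>+ p. indicator A p \<partial>distr (gaussian \<Otimes>\<^sub>M gaussian) borel ?R)" by simp
  also have "\<dots> = (\<integral>\<^sup>+ p. indicator A (?R p) \<partial>(gaussian \<Otimes>\<^sub>M gaussian))"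
    by (subst nn_integral_distr) (auto simp: split_beta')
  also have "\<dots> = (\<integral>\<^sup>+ x. \<integral>\<^sup>+ z. indicator A (c *\<^sub>R x + s *\<^sub>R z) \<partial>gaussian \<partial>gaussian)"
    by (subst gaussian.nn_integral_fst[symmetric]) (auto simp: split_beta')
  also have "\<dots> = emeasure gaussian A"
    by (subst nn_integral_gaussian_conv) (use cs in auto)
  finally show "emeasure (distr (gaussian \<Otimes>\<^sub>M gaussian) borel ?R) A = emeasure gaussian A" .
qed simp

subsection \<open>The entropy integrand\<close>

text \<open>The Bregman divergence of \<open>u * ln u\<close>. If \<open>a\<close> is the mean of
  \<open>u\<close>, the terms \<open>- u + a\<close> cancel after integration and the entropy
  remains. Being nonnegative, it can be integrated in \<open>ennreal\<close> before anything is
  known to be finite. At \<open>u = 0\<close> the product is 0, so the value \<open>a\<close> is the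
  continuous extension.\<close>

definition kent :: "real \<Rightarrow> real \<Rightarrow> real" where
  "kent u a = u * ln (u / a) - u + a"

lemma measurable_kent' [measurable (raw)]:
  assumes [measurable]: "f \<in> borel_measurable M" "g \<in> borel_measurable M"
  shows "(\<lambda>x. kent (f x) (g x)) \<in> borel_measurable M"
  unfolding kent_def by measurable

lemma kent_0 [simp]: "kent 0 a = a"
  by (simp add: kent_def)

lemma kent_nonneg:
  assumes "u \<ge> 0" "a > 0"
  shows "kent u a \<ge> 0"
proof (cases "u = 0")
  case False
  then have u: "u > 0" using assms by simp
  have "ln (a / u) \<le> a / u - 1" using u assms by (intro ln_le_minus_one) auto
  then have "u * ln (a / u) \<le> a - u" using u by (simp add: field_simps)
  moreover have "ln (u / a) = - ln (a / u)" using u assms by (simp add: ln_div)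
  ultimately show ?thesis by (simp add: kent_def)
qed (use assms in auto)

lemma kent_eq_0D:
  assumes "u \<ge> 0" "a > 0" "kent u a = 0"
  shows "u = a"
proof (cases "u = 0")
  case False
  then have u: "u > 0" using assms by simp
  have "ln (u / a) = - ln (a / u)" using u assms by (simp add: ln_div)
  then have "ln (a / u) = a / u - 1" using assms u by (simp add: kent_def field_simps)
  then have "a / u = 1" using u assms by (intro ln_eq_minus_one) auto
  then show ?thesis using u by simp
qed (use assms in auto)

lemma kent_scale: "c > 0 \<Longrightarrow> kent (c * u) (c * a) = c * kent u a"
  by (simp add: kent_def algebra_simps)

text \<open>A change of reference value adds only terms affine in \<open>u\<close>. The entropy
  chain rule and the comparison with translated Gaussians are integrated forms of this
  identity.\<close>

lemma kent_change:
  assumes "u \<ge> 0" "a > 0" "b > 0"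
  shows "kent u a = kent u b + (u * ln (b / a) - b + a)"
proof (cases "u = 0")
  case False
  then show ?thesis using assms by (simp add: kent_def ln_div algebra_simps)
qed auto

text \<open>The Fenchel-Young inequality, read off from nonnegativity of the divergence from
  \<open>a * exp h\<close>. Its left side is affine in \<open>u\<close> for fixed \<open>h\<close>,
  which is what allows limits of densities later on.\<close>

lemma kent_dual:
  assumes "u \<ge> 0" "a > 0"
  shows "u * h - a * exp h + a \<le> kent u a"
proof -
  have "0 \<le> kent u (a * exp h)" by (rule kent_nonneg) (use assms in auto)
  moreover have "kent u a = kent u (a * exp h) + (u * h - a * exp h + a)"
    using assms by (subst kent_change[of u a "a * exp h"]) auto
  ultimately show ?thesis by simp
qed

text \<open>Both sides vanish at 0, and the sign of the derivative of their difference decides. For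
  negative \<open>y\<close> the cubic term is there to absorb the error in
  \<open>ln (1 + x) \<ge> x - x\<^sup>2 / (1 + x)\<close>, with \<open>q\<close> keeping
  \<open>1 + x\<close> away from 0.\<close>

lemma one_plus_mult_ln_le:
  fixes y q :: real
  assumes q: "0 < q" "q \<le> 1" "q \<le> 1 + y"
  shows "(1 + y) * ln (1 + y) - y \<le> y\<^sup>2 / 2 + \<bar>y\<bar> ^ 3 / (3 * q)"
proof (cases "y \<ge> 0")
  case True
  define g where "g = (\<lambda>y::real. y\<^sup>2 / 2 - ((1 + y) * ln (1 + y) - y))"
  have "g 0 \<le> g y"
  proof (rule DERIV_nonneg_imp_nondecreasing[OF True])
    fix x :: real assume x: "0 \<le> x" "x \<le> y"
    have "(g has_real_derivative (x - ln (1 + x))) (at x)"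
      unfolding g_def using x by (auto intro!: derivative_eq_intros)
    moreover have "ln (1 + x) \<le> x" using x ln_add_one_self_le_self by simp
    ultimately show "\<exists>d. (g has_real_derivative d) (at x) \<and> 0 \<le> d" by (intro exI[of _ "x - ln (1 + x)"]) auto
  qed
  moreover have "0 \<le> \<bar>y\<bar> ^ 3 / (3 * q)" using q by simp
  ultimately show ?thesis by (simp add: g_def)
next
  case False
  define g where "g = (\<lambda>y::real. y\<^sup>2 / 2 - y ^ 3 / (3 * q) - ((1 + y) * ln (1 + y) - y))"
  have "g y \<ge> g 0"
  proof (rule DERIV_nonpos_imp_nonincreasing[of y 0])
    show "y \<le> 0" using False by simp
    fix x :: real assume x: "y \<le> x" "x \<le> 0"
    then have x1: "1 + x \<ge> q" using q by simp
    have d: "(g has_real_derivative (x - x\<^sup>2 / q - ln (1 + x))) (at x)"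
      unfolding g_def using x1 q by (auto intro!: derivative_eq_intros simp: power2_eq_square)
    have "ln (1 / (1 + x)) \<le> 1 / (1 + x) - 1" using x1 q by (intro ln_le_minus_one) auto
    then have "ln (1 + x) \<ge> 1 - 1 / (1 + x)" using x1 q by (simp add: ln_div)
    also have "1 - 1 / (1 + x) = x - x\<^sup>2 / (1 + x)" using x1 q by (simp add: field_simps power2_eq_square)
    finally have "ln (1 + x) \<ge> x - x\<^sup>2 / (1 + x)" .
    moreover have "x\<^sup>2 / (1 + x) \<le> x\<^sup>2 / q" using x1 q by (intro divide_left_mono) auto
    ultimately have "x - x\<^sup>2 / q - ln (1 + x) \<le> 0" by simp
    then show "\<exists>d. (g has_real_derivative d) (at x) \<and> d \<le> 0" using d by blast
  qed
  moreover have "\<bar>y\<bar> ^ 3 = - (y ^ 3)" using False by (simp add: power3_eq_cube)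
  ultimately show ?thesis by (simp add: g_def)
qed

text \<open>Rescaling by \<open>a\<close> reduces this to the previous expansion at
  \<open>y = (b - a) / a\<close>. The quadratic term keeps the exact denominator \<open>a\<close>,
  because it turns into the Fisher information; the cubic term only needs a constant uniform in
  \<open>a\<close> and \<open>b\<close>.\<close>

lemma kent_le:
  assumes "0 < e" "e \<le> a" "a \<le> C" "e \<le> b"
  shows "kent b a \<le> (b - a)\<^sup>2 / (2 * a) + C / (3 * e ^ 3) * \<bar>b - a\<bar> ^ 3"
proof -
  define y where "y = (b - a) / a"
  have a: "a > 0" and C: "C > 0" using assms by auto
  have b_eq: "b = a * (1 + y)" using a by (simp add: y_def field_simps)
  have "e / C \<le> 1 + y"
  proof -
    have "e / C \<le> e / a" using assms a by (intro divide_left_mono) auto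
    also have "\<dots> \<le> b / a" using assms a by (intro divide_right_mono) auto
    also have "\<dots> = 1 + y" using a by (simp add: y_def field_simps)
    finally show ?thesis .
  qed
  then have "(1 + y) * ln (1 + y) - y \<le> y\<^sup>2 / 2 + \<bar>y\<bar> ^ 3 / (3 * (e / C))"
    using assms C by (intro one_plus_mult_ln_le) auto
  then have "a * ((1 + y) * ln (1 + y) - y) \<le> a * (y\<^sup>2 / 2 + \<bar>y\<bar> ^ 3 / (3 * (e / C)))"
    using a by (intro mult_left_mono) auto
  also have "a * ((1 + y) * ln (1 + y) - y) = kent b a"
  proof -
    have "b / a = 1 + y" using a by (simp add: b_eq)
    then show ?thesis by (simp add: kent_def b_eq algebra_simps)
  qed
  also have "a * (y\<^sup>2 / 2 + \<bar>y\<bar> ^ 3 / (3 * (e / C))) = (b - a)\<^sup>2 / (2 * a) + C / (3 * e * a\<^sup>2) * \<bar>b - a\<bar> ^ 3"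
  proof -
    have "a * y\<^sup>2 = (b - a)\<^sup>2 / a" using a by (simp add: y_def power_divide power2_eq_square)
    moreover have "a * \<bar>y\<bar> ^ 3 = \<bar>b - a\<bar> ^ 3 / a\<^sup>2" using a by (simp add: y_def abs_divide power_divide power2_eq_square power3_eq_cube)
    moreover have "a * (y\<^sup>2 / 2 + \<bar>y\<bar> ^ 3 / (3 * (e / C))) = (a * y\<^sup>2) / 2 + (a * \<bar>y\<bar> ^ 3) * C / (3 * e)"
      by (simp add: distrib_left)
    ultimately show ?thesis by (simp add: ac_simps)
  qed
  also have "\<dots> \<le> (b - a)\<^sup>2 / (2 * a) + C / (3 * e * e\<^sup>2) * \<bar>b - a\<bar> ^ 3"
  proof (intro add_left_mono mult_right_mono)
    have "e\<^sup>2 \<le> a\<^sup>2" using assms by (intro power_mono) auto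
    then have "3 * e * e\<^sup>2 \<le> 3 * e * a\<^sup>2" using assms by (intro mult_left_mono) auto
    then show "C / (3 * e * a\<^sup>2) \<le> C / (3 * e * e\<^sup>2)" using assms C a by (intro divide_left_mono) auto
  qed auto
  finally show ?thesis by (simp add: power2_eq_square power3_eq_cube mult.assoc)
qed

text \<open>Since \<open>b\<close> is the mean of \<open>u\<close>, the affine term of
  \<open>kent_change\<close> integrates to \<open>kent b a\<close>. The two divergences differ by an
  integrable function, so they are integrable together or both integrals are infinite.\<close>

lemma nn_integral_kent_chain:
  assumes M: "prob_space M" and u: "integrable M u" "\<And>x. x \<in> space M \<Longrightarrow> u x \<ge> 0"
    and b: "b = (\<integral>x. u x \<partial>M)" "b > 0" and a: "a > 0"
  shows "(\<integral>\<^sup>+ x. ennreal (kent (u x) a) \<partial>M) = (\<integral>\<^sup>+ x. ennreal (kent (u x) b) \<partial>M) + ennreal (kent b a)"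
proof -
  interpret prob_space M by fact
  have [measurable]: "u \<in> borel_measurable M" using u by auto
  let ?l = "\<lambda>x. u x * ln (b / a) - b + a"
  have li: "integrable M ?l" using u by simp
  have ll: "(\<integral>x. ?l x \<partial>M) = kent b a" using u b by (simp add: prob_space kent_def)
  have ch: "kent (u x) a = kent (u x) b + ?l x" if "x \<in> space M" for x using kent_change u(2)[OF that] a b by blast
  have nn: "AE x in M. 0 \<le> kent (u x) c" if "c > 0" for c using kent_nonneg u that by auto
  have ni: "(\<integral>\<^sup>+ x. ennreal (g x) \<partial>M) = \<infinity>"
    if "AE x in M. 0 \<le> g x" "\<not> integrable M g" "g \<in> borel_measurable M" for g
    using integrableI_nonneg[of g M] that by (metis infinity_ennreal_def top.not_eq_extremum)
  show ?thesis
  proof (cases "integrable M (\<lambda>x. kent (u x) b)")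
    case True
    have ia: "integrable M (\<lambda>x. kent (u x) a)"
      using Bochner_Integration.integrable_add[OF True li] ch by (subst Bochner_Integration.integrable_cong[OF refl]) auto
    have "(\<integral>x. kent (u x) a \<partial>M) = (\<integral>x. kent (u x) b + ?l x \<partial>M)"
      by (intro Bochner_Integration.integral_cong refl) (use ch in auto)
    also have "\<dots> = (\<integral>x. kent (u x) b \<partial>M) + kent b a"
      using True li ll by (subst Bochner_Integration.integral_add) auto
    finally show ?thesis
      using True ia nn a b kent_nonneg[of b a]
      by (subst (1 2) nn_integral_eq_integral) (auto simp: ennreal_plus[symmetric] integral_nonneg_AE simp del: ennreal_plus)
  next
    case False
    have "\<not> integrable M (\<lambda>x. kent (u x) a)"
    proof
      assume "integrable M (\<lambda>x. kent (u x) a)"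
      from Bochner_Integration.integrable_diff[OF this li] have "integrable M (\<lambda>x. kent (u x) b)"
        using ch by (subst Bochner_Integration.integrable_cong[OF refl, of _ _ "\<lambda>x. kent (u x) a - ?l x"]) auto
      then show False using False by simp
    qed
    then have "(\<integral>\<^sup>+ x. ennreal (kent (u x) a) \<partial>M) = \<infinity>"
      by (intro ni nn[OF a]) measurable
    moreover have "(\<integral>\<^sup>+ x. ennreal (kent (u x) b) \<partial>M) = \<infinity>"
      by (intro ni nn[OF b(2)] False) measurable
    ultimately show ?thesis by simp
  qed
qed

subsection \<open>The logarithmic Sobolev inequality for bounded functions\<close>

text \<open>Averaging over Gaussian noise of variance \<open>h\<close>: the heat semigroup generated
  by half the Laplacian. Vector values are allowed so that a function and its gradient are averaged
  by the same operator.\<close>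

definition heat :: "real \<Rightarrow> ('a::euclidean_space \<Rightarrow> 'b::euclidean_space) \<Rightarrow> 'a \<Rightarrow> 'b" where
  "heat h F x = (\<integral>z. F (x + sqrt h *\<^sub>R z) \<partial>gaussian)"

lemma integrable_gaussian_bounded:
  fixes F :: "'a::euclidean_space \<Rightarrow> 'b::euclidean_space"
  assumes "F \<in> borel_measurable borel" "\<And>x. norm (F x) \<le> B"
  shows "integrable gaussian F"
  by (rule gaussian.integrable_const_bound[of _ B]) (use assms in \<open>auto simp: gaussian_def\<close>)

lemma measurable_heat [measurable]:
  assumes [measurable]: "F \<in> borel_measurable borel"
  shows "heat h F \<in> borel_measurable borel"
  unfolding heat_def by measurable

lemma heat_bounded:
  fixes F :: "'a::euclidean_space \<Rightarrow> 'b::euclidean_space"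
  assumes "F \<in> borel_measurable borel" "\<And>x. norm (F x) \<le> B"
  shows "norm (heat h F x) \<le> B"
proof -
  have [measurable]: "F \<in> borel_measurable borel" by fact
  have "norm (heat h F x) \<le> (\<integral>z. norm (F (x + sqrt h *\<^sub>R z)) \<partial>gaussian)"
    unfolding heat_def by (rule integral_norm_bound)
  also have "\<dots> \<le> (\<integral>z. B \<partial>(gaussian::'a measure))"
    using assms order_trans[OF norm_ge_zero assms(2)] by (intro integral_mono integrable_gaussian_bounded[of _ B]) auto
  finally show ?thesis by simp
qed

lemma integrable_heat:
  fixes F :: "'a::euclidean_space \<Rightarrow> 'b::euclidean_space"
  assumes [measurable]: "F \<in> borel_measurable borel" and "\<And>x. norm (F x) \<le> B"
  shows "integrable gaussian (\<lambda>z. F (x + sqrt h *\<^sub>R z))"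
  by (rule integrable_gaussian_bounded[of _ B]) (use assms in auto)

lemma heat_mono:
  fixes F G :: "'a::euclidean_space \<Rightarrow> real"
  assumes "F \<in> borel_measurable borel" "\<And>x. norm (F x) \<le> B" "G \<in> borel_measurable borel" "\<And>x. norm (G x) \<le> B"
    and "\<And>x. F x \<le> G x"
  shows "heat h F x \<le> heat h G x"
  unfolding heat_def by (intro integral_mono integrable_heat[of _ B]) (use assms in auto)

lemma heat_0 [simp]: "heat 0 F = F"
  by (auto simp: heat_def fun_eq_iff)

text \<open>Independent noises of variances \<open>a\<close> and \<open>b\<close> add up to one
  noise of variance \<open>a + b\<close>. Normalising the two scales gives weights with
  \<open>c\<^sup>2 + s\<^sup>2 = 1\<close>, and rotation invariance applies.\<close>

lemma heat_heat:
  fixes F :: "'a::euclidean_space \<Rightarrow> 'b::euclidean_space"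
  assumes [measurable]: "F \<in> borel_measurable borel" and B: "\<And>x. norm (F x) \<le> B" and ab: "a \<ge> 0" "b \<ge> 0"
  shows "heat a (heat b F) x = heat (a + b) F x"
proof (cases "a + b = 0")
  case True
  then have "a = 0" "b = 0" using ab by auto
  then show ?thesis by simp
next
  case False
  then have p: "a + b > 0" using ab by auto
  define c where "c = sqrt (a / (a + b))"
  define s where "s = sqrt (b / (a + b))"
  have cs: "c\<^sup>2 + s\<^sup>2 = 1" using ab p by (simp add: c_def s_def add_divide_distrib[symmetric])
  have ca: "sqrt (a + b) * c = sqrt a" "sqrt (a + b) * s = sqrt b"
    using p by (simp_all add: c_def s_def real_sqrt_mult[symmetric])
  have "heat (a + b) F x = (\<integral>z. F (x + sqrt (a + b) *\<^sub>R z) \<partial>distr (gaussian \<Otimes>\<^sub>M gaussian) borel (\<lambda>(x, z). c *\<^sub>R x + s *\<^sub>R z))"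
    unfolding heat_def distr_gaussian_conv[OF cs] ..
  also have "\<dots> = (\<integral>p. F (x + sqrt (a + b) *\<^sub>R (c *\<^sub>R fst p + s *\<^sub>R snd p)) \<partial>(gaussian \<Otimes>\<^sub>M gaussian))"
    by (subst integral_distr) (auto simp: split_beta')
  also have "\<dots> = (\<integral>p. F (x + sqrt a *\<^sub>R fst p + sqrt b *\<^sub>R snd p) \<partial>(gaussian \<Otimes>\<^sub>M gaussian))"
    by (simp add: scaleR_add_right ca add.assoc)
  also have "\<dots> = (\<integral>z. (\<integral>z'. F (x + sqrt a *\<^sub>R z + sqrt b *\<^sub>R z') \<partial>gaussian) \<partial>gaussian)"
    by (subst gaussian_pair.integral_fst'[symmetric])
      (auto intro!: gaussian_pair.P.integrable_const_bound[of _ B] simp: B)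
  finally show ?thesis by (simp add: heat_def)
qed

text \<open>The pair \<open>(u, w)\<close> plays the role of a bounded \<open>C\<^sup>2\<close> function and its gradient. Keeping
  \<open>w\<close> as separate data makes the class closed under the heat semigroup without any
  differentiation under the integral sign.\<close>

locale taylor_pair =
  fixes e C L :: real and u :: "'a::euclidean_space \<Rightarrow> real" and w :: "'a \<Rightarrow> 'a"
  assumes e: "e > 0" and L: "L \<ge> 0"
    and u_meas [measurable]: "u \<in> borel_measurable borel" and w_meas [measurable]: "w \<in> borel_measurable borel"
    and lower: "\<And>x. e \<le> u x" and upper: "\<And>x. u x \<le> C"
    and taylor: "\<And>x z. \<bar>u (x + z) - u x - w x \<bullet> z\<bar> \<le> L * (norm z)\<^sup>2"
begin

lemma C: "C > 0" using e lower[of 0] upper[of 0] by linarith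

lemma norm_u: "norm (u x) \<le> C" using e lower[of x] upper[of x] by auto

text \<open>The expansion is tested on a unit step in the direction of \<open>w x\<close>, over
  which \<open>u\<close> changes by at most \<open>C\<close>.\<close>

lemma w_bound: "norm (w x) \<le> C + L"
proof (cases "w x = 0")
  case False
  define z where "z = sgn (w x)"
  have z: "norm z = 1" using False by (simp add: z_def norm_sgn)
  have "w x \<bullet> z = norm (w x)" using False by (simp add: z_def sgn_div_norm power2_norm_eq_inner[symmetric] power2_eq_square)
  moreover have "\<bar>u (x + z) - u x\<bar> \<le> C"
    using lower[of x] lower[of "x + z"] upper[of x] upper[of "x + z"] e by linarith
  ultimately show ?thesis using taylor[of x z] z by simp
qed (use C L in auto)

text \<open>The point \<open>x + z\<close> is expanded from \<open>x\<close> and from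
  \<open>y\<close>, and \<open>x\<close> is expanded from \<open>y\<close>. With \<open>z\<close> of
  length \<open>d\<close> along \<open>w x - w y\<close>, the remainders are at most
  \<open>L * d\<^sup>2\<close>, \<open>4 * L * d\<^sup>2\<close> and \<open>L * d\<^sup>2\<close>,
  whence the factor 6.\<close>

lemma w_lipschitz: "norm (w x - w y) \<le> 6 * L * norm (x - y)"
proof (cases "w x = w y \<or> x = y")
  case False
  define d where "d = norm (x - y)"
  have d: "d > 0" using False by (simp add: d_def)
  define z where "z = d *\<^sub>R sgn (w x - w y)"
  have z: "norm z = d" using False d by (simp add: z_def norm_sgn)
  have 1: "(w x - w y) \<bullet> z = d * norm (w x - w y)"
    using False by (simp add: z_def sgn_div_norm power2_norm_eq_inner[symmetric] power2_eq_square)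
  have "(norm (x + z - y))\<^sup>2 \<le> (2 * d)\<^sup>2"
    using norm_triangle_ineq[of "x - y" z] z by (intro power_mono) (auto simp: d_def algebra_simps)
  then have 2: "L * (norm (x + z - y))\<^sup>2 \<le> 4 * (L * d\<^sup>2)" using mult_left_mono[OF _ L, of "(norm (x + z - y))\<^sup>2" "4 * d\<^sup>2"] by (simp add: power_mult_distrib)
  have t1: "w x \<bullet> z \<le> u (x + z) - u x + L * d\<^sup>2" using taylor[of x z] z by (simp add: abs_le_iff)
  have t2: "u (x + z) \<le> u y + w y \<bullet> (x + z - y) + L * (norm (x + z - y))\<^sup>2"
    using taylor[of y "x + z - y"] by (simp add: abs_le_iff)
  have t3: "u x \<ge> u y + w y \<bullet> (x - y) - L * d\<^sup>2"
    using taylor[of y "x - y"] by (simp add: abs_le_iff d_def)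
  have "w y \<bullet> (x + z - y) = w y \<bullet> (x - y) + w y \<bullet> z" by (simp add: algebra_simps inner_add_right inner_diff_right)
  then have "(w x - w y) \<bullet> z \<le> 6 * (L * d\<^sup>2)" using t1 t2 t3 2 by (simp add: inner_diff_left)
  then have "d * norm (w x - w y) \<le> 6 * (L * d\<^sup>2)" by (simp only: 1)
  also have "6 * (L * d\<^sup>2) = d * (6 * L * d)" by (simp add: power2_eq_square)
  finally have "d * norm (w x - w y) \<le> d * (6 * L * d)" .
  then show ?thesis using d by (simp add: d_def)
qed (use L in auto)

lemma taylor_pair_heat: "taylor_pair e C L (heat h u) (heat h w)"
proof
  show "e > 0" "L \<ge> 0" by (fact e L)+
  show "heat h u \<in> borel_measurable borel" "heat h w \<in> borel_measurable borel" by measurable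
  have iu: "integrable gaussian (\<lambda>z. u (x + sqrt h *\<^sub>R z))" for x by (rule integrable_heat[of _ C]) (auto intro: norm_u[simplified])
  have iw: "integrable gaussian (\<lambda>z. w (x + sqrt h *\<^sub>R z))" for x by (rule integrable_heat[of _ "C + L"]) (auto intro: w_bound)
  show "e \<le> heat h u x" for x
    using integral_mono[OF _ iu[of x], of "\<lambda>_. e"] lower by (simp add: heat_def )
  show "heat h u x \<le> C" for x
    using integral_mono[OF iu[of x], of "\<lambda>_. C"] upper by (simp add: heat_def )
  show "\<bar>heat h u (x + z) - heat h u x - heat h w x \<bullet> z\<bar> \<le> L * (norm z)\<^sup>2" for x z
  proof -
    have "heat h u (x + z) - heat h u x - heat h w x \<bullet> z
      = (\<integral>y. (u (x + z + sqrt h *\<^sub>R y) - u (x + sqrt h *\<^sub>R y) - w (x + sqrt h *\<^sub>R y) \<bullet> z) \<partial>gaussian)"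
      unfolding heat_def using iu iw by simp
    also have "\<bar>\<dots>\<bar> \<le> (\<integral>y. L * (norm z)\<^sup>2 \<partial>(gaussian :: 'a measure))"
    proof (rule integral_abs_bound[THEN order_trans], rule integral_mono)
      show "integrable gaussian (\<lambda>y. \<bar>u (x + z + sqrt h *\<^sub>R y) - u (x + sqrt h *\<^sub>R y) - w (x + sqrt h *\<^sub>R y) \<bullet> z\<bar>)"
        using iu iw by auto
      show "\<bar>u (x + z + sqrt h *\<^sub>R y) - u (x + sqrt h *\<^sub>R y) - w (x + sqrt h *\<^sub>R y) \<bullet> z\<bar> \<le> L * (norm z)\<^sup>2" for y
        using taylor[of "x + sqrt h *\<^sub>R y" z] by (simp add: ac_simps)
    qed auto
    finally show ?thesis by simp
  qed
qed

lemma fisher_bound: "norm ((norm (w x))\<^sup>2 / u x) \<le> (C + L)\<^sup>2 / e"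
  using w_bound[of x] lower[of x] e by (auto intro!: frac_le power_mono)

lemma fisher_meas [measurable]: "(\<lambda>x. (norm (w x))\<^sup>2 / u x) \<in> borel_measurable borel"
  by measurable

text \<open>Jensen's inequality for the jointly convex function \<open>(w, u) \<mapsto> |w|\<^sup>2 / u\<close>, obtained from its tangent at the means.\<close>

lemma fisher_heat: "(norm (heat h w x))\<^sup>2 / heat h u x \<le> heat h (\<lambda>x. (norm (w x))\<^sup>2 / u x) x"
proof -
  interpret H: taylor_pair e C L "heat h u" "heat h w" by (rule taylor_pair_heat)
  have iu: "integrable gaussian (\<lambda>z. u (x + sqrt h *\<^sub>R z))" by (rule integrable_heat[of _ C]) (auto intro: norm_u[simplified])
  have iw: "integrable gaussian (\<lambda>z. w (x + sqrt h *\<^sub>R z))" by (rule integrable_heat[of _ "C + L"]) (auto intro: w_bound)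
  define a where "a = heat h u x"
  define q where "q = heat h w x /\<^sub>R a"
  have a: "a > 0" using H.lower[of x] e by (simp add: a_def)
  have pt: "2 * (w y \<bullet> q) - u y * (norm q)\<^sup>2 \<le> (norm (w y))\<^sup>2 / u y" for y
  proof -
    have uy: "u y > 0" using lower[of y] e by simp
    have "0 \<le> (norm (w y - u y *\<^sub>R q))\<^sup>2" by simp
    also have "\<dots> = (norm (w y))\<^sup>2 - 2 * u y * (w y \<bullet> q) + (u y)\<^sup>2 * (norm q)\<^sup>2"
      unfolding power2_norm_eq_inner
      by (simp add: inner_diff_left inner_diff_right inner_commute[of q "w y"] power2_eq_square algebra_simps)
    finally show ?thesis using uy by (simp add: field_simps power2_eq_square)
  qed
  have "(norm (heat h w x))\<^sup>2 / a = 2 * (heat h w x \<bullet> q) - a * (norm q)\<^sup>2"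
    using a by (simp add: q_def power2_norm_eq_inner[symmetric] power_mult_distrib field_simps power2_eq_square)
  also have "\<dots> = (\<integral>z. 2 * (w (x + sqrt h *\<^sub>R z) \<bullet> q) - u (x + sqrt h *\<^sub>R z) * (norm q)\<^sup>2 \<partial>gaussian)"
    unfolding a_def heat_def using iu iw by simp
  also have "\<dots> \<le> heat h (\<lambda>x. (norm (w x))\<^sup>2 / u x) x"
    unfolding heat_def
  proof (rule integral_mono)
    show "integrable gaussian (\<lambda>z. (norm (w (x + sqrt h *\<^sub>R z)))\<^sup>2 / u (x + sqrt h *\<^sub>R z))"
      by (rule integrable_heat[of "\<lambda>x. (norm (w x))\<^sup>2 / u x", OF _ fisher_bound]) measurable
  qed (use iu iw pt in auto)
  finally show ?thesis by (simp add: a_def)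
qed

text \<open>The local form of the heat flow argument: over a time step \<open>h\<close> the entropy
  gained is half of \<open>h\<close> times an averaged Fisher information, up to an error of order
  \<open>h * sqrt h\<close>. The constant is chosen before the pair \<open>v\<close>,
  \<open>w'\<close>, so the errors of all steps along the flow can be added.\<close>

lemma step_const_ex:
  "\<exists>K. \<forall>v w'. taylor_pair e C L v w' \<longrightarrow> (\<forall>h x. 0 < h \<longrightarrow> h \<le> 1 \<longrightarrow>
     heat h (\<lambda>x. v x * ln (v x)) (x::'a) - heat h v x * ln (heat h v x)
       \<le> h / 2 * heat h (\<lambda>x. (norm (w' x))\<^sup>2 / v x) x + K * (h * sqrt h))"
proof -
  define W where "W = C + L"
  define n where "n = real DIM('a)"
  \<comment> \<open>\<open>r\<close> bounds the deviation of an increment from its linear part: the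
    squared norm comes from the Taylor bound, and \<open>n\<close> from recentring at the mean.
    \<open>Q1\<close> collects the cross and square terms of the squared increment,
    \<open>Q2\<close> bounds its cube.\<close>
  define r where "r = (\<lambda>z::'a. (norm z)\<^sup>2 + n)"
  define Q1 where "Q1 = (\<lambda>z::'a. 2 * W * L * (norm z * r z) + L\<^sup>2 * (r z)\<^sup>2)"
  define Q2 where "Q2 = (\<lambda>z::'a. (W * norm z + L * r z) ^ 3)"
  define m1 where "m1 = (\<integral>z. norm (z::'a) \<partial>gaussian)"
  have n0: "n \<ge> 0" by (simp add: n_def)
  have r0: "r z \<ge> 0" for z using n0 by (simp add: r_def)
  have W0: "W \<ge> 0" using C L by (simp add: W_def)
  have ip: "integrable gaussian (\<lambda>z::'a. norm z ^ k)" for k by (rule integrable_gaussian_norm_power)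
  have ip1: "integrable gaussian (\<lambda>z::'a. norm z)" using ip[of 1] by simp
  have m1: "m1 \<ge> 0" unfolding m1_def by simp
  have iQ1: "integrable gaussian Q1"
  proof -
    have "Q1 = (\<lambda>z. 2 * W * L * norm z ^ 3 + 2 * W * L * n * norm z ^ 1 + L\<^sup>2 * norm z ^ 4 + 2 * L\<^sup>2 * n * norm z ^ 2 + L\<^sup>2 * n\<^sup>2)"
      by (auto simp: Q1_def r_def fun_eq_iff algebra_simps power2_eq_square eval_nat_numeral)
    then show ?thesis by (simp only:) (intro Bochner_Integration.integrable_add integrable_mult_right ip, simp)
  qed
  have iQ2: "integrable gaussian Q2"
  proof (rule Bochner_Integration.integrable_bound)
    show "integrable gaussian (\<lambda>z::'a. (W + L + L * n) ^ 3 * (1 + norm z ^ 6))"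
      by (intro integrable_mult_right Bochner_Integration.integrable_add ip) auto
    have "\<bar>Q2 z\<bar> \<le> (W + L + L * n) ^ 3 * (1 + norm z ^ 6)" for z :: 'a
    proof -
      define M where "M = max 1 ((norm z)\<^sup>2)"
      have M: "M \<ge> 1" "M \<ge> (norm z)\<^sup>2" by (auto simp: M_def)
      have zM: "norm z \<le> M"
      proof (cases "norm z \<le> 1")
        case False
        then have "norm z * 1 \<le> norm z * norm z" by (intro mult_left_mono) auto
        then show ?thesis using M by (simp add: power2_eq_square)
      qed (use M in linarith)
      have "W * norm z + L * r z \<le> W * M + L * (M + n * M)"
        unfolding r_def using M zM W0 L n0 by (intro add_mono mult_left_mono) (auto simp: mult_le_cancel_left1)
      then have "W * norm z + L * r z \<le> (W + L + L * n) * M" by (simp add: algebra_simps)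
      then have "(W * norm z + L * r z) ^ 3 \<le> ((W + L + L * n) * M) ^ 3"
        using W0 L r0 by (intro power_mono) auto
      also have "\<dots> = (W + L + L * n) ^ 3 * M ^ 3" by (simp add: power_mult_distrib)
      also have "M ^ 3 \<le> 1 + norm z ^ 6"
        by (auto simp: M_def max_def power_mult[symmetric])
      finally show ?thesis using W0 L r0 n0 unfolding Q2_def by (simp add: mult_left_mono abs_of_nonneg)
    qed
    then show "AE z in gaussian. norm (Q2 z) \<le> norm ((W + L + L * n) ^ 3 * (1 + norm z ^ 6))"
      using W0 L n0 by auto
  qed (simp add: Q2_def r_def)
  \<comment> \<open>The three summands pay for the remainder in the quadratic term, for the cubic
    term of \<open>kent_le\<close>, and for replacing \<open>w' x\<close> by its average.\<close>
  define K where "K = (\<integral>z. Q1 z \<partial>gaussian) / (2 * e) + C / (3 * e ^ 3) * (\<integral>z. Q2 z \<partial>gaussian) + 6 * W * L * m1 / e"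
  show ?thesis
  proof (intro exI[of _ K] allI impI)
    fix v :: "'a \<Rightarrow> real" and w' :: "'a \<Rightarrow> 'a" and h :: real and x :: 'a
    assume "taylor_pair e C L v w'" and h: "0 < h" "h \<le> 1"
    interpret V: taylor_pair e C L v w' by fact
    interpret H: taylor_pair e C L "heat h v" "heat h w'" by (rule V.taylor_pair_heat)
    have iv: "integrable gaussian (\<lambda>z. v (x + sqrt h *\<^sub>R z))" by (rule integrable_heat[of _ C]) (auto intro: V.norm_u[simplified])
    have iw: "integrable gaussian (\<lambda>z. w' (x + sqrt h *\<^sub>R z))" by (rule integrable_heat[of _ "C + L"]) (auto intro: V.w_bound)
    define a where "a = heat h v x"
    have a: "e \<le> a" "a \<le> C" "a > 0" using H.lower[of x] H.upper[of x] e by (auto simp: a_def)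
    have h1: "sqrt h \<le> 1" "sqrt h > 0" "sqrt h * sqrt h = h" using h by auto
    define d where "d = (\<lambda>z. v (x + sqrt h *\<^sub>R z) - v x - sqrt h * (w' x \<bullet> z))"
    have d: "\<bar>d z\<bar> \<le> L * h * (norm z)\<^sup>2" for z
      using V.taylor[of x "sqrt h *\<^sub>R z"] h by (simp add: d_def power_mult_distrib)
    have ii: "integrable gaussian (\<lambda>z. w' x \<bullet> z)"
      by (rule Bochner_Integration.integrable_bound[OF integrable_mult_right[OF ip1, of "norm (w' x)"]]) (auto simp: Cauchy_Schwarz_ineq2)
    have id: "integrable gaussian d" unfolding d_def using iv ii by auto
    have av: "a - v x = (\<integral>z. d z \<partial>gaussian)"
      unfolding d_def a_def heat_def using iv ii by (simp add: integral_gaussian_inner )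
    have "\<bar>a - v x\<bar> \<le> (\<integral>z. L * h * (norm z)\<^sup>2 \<partial>(gaussian::'a measure))"
      unfolding av using id d by (intro integral_abs_bound[THEN order_trans] integral_mono) (auto intro: ip)
    then have av': "\<bar>a - v x\<bar> \<le> L * h * n" by (simp add: integral_gaussian_norm_sq n_def)
    define D where "D = (\<lambda>z. v (x + sqrt h *\<^sub>R z) - a)"
    define E where "E = (\<lambda>z. D z - sqrt h * (w' x \<bullet> z))"
    have E: "\<bar>E z\<bar> \<le> L * h * r z" for z
    proof -
      have "E z = d z - (a - v x)" by (simp add: E_def D_def d_def)
      then have "\<bar>E z\<bar> \<le> \<bar>d z\<bar> + \<bar>a - v x\<bar>" by linarith
      also have "\<dots> \<le> L * h * (norm z)\<^sup>2 + L * h * n" using d[of z] av' by linarith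
      finally show ?thesis by (simp add: r_def algebra_simps)
    qed
    have wz: "\<bar>w' x \<bullet> z\<bar> \<le> W * norm z" for z
      using Cauchy_Schwarz_ineq2[of "w' x" z] mult_right_mono[OF V.w_bound[of x], of "norm z"] by (simp add: W_def)
    have hh: "h * h \<le> h * sqrt h" using h h1 by (intro mult_left_mono) (auto simp: real_le_rsqrt power2_eq_square mult_left_le)
    have D2: "(D z)\<^sup>2 \<le> h * (w' x \<bullet> z)\<^sup>2 + (h * sqrt h) * Q1 z" for z
    proof -
      have "(D z)\<^sup>2 = h * (w' x \<bullet> z)\<^sup>2 + 2 * sqrt h * ((w' x \<bullet> z) * E z) + (E z)\<^sup>2"
        using h1(3) by (simp add: E_def power2_eq_square algebra_simps)
      also have "\<dots> \<le> h * (w' x \<bullet> z)\<^sup>2 + 2 * sqrt h * ((W * norm z) * (L * h * r z)) + (L * h * r z)\<^sup>2"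
      proof (intro add_mono mult_left_mono order_refl)
        have "(w' x \<bullet> z) * E z \<le> \<bar>w' x \<bullet> z\<bar> * \<bar>E z\<bar>" by (metis abs_ge_self abs_mult)
        also have "\<dots> \<le> (W * norm z) * (L * h * r z)" using wz E W0 by (intro mult_mono) auto
        finally show "(w' x \<bullet> z) * E z \<le> (W * norm z) * (L * h * r z)" .
        show "(E z)\<^sup>2 \<le> (L * h * r z)\<^sup>2" using power_mono[OF E[of z], of 2] by simp
      qed (use h in auto)
      also have "(L * h * r z)\<^sup>2 = (h * h) * (L\<^sup>2 * (r z)\<^sup>2)" by (simp add: power2_eq_square algebra_simps)
      also have "\<dots> \<le> (h * sqrt h) * (L\<^sup>2 * (r z)\<^sup>2)" by (intro mult_right_mono hh) auto
      finally show ?thesis by (simp add: Q1_def algebra_simps)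
    qed
    have D3: "\<bar>D z\<bar> ^ 3 \<le> (h * sqrt h) * Q2 z" for z
    proof -
      have "\<bar>D z\<bar> \<le> sqrt h * \<bar>w' x \<bullet> z\<bar> + \<bar>E z\<bar>"
      proof -
        have "D z = sqrt h * (w' x \<bullet> z) + E z" by (simp add: E_def)
        then have "\<bar>D z\<bar> \<le> \<bar>sqrt h * (w' x \<bullet> z)\<bar> + \<bar>E z\<bar>" by (simp only: abs_triangle_ineq)
        then show ?thesis using h1 by (simp add: abs_mult)
      qed
      also have "\<dots> \<le> sqrt h * (W * norm z) + L * h * r z" using wz[of z] E[of z] h1 by (intro add_mono mult_left_mono) auto
      also have "L * h * r z \<le> sqrt h * (L * r z)"
      proof -
        have "h \<le> sqrt h" using h1 mult_left_mono[of "sqrt h" 1 "sqrt h"] by simp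
        then have "h * (L * r z) \<le> sqrt h * (L * r z)" using L r0 by (intro mult_right_mono) auto
        then show ?thesis by (simp add: ac_simps)
      qed
      finally have "\<bar>D z\<bar> \<le> sqrt h * (W * norm z + L * r z)" by (simp add: algebra_simps)
      then have "\<bar>D z\<bar> ^ 3 \<le> (sqrt h * (W * norm z + L * r z)) ^ 3" by (intro power_mono) auto
      also have "\<dots> = (sqrt h * sqrt h * sqrt h) * Q2 z" by (simp add: Q2_def power_mult_distrib power3_eq_cube)
      finally show ?thesis by (simp only: h1(3))
    qed
    \<comment> \<open>The second summand on the right averages to zero because \<open>a\<close> is
      the mean of \<open>v\<close> over the step, so only the divergence from the mean is
      left.\<close>
    have vl: "v y * ln (v y) - a * ln a = kent (v y) a + (v y - a) * (ln a + 1)" for y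
      using V.lower[of y] e a by (simp add: kent_def ln_div algebra_simps)
    have bl: "norm (v y * ln (v y)) \<le> C * (\<bar>ln e\<bar> + \<bar>ln C\<bar>)" for y
    proof -
      have "ln e \<le> ln (v y)" "ln (v y) \<le> ln C" using V.lower[of y] V.upper[of y] e C by auto
      then have "\<bar>ln (v y)\<bar> \<le> \<bar>ln e\<bar> + \<bar>ln C\<bar>" by linarith
      then show ?thesis using V.norm_u[of y] C by (simp add: abs_mult mult_mono)
    qed
    have iln: "integrable gaussian (\<lambda>z. v (x + sqrt h *\<^sub>R z) * ln (v (x + sqrt h *\<^sub>R z)))"
      by (rule integrable_heat[of "\<lambda>x. v x * ln (v x)", OF _ bl]) measurable
    have ik: "integrable gaussian (\<lambda>z. kent (v (x + sqrt h *\<^sub>R z)) a)"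
    proof -
      have "(\<lambda>z. kent (v (x + sqrt h *\<^sub>R z)) a) = (\<lambda>z. v (x + sqrt h *\<^sub>R z) * ln (v (x + sqrt h *\<^sub>R z)) - a * ln a - (v (x + sqrt h *\<^sub>R z) - a) * (ln a + 1))"
        using vl by (auto simp: fun_eq_iff algebra_simps)
      then show ?thesis using iln iv by simp
    qed
    have "heat h (\<lambda>x. v x * ln (v x)) x - a * ln a = (\<integral>z. v (x + sqrt h *\<^sub>R z) * ln (v (x + sqrt h *\<^sub>R z)) - a * ln a \<partial>gaussian)"
      unfolding heat_def using iln by simp
    also have "\<dots> = (\<integral>z. kent (v (x + sqrt h *\<^sub>R z)) a + (v (x + sqrt h *\<^sub>R z) - a) * (ln a + 1) \<partial>gaussian)"
      by (simp only: vl)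
    also have "\<dots> = (\<integral>z. kent (v (x + sqrt h *\<^sub>R z)) a \<partial>gaussian)"
      using ik iv by (simp add: a_def heat_def)
    also have "\<dots> \<le> (\<integral>z. (h * (w' x \<bullet> z)\<^sup>2 + (h * sqrt h) * Q1 z) / (2 * a) + C / (3 * e ^ 3) * ((h * sqrt h) * Q2 z) \<partial>gaussian)"
    proof (rule integral_mono[OF ik])
      show "integrable gaussian (\<lambda>z. (h * (w' x \<bullet> z)\<^sup>2 + (h * sqrt h) * Q1 z) / (2 * a) + C / (3 * e ^ 3) * ((h * sqrt h) * Q2 z))"
        using iQ1 iQ2 integrable_gaussian_coord2[of "w' x" "w' x"] by (auto simp: power2_eq_square inner_commute)
      fix z
      have "kent (v (x + sqrt h *\<^sub>R z)) a \<le> (D z)\<^sup>2 / (2 * a) + C / (3 * e ^ 3) * \<bar>D z\<bar> ^ 3"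
        unfolding D_def using a e V.lower by (intro kent_le) auto
      also have "\<dots> \<le> (h * (w' x \<bullet> z)\<^sup>2 + (h * sqrt h) * Q1 z) / (2 * a) + C / (3 * e ^ 3) * ((h * sqrt h) * Q2 z)"
        using a e C by (intro add_mono divide_right_mono mult_left_mono D2 D3) auto
      finally show "kent (v (x + sqrt h *\<^sub>R z)) a \<le> \<dots>" .
    qed
    also have "\<dots> = (h * (norm (w' x))\<^sup>2 + (h * sqrt h) * (\<integral>z. Q1 z \<partial>gaussian)) / (2 * a) + C / (3 * e ^ 3) * ((h * sqrt h) * (\<integral>z. Q2 z \<partial>gaussian))"
      using iQ1 iQ2 integrable_gaussian_coord2[of "w' x" "w' x"] integral_gaussian_inner_sq[of "w' x"]
      by (simp add: power2_eq_square inner_commute)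
    also have "\<dots> = h / 2 * ((norm (w' x))\<^sup>2 / a) + (h * sqrt h) * ((\<integral>z. Q1 z \<partial>gaussian) / (2 * a) + C / (3 * e ^ 3) * (\<integral>z. Q2 z \<partial>gaussian))"
      by (simp add: add_divide_distrib algebra_simps)
    also have "(\<integral>z. Q1 z \<partial>gaussian) / (2 * a) \<le> (\<integral>z. Q1 z \<partial>gaussian) / (2 * e)"
      using a e W0 L r0 by (intro divide_left_mono integral_nonneg_AE) (auto simp: Q1_def)
    \<comment> \<open>The expansion produced the gradient at \<open>x\<close> itself, while summing
      over steps needs an averaged Fisher information. The Lipschitz bound makes the difference of
      order \<open>sqrt h\<close>, and Jensen's inequality in \<open>fisher_heat\<close> does the
      rest.\<close>
    also have "(norm (w' x))\<^sup>2 / a \<le> heat h (\<lambda>x. (norm (w' x))\<^sup>2 / v x) x + 12 * W * L * m1 * sqrt h / e"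
    proof -
      define p where "p = heat h w' x"
      have "norm (w' x - p) \<le> (\<integral>z. norm (w' x - w' (x + sqrt h *\<^sub>R z)) \<partial>gaussian)"
      proof -
        have "w' x - p = (\<integral>z. w' x - w' (x + sqrt h *\<^sub>R z) \<partial>gaussian)"
          unfolding p_def heat_def using iw by simp
        then show ?thesis by simp
      qed
      also have "\<dots> \<le> (\<integral>z. 6 * L * sqrt h * norm z \<partial>(gaussian::'a measure))"
      proof (rule integral_mono)
        show "norm (w' x - w' (x + sqrt h *\<^sub>R z)) \<le> 6 * L * sqrt h * norm z" for z
          using V.w_lipschitz[of x "x + sqrt h *\<^sub>R z"] h by simp
      qed (use iw ip1 in auto)
      finally have wp: "norm (w' x - p) \<le> 6 * L * sqrt h * m1" by (simp add: m1_def)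
      have pW: "norm p \<le> W" unfolding p_def W_def by (rule H.w_bound)
      have "(norm (w' x))\<^sup>2 - (norm p)\<^sup>2 = (norm (w' x) - norm p) * (norm (w' x) + norm p)"
        by (simp add: power2_eq_square algebra_simps)
      also have "\<dots> \<le> norm (w' x - p) * (norm (w' x) + norm p)"
        by (intro mult_right_mono norm_triangle_ineq2) auto
      also have "\<dots> \<le> (6 * L * sqrt h * m1) * (W + W)"
        using V.w_bound[of x] pW wp L h m1 W0 by (intro mult_mono add_mono) (auto simp: W_def)
      finally have "(norm (w' x))\<^sup>2 \<le> (norm p)\<^sup>2 + 12 * W * L * m1 * sqrt h" by (simp add: algebra_simps)
      then have "(norm (w' x))\<^sup>2 / a \<le> ((norm p)\<^sup>2 + 12 * W * L * m1 * sqrt h) / a" using a by (intro divide_right_mono) auto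
      also have "\<dots> = (norm p)\<^sup>2 / a + 12 * W * L * m1 * sqrt h / a" by (simp add: add_divide_distrib)
      also have "\<dots> \<le> heat h (\<lambda>x. (norm (w' x))\<^sup>2 / v x) x + 12 * W * L * m1 * sqrt h / e"
        using V.fisher_heat[of h x] a e W0 L m1 h unfolding a_def p_def by (intro add_mono divide_left_mono) auto
      finally show ?thesis .
    qed
    finally show "heat h (\<lambda>x. v x * ln (v x)) x - heat h v x * ln (heat h v x)
       \<le> h / 2 * heat h (\<lambda>x. (norm (w' x))\<^sup>2 / v x) x + K * (h * sqrt h)"
      using h1 h by (simp add: a_def K_def algebra_simps mult_left_mono)
  qed
qed

text \<open>A discrete heat flow proof that adds increments instead of differentiating in time. The
  Fisher information of an averaged function is at most the average of the Fisher information, so by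
  the semigroup law every step is charged the same \<open>h / 2 * heat 1 I 0\<close>. The errors sum
  to \<open>K * sqrt h\<close> and vanish as the step shrinks. Heat at time 1, evaluated at 0, is
  the Gaussian integral.\<close>

theorem lsi_taylor:
  "(\<integral>x. u x * ln (u x) \<partial>gaussian) - (\<integral>x. u x \<partial>gaussian) * ln (\<integral>x. u x \<partial>gaussian)
     \<le> 1 / 2 * (\<integral>x. (norm (w x))\<^sup>2 / u x \<partial>gaussian)"
proof -
  obtain K where K: "\<And>v w' h x. taylor_pair e C L v w' \<Longrightarrow> 0 < h \<Longrightarrow> h \<le> 1 \<Longrightarrow>
     heat h (\<lambda>x. v x * ln (v x)) (x::'a) - heat h v x * ln (heat h v x)
       \<le> h / 2 * heat h (\<lambda>x. (norm (w' x))\<^sup>2 / v x) x + K * (h * sqrt h)"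
    using step_const_ex by blast
  define I where "I = (\<lambda>x. (norm (w x))\<^sup>2 / u x)"
  define B where "B = (C + L)\<^sup>2 / e"
  have I_meas[measurable]: "I \<in> borel_measurable borel" and I_bd: "norm (I x) \<le> B" for x
    unfolding I_def B_def by (measurable, rule fisher_bound)
  have tp: "taylor_pair e C L (heat s u) (heat s w)" for s by (rule taylor_pair_heat)
  define Bl where "Bl = C * (\<bar>ln e\<bar> + \<bar>ln C\<bar>)"
  have bl: "norm (v y * ln (v y)) \<le> Bl" if "taylor_pair e C L v w'" for v w' y
  proof -
    interpret V: taylor_pair e C L v w' by fact
    have "ln e \<le> ln (v y)" "ln (v y) \<le> ln C" using V.lower[of y] V.upper[of y] e C by auto
    then have "\<bar>ln (v y)\<bar> \<le> \<bar>ln e\<bar> + \<bar>ln C\<bar>" by linarith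
    then show ?thesis using V.norm_u[of y] C by (simp add: Bl_def abs_mult mult_mono)
  qed
  have main: "heat 1 (\<lambda>x. u x * ln (u x)) 0 - heat 1 u 0 * ln (heat 1 u 0) \<le> 1 / 2 * heat 1 I 0 + K * sqrt (1 / real N)"
    if N: "N > 0" for N
  proof -
    define h where "h = 1 / real N"
    have h: "0 < h" "h \<le> 1" and Nh: "real N * h = 1" using N by (auto simp: h_def)
    define U where "U = (\<lambda>j. heat (real (N - j) * h) u)"
    define V where "V = (\<lambda>j. heat (real (N - j) * h) w)"
    \<comment> \<open>The total noise is always of variance 1, split between the argument of
      \<open>x * ln x\<close> and the outer average. \<open>\<Phi> N\<close> is the mean of
      \<open>u * ln u\<close>, and \<open>\<Phi> 0\<close> is \<open>x * ln x\<close> at the mean of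
      \<open>u\<close>.\<close>
    define \<Phi> where "\<Phi> = (\<lambda>j. heat (real j * h) (\<lambda>x. U j x * ln (U j x)) 0)"
    have step: "\<Phi> (Suc j) - \<Phi> j \<le> h / 2 * heat 1 I 0 + K * (h * sqrt h)" if j: "j < N" for j
    proof -
      let ?v = "U (Suc j)" let ?w = "V (Suc j)"
      interpret V: taylor_pair e C L ?v ?w unfolding U_def V_def by (rule tp)
      have Uj: "U j x = heat h ?v x" for x
      proof -
        have "heat h ?v x = heat (h + real (N - Suc j) * h) u x"
          unfolding U_def using h by (intro heat_heat[of _ C]) (auto intro: norm_u[simplified])
        also have "h + real (N - Suc j) * h = real (N - j) * h"
          using j by (simp add: of_nat_diff algebra_simps)
        finally show ?thesis by (simp add: U_def)
      qed
      have tj: "taylor_pair e C L (U j) (V j)" unfolding U_def V_def by (rule tp)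
      interpret J: taylor_pair e C L "U j" "V j" by (rule tj)
      have \<Phi>S: "\<Phi> (Suc j) = heat (real j * h) (heat h (\<lambda>x. ?v x * ln (?v x))) 0"
        unfolding \<Phi>_def using h bl[OF V.taylor_pair_axioms]
        by (subst heat_heat[of _ Bl]) (auto simp: algebra_simps)
      have Ib: "norm ((norm (?w x))\<^sup>2 / ?v x) \<le> B" for x unfolding B_def by (rule V.fisher_bound)
      have Fle: "(norm (?w x))\<^sup>2 / ?v x \<le> heat (real (N - Suc j) * h) I x" for x
        unfolding U_def V_def I_def by (rule fisher_heat)
      have hI: "heat h (\<lambda>x. (norm (?w x))\<^sup>2 / ?v x) x \<le> heat (h + real (N - Suc j) * h) I x" for x
      proof -
        have "heat h (\<lambda>x. (norm (?w x))\<^sup>2 / ?v x) x \<le> heat h (heat (real (N - Suc j) * h) I) x"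
          by (rule heat_mono[of _ B]) (auto intro: Fle simp del: real_norm_def intro!: Ib heat_bounded I_bd)
        also have "\<dots> = heat (h + real (N - Suc j) * h) I x"
          using h by (intro heat_heat[of _ B]) (auto intro: I_bd[simplified])
        finally show ?thesis .
      qed
      have le: "heat h (\<lambda>x. ?v x * ln (?v x)) x - U j x * ln (U j x) \<le> h / 2 * heat (h + real (N - Suc j) * h) I x + K * (h * sqrt h)" for x
      proof -
        have "heat h (\<lambda>x. ?v x * ln (?v x)) x - U j x * ln (U j x) \<le> h / 2 * heat h (\<lambda>x. (norm (?w x))\<^sup>2 / ?v x) x + K * (h * sqrt h)"
          using K[OF V.taylor_pair_axioms h, of x] by (simp only: Uj)
        also have "\<dots> \<le> h / 2 * heat (h + real (N - Suc j) * h) I x + K * (h * sqrt h)"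
          using hI[of x] h by (intro add_right_mono mult_left_mono) auto
        finally show ?thesis .
      qed
      let ?t = "h + real (N - Suc j) * h"
      have i1: "integrable gaussian (\<lambda>z. heat h (\<lambda>x. ?v x * ln (?v x)) (0 + sqrt (real j * h) *\<^sub>R z))"
        by (rule integrable_heat[of _ Bl]) (auto simp del: real_norm_def intro!: heat_bounded bl[OF V.taylor_pair_axioms])
      have i2: "integrable gaussian (\<lambda>z. U j (0 + sqrt (real j * h) *\<^sub>R z) * ln (U j (0 + sqrt (real j * h) *\<^sub>R z)))"
        by (rule integrable_heat[of "\<lambda>x. U j x * ln (U j x)" Bl]) (auto simp del: real_norm_def intro!: bl[OF tj])
      have i3: "integrable gaussian (\<lambda>z. heat ?t I (0 + sqrt (real j * h) *\<^sub>R z))"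
        by (rule integrable_heat[of _ B]) (auto simp del: real_norm_def intro!: heat_bounded I_bd)
      have "\<Phi> (Suc j) - \<Phi> j = (\<integral>z. heat h (\<lambda>x. ?v x * ln (?v x)) (0 + sqrt (real j * h) *\<^sub>R z)
          - U j (0 + sqrt (real j * h) *\<^sub>R z) * ln (U j (0 + sqrt (real j * h) *\<^sub>R z)) \<partial>gaussian)"
        unfolding \<Phi>S unfolding \<Phi>_def unfolding heat_def[of "real j * h"] using i1 i2 by simp
      also have "\<dots> \<le> (\<integral>z. h / 2 * heat ?t I (0 + sqrt (real j * h) *\<^sub>R z) + K * (h * sqrt h) \<partial>gaussian)"
        using i1 i2 i3 le by (intro integral_mono) auto
      also have "\<dots> = h / 2 * heat (real j * h) (heat ?t I) 0 + K * (h * sqrt h)"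
        unfolding heat_def[of "real j * h"] using i3 by simp
      also have "heat (real j * h) (heat ?t I) 0 = heat (real j * h + ?t) I 0"
        using h by (intro heat_heat[of _ B]) (auto intro: I_bd[simplified])
      also have "real j * h + ?t = 1"
        using j Nh by (simp add: of_nat_diff algebra_simps)
      finally show ?thesis .
    qed
    have "\<Phi> N - \<Phi> 0 = (\<Sum>j<N. \<Phi> (Suc j) - \<Phi> j)" by (simp add: sum_lessThan_telescope)
    also have "\<dots> \<le> (\<Sum>j<N. h / 2 * heat 1 I 0 + K * (h * sqrt h))" by (intro sum_mono step) auto
    also have "\<dots> = (real N * h) * (1 / 2 * heat 1 I 0 + K * sqrt h)" by (simp add: algebra_simps)
    finally show ?thesis by (simp add: Nh \<Phi>_def U_def) (simp add: h_def)
  qed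
  have "(\<lambda>N. 1 / 2 * heat 1 I 0 + K * sqrt (1 / real N)) \<longlonglongrightarrow> 1 / 2 * heat 1 I 0 + K * sqrt 0"
    by (intro tendsto_intros lim_const_over_n)
  then have "heat 1 (\<lambda>x. u x * ln (u x)) 0 - heat 1 u 0 * ln (heat 1 u 0) \<le> 1 / 2 * heat 1 I 0 + K * sqrt 0"
    by (rule LIMSEQ_le_const) (use main in \<open>auto intro!: exI[of _ 1]\<close>)
  then show ?thesis by (simp add: heat_def I_def)
qed

end

subsection \<open>Test functions and weak gradients\<close>

text \<open>A test function bundled with its gradient field and a radius of support. Carrying the
  gradient as data makes product and chain rules direct, and the radius is what the integrability
  arguments consume.\<close>

definition ctest :: "('a::euclidean_space \<Rightarrow> real) \<Rightarrow> ('a \<Rightarrow> 'a) \<Rightarrow> real \<Rightarrow> bool" where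
  "ctest \<phi> G R \<longleftrightarrow> (\<forall>x. (\<phi> has_derivative (\<lambda>v. G x \<bullet> v)) (at x)) \<and> continuous_on UNIV G \<and>
     (\<forall>x. norm x > R \<longrightarrow> \<phi> x = 0 \<and> G x = 0)"

definition locally_integrable :: "('a::euclidean_space \<Rightarrow> 'b::euclidean_space) \<Rightarrow> bool" where
  "locally_integrable f \<longleftrightarrow> f \<in> borel_measurable borel \<and> (\<forall>r. integrable lborel (\<lambda>x. indicator (cball 0 r) x *\<^sub>R f x))"

lemma ctestI:
  assumes "\<And>x. (\<phi> has_derivative (\<lambda>v. G x \<bullet> v)) (at x)" "continuous_on UNIV G" "\<And>x. norm x > R \<Longrightarrow> \<phi> x = 0"
  shows "ctest \<phi> G R"
proof -
  have "G x = 0" if "norm x > R" for x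
  proof -
    have "(\<phi> has_derivative (\<lambda>v. 0)) (at x)"
      by (rule has_derivative_transform_within_open[of "\<lambda>_. 0" _ _ _ "{x. norm x > R}"])
        (use that assms(3) in \<open>auto intro!: open_Collect_less continuous_intros\<close>)
    then have "(\<lambda>v. G x \<bullet> v) = (\<lambda>v. 0)" using assms(1) has_derivative_unique by blast
    then have "G x \<bullet> G x = 0" by (rule fun_cong)
    then show ?thesis by simp
  qed
  then show ?thesis using assms by (auto simp: ctest_def)
qed

lemma ctestD:
  assumes "ctest \<phi> G R"
  shows "(\<phi> has_derivative (\<lambda>v. G x \<bullet> v)) (at x)" "continuous_on UNIV G" "norm x > R \<Longrightarrow> \<phi> x = 0" "norm x > R \<Longrightarrow> G x = 0"
    "continuous_on UNIV \<phi>"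
  using assms by (auto simp: ctest_def intro!: continuous_at_imp_continuous_on dest: has_derivative_continuous)

lemma ctest_measurable:
  assumes "ctest \<phi> G R"
  shows "\<phi> \<in> borel_measurable borel" "G \<in> borel_measurable borel"
  using ctestD[OF assms] by (auto intro: borel_measurable_continuous_onI)

lemma ctest_bounded:
  assumes "ctest \<phi> G R"
  obtains B where "B \<ge> 0" "\<And>x. \<bar>\<phi> x\<bar> \<le> B" "\<And>x. norm (G x) \<le> B"
proof -
  have "compact (cball (0::'a) R)" by simp
  then have "bounded (\<phi> ` cball 0 R)" "bounded (G ` cball 0 R)"
    using ctestD[OF assms] by (auto intro!: compact_imp_bounded compact_continuous_image intro: continuous_on_subset)
  then obtain B1 B2 where B: "\<forall>y\<in>\<phi> ` cball 0 R. norm y \<le> B1" "\<forall>y\<in>G ` cball 0 R. norm y \<le> B2"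
    unfolding bounded_iff by blast
  have B': "\<bar>\<phi> x\<bar> \<le> max 0 (max B1 B2)" "norm (G x) \<le> max 0 (max B1 B2)" for x
  proof -
    have "\<bar>\<phi> x\<bar> \<le> B1 \<and> norm (G x) \<le> B2 \<or> \<phi> x = 0 \<and> G x = 0"
    proof (cases "norm x > R")
      case False
      then have "x \<in> cball 0 R" by simp
      then show ?thesis using B by (metis imageI real_norm_def)
    qed (use ctestD(3,4)[OF assms] in auto)
    then show "\<bar>\<phi> x\<bar> \<le> max 0 (max B1 B2)" "norm (G x) \<le> max 0 (max B1 B2)" by auto
  qed
  show ?thesis by (rule that[of "max 0 (max B1 B2)"]) (use B' in auto)
qed

lemma ctest_test_function:
  fixes \<phi> :: "'a::euclidean_space \<Rightarrow> real"
  assumes "ctest \<phi> G R"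
  shows "test_function \<phi>" "frechet_derivative \<phi> (at x) b = G x \<bullet> b"
proof -
  note D = ctestD[OF assms]
  show fd: "frechet_derivative \<phi> (at x) b = G x \<bullet> b" for x b
    using frechet_derivative_at[OF D(1)[of x]] by metis
  have "{x. \<phi> x \<noteq> 0} \<subseteq> cball 0 R" using D(3) by force
  then have "closure {x. \<phi> x \<noteq> 0} \<subseteq> cball 0 R" by (intro closure_minimal) auto
  then have "compact (closure {x. \<phi> x \<noteq> 0})"
    by (meson bounded_cball bounded_subset closed_closure compact_eq_bounded_closed)
  moreover have "continuous_on UNIV (\<lambda>x. G x \<bullet> b)" for b using D(2) by (intro continuous_intros)
  ultimately show "test_function \<phi>"
    using D(1) by (auto simp: test_function_def fd differentiable_def)
qed

lemma test_function_ctest: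
  fixes \<phi> :: "'a::euclidean_space \<Rightarrow> real"
  assumes "test_function \<phi>"
  obtains G R where "ctest \<phi> G R"
proof -
  define G where "G = (\<lambda>x. \<Sum>b\<in>Basis. frechet_derivative \<phi> (at x) b *\<^sub>R (b::'a))"
  have d: "(\<phi> has_derivative frechet_derivative \<phi> (at x)) (at x)" for x
    using assms by (auto simp: test_function_def frechet_derivative_works[symmetric])
  have "frechet_derivative \<phi> (at x) = (\<lambda>v. G x \<bullet> v)" for x
  proof
    fix v
    interpret bounded_linear "frechet_derivative \<phi> (at x)" using d by (rule has_derivative_bounded_linear)
    have "frechet_derivative \<phi> (at x) v = frechet_derivative \<phi> (at x) (\<Sum>b\<in>Basis. (v \<bullet> b) *\<^sub>R b)"
      by (simp add: euclidean_representation)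
    also have "\<dots> = (\<Sum>b\<in>Basis. (v \<bullet> b) * frechet_derivative \<phi> (at x) b)" by (simp add: sum scaleR)
    also have "\<dots> = G x \<bullet> v" unfolding G_def inner_sum_left by (intro sum.cong refl) (simp add: inner_commute mult.commute)
    finally show "frechet_derivative \<phi> (at x) v = G x \<bullet> v" .
  qed
  then have 1: "(\<phi> has_derivative (\<lambda>v. G x \<bullet> v)) (at x)" for x using d[of x] by simp
  have 2: "continuous_on UNIV G" unfolding G_def using assms
    by (intro continuous_intros) (auto simp: test_function_def)
  have "bounded (closure {x. \<phi> x \<noteq> 0})" using assms by (auto simp: test_function_def dest: compact_imp_bounded)
  then have "bounded {x. \<phi> x \<noteq> 0}" using bounded_subset closure_subset by blast
  then obtain R where "\<forall>x\<in>{x. \<phi> x \<noteq> 0}. norm x \<le> R" unfolding bounded_iff by blast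
  then have "\<phi> x = 0" if "norm x > R" for x using that by force
  then have "ctest \<phi> G R" using 1 2 by (intro ctestI)
  then show ?thesis by (rule that)
qed

lemma ctest_translate:
  assumes "ctest \<phi> G R"
  shows "ctest (\<lambda>x. \<phi> (x + a)) (\<lambda>x. G (x + a)) (R + norm a)"
proof (rule ctestI)
  show "((\<lambda>x. \<phi> (x + a)) has_derivative (\<lambda>v. G (x + a) \<bullet> v)) (at x)" for x
    by (rule has_derivative_compose[of "\<lambda>x. x + a" "\<lambda>v. v", OF _ ctestD(1)[OF assms, of "x + a"], simplified])
      (auto intro!: derivative_eq_intros)
  show "continuous_on UNIV (\<lambda>x. G (x + a))"
    by (rule continuous_on_compose2[OF ctestD(2)[OF assms]]) (auto intro!: continuous_intros)
  show "\<phi> (x + a) = 0" if "norm x > R + norm a" for x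
    using that norm_triangle_ineq2[of x "- a"] by (intro ctestD(3)[OF assms]) simp
qed

lemma integrable_lborel_compact:
  fixes f :: "'a::euclidean_space \<Rightarrow> 'b::euclidean_space"
  assumes [measurable]: "f \<in> borel_measurable borel" and "\<And>x. norm (f x) \<le> B" "\<And>x. norm x > R \<Longrightarrow> f x = 0"
  shows "integrable lborel f"
proof (rule Bochner_Integration.integrable_bound)
  show "integrable lborel (\<lambda>x. B * indicator (cball (0::'a) R) x)"
    by (intro integrable_mult_right integrable_real_indicator) (use emeasure_bounded_finite[of "cball (0::'a) R"] in auto)
  have "norm (f x) \<le> norm (B * indicator (cball 0 R) x)" for x
    using assms(2)[of x] assms(3)[of x] by (cases "norm x > R") (auto simp: indicator_def)
  then show "AE x in lborel. norm (f x) \<le> norm (B * indicator (cball 0 R) x)" by simp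
qed simp

lemma locally_integrable_mult:
  fixes f :: "'a::euclidean_space \<Rightarrow> 'b::euclidean_space"
  assumes f: "locally_integrable f" and [measurable]: "\<phi> \<in> borel_measurable borel"
    and "\<And>x. \<bar>\<phi> x\<bar> \<le> B" "\<And>x. norm x > R \<Longrightarrow> \<phi> x = 0"
  shows "integrable lborel (\<lambda>x. \<phi> x *\<^sub>R f x)"
proof -
  have [measurable]: "f \<in> borel_measurable borel" using f by (simp add: locally_integrable_def)
  show ?thesis
proof (rule Bochner_Integration.integrable_bound)
  show "integrable lborel (\<lambda>x. B *\<^sub>R (indicator (cball 0 R) x *\<^sub>R f x))"
    using f unfolding locally_integrable_def by (intro integrable_scaleR_right) blast
  have "norm (\<phi> x *\<^sub>R f x) \<le> norm (B *\<^sub>R (indicator (cball 0 R) x *\<^sub>R f x))" for x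
    using assms(3)[of x] assms(4)[of x] by (cases "norm x > R") (auto simp: indicator_def intro!: mult_right_mono)
  then show "AE x in lborel. norm (\<phi> x *\<^sub>R f x) \<le> norm (B *\<^sub>R (indicator (cball 0 R) x *\<^sub>R f x))" by simp
qed measurable
qed

text \<open>Measurability of \<open>f\<close> itself is recovered from its truncations to growing
  balls, which converge to it pointwise and eventually agree with it.\<close>

lemma set_integrable_compact_locally_integrable:
  fixes f :: "'a::euclidean_space \<Rightarrow> 'b::euclidean_space"
  assumes "\<And>K. compact K \<Longrightarrow> set_integrable lborel K f"
  shows "locally_integrable f"
proof -
  have i: "integrable lborel (\<lambda>x. indicator (cball 0 r) x *\<^sub>R f x)" for r
    using assms[of "cball 0 r"] by (simp add: set_integrable_def)
  have "f \<in> borel_measurable borel"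
  proof (rule borel_measurable_LIMSEQ_metric)
    show "(\<lambda>x. indicator (cball 0 (real n)) x *\<^sub>R f x) \<in> borel_measurable borel" for n
      using i[of "real n"] by auto
    show "(\<lambda>n. indicator (cball 0 (real n)) x *\<^sub>R f x) \<longlonglongrightarrow> f x" for x
    proof (rule tendsto_eventually)
      obtain N where "norm x \<le> real N" using real_arch_simple by blast
      then show "\<forall>\<^sub>F n in sequentially. indicator (cball 0 (real n)) x *\<^sub>R f x = f x"
        by (intro eventually_sequentiallyI[of N]) (auto simp: indicator_def)
    qed
  qed
  then show ?thesis using i by (simp add: locally_integrable_def)
qed

lemma locally_integrable_set_integrable:
  fixes f :: "'a::euclidean_space \<Rightarrow> 'b::euclidean_space"
  assumes "locally_integrable f" "compact K"
  shows "set_integrable lborel K f"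
proof -
  obtain R where R: "\<forall>x\<in>K. norm x \<le> R" using assms(2) compact_imp_bounded bounded_iff by metis
  have "K \<in> sets borel" using assms(2) by (simp add: borel_compact)
  then show ?thesis unfolding set_integrable_def
    by (intro locally_integrable_mult[OF assms(1), of _ 1 R]) (use R in \<open>auto simp: indicator_def\<close>)
qed

lemma weak_gradientD:
  assumes "weak_gradient f g"
  shows "locally_integrable f" "locally_integrable g"
    "ctest \<phi> G R \<Longrightarrow> (\<integral>x. f x * (G x \<bullet> v) \<partial>lborel) = - (\<integral>x. (g x \<bullet> v) * \<phi> x \<partial>lborel)"
proof -
  show lf: "locally_integrable f" and lg: "locally_integrable g"
    using assms by (auto simp: weak_gradient_def intro!: set_integrable_compact_locally_integrable)
  assume c: "ctest \<phi> G R"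
  note [measurable] = ctest_measurable[OF c]
  obtain B where B: "B \<ge> 0" "\<And>x. \<bar>\<phi> x\<bar> \<le> B" "\<And>x. norm (G x) \<le> B" using ctest_bounded[OF c] by blast
  have b: "(\<integral>x. f x * (G x \<bullet> b) \<partial>lborel) = - (\<integral>x. (g x \<bullet> b) * \<phi> x \<partial>lborel)" if "b \<in> Basis" for b
    using assms that ctest_test_function(1)[OF c] unfolding weak_gradient_def ctest_test_function(2)[OF c, symmetric] by blast
  have i1: "integrable lborel (\<lambda>x. f x * (G x \<bullet> b))" if "b \<in> Basis" for b
  proof -
    have "integrable lborel (\<lambda>x. (G x \<bullet> b) *\<^sub>R f x)"
    proof (rule locally_integrable_mult[OF lf])
      show "\<bar>G x \<bullet> b\<bar> \<le> B" for x using B(3)[of x] that Basis_le_norm[OF that, of "G x"] by linarith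
      show "G x \<bullet> b = 0" if "norm x > R" for x using ctestD(4)[OF c that] by simp
    qed simp
    then show ?thesis by (simp add: mult.commute)
  qed
  have i2: "integrable lborel (\<lambda>x. (g x \<bullet> b) * \<phi> x)" for b
  proof -
    have "integrable lborel (\<lambda>x. \<phi> x *\<^sub>R g x)"
      by (rule locally_integrable_mult[OF lg]) (use B ctestD(3)[OF c] in auto)
    then have "integrable lborel (\<lambda>x. (\<phi> x *\<^sub>R g x) \<bullet> b)" by (rule integrable_inner_left)
    then show ?thesis by (simp add: mult.commute)
  qed
  have "(\<integral>x. f x * (G x \<bullet> v) \<partial>lborel) = (\<integral>x. (\<Sum>b\<in>Basis. (v \<bullet> b) * (f x * (G x \<bullet> b))) \<partial>lborel)"
    by (intro Bochner_Integration.integral_cong refl) (subst euclidean_inner, simp add: sum_distrib_left ac_simps)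
  also have "\<dots> = (\<Sum>b\<in>Basis. (v \<bullet> b) * (\<integral>x. f x * (G x \<bullet> b) \<partial>lborel))"
    using i1 by (subst Bochner_Integration.integral_sum) auto
  also have "\<dots> = - (\<Sum>b\<in>Basis. (v \<bullet> b) * (\<integral>x. (g x \<bullet> b) * \<phi> x \<partial>lborel))"
    by (simp add: b sum_negf)
  also have "(\<Sum>b\<in>Basis. (v \<bullet> b) * (\<integral>x. (g x \<bullet> b) * \<phi> x \<partial>lborel)) = (\<integral>x. (\<Sum>b\<in>Basis. (v \<bullet> b) * ((g x \<bullet> b) * \<phi> x)) \<partial>lborel)"
    using i2 by (subst Bochner_Integration.integral_sum) auto
  also have "\<dots> = (\<integral>x. (g x \<bullet> v) * \<phi> x \<partial>lborel)"
    by (intro Bochner_Integration.integral_cong refl) (subst euclidean_inner[of "g _" v], simp add: sum_distrib_left sum_distrib_right ac_simps)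
  finally show "(\<integral>x. f x * (G x \<bullet> v) \<partial>lborel) = - (\<integral>x. (g x \<bullet> v) * \<phi> x \<partial>lborel)" .
qed

lemma weak_gradientI:
  fixes f :: "'a::euclidean_space \<Rightarrow> real"
  assumes "locally_integrable f" "locally_integrable g"
    and "\<And>\<phi> G R b. ctest \<phi> G R \<Longrightarrow> b \<in> Basis \<Longrightarrow> (\<integral>x. f x * (G x \<bullet> b) \<partial>lborel) = - (\<integral>x. (g x \<bullet> b) * \<phi> x \<partial>lborel)"
  shows "weak_gradient f g"
  unfolding weak_gradient_def
proof (intro conjI allI impI ballI locally_integrable_set_integrable assms)
  fix \<phi> :: "'a \<Rightarrow> real" and b :: 'a assume t: "test_function \<phi>" and b: "b \<in> Basis"
  obtain G R where c: "ctest \<phi> G R" using test_function_ctest[OF t] by blast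
  show "(\<integral>x. f x * frechet_derivative \<phi> (at x) b \<partial>lborel) = - (\<integral>x. (g x \<bullet> b) * \<phi> x \<partial>lborel)"
    using assms(3)[OF c b] by (simp add: ctest_test_function[OF c])
qed

lemma lborel_integral_translate:
  fixes f :: "'a::euclidean_space \<Rightarrow> 'b::{banach, second_countable_topology}"
  assumes [measurable]: "f \<in> borel_measurable borel"
  shows "(\<integral>x. f (c + x) \<partial>lborel) = (\<integral>x. f x \<partial>lborel)"
proof -
  have "(\<integral>x. f x \<partial>lborel) = (\<integral>x. f x \<partial>distr lborel borel ((+) c))" by (simp only: lborel_distr_plus)
  then show ?thesis by (subst (asm) integral_distr) auto
qed

lemma ctest_line_FTC:
  assumes "ctest \<phi> G R" "t \<ge> 0"
  shows "\<phi> (x + t *\<^sub>R v) - \<phi> x = (\<integral>s. (G (x + s *\<^sub>R v) \<bullet> v) * indicator {0..t} s \<partial>lborel)"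
proof -
  have "has_bochner_integral lborel (\<lambda>s. (G (x + s *\<^sub>R v) \<bullet> v) * indicator {0..t} s) (\<phi> (x + t *\<^sub>R v) - \<phi> (x + 0 *\<^sub>R v))"
  proof (rule has_bochner_integral_FTC_Icc_real[OF assms(2)])
    fix s
    have "((\<lambda>s. \<phi> (x + s *\<^sub>R v)) has_derivative (\<lambda>r. G (x + s *\<^sub>R v) \<bullet> (r *\<^sub>R v))) (at s)"
      by (rule has_derivative_compose[of "\<lambda>s. x + s *\<^sub>R v" "\<lambda>r. r *\<^sub>R v", OF _ ctestD(1)[OF assms(1)]])
        (auto intro!: derivative_eq_intros)
    then show "DERIV (\<lambda>s. \<phi> (x + s *\<^sub>R v)) s :> G (x + s *\<^sub>R v) \<bullet> v"
      by (simp add: has_field_derivative_def mult_commute_abs)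
    have "continuous_on UNIV (\<lambda>s. G (x + s *\<^sub>R v) \<bullet> v)"
      by (intro continuous_intros continuous_on_compose2[OF ctestD(2)[OF assms(1)]]) auto
    then show "isCont (\<lambda>s. G (x + s *\<^sub>R v) \<bullet> v) s" by (simp add: continuous_on_eq_continuous_at)
  qed
  then show ?thesis by (simp add: has_bochner_integral_iff)
qed

text \<open>The difference of \<open>\<phi>\<close> and its translate by \<open>v\<close> has
  integral zero. Writing it as a line integral of the derivative and exchanging integrals gives an
  average over \<open>s\<close> of one and the same number, which therefore is zero.\<close>

lemma integral_ctest_deriv:
  fixes \<phi> :: "'a::euclidean_space \<Rightarrow> real"
  assumes c: "ctest \<phi> G R"
  shows "(\<integral>x. G x \<bullet> v \<partial>lborel) = 0"
proof -
  note [measurable] = ctest_measurable[OF c]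
  obtain B where B: "B \<ge> 0" "\<And>x. \<bar>\<phi> x\<bar> \<le> B" "\<And>x. norm (G x) \<le> B" using ctest_bounded[OF c] by blast
  have ip: "integrable lborel \<phi>" by (rule integrable_lborel_compact[of _ B R]) (use B ctestD[OF c] in auto)
  have ip': "integrable lborel (\<lambda>x. \<phi> (x + 1 *\<^sub>R v))"
    by (rule integrable_lborel_compact[of _ B "R + norm v"])
      (use B ctestD(3)[OF ctest_translate[OF c]] in auto)
  let ?h = "\<lambda>(x, s). (G (x + s *\<^sub>R v) \<bullet> v) * indicator {0..1::real} s"
  have "integrable lborel ?h"
  proof (rule integrable_lborel_compact)
    show "norm (?h p) \<le> B * norm v" for p
      using Cauchy_Schwarz_ineq2[of "G (fst p + snd p *\<^sub>R v)" v] mult_right_mono[OF B(3)[of "fst p + snd p *\<^sub>R v"], of "norm v"] B(1)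
      by (auto simp: split_beta indicator_def)
    show "?h p = 0" if p: "norm p > \<bar>R\<bar> + norm v + 1 + 1" for p
    proof (cases "\<bar>snd p\<bar> > 1")
      case False
      obtain x s where ps: "p = (x, s)" by (cases p)
      have "norm x > \<bar>R\<bar> + norm v" using False norm_Pair_le[of x s] p ps by auto
      moreover have "norm (s *\<^sub>R v) \<le> norm v" using False ps by (auto intro: mult_left_le_one_le)
      ultimately have "norm (x + s *\<^sub>R v) > R" using norm_triangle_ineq2[of x "- (s *\<^sub>R v)"] by auto
      then show ?thesis using ps ctestD(4)[OF c] by auto
    qed (auto simp: indicator_def split_beta)
  qed (auto simp: split_beta borel_prod[symmetric])
  then have ih: "integrable (lborel \<Otimes>\<^sub>M lborel) ?h" by (simp add: lborel_prod)
  have "0 = (\<integral>x. \<phi> (x + 1 *\<^sub>R v) - \<phi> x \<partial>lborel)"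
    using ip ip' lborel_integral_translate[of \<phi> v] by (simp add: add.commute)
  also have "\<dots> = (\<integral>x. \<integral>s. (G (x + s *\<^sub>R v) \<bullet> v) * indicator {0..1} s \<partial>lborel \<partial>lborel)"
    by (intro Bochner_Integration.integral_cong refl ctest_line_FTC[OF c]) auto
  also have "\<dots> = (\<integral>s. \<integral>x. (G (x + s *\<^sub>R v) \<bullet> v) * indicator {0..1} s \<partial>lborel \<partial>lborel)"
    using lborel_pair.Fubini_integral[OF ih] by simp
  also have "\<dots> = (\<integral>s. (\<integral>x. G x \<bullet> v \<partial>lborel) * indicator {0..1::real} s \<partial>lborel)"
  proof -
    have "(\<integral>x. G (x + s *\<^sub>R v) \<bullet> v \<partial>lborel) = (\<integral>x. G x \<bullet> v \<partial>lborel)" for s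
      using lborel_integral_translate[of "\<lambda>x. G x \<bullet> v" "s *\<^sub>R v"] by (simp add: add.commute)
    then show ?thesis by (simp only: integral_mult_left_zero)
  qed
  also have "\<dots> = (\<integral>x. G x \<bullet> v \<partial>lborel) * measure lborel {0..1::real}"
    by (subst integral_mult_right_zero) simp
  also have "\<dots> = (\<integral>x. G x \<bullet> v \<partial>lborel)" by (subst measure_lborel_Icc) auto
  finally show ?thesis by simp
qed

section \<open>Continuously differentiable cutoffs and the fundamental lemma of the calculus of
  variations\<close>

definition sqpos :: "real \<Rightarrow> real" where "sqpos r = (max 0 r)\<^sup>2"

lemma sqpos_deriv: "(sqpos has_real_derivative (2 * max 0 r)) (at r)"
proof (cases "r = 0")
  case True
  have "((\<lambda>h. sqpos h / h) \<longlongrightarrow> 0) (at 0)"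
  proof (rule Lim_null_comparison[of _ "\<lambda>h. \<bar>h\<bar>"])
    show "\<forall>\<^sub>F h in at 0. norm (sqpos h / h) \<le> \<bar>h\<bar>"
      by (auto simp: sqpos_def eventually_at_filter max_def power2_eq_square intro!: always_eventually)
    show "(abs \<longlongrightarrow> 0) (at (0::real))" by (rule tendsto_eq_intros | simp)+
  qed
  then show ?thesis using True by (simp add: has_field_derivative_iff sqpos_def)
next
  case False
  consider "r > 0" | "r < 0" using False by linarith
  then show ?thesis
  proof cases
    case 1
    have "((\<lambda>r. r\<^sup>2) has_real_derivative (2 * r)) (at r)" by (auto intro!: derivative_eq_intros)
    then have "(sqpos has_real_derivative (2 * r)) (at r)"
      by (rule has_field_derivative_transform_within_open[of _ _ _ "{0<..}"]) (use 1 in \<open>auto simp: sqpos_def\<close>)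
    then show ?thesis using 1 by simp
  next
    case 2
    have "((\<lambda>r. 0) has_real_derivative 0) (at r)" by (auto intro!: derivative_eq_intros)
    then have "(sqpos has_real_derivative 0) (at r)"
      by (rule has_field_derivative_transform_within_open[of _ _ _ "{..<0}"]) (use 2 in \<open>auto simp: sqpos_def\<close>)
    then show ?thesis using 2 by simp
  qed
qed

lemma sqpos_nonneg [simp]: "sqpos r \<ge> 0" by (simp add: sqpos_def)

lemma sqpos_eq_0 [simp]: "sqpos r = 0 \<longleftrightarrow> r \<le> 0" by (auto simp: sqpos_def max_def)

text \<open>Indicators of boxes are pointwise limits of uniformly bounded test functions with common
  support, so \<open>h\<close> integrates to zero over every box. Lebesgue differentiation over
  shrinking boxes then gives the value zero at almost every point.\<close>

lemma locally_integrable_eq_0: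
  fixes h :: "'a::euclidean_space \<Rightarrow> real"
  assumes h: "locally_integrable h" and z: "\<And>\<phi> G R. ctest \<phi> G R \<Longrightarrow> (\<integral>x. \<phi> x * h x \<partial>lborel) = 0"
  shows "AE x in lborel. h x = 0"
proof -
  have [measurable]: "h \<in> borel_measurable borel" using h by (simp add: locally_integrable_def)
  have box0: "(\<integral>x. indicator (cbox a b) x * h x \<partial>lborel) = 0" for a b :: 'a
  proof -
    \<comment> \<open>\<open>s\<close> vanishes exactly on the box and is at least 1 once a
      coordinate is 1 outside of it. Hence the functions \<open>\<psi>\<close> below equal 1 on the
      box, decrease to its indicator, and vanish outside the ball of radius \<open>R\<close>, where
      some coordinate has left the box by more than 1.\<close>
    define s where "s = (\<lambda>x::'a. \<Sum>i\<in>Basis. sqpos (a \<bullet> i - x \<bullet> i) + sqpos (x \<bullet> i - b \<bullet> i))"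
    define Gs where "Gs = (\<lambda>x::'a. \<Sum>i\<in>Basis. (2 * max 0 (x \<bullet> i - b \<bullet> i) - 2 * max 0 (a \<bullet> i - x \<bullet> i)) *\<^sub>R i)"
    have s_nonneg: "s x \<ge> 0" for x by (simp add: s_def sum_nonneg)
    have ds: "(s has_derivative (\<lambda>v. Gs x \<bullet> v)) (at x)" for x
    proof -
      have 1: "((\<lambda>x. sqpos (a \<bullet> i - x \<bullet> i)) has_derivative (\<lambda>v. - (2 * max 0 (a \<bullet> i - x \<bullet> i)) * (v \<bullet> i))) (at x)" for i
        by (rule has_derivative_eq_rhs[OF has_derivative_compose[OF _ sqpos_deriv[unfolded has_field_derivative_def]]])
          (auto intro!: derivative_eq_intros)
      have 2: "((\<lambda>x. sqpos (x \<bullet> i - b \<bullet> i)) has_derivative (\<lambda>v. (2 * max 0 (x \<bullet> i - b \<bullet> i)) * (v \<bullet> i))) (at x)" for i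
        by (rule has_derivative_eq_rhs[OF has_derivative_compose[OF _ sqpos_deriv[unfolded has_field_derivative_def]]])
          (auto intro!: derivative_eq_intros)
      show ?thesis unfolding s_def
        by (rule has_derivative_eq_rhs[OF has_derivative_sum[OF has_derivative_add[OF 1 2]]])
          (unfold Gs_def inner_sum_left, auto simp: fun_eq_iff algebra_simps inner_commute intro!: sum.cong)
    qed
    have cs: "continuous_on UNIV s" using ds by (intro continuous_at_imp_continuous_on) (auto dest: has_derivative_continuous)
    have cG: "continuous_on UNIV Gs" unfolding Gs_def by (intro continuous_intros)
    define \<psi> where "\<psi> = (\<lambda>k::nat. \<lambda>x. sqpos (1 - real (Suc k) * s x))"
    define R where "R = (\<Sum>i\<in>Basis. \<bar>a \<bullet> i\<bar> + \<bar>b \<bullet> i\<bar> + 1)"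
    have sup: "\<psi> k x = 0" if "norm x > R" for k x
    proof -
      have "\<exists>i\<in>Basis. \<bar>x \<bullet> i\<bar> > \<bar>a \<bullet> i\<bar> + \<bar>b \<bullet> i\<bar> + 1"
      proof (rule ccontr)
        assume "\<not> ?thesis"
        then have "(\<Sum>i\<in>Basis. \<bar>x \<bullet> i\<bar>) \<le> R" unfolding R_def by (intro sum_mono) auto
        then show False using norm_le_l1[of x] that by simp
      qed
      then obtain i where i: "i \<in> Basis" "\<bar>x \<bullet> i\<bar> > \<bar>a \<bullet> i\<bar> + \<bar>b \<bullet> i\<bar> + 1" by blast
      have "1 \<le> max 0 (a \<bullet> i - x \<bullet> i) \<or> 1 \<le> max 0 (x \<bullet> i - b \<bullet> i)" using i by auto
      then have "1 \<le> sqpos (a \<bullet> i - x \<bullet> i) \<or> 1 \<le> sqpos (x \<bullet> i - b \<bullet> i)"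
        unfolding sqpos_def by (auto simp: one_le_power)
      then have "1 \<le> sqpos (a \<bullet> i - x \<bullet> i) + sqpos (x \<bullet> i - b \<bullet> i)"
        using sqpos_nonneg[of "a \<bullet> i - x \<bullet> i"] sqpos_nonneg[of "x \<bullet> i - b \<bullet> i"] by linarith
      also have "\<dots> \<le> s x" unfolding s_def using i(1)
        by (intro member_le_sum[of i Basis "\<lambda>i. sqpos (a \<bullet> i - x \<bullet> i) + sqpos (x \<bullet> i - b \<bullet> i)"]) auto
      finally have "1 \<le> s x" .
      then have "1 * 1 \<le> real (Suc k) * s x" by (intro mult_mono) auto
      then show ?thesis by (simp add: \<psi>_def)
    qed
    have ct: "ctest (\<psi> k) (\<lambda>x. (- 2 * max 0 (1 - real (Suc k) * s x) * real (Suc k)) *\<^sub>R Gs x) R" for k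
    proof (rule ctestI)
      fix x
      have "((\<lambda>x. 1 - real (Suc k) * s x) has_derivative (\<lambda>v. - (real (Suc k) * (Gs x \<bullet> v)))) (at x)"
        by (rule has_derivative_eq_rhs[OF has_derivative_diff[OF has_derivative_const has_derivative_mult_right[OF ds]]]) auto
      then show "(\<psi> k has_derivative (\<lambda>v. ((- 2 * max 0 (1 - real (Suc k) * s x) * real (Suc k)) *\<^sub>R Gs x) \<bullet> v)) (at x)"
        unfolding \<psi>_def
        by (rule has_derivative_eq_rhs[OF has_derivative_compose[OF _ sqpos_deriv[unfolded has_field_derivative_def]]])
          (auto simp: fun_eq_iff)
    next
      show "continuous_on UNIV (\<lambda>x. (- 2 * max 0 (1 - real (Suc k) * s x) * real (Suc k)) *\<^sub>R Gs x)"
        by (intro continuous_intros cs cG)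
    qed (rule sup)
    have [measurable]: "\<psi> k \<in> borel_measurable borel" for k by (rule ctest_measurable[OF ct])
    have b1: "\<bar>\<psi> k x\<bar> \<le> 1" for k x
    proof -
      have "max 0 (1 - real (Suc k) * s x) \<le> 1" using s_nonneg[of x] by simp
      then have "(max 0 (1 - real (Suc k) * s x))\<^sup>2 \<le> 1" by (intro power_le_one) auto
      then show ?thesis by (simp add: \<psi>_def sqpos_def)
    qed
    have lim: "(\<lambda>k. \<psi> k x) \<longlonglongrightarrow> indicator (cbox a b) x" for x
    proof (cases "x \<in> cbox a b")
      case True
      then have "s x = 0" unfolding s_def by (intro sum.neutral) (auto simp: mem_box add_nonneg_eq_0_iff)
      then show ?thesis using True by (simp add: \<psi>_def sqpos_def)
    next
      case False
      then obtain i where i: "i \<in> Basis" "a \<bullet> i > x \<bullet> i \<or> x \<bullet> i > b \<bullet> i" by (auto simp: mem_box not_le)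
      then have "0 < sqpos (a \<bullet> i - x \<bullet> i) + sqpos (x \<bullet> i - b \<bullet> i)"
        using sqpos_nonneg sqpos_eq_0 by (smt (verit))
      also have "\<dots> \<le> s x" unfolding s_def using i(1)
        by (intro member_le_sum[of i Basis "\<lambda>i. sqpos (a \<bullet> i - x \<bullet> i) + sqpos (x \<bullet> i - b \<bullet> i)"]) auto
      finally have sx: "s x > 0" .
      obtain N where N: "real N > 1 / s x" using reals_Archimedean2 by blast
      have "\<psi> k x = 0" if "k \<ge> N" for k
      proof -
        have "1 / s x \<le> real (Suc k)" using N that by simp
        then have "1 \<le> real (Suc k) * s x" using sx by (simp add: field_simps del: of_nat_Suc)
        then show ?thesis by (simp add: \<psi>_def)
      qed
      then have "\<forall>\<^sub>F k in sequentially. \<psi> k x = 0" by (intro eventually_sequentiallyI[of N])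
      then show ?thesis using False by (simp add: tendsto_eventually)
    qed
    have "(\<lambda>k. \<integral>x. \<psi> k x * h x \<partial>lborel) \<longlonglongrightarrow> (\<integral>x. indicator (cbox a b) x * h x \<partial>lborel)"
    proof (rule integral_dominated_convergence)
      show "integrable lborel (\<lambda>x. norm (indicator (cball 0 R) x *\<^sub>R h x))"
        using h by (intro integrable_norm) (auto simp: locally_integrable_def)
      show "AE x in lborel. (\<lambda>k. \<psi> k x * h x) \<longlonglongrightarrow> indicator (cbox a b) x * h x"
        using lim by (intro always_eventually allI tendsto_mult tendsto_const) auto
      show "AE x in lborel. norm (\<psi> k x * h x) \<le> norm (indicator (cball 0 R) x *\<^sub>R h x)" for k
      proof (intro always_eventually allI)
        fix x show "norm (\<psi> k x * h x) \<le> norm (indicator (cball 0 R) x *\<^sub>R h x)"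
          using b1[of k x] sup[of x k] by (cases "norm x > R") (auto simp: indicator_def abs_mult mult_left_le_one_le)
      qed
    qed auto
    then show ?thesis using z[OF ct] by (simp add: LIMSEQ_const_iff)
  qed
  have si: "set_integrable lborel (cbox a b) h" for a b
    by (rule locally_integrable_set_integrable[OF h]) simp
  have hk: "h integrable_on cbox a b" "integral (cbox a b) h = 0" for a b
    using set_borel_integral_eq_integral[OF si[of a b]] box0[of a b] by (auto simp: set_lebesgue_integral_def)
  obtain N where N: "negligible N" "\<And>x e. \<lbrakk>x \<notin> N; 0 < e\<rbrakk> \<Longrightarrow> \<exists>d>0. \<forall>t. 0 < t \<and> t < d \<longrightarrow>
                         norm (integral (cbox x (x + t *\<^sub>R One)) h /\<^sub>R t ^ DIM('a) - h x) < e"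
    using integrable_ccontinuous_explicit[OF hk(1)] by blast
  have "h x = 0" if xN: "x \<notin> N" for x
  proof (rule ccontr)
    assume "h x \<noteq> 0"
    then obtain d where d: "d > 0" "\<forall>t. 0 < t \<and> t < d \<longrightarrow> norm (integral (cbox x (x + t *\<^sub>R One)) h /\<^sub>R t ^ DIM('a) - h x) < \<bar>h x\<bar>"
      using N(2)[OF xN, of "\<bar>h x\<bar>"] by auto
    then have "norm (integral (cbox x (x + (d/2) *\<^sub>R One)) h /\<^sub>R (d/2) ^ DIM('a) - h x) < \<bar>h x\<bar>" by auto
    then show False by (simp add: hk)
  qed
  then have "AE x in lebesgue. h x = 0"
    using N(1) by (intro AE_I'[of N]) (auto simp: negligible_iff_null_sets)
  then show ?thesis by (subst (asm) AE_completion_iff) auto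
qed

subsection \<open>Differentiation along lines\<close>

lemma cball_borel [measurable]: "cball a r \<in> sets (borel :: 'a::euclidean_space measure)"
  by simp

text \<open>This justifies Fubini in the base point and the line parameter. By translation
  invariance every slice in \<open>s\<close> has mass at most the same constant, namely that of
  \<open>k\<close> on a ball enlarged by \<open>t * norm v\<close>, and only \<open>s\<close> in
  \<open>[0, t]\<close> contributes.\<close>

lemma integrable_line:
  fixes k :: "'a::euclidean_space \<Rightarrow> real"
  assumes k: "locally_integrable k" and [measurable]: "\<phi> \<in> borel_measurable borel"
    and B: "\<And>x. \<bar>\<phi> x\<bar> \<le> B" and R: "\<And>x. norm x > R \<Longrightarrow> \<phi> x = 0" and t: "t \<ge> 0"
  shows "integrable (lborel \<Otimes>\<^sub>M lborel) (\<lambda>(x, s). \<phi> x * k (x + s *\<^sub>R v) * indicator {0..t} s)"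
proof (rule integrableI_bounded)
  have [measurable]: "k \<in> borel_measurable borel" using k by (simp add: locally_integrable_def)
  show "(\<lambda>(x, s). \<phi> x * k (x + s *\<^sub>R v) * indicator {0..t} s) \<in> borel_measurable (lborel \<Otimes>\<^sub>M lborel)"
    by measurable
  define R' where "R' = R + t * norm v"
  define C where "C = (\<integral>\<^sup>+ y. ennreal (norm (B * (indicator (cball 0 R') y *\<^sub>R k y))) \<partial>(lborel::'a measure))"
  have "integrable lborel (\<lambda>y. B * (indicator (cball 0 R') y *\<^sub>R k y))"
    using k unfolding locally_integrable_def by (intro integrable_mult_right) blast
  then have C: "C < \<infinity>" unfolding C_def by (simp only: integrable_iff_bounded)
  have Bnn: "B \<ge> 0" using B[of 0] by linarith
  have pt: "ennreal (norm (\<phi> x * k (x + s *\<^sub>R v) * indicator {0..t} s))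
     \<le> ennreal (norm (B * (indicator (cball 0 R') (x + s *\<^sub>R v) *\<^sub>R k (x + s *\<^sub>R v)))) * indicator {0..t} s" for x s
  proof (cases "s \<in> {0..t} \<and> norm x \<le> R")
    case True
    then have "norm (s *\<^sub>R v) \<le> t * norm v" by (auto intro: mult_right_mono)
    then have "norm (x + s *\<^sub>R v) \<le> R'" using True norm_triangle_ineq[of x "s *\<^sub>R v"] by (auto simp: R'_def)
    then show ?thesis using True B[of x] Bnn by (auto simp: abs_mult intro!: ennreal_leI mult_right_mono)
  next
    case False
    then show ?thesis using R[of x] by (auto simp: indicator_def)
  qed
  have "(\<integral>\<^sup>+ p. ennreal (norm (case p of (x, s) \<Rightarrow> \<phi> x * k (x + s *\<^sub>R v) * indicator {0..t} s)) \<partial>(lborel \<Otimes>\<^sub>M lborel))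
    = (\<integral>\<^sup>+ s. \<integral>\<^sup>+ x. ennreal (norm (\<phi> x * k (x + s *\<^sub>R v) * indicator {0..t} s)) \<partial>lborel \<partial>lborel)"
    by (subst lborel_pair.nn_integral_snd[symmetric]) auto
  also have "\<dots> \<le> (\<integral>\<^sup>+ s. \<integral>\<^sup>+ x. ennreal (norm (B * (indicator (cball 0 R') (x + s *\<^sub>R v) *\<^sub>R k (x + s *\<^sub>R v)))) * indicator {0..t} s \<partial>lborel \<partial>lborel)"
    by (intro nn_integral_mono pt)
  also have "\<dots> = (\<integral>\<^sup>+ s. C * indicator {0..t} s \<partial>lborel)"
  proof (intro nn_integral_cong)
    fix s
    have "(\<integral>\<^sup>+ x. ennreal (norm (B * (indicator (cball 0 R') (x + s *\<^sub>R v) *\<^sub>R k (x + s *\<^sub>R v)))) \<partial>lborel) = C"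
      using nn_integral_lborel_translate[of "\<lambda>y. ennreal (norm (B * (indicator (cball 0 R') y *\<^sub>R k y)))" "s *\<^sub>R v"]
      by (simp add: C_def add.commute)
    then show "(\<integral>\<^sup>+ x. ennreal (norm (B * (indicator (cball 0 R') (x + s *\<^sub>R v) *\<^sub>R k (x + s *\<^sub>R v)))) * indicator {0..t} s \<partial>lborel)
      = C * indicator {0..t} s"
      by (subst nn_integral_multc) auto
  qed
  also have "\<dots> = C * ennreal t" using t by (subst nn_integral_cmult) auto
  also have "\<dots> < \<infinity>" using C by (simp add: ennreal_mult_less_top)
  finally show "(\<integral>\<^sup>+ p. ennreal (norm (case p of (x, s) \<Rightarrow> \<phi> x * k (x + s *\<^sub>R v) * indicator {0..t} s)) \<partial>(lborel \<Otimes>\<^sub>M lborel)) < \<infinity>" .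
qed

lemma locally_integrable_inner:
  fixes g :: "'a::euclidean_space \<Rightarrow> 'b::euclidean_space"
  assumes "locally_integrable g"
  shows "locally_integrable (\<lambda>x. g x \<bullet> v)"
  unfolding locally_integrable_def
proof (intro conjI allI)
  show "(\<lambda>x. g x \<bullet> v) \<in> borel_measurable borel" using assms by (auto simp: locally_integrable_def)
  fix r
  have "integrable lborel (\<lambda>x. (indicator (cball 0 r) x *\<^sub>R g x) \<bullet> v)"
    using assms by (intro integrable_inner_left) (auto simp: locally_integrable_def)
  then show "integrable lborel (\<lambda>x. indicat_real (cball 0 r) x *\<^sub>R (g x \<bullet> v))" by simp
qed

text \<open>Tested against \<open>\<phi>\<close>, the translation of \<open>f\<close> is moved onto
  the test function, where the classical fundamental theorem holds along the line. The definition of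
  the weak gradient moves the derivative back to \<open>f\<close>, and equality of all these
  integrals gives equality almost everywhere.\<close>

lemma weak_gradient_line:
  fixes f :: "'a::euclidean_space \<Rightarrow> real"
  assumes wg: "weak_gradient f g" and t: "t \<ge> 0"
  shows "AE x in lborel. f (x + t *\<^sub>R v) - f x = (\<integral>s. (g (x + s *\<^sub>R v) \<bullet> v) * indicator {0..t} s \<partial>lborel)"
proof -
  define k where "k = (\<lambda>x. g x \<bullet> v)"
  have lf: "locally_integrable f" and lg: "locally_integrable g" by (rule weak_gradientD[OF wg])+
  have lk: "locally_integrable k" unfolding k_def by (rule locally_integrable_inner[OF lg])
  have [measurable]: "f \<in> borel_measurable borel" "k \<in> borel_measurable borel" using lf lk by (auto simp: locally_integrable_def)
  define I where "I = (\<lambda>x. \<integral>s. k (x + s *\<^sub>R v) * indicator {0..t} s \<partial>lborel)"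
  have [measurable]: "I \<in> borel_measurable borel" unfolding I_def by measurable
  have iI: "integrable lborel (\<lambda>x. \<phi> x * I x)"
    and eI: "(\<integral>x. \<phi> x * I x \<partial>lborel) = (\<integral>s. (\<integral>x. \<phi> x * k (x + s *\<^sub>R v) \<partial>lborel) * indicator {0..t} s \<partial>lborel)"
    if "\<phi> \<in> borel_measurable borel" "\<And>x. \<bar>\<phi> x\<bar> \<le> B" "\<And>x. norm x > R \<Longrightarrow> \<phi> x = 0" for \<phi> :: "'a \<Rightarrow> real" and B R
  proof -
    note i = integrable_line[OF lk that t, where v = v]
    have "integrable lborel (\<lambda>x. \<integral>s. \<phi> x * k (x + s *\<^sub>R v) * indicator {0..t} s \<partial>lborel)"
      using lborel_pair.integrable_fst'[OF i] by simp
    then show "integrable lborel (\<lambda>x. \<phi> x * I x)" by (simp add: I_def mult.assoc)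
    have "(\<integral>x. \<phi> x * I x \<partial>lborel) = (\<integral>x. \<integral>s. \<phi> x * k (x + s *\<^sub>R v) * indicator {0..t} s \<partial>lborel \<partial>lborel)"
      by (simp add: I_def mult.assoc)
    also have "\<dots> = (\<integral>s. \<integral>x. \<phi> x * k (x + s *\<^sub>R v) * indicator {0..t} s \<partial>lborel \<partial>lborel)"
      using lborel_pair.Fubini_integral[OF i] by simp
    finally show "(\<integral>x. \<phi> x * I x \<partial>lborel) = (\<integral>s. (\<integral>x. \<phi> x * k (x + s *\<^sub>R v) \<partial>lborel) * indicator {0..t} s \<partial>lborel)" by simp
  qed
  have if1: "integrable lborel (\<lambda>x. \<phi> x * f (x + a))"
    if [measurable]: "\<phi> \<in> borel_measurable borel" and "\<And>x. \<bar>\<phi> x\<bar> \<le> B" "\<And>x. norm x > R \<Longrightarrow> \<phi> x = 0" for \<phi> :: "'a \<Rightarrow> real" and B R a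
  proof -
    have "integrable lborel (\<lambda>x. \<phi> (x - a) *\<^sub>R f x)"
    proof (rule locally_integrable_mult[OF lf, of _ B "R + norm a"])
      show "\<phi> (x - a) = 0" if "norm x > R + norm a" for x
        using that norm_triangle_ineq2[of x a] \<open>\<And>x. norm x > R \<Longrightarrow> \<phi> x = 0\<close> by simp
    qed (use that in auto)
    then have "integrable (distr lborel borel ((+) a)) (\<lambda>x. \<phi> (x - a) *\<^sub>R f x)" by (simp only: lborel_distr_plus)
    then show ?thesis by (subst (asm) integrable_distr_eq) (auto simp: add.commute)
  qed
  have lh: "locally_integrable (\<lambda>x. f (x + t *\<^sub>R v) - f x - I x)"
    unfolding locally_integrable_def
  proof (intro conjI allI)
    fix r
    have p: "(indicator (cball 0 r) :: 'a \<Rightarrow> real) \<in> borel_measurable borel" "\<And>x::'a. \<bar>indicator (cball 0 r) x\<bar> \<le> (1::real)"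
      "\<And>x::'a. norm x > r \<Longrightarrow> indicator (cball 0 r) x = (0::real)" by (auto intro!: borel_measurable_indicator)
    show "integrable lborel (\<lambda>x. indicat_real (cball 0 r) x *\<^sub>R (f (x + t *\<^sub>R v) - f x - I x))"
      using Bochner_Integration.integrable_diff[OF Bochner_Integration.integrable_diff[OF if1[OF p, where a = "t *\<^sub>R v"] if1[OF p, where a = 0]] iI[OF p]]
      by (simp add: algebra_simps)
  qed measurable
  have "AE x in lborel. f (x + t *\<^sub>R v) - f x - I x = 0"
  proof (rule locally_integrable_eq_0[OF lh])
    fix \<phi> :: "'a \<Rightarrow> real" and G R assume c: "ctest \<phi> G R"
    note [measurable] = ctest_measurable[OF c]
    obtain B where B: "B \<ge> 0" "\<And>x. \<bar>\<phi> x\<bar> \<le> B" "\<And>x. norm (G x) \<le> B" using ctest_bounded[OF c] by blast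
    have p: "\<phi> \<in> borel_measurable borel" "\<And>x. \<bar>\<phi> x\<bar> \<le> B" "\<And>x. norm x > R \<Longrightarrow> \<phi> x = 0"
      using B ctestD[OF c] by auto
    have p': "integrable lborel (\<lambda>y. \<phi> (y - t *\<^sub>R v) * f y)"
    proof -
      have "integrable lborel (\<lambda>y. \<phi> (y + (- t *\<^sub>R v)) *\<^sub>R f y)"
        using ctestD(3)[OF ctest_translate[OF c, of "- t *\<^sub>R v"]] B
        by (intro locally_integrable_mult[OF lf, of _ B "R + norm (- t *\<^sub>R v)"]) auto
      then show ?thesis by simp
    qed
    \<comment> \<open>The dominating function is an instance of \<open>integrable_line\<close> with
      direction 0: \<open>f\<close> stays in place, and the moving test function is bounded by a
      multiple of the indicator of an enlarged ball.\<close>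
    have fub: "integrable (lborel \<Otimes>\<^sub>M lborel) (\<lambda>(y, s). f y * (G (y + s *\<^sub>R (- v)) \<bullet> (- v)) * indicator {0..t} s)"
    proof (rule Bochner_Integration.integrable_bound)
      define R' where "R' = R + t * norm v"
      show "integrable (lborel \<Otimes>\<^sub>M lborel) (\<lambda>(y, s). (B * norm v * indicator (cball 0 R') y) * f (y + s *\<^sub>R 0) * indicator {0..t} s)"
        by (rule integrable_line[OF lf, of _ "B * norm v" R']) (use B t in \<open>auto simp: indicator_def\<close>)
      have "\<bar>f y * (G (y + s *\<^sub>R (- v)) \<bullet> (- v)) * indicator {0..t} s\<bar> \<le> \<bar>(B * norm v * indicator (cball 0 R') y) * f (y + s *\<^sub>R 0) * indicator {0..t} s\<bar>" for y s
      proof (cases "s \<in> {0..t} \<and> norm (y + s *\<^sub>R (- v)) \<le> R")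
        case True
        have "norm (s *\<^sub>R v) \<le> t * norm v" using True by (auto intro: mult_right_mono)
        then have "norm y \<le> R'" using True norm_triangle_ineq[of "y + s *\<^sub>R (- v)" "s *\<^sub>R v"] by (auto simp: R'_def)
        moreover have "\<bar>G (y + s *\<^sub>R (- v)) \<bullet> (- v)\<bar> \<le> B * norm v"
          using Cauchy_Schwarz_ineq2[of "G (y + s *\<^sub>R (- v))" "- v"] mult_right_mono[OF B(3), of "norm v" "y + s *\<^sub>R (- v)"] by simp
        ultimately show ?thesis using True B by (auto simp: abs_mult mult.commute intro!: mult_left_mono)
      next
        case False
        then show ?thesis using ctestD(4)[OF c, of "y + s *\<^sub>R (- v)"] by (auto simp: indicator_def)
      qed
      then show "AE p in lborel \<Otimes>\<^sub>M lborel. norm (case p of (y, s) \<Rightarrow> f y * (G (y + s *\<^sub>R (- v)) \<bullet> (- v)) * indicator {0..t} s)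
         \<le> norm (case p of (y, s) \<Rightarrow> (B * norm v * indicator (cball 0 R') y) * f (y + s *\<^sub>R 0) * indicator {0..t} s)"
        by (auto simp: split_beta)
    qed measurable
    have "(\<integral>x. \<phi> x * f (x + t *\<^sub>R v) \<partial>lborel) = (\<integral>y. \<phi> (y - t *\<^sub>R v) * f y \<partial>lborel)"
      using lborel_integral_translate[of "\<lambda>y. \<phi> (y - t *\<^sub>R v) * f y" "t *\<^sub>R v"] by (simp add: add.commute)
    then have "(\<integral>x. \<phi> x * f (x + t *\<^sub>R v) \<partial>lborel) - (\<integral>x. \<phi> x * f x \<partial>lborel) = (\<integral>y. \<phi> (y - t *\<^sub>R v) * f y - \<phi> y * f y \<partial>lborel)"
      using if1[OF p, where a = 0] p' by simp
    also have "\<dots> = (\<integral>y. f y * (\<phi> (y + t *\<^sub>R (- v)) - \<phi> y) \<partial>lborel)" by (simp add: algebra_simps)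
    also have "\<dots> = (\<integral>y. \<integral>s. f y * (G (y + s *\<^sub>R (- v)) \<bullet> (- v)) * indicator {0..t} s \<partial>lborel \<partial>lborel)"
      unfolding ctest_line_FTC[OF c t] by (simp only: mult.assoc integral_mult_right_zero)
    also have "\<dots> = (\<integral>s. \<integral>y. f y * (G (y + s *\<^sub>R (- v)) \<bullet> (- v)) * indicator {0..t} s \<partial>lborel \<partial>lborel)"
      using lborel_pair.Fubini_integral[OF fub] by simp
    also have "\<dots> = (\<integral>s. (\<integral>y. f y * (G (y + s *\<^sub>R (- v)) \<bullet> (- v)) \<partial>lborel) * indicator {0..t} s \<partial>lborel)"
      by (simp only: integral_mult_left_zero)
    also have "\<dots> = (\<integral>s. (\<integral>x. \<phi> x * k (x + s *\<^sub>R v) \<partial>lborel) * indicator {0..t} s \<partial>lborel)"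
    proof -
      have "(\<integral>y. f y * (G (y + s *\<^sub>R (- v)) \<bullet> (- v)) \<partial>lborel) = (\<integral>x. \<phi> x * k (x + s *\<^sub>R v) \<partial>lborel)" for s
      proof -
        have "(\<integral>y. f y * (G (y + s *\<^sub>R (- v)) \<bullet> (- v)) \<partial>lborel) = - (\<integral>y. (g y \<bullet> (- v)) * \<phi> (y + s *\<^sub>R (- v)) \<partial>lborel)"
          by (rule weak_gradientD(3)[OF wg ctest_translate[OF c]])
        also have "\<dots> = (\<integral>y. \<phi> (y - s *\<^sub>R v) * k y \<partial>lborel)" by (simp add: k_def mult.commute)
        also have "\<dots> = (\<integral>x. \<phi> x * k (x + s *\<^sub>R v) \<partial>lborel)"
          using lborel_integral_translate[of "\<lambda>y. \<phi> (y - s *\<^sub>R v) * k y" "s *\<^sub>R v"] by (simp add: add.commute)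
        finally show ?thesis .
      qed
      then show ?thesis by simp
    qed
    also have "\<dots> = (\<integral>x. \<phi> x * I x \<partial>lborel)" using eI[OF p] by simp
    finally show "(\<integral>x. \<phi> x * (f (x + t *\<^sub>R v) - f x - I x) \<partial>lborel) = 0"
      using if1[OF p, where a = "t *\<^sub>R v"] if1[OF p, where a = 0] iI[OF p] by (simp add: right_diff_distrib)
  qed
  then show ?thesis by (simp add: I_def k_def)
qed

text \<open>With countable quantifiers the set of points of convergence is visibly
  measurable.\<close>

lemma LIMSEQ_iff_countable:
  fixes X :: "nat \<Rightarrow> real"
  shows "X \<longlonglongrightarrow> L \<longleftrightarrow> (\<forall>m. \<exists>N. \<forall>n\<ge>N. \<bar>X n - L\<bar> < 1 / real (Suc m))"
proof
  assume "X \<longlonglongrightarrow> L"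
  then show "\<forall>m. \<exists>N. \<forall>n\<ge>N. \<bar>X n - L\<bar> < 1 / real (Suc m)"
    by (auto simp: LIMSEQ_iff simp del: of_nat_Suc)
next
  assume *: "\<forall>m. \<exists>N. \<forall>n\<ge>N. \<bar>X n - L\<bar> < 1 / real (Suc m)"
  show "X \<longlonglongrightarrow> L"
  proof (rule LIMSEQ_I)
    fix r :: real assume "r > 0"
    then obtain m where "1 / real (Suc m) < r" by (metis nat_approx_posE)
    then show "\<exists>no. \<forall>n\<ge>no. norm (X n - L) < r" using *[rule_format, of m] by (force intro: less_trans)
  qed
qed

text \<open>Lebesgue differentiation in one direction only. On almost every line the one-dimensional
  theorem applies for almost every parameter; averaging over a unit range of parameters and using
  translation invariance turns this into a statement about almost every point.\<close>

lemma lborel_line_differentiation: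
  fixes k :: "'a::euclidean_space \<Rightarrow> real"
  assumes k: "locally_integrable k"
  shows "AE x in lborel. (\<lambda>n. real (Suc n) * (\<integral>s. k (x + s *\<^sub>R v) * indicator {0..1 / real (Suc n)} s \<partial>lborel)) \<longlonglongrightarrow> k x"
proof -
  have [measurable]: "k \<in> borel_measurable borel" using k by (simp add: locally_integrable_def)
  define F where "F = (\<lambda>n x. real (Suc n) * (\<integral>s. k (x + s *\<^sub>R v) * indicator {0..1 / real (Suc n)} s \<partial>lborel))"
  have [measurable]: "F n \<in> borel_measurable borel" for n unfolding F_def by measurable
  define P where "P = (\<lambda>x. \<forall>m. \<exists>N. \<forall>n. n \<ge> N \<longrightarrow> \<bar>F n x - k x\<bar> < 1 / real (Suc m))"
  have [measurable]: "Measurable.pred borel P" unfolding P_def by measurable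
  have P: "P x \<longleftrightarrow> (\<lambda>n. F n x) \<longlonglongrightarrow> k x" for x unfolding P_def LIMSEQ_iff_countable ..
  have "AE x in lborel. integrable lborel (\<lambda>s. indicator (cball 0 (real n)) x * k (x + s *\<^sub>R v) * indicator {0..2} s)" for n
  proof -
    have "integrable (lborel \<Otimes>\<^sub>M lborel) (\<lambda>(x, s). indicator (cball 0 (real n)) x * k (x + s *\<^sub>R v) * indicator {0..2} s)"
      by (rule integrable_line[OF k, of _ 1 "real n"]) (auto intro!: borel_measurable_indicator)
    from lborel_pair.AE_integrable_fst'[OF this] show ?thesis by simp
  qed
  then have "AE x in lborel. \<forall>n. integrable lborel (\<lambda>s. indicator (cball 0 (real n)) x * k (x + s *\<^sub>R v) * indicator {0..2} s)"
    by (simp add: AE_all_countable)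
  then have ae: "AE x in lborel. AE s in lborel. s \<in> {0..1} \<longrightarrow> P (x + s *\<^sub>R v)"
  proof eventually_elim
    case (elim x)
    obtain n where n: "norm x \<le> real n" using real_arch_simple by blast
    \<comment> \<open>The cutoff at 2 leaves room: base parameters lie in \<open>[0, 1]\<close> and
      the averaging steps have length at most 1.\<close>
    define q where "q = (\<lambda>s. k (x + s *\<^sub>R v) * indicator {0..2} s :: real)"
    have iq: "integrable lborel q" using elim[rule_format, of n] n by (simp add: q_def)
    have [measurable]: "q \<in> borel_measurable borel" unfolding q_def by measurable
    have "q integrable_on cbox a b" for a b
      using integrable_on_lborel[OF iq] integrable_on_subcbox by blast
    then obtain N where N: "negligible N" "\<And>x e. \<lbrakk>x \<notin> N; 0 < e\<rbrakk> \<Longrightarrow> \<exists>d>0. \<forall>t. 0 < t \<and> t < d \<longrightarrow>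
                         norm (integral (cbox x (x + t *\<^sub>R One)) q /\<^sub>R t ^ DIM(real) - q x) < e"
      using integrable_ccontinuous_explicit by blast
    have "AE s in lebesgue. s \<notin> N" using N(1) by (intro AE_I'[of N]) (auto simp: negligible_iff_null_sets)
    moreover have "AE s in lebesgue. s \<noteq> (1::real)"
      by (intro AE_I'[of "{1}"]) auto
    ultimately have "AE s in lebesgue. s \<in> {0..1} \<longrightarrow> P (x + s *\<^sub>R v)"
    proof eventually_elim
      case (elim s)
      show ?case
      proof
        assume "s \<in> {0..1}"
        then have s: "0 \<le> s" "s < 1" using elim by auto
        have av: "F n (x + s *\<^sub>R v) = integral (cbox s (s + 1 / real (Suc n))) q * real (Suc n)" for n
        proof -
          let ?h = "1 / real (Suc n)"
          have h: "0 < ?h" "?h \<le> 1" by auto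
          have ind: "k (x + (s + r) *\<^sub>R v) * indicator {0..?h} r = q (s + r) * indicator {s..s + ?h} (s + r)" for r
            using s by (auto simp: q_def indicator_def simp del: of_nat_Suc dest: order_trans[OF _ h(2)])
          have "(\<integral>r. k (x + s *\<^sub>R v + r *\<^sub>R v) * indicator {0..?h} r \<partial>lborel) = (\<integral>r. q (s + r) * indicator {s..s + ?h} (s + r) \<partial>lborel)"
            by (simp only: ind[symmetric]) (simp add: algebra_simps)
          also have "\<dots> = (\<integral>r. q r * indicator {s..s + ?h} r \<partial>lborel)"
            by (rule lborel_integral_translate[of "\<lambda>r. q r * indicator {s..s + ?h} r" s]) measurable
          also have "\<dots> = integral (cbox s (s + ?h)) q"
          proof -
            have "set_integrable lborel (cbox s (s + ?h)) q"
              unfolding set_integrable_def by (rule integrable_mult_indicator[OF _ iq]) simp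
            from set_borel_integral_eq_integral(2)[OF this] show ?thesis
              by (simp add: set_lebesgue_integral_def mult.commute cbox_interval)
          qed
          finally show ?thesis by (simp add: F_def)
        qed
        have "(\<lambda>n. F n (x + s *\<^sub>R v)) \<longlonglongrightarrow> k (x + s *\<^sub>R v)"
        proof (rule LIMSEQ_I)
          fix e :: real assume "e > 0"
          then obtain d where d: "d > 0" "\<And>t. 0 < t \<Longrightarrow> t < d \<Longrightarrow> norm (integral (cbox s (s + t *\<^sub>R One)) q /\<^sub>R t ^ DIM(real) - q s) < e"
            using N(2)[of s e] elim by blast
          obtain M where M: "1 / real (Suc M) < d" using d(1) by (metis nat_approx_posE)
          have "norm (F n (x + s *\<^sub>R v) - k (x + s *\<^sub>R v)) < e" if "n \<ge> M" for n
          proof -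
            have "1 / real (Suc n) \<le> 1 / real (Suc M)" using that by (intro divide_left_mono) auto
            then have "norm (integral (cbox s (s + (1 / real (Suc n)) *\<^sub>R One)) q /\<^sub>R (1 / real (Suc n)) ^ DIM(real) - q s) < e"
              using M by (intro d) auto
            then show ?thesis using s by (simp add: av q_def mult.commute del: of_nat_Suc)
          qed
          then show "\<exists>no. \<forall>n\<ge>no. norm (F n (x + s *\<^sub>R v) - k (x + s *\<^sub>R v)) < e" by blast
        qed
        then show "P (x + s *\<^sub>R v)" by (simp add: P)
      qed
    qed
    then show ?case by (subst (asm) AE_completion_iff) auto
  qed
  \<comment> \<open>The indicator of the bad set. Its integral equals the average over
    \<open>s\<close> in \<open>[0, 1]\<close> of the integrals of its translates, which Fubini turns
    into integrals along lines, and these are zero.\<close>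
  define c where "c = (\<lambda>y. if P y then 0 else 1 :: ennreal)"
  have [measurable]: "c \<in> borel_measurable borel" unfolding c_def by measurable
  have "(\<integral>\<^sup>+ y. c y \<partial>lborel) = (\<integral>\<^sup>+ s. (\<integral>\<^sup>+ y. c y \<partial>lborel) * indicator {0..1::real} s \<partial>lborel)"
    by (subst nn_integral_cmult) auto
  also have "\<dots> = (\<integral>\<^sup>+ s. \<integral>\<^sup>+ x. c (x + s *\<^sub>R v) * indicator {0..1} s \<partial>lborel \<partial>lborel)"
  proof (intro nn_integral_cong)
    fix s :: real
    show "(\<integral>\<^sup>+ y. c y \<partial>lborel) * indicator {0..1} s = (\<integral>\<^sup>+ x. c (x + s *\<^sub>R v) * indicator {0..1} s \<partial>lborel)"
      using nn_integral_lborel_translate[of c "s *\<^sub>R v"] by (subst nn_integral_multc) (auto simp: add.commute)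
  qed
  also have "\<dots> = (\<integral>\<^sup>+ x. \<integral>\<^sup>+ s. c (x + s *\<^sub>R v) * indicator {0..1} s \<partial>lborel \<partial>lborel)"
    by (rule lborel_pair.Fubini') measurable
  also have "\<dots> = (\<integral>\<^sup>+ x. 0 \<partial>(lborel :: 'a measure))"
  proof (rule nn_integral_cong_AE, use ae in eventually_elim)
    case (elim x)
    have "(\<integral>\<^sup>+ s. c (x + s *\<^sub>R v) * indicator {0..1} s \<partial>lborel) = (\<integral>\<^sup>+ s. 0 \<partial>(lborel :: real measure))"
      by (rule nn_integral_cong_AE, use elim in eventually_elim) (auto simp: c_def indicator_def)
    then show ?case by simp
  qed
  finally have "(\<integral>\<^sup>+ y. c y \<partial>lborel) = 0" by simp
  then have "AE y in lborel. c y = 0" by (subst (asm) nn_integral_0_iff_AE) auto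
  then show ?thesis by eventually_elim (auto simp: c_def P F_def split: if_splits)
qed

text \<open>At a zero of a nonnegative function all difference quotients are nonnegative, and in the
  limit so is the derivative in every direction, hence in \<open>b\<close> and in
  \<open>- b\<close>. This makes the convention of division by zero in the Fisher information
  harmless.\<close>

lemma weak_gradient_zero_set:
  fixes f :: "'a::euclidean_space \<Rightarrow> real"
  assumes wg: "weak_gradient f g" and nn: "\<And>x. f x \<ge> 0"
  shows "AE x in lborel. f x = 0 \<longrightarrow> g x = 0"
proof -
  have ge: "AE x in lborel. f x = 0 \<longrightarrow> g x \<bullet> v \<ge> 0" for v
  proof -
    have "AE x in lborel. \<forall>n. f (x + (1 / real (Suc n)) *\<^sub>R v) - f x = (\<integral>s. (g (x + s *\<^sub>R v) \<bullet> v) * indicator {0..1 / real (Suc n)} s \<partial>lborel)"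
      unfolding AE_all_countable by (intro allI weak_gradient_line[OF wg]) simp
    moreover have "AE x in lborel. (\<lambda>n. real (Suc n) * (\<integral>s. (g (x + s *\<^sub>R v) \<bullet> v) * indicator {0..1 / real (Suc n)} s \<partial>lborel)) \<longlonglongrightarrow> g x \<bullet> v"
      by (rule lborel_line_differentiation[OF locally_integrable_inner[OF weak_gradientD(2)[OF wg]]])
    ultimately show ?thesis
    proof eventually_elim
      case (elim x)
      show ?case
      proof
        assume "f x = 0"
        then have "0 \<le> real (Suc n) * (\<integral>s. (g (x + s *\<^sub>R v) \<bullet> v) * indicator {0..1 / real (Suc n)} s \<partial>lborel)" for n
          using nn[of "x + (1 / real (Suc n)) *\<^sub>R v"] elim(1)[rule_format, of n] by (metis diff_zero mult_nonneg_nonneg of_nat_0_le_iff)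
        then show "g x \<bullet> v \<ge> 0" using elim(2) by (intro LIMSEQ_le_const[OF elim(2)]) auto
      qed
    qed
  qed
  have "AE x in lborel. \<forall>b\<in>Basis. (f x = 0 \<longrightarrow> g x \<bullet> b \<ge> 0) \<and> (f x = 0 \<longrightarrow> g x \<bullet> (- b) \<ge> 0)"
    by (intro AE_finite_allI finite_Basis AE_conjI ge)
  then show ?thesis
  proof eventually_elim
    case (elim x)
    then have "f x = 0 \<Longrightarrow> b \<in> Basis \<Longrightarrow> g x \<bullet> b = 0" for b by (force intro: antisym)
    then show ?case by (auto intro: euclidean_eqI)
  qed
qed

subsection \<open>Gaussian mollification\<close>

lemma nn_integral_lborel_affine:
  fixes f :: "'a::euclidean_space \<Rightarrow> ennreal"
  assumes [measurable]: "f \<in> borel_measurable borel" and c: "c > 0"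
  shows "(\<integral>\<^sup>+ x. f x \<partial>lborel) = ennreal (c ^ DIM('a)) * (\<integral>\<^sup>+ x. f (t + c *\<^sub>R x) \<partial>lborel)"
proof -
  have "(\<integral>\<^sup>+ x. f x \<partial>lborel) = (\<integral>\<^sup>+ x. f x \<partial>density (distr lborel borel (\<lambda>x. t + c *\<^sub>R x)) (\<lambda>_. \<bar>c\<bar> ^ DIM('a)))"
    using lborel_affine[of c t] c by simp
  also have "\<dots> = ennreal (c ^ DIM('a)) * (\<integral>\<^sup>+ x. f (t + c *\<^sub>R x) \<partial>lborel)"
    using c by (simp add: nn_integral_density nn_integral_distr nn_integral_cmult)
  finally show ?thesis .
qed

lemma integral_lborel_affine:
  fixes f :: "'a::euclidean_space \<Rightarrow> 'b::{banach, second_countable_topology}"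
  assumes [measurable]: "f \<in> borel_measurable borel" and c: "c > 0"
  shows "(\<integral>x. f x \<partial>lborel) = (c ^ DIM('a)) *\<^sub>R (\<integral>x. f (t + c *\<^sub>R x) \<partial>lborel)"
    and "integrable lborel f \<longleftrightarrow> integrable lborel (\<lambda>x. f (t + c *\<^sub>R x))"
proof -
  have l: "lborel = density (distr lborel borel (\<lambda>x. t + c *\<^sub>R x)) (\<lambda>_. ennreal (c ^ DIM('a)))"
    using lborel_affine[of c t] c by simp
  have "(\<integral>x. f x \<partial>lborel) = (\<integral>x. f x \<partial>density (distr lborel borel (\<lambda>x. t + c *\<^sub>R x)) (\<lambda>_. ennreal (c ^ DIM('a))))"
    by (subst l) (rule refl)
  also have "\<dots> = (c ^ DIM('a)) *\<^sub>R (\<integral>x. f (t + c *\<^sub>R x) \<partial>lborel)"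
    using c by (subst integral_density) (auto simp: integral_distr)
  finally show "(\<integral>x. f x \<partial>lborel) = (c ^ DIM('a)) *\<^sub>R (\<integral>x. f (t + c *\<^sub>R x) \<partial>lborel)" .
  have "integrable lborel f \<longleftrightarrow> integrable (density (distr lborel borel (\<lambda>x. t + c *\<^sub>R x)) (\<lambda>_. ennreal (c ^ DIM('a)))) f"
    by (subst l) (rule refl)
  also have "\<dots> \<longleftrightarrow> integrable lborel (\<lambda>x. (c ^ DIM('a)) *\<^sub>R f (t + c *\<^sub>R x))"
    using c by (subst integrable_density) (auto simp: integrable_distr_eq)
  also have "\<dots> \<longleftrightarrow> integrable lborel (\<lambda>x. f (t + c *\<^sub>R x))"
    using integrable_scaleR_right[of "1 / c ^ DIM('a)" lborel "\<lambda>x. (c ^ DIM('a)) *\<^sub>R f (t + c *\<^sub>R x)"]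
      integrable_scaleR_right[of "c ^ DIM('a)" lborel "\<lambda>x. f (t + c *\<^sub>R x)"] c by auto
  finally show "integrable lborel f \<longleftrightarrow> integrable lborel (\<lambda>x. f (t + c *\<^sub>R x))" .
qed

lemma integral_gaussian:
  fixes f :: "'a::euclidean_space \<Rightarrow> 'b::{banach, second_countable_topology}"
  assumes [measurable]: "f \<in> borel_measurable borel"
  shows "(\<integral>x. f x \<partial>gaussian) = (\<integral>x. gauss_density x *\<^sub>R f x \<partial>lborel)"
    and "integrable gaussian f \<longleftrightarrow> integrable lborel (\<lambda>x. gauss_density x *\<^sub>R f x)"
  unfolding gaussian_eq by (auto simp: integral_density integrable_density)

lemma ennreal_integral_le_nn_integral:
  assumes h: "integrable M h" and le: "AE x in M. h x \<le> k x" and [measurable]: "k \<in> borel_measurable M"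
  shows "ennreal (\<integral>x. h x \<partial>M) \<le> (\<integral>\<^sup>+ x. ennreal (k x) \<partial>M)"
proof -
  have i: "integrable M (\<lambda>x. max 0 (h x))" using h by simp
  have "(\<integral>x. h x \<partial>M) \<le> (\<integral>x. max 0 (h x) \<partial>M)" by (intro integral_mono h i) auto
  then have "ennreal (\<integral>x. h x \<partial>M) \<le> ennreal (\<integral>x. max 0 (h x) \<partial>M)" by (rule ennreal_leI)
  also have "\<dots> = (\<integral>\<^sup>+ x. ennreal (max 0 (h x)) \<partial>M)" using i by (intro nn_integral_eq_integral[symmetric]) auto
  also have "\<dots> \<le> (\<integral>\<^sup>+ x. ennreal (k x) \<partial>M)"
    by (rule nn_integral_mono_AE, use le in eventually_elim) (auto simp: max_def intro: ennreal_leI)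
  finally show ?thesis .
qed

text \<open>The Gaussian kernel of variance \<open>s\<close> without its factor
  \<open>1 / sqrt s ^ DIM('a)\<close>, which is restored in \<open>heat_gker\<close>. In this form
  it has a bound independent of \<open>s\<close>.\<close>

definition gker :: "real \<Rightarrow> 'a::euclidean_space \<Rightarrow> real" where
  "gker s p = gauss_density ((1 / sqrt s) *\<^sub>R p)"

lemma gker_eq: "s > 0 \<Longrightarrow> gker s p = (2 * pi) powr (- real DIM('a) / 2) * exp (- (p \<bullet> p) / (2 * s))" for p :: "'a::euclidean_space"
  by (simp add: gker_def gauss_density_def power_divide power_mult_distrib power2_norm_eq_inner)

lemma gker_pos: "gker s p > 0" by (simp add: gker_def gauss_density_pos)

lemma gker_measurable [measurable]: "gker s \<in> borel_measurable borel"
  unfolding gker_def by measurable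

lemma gker_le: "s > 0 \<Longrightarrow> gker s (p::'a::euclidean_space) \<le> (2 * pi) powr (- real DIM('a) / 2)"
  by (subst gker_eq) (auto intro!: mult_left_le)

lemma gker_deriv:
  fixes p :: "'a::euclidean_space"
  assumes "s > 0"
  shows "(gker s has_derivative (\<lambda>v. (- (gker s p / s) *\<^sub>R p) \<bullet> v)) (at p)"
proof -
  have "((\<lambda>p::'a. (2 * pi) powr (- real DIM('a) / 2) * exp (- (p \<bullet> p) / (2 * s))) has_derivative
      (\<lambda>v. (- (gker s p / s) *\<^sub>R p) \<bullet> v)) (at p)"
    using assms
    by (auto intro!: derivative_eq_intros simp: gker_eq fun_eq_iff field_simps inner_commute)
  then show ?thesis
    by (rule has_derivative_transform_within_open[of _ _ _ _ UNIV]) (use gker_eq[OF assms, where ?'a = 'a] in auto)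
qed

lemma gker_bound2:
  fixes p :: "'a::euclidean_space"
  assumes "s > 0"
  shows "(norm p)\<^sup>2 * gker s p \<le> 2 * s * (2 * pi) powr (- real DIM('a) / 2)"
proof -
  define t where "t = (p \<bullet> p) / (2 * s)"
  have "t \<le> exp t" using exp_ge_add_one_self[of t] by linarith
  then have "t * exp (- t) \<le> exp t * exp (- t)" by (intro mult_right_mono) auto
  then have "t * exp (- t) \<le> 1" by (simp add: exp_minus)
  then have "2 * s * (2 * pi) powr (- real DIM('a) / 2) * (t * exp (- t)) \<le> 2 * s * (2 * pi) powr (- real DIM('a) / 2) * 1"
    using assms by (intro mult_left_mono) auto
  moreover have "(norm p)\<^sup>2 * gker s p = 2 * s * (2 * pi) powr (- real DIM('a) / 2) * (t * exp (- t))"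
    using assms by (simp add: gker_eq t_def power2_norm_eq_inner)
  ultimately show ?thesis by simp
qed

text \<open>Two applications of the mean value theorem along the segment from \<open>p\<close> to
  \<open>p + z\<close>. The second derivative is at most \<open>3 / s\<close> times the maximum of
  the kernel and \<open>(norm z)\<^sup>2\<close>: a share 2 comes from \<open>gker_bound2\<close>
  and a share 1 from \<open>gker_le\<close>.\<close>

lemma gker_taylor:
  fixes p z :: "'a::euclidean_space"
  assumes s: "s > 0"
  shows "\<bar>gker s (p + z) - gker s p - (- (gker s p / s) *\<^sub>R p) \<bullet> z\<bar> \<le> (3 / s * (2 * pi) powr (- real DIM('a) / 2)) * (norm z)\<^sup>2"
proof -
  define c where "c = (2 * pi) powr (- real DIM('a) / 2)"
  define D where "D = (\<lambda>r. gker s (p + r *\<^sub>R z))"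
  define D1 where "D1 = (\<lambda>r. - (gker s (p + r *\<^sub>R z) / s) * ((p + r *\<^sub>R z) \<bullet> z))"
  define D2 where "D2 = (\<lambda>r. gker s (p + r *\<^sub>R z) / s\<^sup>2 * ((p + r *\<^sub>R z) \<bullet> z)\<^sup>2 - gker s (p + r *\<^sub>R z) / s * (z \<bullet> z))"
  have d: "(D has_real_derivative D1 r) (at r)" for r
  proof -
    have "((\<lambda>r. gker s (p + r *\<^sub>R z)) has_derivative (\<lambda>h. (- (gker s (p + r *\<^sub>R z) / s) *\<^sub>R (p + r *\<^sub>R z)) \<bullet> (h *\<^sub>R z))) (at r)"
      by (rule has_derivative_compose[OF _ gker_deriv[OF s]]) (auto intro!: derivative_eq_intros)
    then show ?thesis unfolding has_field_derivative_def D_def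
      by (rule has_derivative_eq_rhs) (auto simp: fun_eq_iff D1_def inner_add_left algebra_simps add_divide_distrib)
  qed
  have d1: "(D1 has_real_derivative D2 r) (at r)" for r
  proof -
    have "((\<lambda>r. (p + r *\<^sub>R z) \<bullet> z) has_real_derivative (z \<bullet> z)) (at r)"
      unfolding has_field_derivative_def by (auto intro!: derivative_eq_intros simp: mult_commute_abs)
    note dm = DERIV_mult[OF DERIV_cmult[OF d, of "- (1 / s)"] this]
    have D1': "D1 = (\<lambda>r. - (1 / s) * D r * ((p + r *\<^sub>R z) \<bullet> z))" by (simp add: D1_def D_def fun_eq_iff)
    have gen: "- (1 / s) * (- (k / s) * q) * q + b * (- (1 / s) * k) = k / s\<^sup>2 * q\<^sup>2 - k / s * b" for k q b :: real
      by (simp add: power2_eq_square mult.assoc mult.commute[of b k])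
    have "- (1 / s) * D1 r * ((p + r *\<^sub>R z) \<bullet> z) + z \<bullet> z * (- (1 / s) * D r) = D2 r"
      unfolding D1_def D_def D2_def by (rule gen)
    then show ?thesis using DERIV_cong[OF dm] unfolding D1' by simp
  qed
  have D2: "\<bar>D2 r\<bar> \<le> 3 / s * c * (norm z)\<^sup>2" for r
  proof -
    let ?q = "p + r *\<^sub>R z"
    have k: "0 \<le> gker s ?q" "gker s ?q \<le> c" using gker_pos[of s ?q] gker_le[OF s, of ?q] by (auto simp: c_def)
    have "(?q \<bullet> z)\<^sup>2 \<le> ((norm ?q) * norm z)\<^sup>2"
      using Cauchy_Schwarz_ineq2[of ?q z] by (intro abs_le_square_iff[THEN iffD1]) simp
    then have "gker s ?q * (?q \<bullet> z)\<^sup>2 \<le> gker s ?q * ((norm ?q) * norm z)\<^sup>2" using k by (intro mult_left_mono)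
    also have "\<dots> = ((norm ?q)\<^sup>2 * gker s ?q) * (norm z)\<^sup>2" by (simp add: power_mult_distrib)
    also have "\<dots> \<le> (2 * s * c) * (norm z)\<^sup>2" unfolding c_def by (intro mult_right_mono gker_bound2[OF s]) auto
    finally have "gker s ?q * (?q \<bullet> z)\<^sup>2 / s\<^sup>2 \<le> (2 * s * c) * (norm z)\<^sup>2 / s\<^sup>2" by (intro divide_right_mono) auto
    then have 1: "gker s ?q / s\<^sup>2 * (?q \<bullet> z)\<^sup>2 \<le> 2 / s * c * (norm z)\<^sup>2" using s by (simp add: power2_eq_square field_simps)
    have "gker s ?q * (norm z)\<^sup>2 / s \<le> c * (norm z)\<^sup>2 / s" using k s by (intro divide_right_mono mult_right_mono) auto
    then have 2: "gker s ?q / s * (z \<bullet> z) \<le> 1 / s * c * (norm z)\<^sup>2" by (simp add: power2_norm_eq_inner)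
    have 3: "0 \<le> gker s ?q / s\<^sup>2 * (?q \<bullet> z)\<^sup>2" "0 \<le> gker s ?q / s * (z \<bullet> z)" using k s by auto
    have "3 / s * c * (norm z)\<^sup>2 = 2 / s * c * (norm z)\<^sup>2 + 1 / s * c * (norm z)\<^sup>2" by (simp add: field_simps)
    then show ?thesis using 1 2 3 unfolding D2_def by linarith
  qed
  define M where "M = 3 / s * c * (norm z)\<^sup>2"
  have D1: "\<bar>D1 r - D1 0\<bar> \<le> M" if r: "0 < r" "r \<le> 1" for r
  proof -
    obtain y where "D1 r - D1 0 = (r - 0) * D2 y" using MVT2[OF r(1), of D1 D2] d1 by blast
    then have "\<bar>D1 r - D1 0\<bar> = r * \<bar>D2 y\<bar>" using that by (simp add: abs_mult)
    also have "\<dots> \<le> 1 * M" using that D2[of y] by (intro mult_mono) (auto simp: M_def)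
    finally show ?thesis by simp
  qed
  obtain y where y: "0 < y" "y < 1" "D 1 - D 0 = (1 - 0) * D1 y" using MVT2[of 0 1 D D1] d by force
  then have "\<bar>D 1 - D 0 - D1 0\<bar> \<le> M" using D1[of y] by simp
  then show ?thesis by (simp add: D_def D1_def M_def c_def)
qed

lemma heat_gker:
  fixes F :: "'a::euclidean_space \<Rightarrow> 'b::euclidean_space"
  assumes [measurable]: "F \<in> borel_measurable borel" and s: "s > 0"
  shows "heat s F x = (1 / sqrt s ^ DIM('a)) *\<^sub>R (\<integral>y. gker s (y - x) *\<^sub>R F y \<partial>lborel)"
proof -
  have "heat s F x = (\<integral>z. gauss_density z *\<^sub>R F (x + sqrt s *\<^sub>R z) \<partial>lborel)"
    unfolding heat_def by (subst integral_gaussian) auto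
  moreover have "(\<integral>y. gker s (y - x) *\<^sub>R F y \<partial>lborel) = (sqrt s ^ DIM('a)) *\<^sub>R (\<integral>z. gauss_density z *\<^sub>R F (x + sqrt s *\<^sub>R z) \<partial>lborel)"
    using s by (subst integral_lborel_affine(1)[of _ "sqrt s" x]) (auto simp: gker_def)
  ultimately show ?thesis using s by simp
qed

lemma integrable_gker:
  fixes F :: "'a::euclidean_space \<Rightarrow> 'b::euclidean_space"
  assumes F: "integrable lborel F" and s: "s > 0"
  shows "integrable lborel (\<lambda>y. gker s (y - x) *\<^sub>R F y)"
proof (rule Bochner_Integration.integrable_bound)
  show "integrable lborel (\<lambda>y. (2 * pi) powr (- real DIM('a) / 2) *\<^sub>R F y)" using F by auto
  show "AE y in lborel. norm (gker s (y - x) *\<^sub>R F y) \<le> norm ((2 * pi) powr (- real DIM('a) / 2) *\<^sub>R F y)"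
    using gker_le[OF s, of "y - x" for y] gker_pos[of s "y - x" for y] by (auto intro!: always_eventually mult_right_mono simp: less_imp_le)
qed (use F in auto)

lemma integrable_heat_lborel:
  fixes F :: "'a::euclidean_space \<Rightarrow> 'b::euclidean_space"
  assumes F: "integrable lborel F" and s: "s > 0"
  shows "integrable gaussian (\<lambda>z. F (x + sqrt s *\<^sub>R z))"
proof -
  have [measurable]: "F \<in> borel_measurable borel" using F by auto
  have "integrable lborel (\<lambda>z. gker s (x + sqrt s *\<^sub>R z - x) *\<^sub>R F (x + sqrt s *\<^sub>R z))"
    using integrable_gker[OF F s, of x] s by (subst (asm) integral_lborel_affine(2)[of _ "sqrt s" x]) auto
  then show ?thesis using s by (subst integral_gaussian) (auto simp: gker_def)
qed

lemma integrable_gaussian_lborel: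
  fixes F :: "'a::euclidean_space \<Rightarrow> 'b::euclidean_space"
  assumes F: "integrable lborel F"
  shows "integrable gaussian F"
  using integrable_heat_lborel[OF F, of 1 0] by simp

text \<open>Rotating the pair of variables moves the noise from \<open>F\<close> onto
  \<open>h\<close>. When the noise tends to 0, continuity is then required of the bounded factor
  \<open>h\<close> and not of the merely integrable \<open>F\<close>.\<close>

lemma integral_gaussian_mehler:
  fixes F :: "'a::euclidean_space \<Rightarrow> real"
  assumes F: "integrable gaussian F" and [measurable]: "h \<in> borel_measurable borel" and h: "\<And>x. \<bar>h x\<bar> \<le> B"
    and cs: "c\<^sup>2 + s\<^sup>2 = 1" "s \<noteq> 0"
  shows "(\<integral>x. (\<integral>z. F (c *\<^sub>R x + s *\<^sub>R z) \<partial>gaussian) * h x \<partial>gaussian)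
     = (\<integral>p. F (fst p) * h (c *\<^sub>R fst p - s *\<^sub>R snd p) \<partial>(gaussian \<Otimes>\<^sub>M (gaussian :: 'a measure)))"
    and "integrable (gaussian \<Otimes>\<^sub>M (gaussian :: 'a measure)) (\<lambda>p. F (fst p))"
proof -
  have [measurable]: "F \<in> borel_measurable borel" using borel_measurable_integrable[OF F] by simp
  show i0: "integrable (gaussian \<Otimes>\<^sub>M (gaussian :: 'a measure)) (\<lambda>p. F (fst p))"
    using F by (subst integrable_distr_eq[symmetric, where N = gaussian])
      (auto simp: gaussian.distr_pair_fst)
  have i1: "integrable (gaussian \<Otimes>\<^sub>M (gaussian :: 'a measure)) (\<lambda>p. F (fst p) * h (c *\<^sub>R fst p - s *\<^sub>R snd p))"
  proof (rule Bochner_Integration.integrable_bound)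
    show "integrable (gaussian \<Otimes>\<^sub>M (gaussian :: 'a measure)) (\<lambda>p. B * F (fst p))" using i0 by auto
    show "AE p in gaussian \<Otimes>\<^sub>M gaussian. norm (F (fst p) * h (c *\<^sub>R fst p - s *\<^sub>R snd p)) \<le> norm (B * F (fst p))"
    proof (intro always_eventually allI)
      fix p :: "'a \<times> 'a"
      have "B \<ge> 0" using order_trans[OF abs_ge_zero h] by blast
      then show "norm (F (fst p) * h (c *\<^sub>R fst p - s *\<^sub>R snd p)) \<le> norm (B * F (fst p))"
        using mult_left_mono[OF h, of "\<bar>F (fst p)\<bar>" "c *\<^sub>R fst p - s *\<^sub>R snd p"] by (simp add: abs_mult mult.commute)
    qed
  qed measurable
  let ?R = "\<lambda>(x, z). (c *\<^sub>R x + s *\<^sub>R z, c *\<^sub>R z - s *\<^sub>R x :: 'a)"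
  have rot: "c *\<^sub>R (c *\<^sub>R x + s *\<^sub>R z) - s *\<^sub>R (c *\<^sub>R z - s *\<^sub>R x) = x" for x z :: 'a
  proof -
    have "c *\<^sub>R (c *\<^sub>R x + s *\<^sub>R z) - s *\<^sub>R (c *\<^sub>R z - s *\<^sub>R x) = (c\<^sup>2 + s\<^sup>2) *\<^sub>R x" by (simp add: algebra_simps power2_eq_square)
    then show ?thesis using cs by simp
  qed
  have i2: "integrable (gaussian \<Otimes>\<^sub>M (gaussian :: 'a measure)) (\<lambda>p. F (c *\<^sub>R fst p + s *\<^sub>R snd p) * h (fst p))"
    using i1 by (subst (asm) distr_gaussian_rotate[OF cs, symmetric], subst (asm) integrable_distr_eq) (auto simp: split_beta' rot)
  have "(\<integral>x. (\<integral>z. F (c *\<^sub>R x + s *\<^sub>R z) \<partial>gaussian) * h x \<partial>gaussian) = (\<integral>x. (\<integral>z. F (c *\<^sub>R x + s *\<^sub>R z) * h x \<partial>gaussian) \<partial>gaussian)"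
    by simp
  also have "\<dots> = (\<integral>p. F (c *\<^sub>R fst p + s *\<^sub>R snd p) * h (fst p) \<partial>(gaussian \<Otimes>\<^sub>M (gaussian :: 'a measure)))"
    using gaussian_pair.integral_fst'[OF i2] by simp
  also have "\<dots> = (\<integral>p. F (fst p) * h (c *\<^sub>R fst p - s *\<^sub>R snd p) \<partial>distr (gaussian \<Otimes>\<^sub>M gaussian) (borel \<Otimes>\<^sub>M borel) ?R)"
    by (subst integral_distr) (auto simp: split_beta' rot)
  also have "\<dots> = (\<integral>p. F (fst p) * h (c *\<^sub>R fst p - s *\<^sub>R snd p) \<partial>(gaussian \<Otimes>\<^sub>M (gaussian :: 'a measure)))"
    by (simp only: distr_gaussian_rotate[OF cs])
  finally show "(\<integral>x. (\<integral>z. F (c *\<^sub>R x + s *\<^sub>R z) \<partial>gaussian) * h x \<partial>gaussian)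
     = (\<integral>p. F (fst p) * h (c *\<^sub>R fst p - s *\<^sub>R snd p) \<partial>(gaussian \<Otimes>\<^sub>M (gaussian :: 'a measure)))" .
qed

subsection \<open>The logarithmic Sobolev inequality for weak gradients\<close>

lemma le_one_plus_square: "x \<le> 1 + x\<^sup>2" for x :: real
proof -
  have "0 \<le> (x - 1 / 2)\<^sup>2" by simp
  then show ?thesis by (simp add: power2_diff power_divide)
qed

lemma norm_gker_le:
  fixes p :: "'a::euclidean_space"
  assumes s: "s > 0"
  shows "norm (gker s p *\<^sub>R p) \<le> (1 + 2 * s) * (2 * pi) powr (- real DIM('a) / 2)"
proof -
  have "norm p \<le> 1 + (norm p)\<^sup>2"
    by (rule le_one_plus_square)
  then have "gker s p * norm p \<le> gker s p * (1 + (norm p)\<^sup>2)" using gker_pos[of s p] by (intro mult_left_mono) auto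
  also have "\<dots> = gker s p + (norm p)\<^sup>2 * gker s p" by (simp add: algebra_simps)
  also have "\<dots> \<le> (2 * pi) powr (- real DIM('a) / 2) + 2 * s * (2 * pi) powr (- real DIM('a) / 2)"
    by (intro add_mono gker_le gker_bound2 s)
  finally show ?thesis using gker_pos[of s p] by (simp add: algebra_simps)
qed

lemma integrable_bounded_mult:
  fixes F :: "'a::euclidean_space \<Rightarrow> real" and k :: "'a \<Rightarrow> 'b::euclidean_space"
  assumes F: "integrable M F" and [measurable]: "k \<in> borel_measurable M" and k: "\<And>x. norm (k x) \<le> B"
  shows "integrable M (\<lambda>x. F x *\<^sub>R k x)"
proof (rule Bochner_Integration.integrable_bound)
  show "integrable M (\<lambda>x. B * F x)" using F by auto
  show "AE x in M. norm (F x *\<^sub>R k x) \<le> norm (B * F x)"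
  proof (intro always_eventually allI)
    fix x
    have "B \<ge> 0" using order_trans[OF norm_ge_zero k] by blast
    then show "norm (F x *\<^sub>R k x) \<le> norm (B * F x)"
      using mult_left_mono[OF k, of "\<bar>F x\<bar>" x] by (simp add: abs_mult mult.commute)
  qed
qed (use F in auto)

lemma integral_diff3:
  fixes a b c :: "'a \<Rightarrow> real"
  assumes "integrable M a" "integrable M b" "integrable M c"
  shows "(\<integral>x. a x - b x - c x \<partial>M) = (\<integral>x. a x \<partial>M) - (\<integral>x. b x \<partial>M) - (\<integral>x. c x \<partial>M)"
  using assms by simp

text \<open>The cutoff enters squared: with \<open>F\<close> equal to \<open>ch\<close> squared
  times \<open>f\<close>, the quotient of the squared gradient by \<open>F\<close> contains no
  division by \<open>ch\<close>, because both terms of the gradient carry a factor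
  \<open>ch\<close>.\<close>

locale cut_weak =
  fixes f :: "'a::euclidean_space \<Rightarrow> real" and g :: "'a \<Rightarrow> 'a" and ch :: "'a \<Rightarrow> real" and X :: "'a \<Rightarrow> 'a" and R :: real
  assumes wg: "weak_gradient f g" and f_nonneg: "\<And>x. f x \<ge> 0"
    and ch: "ctest ch X R" and ch01: "\<And>x. 0 \<le> ch x" "\<And>x. ch x \<le> 1"
begin

definition F where "F x = (ch x)\<^sup>2 * f x"
definition G where "G x = (ch x)\<^sup>2 *\<^sub>R g x + (2 * ch x * f x) *\<^sub>R X x"
text \<open>Setting the gradient to zero where \<open>F\<close> vanishes makes the tangent
  inequality for the quotient hold at every point. By \<open>weak_gradient_zero_set\<close> the
  change affects only a null set.\<close>

definition G' where "G' x = (if F x = 0 then 0 else G x)"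
definition J where "J = (\<integral>\<^sup>+ x. ennreal ((norm (G' x))\<^sup>2 / F x) \<partial>gaussian)"

lemma lf: "locally_integrable f" and lg: "locally_integrable g" by (rule weak_gradientD[OF wg])+

lemma meas [measurable]: "f \<in> borel_measurable borel" "g \<in> borel_measurable borel" "ch \<in> borel_measurable borel" "X \<in> borel_measurable borel"
  using lf lg ctest_measurable[OF ch] by (auto simp: locally_integrable_def)

lemma meas' [measurable]: "F \<in> borel_measurable borel" "G \<in> borel_measurable borel" "G' \<in> borel_measurable borel"
  unfolding F_def[abs_def] G_def[abs_def] G'_def[abs_def] by measurable

lemma F_nonneg: "F x \<ge> 0" by (simp add: F_def f_nonneg)

lemma ch2: "\<bar>(ch x)\<^sup>2\<bar> \<le> 1" using ch01[of x] by (simp add: power_le_one)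

lemma iF: "integrable lborel F"
proof -
  have "integrable lborel (\<lambda>x. (ch x)\<^sup>2 *\<^sub>R f x)"
    by (rule locally_integrable_mult[OF lf _ ch2]) (use ctestD(3)[OF ch] in auto)
  then show ?thesis by (simp add: F_def[abs_def])
qed

lemma iG: "integrable lborel G"
proof -
  have 1: "integrable lborel (\<lambda>x. (ch x)\<^sup>2 *\<^sub>R g x)"
    by (rule locally_integrable_mult[OF lg _ ch2]) (use ctestD(3)[OF ch] in auto)
  obtain B where B: "B \<ge> 0" "\<And>x. \<bar>ch x\<bar> \<le> B" "\<And>x. norm (X x) \<le> B" using ctest_bounded[OF ch] by blast
  have i: "integrable lborel (\<lambda>x. 2 * ch x * f x)"
  proof -
    have "integrable lborel (\<lambda>x. (2 * ch x) *\<^sub>R f x)"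
      by (rule locally_integrable_mult[OF lf, of _ "2 * B" R]) (use B ctestD(3)[OF ch] in \<open>auto simp: abs_mult\<close>)
    then show ?thesis by simp
  qed
  have "integrable lborel (\<lambda>x. (2 * ch x * f x) *\<^sub>R X x)"
    by (rule integrable_bounded_mult[OF i _ B(3)]) measurable
  then show ?thesis using 1 by (simp add: G_def[abs_def])
qed

lemma G'_AE: "AE x in lborel. G' x = G x"
  using weak_gradient_zero_set[OF wg f_nonneg]
proof eventually_elim
  case (elim x)
  show ?case
  proof (cases "F x = 0")
    case True
    then have "f x = 0 \<or> ch x = 0" by (auto simp: F_def)
    then have "G x = 0" using elim by (auto simp: G_def)
    then show ?thesis by (simp add: G'_def)
  qed (simp add: G'_def)
qed

lemma iG': "integrable lborel G'"
  using iG G'_AE by (subst integrable_cong_AE[of _ _ G]) auto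

text \<open>The derivative falls on the kernel. The kernel lacks compact support, but multiplied by
  the squared cutoff contained in \<open>F\<close> it becomes an admissible test function, and the
  product rule yields exactly the extra term of \<open>G\<close>.\<close>

lemma heat_gradient:
  assumes s: "s > 0"
  shows "heat s G' x = (1 / sqrt s ^ DIM('a)) *\<^sub>R (\<integral>y. F y *\<^sub>R ((gker s (y - x) / s) *\<^sub>R (y - x)) \<partial>lborel)"
    and "integrable lborel (\<lambda>y. F y *\<^sub>R ((gker s (y - x) / s) *\<^sub>R (y - x)))"
proof -
  define \<psi> where "\<psi> = (\<lambda>y. (ch y)\<^sup>2 * gker s (y - x))"
  define G\<psi> where "G\<psi> = (\<lambda>y. (2 * ch y * gker s (y - x)) *\<^sub>R X y - ((ch y)\<^sup>2 * (gker s (y - x) / s)) *\<^sub>R (y - x))"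
  have dk: "((\<lambda>y. gker s (y - x)) has_derivative (\<lambda>v. (- (gker s (y - x) / s) *\<^sub>R (y - x)) \<bullet> v)) (at y)" for y
    by (rule has_derivative_eq_rhs[OF has_derivative_compose[OF _ gker_deriv[OF s]]]) (auto intro!: derivative_eq_intros)
  have ck: "continuous_on UNIV (\<lambda>y. gker s (y - x))"
    using dk by (intro continuous_at_imp_continuous_on) (auto dest: has_derivative_continuous)
  have ct: "ctest \<psi> G\<psi> R"
  proof (rule ctestI)
    show "(\<psi> has_derivative (\<lambda>v. G\<psi> y \<bullet> v)) (at y)" for y
    proof -
      have "((\<lambda>y. (ch y)\<^sup>2) has_derivative (\<lambda>v. 2 * ch y * (X y \<bullet> v))) (at y)"
        by (rule has_derivative_eq_rhs[OF has_derivative_power[OF ctestD(1)[OF ch]]]) (auto simp: fun_eq_iff)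
      from has_derivative_mult[OF this dk[of y]]
      show ?thesis unfolding \<psi>_def
        by (rule has_derivative_eq_rhs) (auto simp: fun_eq_iff G\<psi>_def inner_diff_left algebra_simps)
    qed
    show "continuous_on UNIV G\<psi>" unfolding G\<psi>_def
      by (intro continuous_intros ck ctestD(2,5)[OF ch]) (use s in auto)
    show "\<psi> y = 0" if "norm y > R" for y using ctestD(3)[OF ch that] by (simp add: \<psi>_def)
  qed
  have iGk: "integrable lborel (\<lambda>y. gker s (y - x) *\<^sub>R G y)" by (rule integrable_gker[OF iG s])
  show iFk: "integrable lborel (\<lambda>y. F y *\<^sub>R ((gker s (y - x) / s) *\<^sub>R (y - x)))"
  proof (rule integrable_bounded_mult[OF iF])
    show "norm ((gker s (y - x) / s) *\<^sub>R (y - x)) \<le> (1 + 2 * s) * (2 * pi) powr (- real DIM('a) / 2) / s" for y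
      using divide_right_mono[OF norm_gker_le[OF s, of "y - x"], of s] s by simp
  qed measurable
  have "(\<integral>y. gker s (y - x) *\<^sub>R G y \<partial>lborel) = (\<integral>y. F y *\<^sub>R ((gker s (y - x) / s) *\<^sub>R (y - x)) \<partial>lborel)"
  proof (rule euclidean_eqI)
    fix b :: 'a assume b: "b \<in> Basis"
    have e: "(\<integral>y. f y * (G\<psi> y \<bullet> b) \<partial>lborel) = - (\<integral>y. (g y \<bullet> b) * \<psi> y \<partial>lborel)"
      by (rule weak_gradientD(3)[OF wg ct])
    have p: "f y * (G\<psi> y \<bullet> b) = (gker s (y - x) *\<^sub>R G y) \<bullet> b - (g y \<bullet> b) * \<psi> y - (F y *\<^sub>R ((gker s (y - x) / s) *\<^sub>R (y - x))) \<bullet> b" for y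
    proof -
      have gen: "f1 * (2 * c * k * xb - c2 * l * yb) = k * (c2 * gb + 2 * c * f1 * xb) - gb * (c2 * k) - c2 * f1 * (l * yb)"
        for f1 c c2 k l xb yb gb :: real by algebra
      show ?thesis
        unfolding G\<psi>_def \<psi>_def G_def F_def inner_diff_left[of "_ *\<^sub>R _"] inner_add_left inner_scaleR_left by (rule gen)
    qed
    have i3: "integrable lborel (\<lambda>y. (g y \<bullet> b) * \<psi> y)"
    proof -
      obtain B where B: "\<And>x. \<bar>\<psi> x\<bar> \<le> B" using ctest_bounded[OF ct] by blast
      have "integrable lborel (\<lambda>y. \<psi> y *\<^sub>R g y)"
        by (rule locally_integrable_mult[OF lg _ B]) (use ctest_measurable[OF ct] ctestD(3)[OF ct] in auto)
      then have "integrable lborel (\<lambda>y. (\<psi> y *\<^sub>R g y) \<bullet> b)" by (rule integrable_inner_left)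
      then show ?thesis by (simp add: mult.commute)
    qed
    have "(\<integral>y. f y * (G\<psi> y \<bullet> b) \<partial>lborel) = (\<integral>y. (gker s (y - x) *\<^sub>R G y) \<bullet> b \<partial>lborel) - (\<integral>y. (g y \<bullet> b) * \<psi> y \<partial>lborel)
       - (\<integral>y. (F y *\<^sub>R ((gker s (y - x) / s) *\<^sub>R (y - x))) \<bullet> b \<partial>lborel)"
      unfolding p by (rule integral_diff3[OF integrable_inner_left[OF iGk] i3 integrable_inner_left[OF iFk]])
    then show "(\<integral>y. gker s (y - x) *\<^sub>R G y \<partial>lborel) \<bullet> b = (\<integral>y. F y *\<^sub>R ((gker s (y - x) / s) *\<^sub>R (y - x)) \<partial>lborel) \<bullet> b"
      using e integral_inner_left[OF iGk, of b] integral_inner_left[OF iFk, of b] by simp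
  qed
  moreover have "(\<integral>y. gker s (y - x) *\<^sub>R G' y \<partial>lborel) = (\<integral>y. gker s (y - x) *\<^sub>R G y \<partial>lborel)"
    by (rule integral_cong_AE) (use G'_AE in auto)
  ultimately show "heat s G' x = (1 / sqrt s ^ DIM('a)) *\<^sub>R (\<integral>y. F y *\<^sub>R ((gker s (y - x) / s) *\<^sub>R (y - x)) \<partial>lborel)"
    using heat_gker[of G' s x] s by simp
qed

text \<open>Jensen's inequality again through the tangent at the means. Adding \<open>e\<close> to
  the denominator only lowers the left side; the right side may be infinite, hence the
  \<open>ennreal\<close> form.\<close>

lemma heat_fisher:
  assumes s: "s > 0" and e: "e > 0"
  shows "ennreal ((norm (heat s G' x))\<^sup>2 / (e + heat s F x)) \<le> (\<integral>\<^sup>+ z. ennreal ((norm (G' (x + sqrt s *\<^sub>R z)))\<^sup>2 / F (x + sqrt s *\<^sub>R z)) \<partial>gaussian)"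
proof -
  let ?y = "\<lambda>z. x + sqrt s *\<^sub>R z"
  have iFh: "integrable gaussian (\<lambda>z. F (?y z))" and iGh: "integrable gaussian (\<lambda>z. G' (?y z))"
    using integrable_heat_lborel[OF iF s] integrable_heat_lborel[OF iG' s] by auto
  define u where "u = e + heat s F x"
  have hF: "heat s F x \<ge> 0" unfolding heat_def by (intro integral_nonneg_AE always_eventually allI F_nonneg)
  have u: "u > 0" using hF e by (simp add: u_def)
  define q where "q = heat s G' x /\<^sub>R u"
  have tang: "2 * (G' y \<bullet> q) - F y * (norm q)\<^sup>2 \<le> (norm (G' y))\<^sup>2 / F y" for y
  proof (cases "F y = 0")
    case False
    then have Fy: "F y > 0" using F_nonneg[of y] by simp
    have "0 \<le> (norm (G' y - F y *\<^sub>R q))\<^sup>2" by simp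
    also have "\<dots> = (norm (G' y))\<^sup>2 - 2 * F y * (G' y \<bullet> q) + (F y)\<^sup>2 * (norm q)\<^sup>2"
      unfolding power2_norm_eq_inner
      by (simp add: inner_diff_left inner_diff_right inner_commute[of q "G' y"] power2_eq_square algebra_simps)
    finally show ?thesis using Fy by (simp add: field_simps power2_eq_square)
  qed (simp add: G'_def)
  have "(norm (heat s G' x))\<^sup>2 / u = 2 * (heat s G' x \<bullet> q) - u * (norm q)\<^sup>2"
    using u by (simp add: q_def power2_norm_eq_inner[symmetric] power_mult_distrib field_simps power2_eq_square)
  also have "\<dots> \<le> 2 * (heat s G' x \<bullet> q) - heat s F x * (norm q)\<^sup>2"
    using e by (intro diff_left_mono mult_right_mono) (auto simp: u_def)
  also have "\<dots> = (\<integral>z. 2 * (G' (?y z) \<bullet> q) - F (?y z) * (norm q)\<^sup>2 \<partial>gaussian)"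
    unfolding heat_def using iFh iGh by simp
  finally have "ennreal ((norm (heat s G' x))\<^sup>2 / u) \<le> ennreal (\<integral>z. 2 * (G' (?y z) \<bullet> q) - F (?y z) * (norm q)\<^sup>2 \<partial>gaussian)"
    by (rule ennreal_leI)
  also have "\<dots> \<le> (\<integral>\<^sup>+ z. ennreal ((norm (G' (?y z)))\<^sup>2 / F (?y z)) \<partial>gaussian)"
    by (rule ennreal_integral_le_nn_integral) (use tang iFh iGh in auto)
  finally show ?thesis by (simp add: u_def)
qed

text \<open>The inequality for regular functions is applied to
  \<open>u x = e + heat s F (\<rho> x)\<close>. Contracting by \<open>\<rho>\<close> compensates the
  added noise, so this Mehler average preserves Gaussian integrals and does not increase the Fisher
  information. The entropy is expressed through \<open>kent_dual\<close>, so that \<open>F\<close>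
  enters linearly and limits can be taken.\<close>

lemma lsi_mollified:
  assumes s: "0 < s" "s < 1" and e: "e > 0" and J: "J < \<infinity>"
    and [measurable]: "h \<in> borel_measurable borel" and h: "\<And>x. \<bar>h x\<bar> \<le> B"
  defines "\<rho> \<equiv> sqrt (1 - s)" and "a \<equiv> (\<integral>x. F x \<partial>gaussian)"
  shows "(\<integral>p. F (fst p) * h (\<rho> *\<^sub>R fst p - sqrt s *\<^sub>R snd p) \<partial>(gaussian \<Otimes>\<^sub>M (gaussian :: 'a measure))) + e * (\<integral>x. h x \<partial>gaussian)
     - (a + e) * (\<integral>x. exp (h x) \<partial>gaussian) + (a + e) \<le> 1 / 2 * enn2real J"
proof -
  define c where "c = (2 * pi) powr (- real DIM('a) / 2) / sqrt s ^ DIM('a)"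
  define IF where "IF = (\<integral>y. F y \<partial>lborel)"
  have c: "c > 0" using s by (simp add: c_def)
  have IF: "IF \<ge> 0" unfolding IF_def by (intro integral_nonneg_AE always_eventually allI F_nonneg)
  have \<rho>: "0 \<le> \<rho>" "\<rho> \<le> 1" "\<rho>\<^sup>2 + (sqrt s)\<^sup>2 = 1" "sqrt s \<noteq> 0" using s by (auto simp: \<rho>_def)
  define u where "u = (\<lambda>x. e + heat s F (\<rho> *\<^sub>R x))"
  define w where "w = (\<lambda>x. \<rho> *\<^sub>R heat s G' (\<rho> *\<^sub>R x))"
  have hF0: "heat s F x \<ge> 0" for x unfolding heat_def by (intro integral_nonneg_AE always_eventually allI F_nonneg)
  have ik: "integrable lborel (\<lambda>y. gker s (y - x) *\<^sub>R F y)" for x by (rule integrable_gker[OF iF]) (use s in auto)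
  have hFu: "heat s F x \<le> c * IF" for x
  proof -
    have "(\<integral>y. gker s (y - x) *\<^sub>R F y \<partial>lborel) \<le> (\<integral>y. (2 * pi) powr (- real DIM('a) / 2) * F y \<partial>lborel)"
    proof (rule integral_mono[OF ik])
      show "integrable lborel (\<lambda>y. (2 * pi) powr (- real DIM('a) / 2) * F y)" using iF by (rule integrable_mult_right)
      show "gker s (y - x) *\<^sub>R F y \<le> (2 * pi) powr (- real DIM('a) / 2) * F y" for y
        unfolding real_scaleR_def by (rule mult_right_mono[OF gker_le[OF s(1)] F_nonneg])
    qed
    then have "(\<integral>y. gker s (y - x) *\<^sub>R F y \<partial>lborel) \<le> (2 * pi) powr (- real DIM('a) / 2) * IF" by (simp add: IF_def)
    then have "(1 / sqrt s ^ DIM('a)) * (\<integral>y. gker s (y - x) *\<^sub>R F y \<partial>lborel) \<le> (1 / sqrt s ^ DIM('a)) * ((2 * pi) powr (- real DIM('a) / 2) * IF)"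
      using s by (intro mult_left_mono) auto
    then show ?thesis using heat_gker[of F s x] s by (simp add: c_def)
  qed
  have tay: "\<bar>heat s F (x + z) - heat s F x - heat s G' x \<bullet> z\<bar> \<le> (3 / s * c * IF) * (norm z)\<^sup>2" for x z
  proof -
    let ?d = "\<lambda>y. F y * (gker s (y - x + (- z)) - gker s (y - x) - (- (gker s (y - x) / s) *\<^sub>R (y - x)) \<bullet> (- z))"
    let ?k = "\<lambda>y. F y *\<^sub>R ((gker s (y - x) / s) *\<^sub>R (y - x))"
    have i1: "integrable lborel ?k" by (rule heat_gradient(2)) (use s in auto)
    have d: "?d y = gker s (y - (x + z)) *\<^sub>R F y - gker s (y - x) *\<^sub>R F y - ?k y \<bullet> z" for y
      by (simp add: algebra_simps)
    have id: "integrable lborel ?d" unfolding d using ik[of "x + z"] ik[of x] integrable_inner_left[OF i1, of z] by simp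
    have "(\<integral>y. ?d y \<partial>lborel) = (\<integral>y. gker s (y - (x + z)) *\<^sub>R F y \<partial>lborel) - (\<integral>y. gker s (y - x) *\<^sub>R F y \<partial>lborel) - (\<integral>y. ?k y \<partial>lborel) \<bullet> z"
      unfolding d integral_inner_left[OF i1, symmetric]
      by (rule integral_diff3[OF ik ik integrable_inner_left[OF i1]])
    then have eq: "heat s F (x + z) - heat s F x - heat s G' x \<bullet> z = (1 / sqrt s ^ DIM('a)) * (\<integral>y. ?d y \<partial>lborel)"
      using heat_gker[of F s x] heat_gker[of F s "x + z"] heat_gradient(1)[of s x] s by (simp add: right_diff_distrib)
    have "\<bar>heat s F (x + z) - heat s F x - heat s G' x \<bullet> z\<bar> \<le> (1 / sqrt s ^ DIM('a)) * (\<integral>y. \<bar>?d y\<bar> \<partial>lborel)"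
    proof -
      have p0: "0 \<le> 1 / sqrt s ^ DIM('a)" using s by simp
      show ?thesis unfolding eq by (subst abs_mult, subst abs_of_nonneg[OF p0], rule mult_left_mono[OF integral_abs_bound p0])
    qed
    also have "\<dots> \<le> (1 / sqrt s ^ DIM('a)) * (\<integral>y. F y * ((3 / s * (2 * pi) powr (- real DIM('a) / 2)) * (norm (- z))\<^sup>2) \<partial>lborel)"
    proof (intro mult_left_mono integral_mono)
      show "\<bar>?d y\<bar> \<le> F y * ((3 / s * (2 * pi) powr (- real DIM('a) / 2)) * (norm (- z))\<^sup>2)" for y
        unfolding abs_mult abs_of_nonneg[OF F_nonneg] by (intro mult_left_mono gker_taylor F_nonneg) (use s in auto)
      show "integrable lborel (\<lambda>y. F y * ((3 / s * (2 * pi) powr (- real DIM('a) / 2)) * (norm (- z))\<^sup>2))"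
        using iF by auto
    qed (use id s in auto)
    also have "\<dots> = (3 / s * c * IF) * (norm z)\<^sup>2" by (simp add: IF_def c_def mult.commute mult.left_commute)
    finally show ?thesis .
  qed
  interpret T: taylor_pair e "e + c * IF" "3 / s * c * IF" u w
  proof
    show "e > 0" by (rule e)
    show "0 \<le> 3 / s * c * IF" using s c IF by simp
    show "u \<in> borel_measurable borel" "w \<in> borel_measurable borel" unfolding u_def w_def by measurable
    show "e \<le> u x" "u x \<le> e + c * IF" for x using hF0 hFu by (auto simp: u_def)
    show "\<bar>u (x + z) - u x - w x \<bullet> z\<bar> \<le> 3 / s * c * IF * (norm z)\<^sup>2" for x z
    proof -
      have "\<bar>u (x + z) - u x - w x \<bullet> z\<bar> \<le> (3 / s * c * IF) * (norm (\<rho> *\<^sub>R z))\<^sup>2"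
        using tay[of "\<rho> *\<^sub>R x" "\<rho> *\<^sub>R z"] by (simp add: u_def w_def scaleR_add_right)
      also have "\<dots> \<le> (3 / s * c * IF) * (norm z)\<^sup>2"
        using \<rho> s c IF by (intro mult_left_mono power_mono) (auto intro: mult_left_le_one_le)
      finally show ?thesis .
    qed
  qed
  have iFg: "integrable gaussian F" by (rule integrable_gaussian_lborel[OF iF])
  note mh = integral_gaussian_mehler[OF iFg _ _ \<rho>(3,4)]
  have iu: "integrable gaussian u" by (rule integrable_gaussian_bounded[of _ "e + c * IF"]) (auto intro: T.norm_u[simplified])
  have ihF: "integrable gaussian (\<lambda>x. heat s F (\<rho> *\<^sub>R x))"
    by (rule integrable_gaussian_bounded[of _ "c * IF"]) (use hF0 hFu in auto)
  have B0: "B \<ge> 0" using order_trans[OF abs_ge_zero h] by blast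
  have ih: "integrable gaussian h" by (rule integrable_gaussian_bounded[of _ B]) (use h in auto)
  have ieh: "integrable gaussian (\<lambda>x. exp (h x))"
    by (rule integrable_gaussian_bounded[of _ "exp B"]) (use h abs_le_D1 in auto)
  have ihFh: "integrable gaussian (\<lambda>x. heat s F (\<rho> *\<^sub>R x) * h x)"
    using integrable_bounded_mult[OF ihF, of h B] h by simp
  have iuh: "integrable gaussian (\<lambda>x. u x * h x)" using ih ihFh by (simp add: u_def distrib_right)
  have heq: "heat s F (\<rho> *\<^sub>R x) = (\<integral>z. F (\<rho> *\<^sub>R x + sqrt s *\<^sub>R z) \<partial>gaussian)" for x by (simp add: heat_def)
  have Uh: "(\<integral>x. u x * h x \<partial>gaussian) = e * (\<integral>x. h x \<partial>gaussian) + (\<integral>p. F (fst p) * h (\<rho> *\<^sub>R fst p - sqrt s *\<^sub>R snd p) \<partial>(gaussian \<Otimes>\<^sub>M (gaussian :: 'a measure)))"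
  proof -
    have "(\<integral>x. u x * h x \<partial>gaussian) = (\<integral>x. e * h x + heat s F (\<rho> *\<^sub>R x) * h x \<partial>gaussian)" by (simp add: u_def distrib_right)
    also have "\<dots> = e * (\<integral>x. h x \<partial>gaussian) + (\<integral>x. heat s F (\<rho> *\<^sub>R x) * h x \<partial>gaussian)" using ih ihFh by simp
    finally show ?thesis using mh(1)[of h B] h by (simp add: heq)
  qed
  have U: "(\<integral>x. u x \<partial>gaussian) = e + a"
  proof -
    have "(\<integral>x. heat s F (\<rho> *\<^sub>R x) * 1 \<partial>gaussian) = (\<integral>p. F (fst p) * 1 \<partial>(gaussian \<Otimes>\<^sub>M (gaussian :: 'a measure)))"
      unfolding heq by (rule mh(1)[of "\<lambda>_. 1" 1]) auto
    also have "\<dots> = (\<integral>x. (\<integral>z. F x \<partial>(gaussian :: 'a measure)) \<partial>gaussian)"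
    proof -
      have i0: "integrable (gaussian \<Otimes>\<^sub>M (gaussian :: 'a measure)) (\<lambda>p. F (fst p))"
        by (rule mh(2)[of "\<lambda>_. 1" 1]) auto
      show ?thesis unfolding mult_1_right by (subst gaussian_pair.integral_fst'[OF i0, symmetric]) simp
    qed
    finally show ?thesis using ihF by (simp add: u_def a_def)
  qed
  have a0: "a \<ge> 0" unfolding a_def by (intro integral_nonneg_AE always_eventually allI F_nonneg)
  define U where "U = e + a"
  have Up: "U > 0" using a0 e by (simp add: U_def)
  have iul: "integrable gaussian (\<lambda>x. u x * ln (u x))"
  proof (rule integrable_gaussian_bounded)
    show "norm (u x * ln (u x)) \<le> (e + c * IF) * (\<bar>ln e\<bar> + \<bar>ln (e + c * IF)\<bar>)" for x
    proof -
      have "ln e \<le> ln (u x)" "ln (u x) \<le> ln (e + c * IF)" using T.lower[of x] T.upper[of x] e by auto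
      then have "\<bar>ln (u x)\<bar> \<le> \<bar>ln e\<bar> + \<bar>ln (e + c * IF)\<bar>" by linarith
      then show ?thesis using T.norm_u[of x] T.C by (simp add: abs_mult mult_mono)
    qed
  qed simp
  have fisher: "(\<integral>x. (norm (w x))\<^sup>2 / u x \<partial>gaussian) \<le> enn2real J"
  proof -
    have i: "integrable gaussian (\<lambda>x. (norm (w x))\<^sup>2 / u x)"
      by (rule integrable_gaussian_bounded[OF T.fisher_meas T.fisher_bound])
    have nn: "(norm (w x))\<^sup>2 / u x \<ge> 0" for x using T.lower[of x] e by simp
    have "ennreal (\<integral>x. (norm (w x))\<^sup>2 / u x \<partial>gaussian) = (\<integral>\<^sup>+ x. ennreal ((norm (w x))\<^sup>2 / u x) \<partial>gaussian)"
      using i nn by (intro nn_integral_eq_integral[symmetric]) auto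
    also have "\<dots> \<le> (\<integral>\<^sup>+ x. \<integral>\<^sup>+ z. ennreal ((norm (G' (\<rho> *\<^sub>R x + sqrt s *\<^sub>R z)))\<^sup>2 / F (\<rho> *\<^sub>R x + sqrt s *\<^sub>R z)) \<partial>gaussian \<partial>gaussian)"
    proof (rule nn_integral_mono)
      fix x
      have "\<rho>\<^sup>2 \<le> 1" using \<rho> by (simp add: power_le_one)
      then have "(norm (w x))\<^sup>2 \<le> (norm (heat s G' (\<rho> *\<^sub>R x)))\<^sup>2"
        by (simp add: w_def power_mult_distrib mult_left_le_one_le)
      then have "(norm (w x))\<^sup>2 / u x \<le> (norm (heat s G' (\<rho> *\<^sub>R x)))\<^sup>2 / (e + heat s F (\<rho> *\<^sub>R x))"
        unfolding u_def using hF0 e by (intro divide_right_mono) (auto intro: add_nonneg_nonneg simp: less_imp_le)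
      then have "ennreal ((norm (w x))\<^sup>2 / u x) \<le> ennreal ((norm (heat s G' (\<rho> *\<^sub>R x)))\<^sup>2 / (e + heat s F (\<rho> *\<^sub>R x)))" by (rule ennreal_leI)
      also have "\<dots> \<le> (\<integral>\<^sup>+ z. ennreal ((norm (G' (\<rho> *\<^sub>R x + sqrt s *\<^sub>R z)))\<^sup>2 / F (\<rho> *\<^sub>R x + sqrt s *\<^sub>R z)) \<partial>gaussian)"
        by (rule heat_fisher[OF s(1) e])
      finally show "ennreal ((norm (w x))\<^sup>2 / u x) \<le> (\<integral>\<^sup>+ z. ennreal ((norm (G' (\<rho> *\<^sub>R x + sqrt s *\<^sub>R z)))\<^sup>2 / F (\<rho> *\<^sub>R x + sqrt s *\<^sub>R z)) \<partial>gaussian)" .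
    qed
    \<comment> \<open>The Gaussian measure is invariant under the Mehler average, because
      \<open>\<rho>\<close> and \<open>sqrt s\<close> have squares adding up to 1.\<close>
    also have "\<dots> = J" unfolding J_def by (rule nn_integral_gaussian_conv[OF _ \<rho>(3)]) measurable
    finally have "ennreal (\<integral>x. (norm (w x))\<^sup>2 / u x \<partial>gaussian) \<le> J" .
    then have "enn2real (ennreal (\<integral>x. (norm (w x))\<^sup>2 / u x \<partial>gaussian)) \<le> enn2real J"
      using assms(4) by (intro enn2real_mono) auto
    moreover have "0 \<le> (\<integral>x. (norm (w x))\<^sup>2 / u x \<partial>gaussian)" by (intro integral_nonneg_AE always_eventually allI nn)
    ultimately show ?thesis by simp
  qed
  have "(\<integral>x. u x * h x \<partial>gaussian) - U * (\<integral>x. exp (h x) \<partial>gaussian) + U = (\<integral>x. u x * h x - U * exp (h x) + U \<partial>gaussian)"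
    using iuh ieh by simp
  also have "\<dots> \<le> (\<integral>x. u x * ln (u x) - u x * ln U - u x + U \<partial>gaussian)"
  proof (rule integral_mono)
    show "integrable gaussian (\<lambda>x. u x * h x - U * exp (h x) + U)" using iuh ieh by simp
    show "integrable gaussian (\<lambda>x. u x * ln (u x) - u x * ln U - u x + U)" using iul iu by simp
    fix x
    have ux: "u x > 0" using T.lower[of x] e by simp
    have "kent (u x) U = u x * ln (u x) - u x * ln U - u x + U" using ux Up by (simp add: kent_def ln_div algebra_simps)
    then show "u x * h x - U * exp (h x) + U \<le> u x * ln (u x) - u x * ln U - u x + U"
      using kent_dual[of "u x" U "h x"] ux Up by simp
  qed
  also have "\<dots> = (\<integral>x. u x * ln (u x) \<partial>gaussian) - U * ln U"
    using iul iu U by (simp add: U_def)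
  also have "\<dots> \<le> 1 / 2 * (\<integral>x. (norm (w x))\<^sup>2 / u x \<partial>gaussian)"
    using T.lsi_taylor by (simp add: U U_def)
  also have "\<dots> \<le> 1 / 2 * enn2real J" using fisher by simp
  finally show ?thesis unfolding Uh U_def by (simp add: algebra_simps)
qed

end

text \<open>The noise \<open>s\<close> and the offset \<open>e\<close> tend to 0 together. After the
  rotation the integrand is dominated by \<open>B * F\<close>, and continuity of \<open>h\<close>
  gives pointwise convergence.\<close>

lemma (in cut_weak) lsi_cut:
  assumes J: "J < \<infinity>" and hc: "continuous_on UNIV h" and h: "\<And>x. \<bar>h x\<bar> \<le> B"
  defines "a \<equiv> (\<integral>x. F x \<partial>gaussian)"
  shows "(\<integral>x. F x * h x \<partial>gaussian) - a * (\<integral>x. exp (h x) \<partial>gaussian) + a \<le> 1 / 2 * enn2real J"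
proof -
  have [measurable]: "h \<in> borel_measurable borel" using hc by (rule borel_measurable_continuous_onI)
  define s where "s = (\<lambda>n::nat. 1 / real (n + 2))"
  have s: "0 < s n" "s n < 1" for n by (auto simp: s_def)
  have s0: "s \<longlonglongrightarrow> 0" unfolding s_def by (rule LIMSEQ_ignore_initial_segment[OF lim_1_over_n])
  define Y where "Y = (\<lambda>n. \<integral>p. F (fst p) * h (sqrt (1 - s n) *\<^sub>R fst p - sqrt (s n) *\<^sub>R snd p) \<partial>(gaussian \<Otimes>\<^sub>M (gaussian :: 'a measure)))"
  have iFg: "integrable gaussian F" by (rule integrable_gaussian_lborel[OF iF])
  have i0: "integrable (gaussian \<Otimes>\<^sub>M (gaussian :: 'a measure)) (\<lambda>p. F (fst p))"
    by (rule integral_gaussian_mehler(2)[OF iFg, of "\<lambda>_. 1" 1 0 1]) auto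
  have i1: "integrable (gaussian \<Otimes>\<^sub>M (gaussian :: 'a measure)) (\<lambda>p. F (fst p) * h (fst p))"
    using integrable_bounded_mult[OF i0, of "\<lambda>p. h (fst p)" B] h by simp
  have Y: "Y \<longlonglongrightarrow> (\<integral>x. F x * h x \<partial>gaussian)"
  proof -
    have "Y \<longlonglongrightarrow> (\<integral>p. F (fst p) * h (fst p) \<partial>(gaussian \<Otimes>\<^sub>M (gaussian :: 'a measure)))"
      unfolding Y_def
    proof (rule integral_dominated_convergence)
      show "integrable (gaussian \<Otimes>\<^sub>M (gaussian :: 'a measure)) (\<lambda>p. B * F (fst p))" using i0 by simp
      show "AE p in gaussian \<Otimes>\<^sub>M gaussian. norm (F (fst p) * h (sqrt (1 - s n) *\<^sub>R fst p - sqrt (s n) *\<^sub>R snd p)) \<le> B * F (fst p)" for n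
      proof (intro always_eventually allI)
        fix p :: "'a \<times> 'a"
        show "norm (F (fst p) * h (sqrt (1 - s n) *\<^sub>R fst p - sqrt (s n) *\<^sub>R snd p)) \<le> B * F (fst p)"
          using mult_right_mono[OF h[of "sqrt (1 - s n) *\<^sub>R fst p - sqrt (s n) *\<^sub>R snd p"] F_nonneg[of "fst p"]]
          by (simp add: abs_mult F_nonneg mult.commute)
      qed
      show "AE p in gaussian \<Otimes>\<^sub>M gaussian. (\<lambda>n. F (fst p) * h (sqrt (1 - s n) *\<^sub>R fst p - sqrt (s n) *\<^sub>R snd p)) \<longlonglongrightarrow> F (fst p) * h (fst p)"
      proof (intro always_eventually allI tendsto_mult tendsto_const)
        fix p :: "'a \<times> 'a"
        have "(\<lambda>n. sqrt (1 - s n) *\<^sub>R fst p - sqrt (s n) *\<^sub>R snd p) \<longlonglongrightarrow> sqrt (1 - 0) *\<^sub>R fst p - sqrt 0 *\<^sub>R snd p"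
          by (intro tendsto_intros s0)
        moreover have "isCont h (fst p)" using hc by (simp add: continuous_on_eq_continuous_at)
        ultimately show "(\<lambda>n. h (sqrt (1 - s n) *\<^sub>R fst p - sqrt (s n) *\<^sub>R snd p)) \<longlonglongrightarrow> h (fst p)"
          using isCont_tendsto_compose[of "fst p" h] by simp
      qed
    qed measurable
    also have "(\<integral>p. F (fst p) * h (fst p) \<partial>(gaussian \<Otimes>\<^sub>M (gaussian :: 'a measure))) = (\<integral>x. F x * h x \<partial>gaussian)"
      by (subst gaussian_pair.integral_fst'[OF i1, symmetric]) simp
    finally show ?thesis .
  qed
  have "(\<lambda>n. Y n + s n * (\<integral>x. h x \<partial>gaussian) - (a + s n) * (\<integral>x. exp (h x) \<partial>gaussian) + (a + s n))
    \<longlonglongrightarrow> (\<integral>x. F x * h x \<partial>gaussian) + 0 * (\<integral>x. h x \<partial>gaussian) - (a + 0) * (\<integral>x. exp (h x) \<partial>gaussian) + (a + 0)"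
    by (intro tendsto_intros Y s0)
  then have "(\<integral>x. F x * h x \<partial>gaussian) + 0 * (\<integral>x. h x \<partial>gaussian) - (a + 0) * (\<integral>x. exp (h x) \<partial>gaussian) + (a + 0) \<le> 1 / 2 * enn2real J"
  proof (rule LIMSEQ_le_const2, intro exI[of _ 0] allI impI)
    fix n
    show "Y n + s n * (\<integral>x. h x \<partial>gaussian) - (a + s n) * (\<integral>x. exp (h x) \<partial>gaussian) + (a + s n) \<le> 1 / 2 * enn2real J"
      unfolding Y_def a_def by (rule lsi_mollified[OF s s(1) J _ h]) measurable
  qed
  then show ?thesis by simp
qed

section \<open>Removal of the cutoff and of the regularity of the dual function\<close>

lemma continuous_approx_AE:
  fixes h :: "'a::euclidean_space \<Rightarrow> real"
  assumes [measurable]: "h \<in> borel_measurable borel" and lu: "\<And>x. l \<le> h x" "\<And>x. h x \<le> u"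
  obtains c where "\<And>n. continuous_on UNIV (c n)" "\<And>n x. l \<le> c n x" "\<And>n x. c n x \<le> u"
    "AE x in lborel. (\<lambda>n. c n x) \<longlonglongrightarrow> h x"
proof -
  have luu: "l \<le> u" using lu[of undefined] by linarith
  have "h measurable_on UNIV"
    by (subst measurable_on_iff_borel_measurable) (auto simp: lebesgue_on_UNIV_eq intro: measurable_completion)
  then obtain N g where N: "negligible N" and g: "\<And>n. continuous_on UNIV (g n)"
    and lim: "\<And>x. x \<notin> N \<Longrightarrow> (\<lambda>n. g n x) \<longlonglongrightarrow> h x"
    unfolding measurable_on_def by auto
  define c where "c = (\<lambda>n x. max l (min u (g n x)))"
  have "(\<lambda>n. c n x) \<longlonglongrightarrow> h x" if "x \<notin> N" for x
  proof -
    have "(\<lambda>n. c n x) \<longlonglongrightarrow> max l (min u (h x))" unfolding c_def by (intro tendsto_intros lim that)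
    then show ?thesis using lu[of x] by (simp add: max_absorb2 min_absorb2)
  qed
  then have "AE x in lebesgue. (\<lambda>n. c n x) \<longlonglongrightarrow> h x"
    using N by (intro AE_I'[of N]) (auto simp: negligible_iff_null_sets)
  moreover have cc: "continuous_on UNIV (c n)" for n unfolding c_def by (intro continuous_intros g)
  then have [measurable]: "c n \<in> borel_measurable borel" for n by (intro borel_measurable_continuous_onI)
  have "{x \<in> space lborel. (\<lambda>n. c n x) \<longlonglongrightarrow> h x} \<in> sets lborel"
    unfolding LIMSEQ_iff_countable by measurable
  ultimately have "AE x in lborel. (\<lambda>n. c n x) \<longlonglongrightarrow> h x"
    by (subst (asm) AE_completion_iff) (auto simp: Measurable.pred_def)
  then show ?thesis using cc luu by (intro that[of c]) (auto simp: c_def)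
qed

lemma AE_gaussian_iff: "(AE x in gaussian. P x) \<longleftrightarrow> (AE x in (lborel :: 'a::euclidean_space measure). P x)"
proof -
  have "(AE x in gaussian. P x) \<longleftrightarrow> (AE x in (lborel :: 'a measure). ennreal (gauss_density x) > 0 \<longrightarrow> P x)"
    unfolding gaussian_eq by (rule AE_density) simp
  then show ?thesis by (simp add: gauss_density_pos)
qed

text \<open>The slope is of order \<open>1 / R\<close>, so the cutoff adds to the Fisher information
  a term that vanishes for large \<open>R\<close>.\<close>

lemma cutoff_ctest:
  fixes R :: real
  assumes R: "R > 0"
  defines "c \<equiv> (\<lambda>x::'a::euclidean_space. sqpos (1 - (x \<bullet> x) / R\<^sup>2))"
    and "X \<equiv> (\<lambda>x::'a. (- (4 / R\<^sup>2) * max 0 (1 - (x \<bullet> x) / R\<^sup>2)) *\<^sub>R x)"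
  shows "ctest c X R" "0 \<le> c x" "c x \<le> 1" "norm (X x) \<le> 4 / R"
proof -
  have out: "1 - (x \<bullet> x) / R\<^sup>2 \<le> 0" if "norm x > R" for x :: 'a
  proof -
    have "R\<^sup>2 \<le> (norm x)\<^sup>2" using that R by (intro power_mono) auto
    then show ?thesis using R by (simp add: power2_norm_eq_inner)
  qed
  show "ctest c X R"
  proof (rule ctestI)
    fix x :: 'a
    have "((\<lambda>x. 1 - (x \<bullet> x) / R\<^sup>2) has_derivative (\<lambda>v. - (2 / R\<^sup>2) * (x \<bullet> v))) (at x)"
    proof -
      have "((\<lambda>x. 1 - k * (x \<bullet> x)) has_derivative (\<lambda>v. - (2 * k) * (x \<bullet> v))) (at x)" for k
        by (auto intro!: derivative_eq_intros simp: fun_eq_iff inner_commute)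
      from this[of "1 / R\<^sup>2"] show ?thesis by simp
    qed
    then show "(c has_derivative (\<lambda>v. X x \<bullet> v)) (at x)" unfolding c_def
      by (rule has_derivative_eq_rhs[OF has_derivative_compose[OF _ sqpos_deriv[unfolded has_field_derivative_def]]])
        (auto simp: X_def fun_eq_iff)
  next
    show "continuous_on UNIV X" unfolding X_def using R by (intro continuous_intros) auto
    show "c x = 0" if "norm x > R" for x using out[OF that] by (simp add: c_def)
  qed
  have m: "max 0 (1 - (x \<bullet> x) / R\<^sup>2) \<le> 1" by simp
  show "0 \<le> c x" by (simp add: c_def)
  show "c x \<le> 1" unfolding c_def sqpos_def by (intro power_le_one m) auto
  show "norm (X x) \<le> 4 / R"
  proof (cases "norm x \<le> R")
    case True
    have "norm (X x) = 4 / R\<^sup>2 * (max 0 (1 - (x \<bullet> x) / R\<^sup>2) * norm x)" by (simp add: X_def abs_mult)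
    also have "\<dots> \<le> 4 / R\<^sup>2 * (1 * R)" using m True by (intro mult_left_mono mult_mono) auto
    finally show ?thesis using R by (simp add: power2_eq_square)
  next
    case False
    then show ?thesis using out[of x] R by (simp add: X_def max_def)
  qed
qed

text \<open>The dual inequality is freed in turn from the cutoff and from continuity of
  \<open>h\<close>. Then \<open>h\<close> approaches the optimal choice \<open>ln (f / A)\<close>
  through bounded truncations, and Fatou's lemma recovers the full divergence.\<close>

theorem lsi_weak:
  fixes f :: "'a::euclidean_space \<Rightarrow> real"
  assumes wg: "weak_gradient f g" and nn: "\<And>x. f x \<ge> 0" and i: "integrable gaussian f"
    and A: "A = (\<integral>x. f x \<partial>gaussian)" "A > 0"
  shows "(\<integral>\<^sup>+ x. ennreal (kent (f x) A) \<partial>gaussian) \<le> ennreal (1 / 2) * (\<integral>\<^sup>+ x. ennreal ((norm (g x))\<^sup>2 / f x) \<partial>gaussian)"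
proof (cases "(\<integral>\<^sup>+ x. ennreal ((norm (g x))\<^sup>2 / f x) \<partial>gaussian) = \<infinity>")
  case True
  then show ?thesis by (simp add: ennreal_mult_top)
next
  case False
  define j where "j = enn2real (\<integral>\<^sup>+ x. ennreal ((norm (g x))\<^sup>2 / f x) \<partial>gaussian)"
  have j: "(\<integral>\<^sup>+ x. ennreal ((norm (g x))\<^sup>2 / f x) \<partial>gaussian) = ennreal j" "j \<ge> 0"
    using False by (auto simp: j_def top.not_eq_extremum intro!: ennreal_enn2real[symmetric])
  have [measurable]: "f \<in> borel_measurable borel" "g \<in> borel_measurable borel"
    using weak_gradientD(1,2)[OF wg] by (auto simp: locally_integrable_def)
  define R where "R = (\<lambda>n::nat. real (Suc n))"
  define c where "c = (\<lambda>n. \<lambda>x::'a. sqpos (1 - (x \<bullet> x) / (R n)\<^sup>2))"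
  define X where "X = (\<lambda>n. \<lambda>x::'a. (- (4 / (R n)\<^sup>2) * max 0 (1 - (x \<bullet> x) / (R n)\<^sup>2)) *\<^sub>R x)"
  have R: "R n > 0" for n by (simp add: R_def)
  have cR: "ctest (c n) (X n) (R n)" "0 \<le> c n x" "c n x \<le> 1" "norm (X n x) \<le> 4 / R n" for n x
    unfolding c_def X_def using cutoff_ctest[OF R[of n]] by blast+
  have [measurable]: "c n \<in> borel_measurable borel" for n by (rule ctest_measurable[OF cR(1)])
  \<comment> \<open>This bounds the Fisher information of the cut function. The second part is
    \<open>(1 + 1 / \<eta>) * 4 * (4 / R n)\<^sup>2 * A\<close> with
    \<open>\<eta> = 1 / R n\<close>: the inner 4 is the slope of the cutoff, the outer one the
    square of the factor 2 in \<open>2 * ch * f\<close>.\<close>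
  define q where "q = (\<lambda>n. (1 + 1 / R n) * j + (64 / (R n)\<^sup>2 + 64 / R n) * A)"
  have cl: "(\<lambda>n. c n x) \<longlonglongrightarrow> 1" for x
  proof -
    have i0: "(\<lambda>n. 1 / R n) \<longlonglongrightarrow> 0" unfolding R_def using LIMSEQ_inverse_real_of_nat by (simp add: inverse_eq_divide)
    have "(\<lambda>n. (max 0 (1 - (x \<bullet> x) * (1 / R n)\<^sup>2))\<^sup>2) \<longlonglongrightarrow> (max 0 (1 - (x \<bullet> x) * 0\<^sup>2))\<^sup>2"
      by (intro tendsto_intros i0)
    then show ?thesis by (simp add: c_def sqpos_def power_divide)
  qed
  have ql: "q \<longlonglongrightarrow> j"
  proof -
    have i0: "(\<lambda>n. 1 / R n) \<longlonglongrightarrow> 0" unfolding R_def using LIMSEQ_inverse_real_of_nat by (simp add: inverse_eq_divide)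
    have "(\<lambda>n. (1 + 1 / R n) * j + (64 * (1 / R n)\<^sup>2 + 64 * (1 / R n)) * A) \<longlonglongrightarrow> (1 + 0) * j + (64 * 0\<^sup>2 + 64 * 0) * A"
      by (intro tendsto_intros i0)
    then show ?thesis by (simp add: q_def power_divide)
  qed
  have star_n: "(\<integral>x. (c n x)\<^sup>2 * f x * h x \<partial>gaussian) - (\<integral>x. (c n x)\<^sup>2 * f x \<partial>gaussian) * (\<integral>x. exp (h x) \<partial>gaussian) + (\<integral>x. (c n x)\<^sup>2 * f x \<partial>gaussian) \<le> 1 / 2 * q n"
    if hc: "continuous_on UNIV h" and hB: "\<And>x. \<bar>h x\<bar> \<le> B" for h :: "'a \<Rightarrow> real" and B n
  proof -
    interpret C: cut_weak f g "c n" "X n" "R n" by unfold_locales (use wg nn cR in auto)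
    define \<eta> where "\<eta> = 1 / R n"
    have \<eta>: "\<eta> > 0" using R by (simp add: \<eta>_def)
    have pt: "(norm (C.G' x))\<^sup>2 / C.F x \<le> (1 + \<eta>) * ((norm (g x))\<^sup>2 / f x) + (1 + 1 / \<eta>) * 4 * (4 / R n)\<^sup>2 * f x" for x
    proof (cases "C.F x = 0")
      case True
      have "0 \<le> (1 + \<eta>) * ((norm (g x))\<^sup>2 / f x) + (1 + 1 / \<eta>) * 4 * (4 / R n)\<^sup>2 * f x"
        using \<eta> nn by (intro add_nonneg_nonneg mult_nonneg_nonneg divide_nonneg_nonneg) auto
      then show ?thesis using True by (simp add: C.G'_def)
    next
      case False
      then have p: "f x > 0" "c n x > 0" using nn[of x] cR(2)[of n x] by (auto simp: C.F_def)
      define v1 v2 where "v1 = c n x *\<^sub>R g x" and "v2 = (2 * f x) *\<^sub>R X n x"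
      have G: "C.G' x = c n x *\<^sub>R (v1 + v2)"
        using False by (simp add: C.G'_def C.G_def v1_def v2_def scaleR_add_right power2_eq_square mult.assoc mult.left_commute)
      \<comment> \<open>Young's inequality with weight \<open>\<eta>\<close>. It leaves a
        coefficient tending to 1 on the true gradient, at the price of a large one on the cutoff
        term, which the slope \<open>1 / R\<close> compensates.\<close>
      have yb: "(norm (v1 + v2))\<^sup>2 \<le> (1 + \<eta>) * (norm v1)\<^sup>2 + (1 + 1 / \<eta>) * (norm v2)\<^sup>2"
      proof -
        have "0 \<le> (norm (\<eta> *\<^sub>R v1 - v2))\<^sup>2 / \<eta>" using \<eta> by simp
        also have "\<dots> = \<eta> * (norm v1)\<^sup>2 - 2 * (v1 \<bullet> v2) + (norm v2)\<^sup>2 / \<eta>"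
          unfolding power2_norm_eq_inner using \<eta>
          by (simp add: inner_diff_left inner_diff_right inner_commute[of v2 v1] field_simps power2_eq_square)
        finally show ?thesis unfolding power2_norm_eq_inner
          by (simp add: inner_add_left inner_add_right inner_commute[of v2 v1] algebra_simps)
      qed
      have "(norm (C.G' x))\<^sup>2 / C.F x = (norm (v1 + v2))\<^sup>2 / f x"
        using p by (simp add: G C.F_def power_mult_distrib)
      also have "\<dots> \<le> ((1 + \<eta>) * (norm v1)\<^sup>2 + (1 + 1 / \<eta>) * (norm v2)\<^sup>2) / f x"
        using p by (intro divide_right_mono yb) auto
      also have "\<dots> = (1 + \<eta>) * ((norm v1)\<^sup>2 / f x) + (1 + 1 / \<eta>) * ((norm v2)\<^sup>2 / f x)"
        by (simp add: add_divide_distrib)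
      also have "\<dots> \<le> (1 + \<eta>) * ((norm (g x))\<^sup>2 / f x) + (1 + 1 / \<eta>) * (4 * (4 / R n)\<^sup>2 * f x)"
      proof (intro add_mono mult_left_mono)
        have "(norm v1)\<^sup>2 \<le> (norm (g x))\<^sup>2" unfolding v1_def
          using cR(2,3)[of n x] by (intro power_mono) (auto intro: mult_left_le_one_le)
        then show "(norm v1)\<^sup>2 / f x \<le> (norm (g x))\<^sup>2 / f x" using p by (intro divide_right_mono) auto
        have "(norm v2)\<^sup>2 / f x = 4 * (norm (X n x))\<^sup>2 * f x" using p by (simp add: v2_def power_mult_distrib power2_eq_square)
        also have "\<dots> \<le> 4 * (4 / R n)\<^sup>2 * f x" using p cR(4)[of n x] by (intro mult_right_mono mult_left_mono power_mono) auto
        finally show "(norm v2)\<^sup>2 / f x \<le> 4 * (4 / R n)\<^sup>2 * f x" .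
      qed (use \<eta> in auto)
      finally show ?thesis by (simp only: mult.assoc)
    qed
    have "C.J \<le> (\<integral>\<^sup>+ x. ennreal (1 + \<eta>) * ennreal ((norm (g x))\<^sup>2 / f x) + ennreal ((1 + 1 / \<eta>) * 4 * (4 / R n)\<^sup>2) * ennreal (f x) \<partial>gaussian)"
      unfolding C.J_def
    proof (rule nn_integral_mono)
      fix x
      have "ennreal ((norm (C.G' x))\<^sup>2 / C.F x) \<le> ennreal ((1 + \<eta>) * ((norm (g x))\<^sup>2 / f x) + (1 + 1 / \<eta>) * 4 * (4 / R n)\<^sup>2 * f x)"
        by (rule ennreal_leI[OF pt])
      also have "\<dots> = ennreal (1 + \<eta>) * ennreal ((norm (g x))\<^sup>2 / f x) + ennreal ((1 + 1 / \<eta>) * 4 * (4 / R n)\<^sup>2) * ennreal (f x)"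
        using \<eta> nn by (simp add: ennreal_plus[symmetric] ennreal_mult[symmetric] del: ennreal_plus)
      finally show "ennreal ((norm (C.G' x))\<^sup>2 / C.F x) \<le> ennreal (1 + \<eta>) * ennreal ((norm (g x))\<^sup>2 / f x) + ennreal ((1 + 1 / \<eta>) * 4 * (4 / R n)\<^sup>2) * ennreal (f x)" .
    qed
    also have "\<dots> = ennreal (1 + \<eta>) * ennreal j + ennreal ((1 + 1 / \<eta>) * 4 * (4 / R n)\<^sup>2) * ennreal A"
      using j i nn by (simp add: nn_integral_add nn_integral_cmult nn_integral_eq_integral A)
    also have "\<dots> = ennreal (q n)"
    proof -
      have "(1 + \<eta>) * j + (1 + 1 / \<eta>) * 4 * (4 / R n)\<^sup>2 * A = q n"
        using R[of n] by (simp add: q_def \<eta>_def power2_eq_square field_simps)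
      moreover have "ennreal (1 + \<eta>) * ennreal j + ennreal ((1 + 1 / \<eta>) * 4 * (4 / R n)\<^sup>2) * ennreal A = ennreal ((1 + \<eta>) * j + (1 + 1 / \<eta>) * 4 * (4 / R n)\<^sup>2 * A)"
        using \<eta> j A by (simp add: ennreal_plus[symmetric] ennreal_mult[symmetric] del: ennreal_plus)
      ultimately show ?thesis by simp
    qed
    finally have J: "C.J \<le> ennreal (q n)" .
    have q0: "q n \<ge> 0" using R[of n] j A by (simp add: q_def)
    have "enn2real C.J \<le> q n" using enn2real_mono[OF J] q0 by simp
    moreover have "C.J < \<infinity>" using J by (rule le_less_trans) simp
    ultimately show ?thesis using C.lsi_cut[OF _ hc hB] by (simp add: C.F_def)
  qed
  have ih: "integrable gaussian (\<lambda>x. f x * h x)" if "h \<in> borel_measurable borel" "\<And>x. \<bar>h x\<bar> \<le> B" for h B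
    using integrable_bounded_mult[OF i, of h B] that by simp
  have star_c: "(\<integral>x. f x * h x \<partial>gaussian) - A * (\<integral>x. exp (h x) \<partial>gaussian) + A \<le> 1 / 2 * j"
    if hc: "continuous_on UNIV h" and hB: "\<And>x. \<bar>h x\<bar> \<le> B" for h :: "'a \<Rightarrow> real" and B
  proof -
    have [measurable]: "h \<in> borel_measurable borel" using hc by (rule borel_measurable_continuous_onI)
    have c2: "(c n x)\<^sup>2 \<le> 1" for n x using cR(2,3)[of n x] by (simp add: power_le_one)
    have c2l: "(\<lambda>n. (c n x)\<^sup>2) \<longlonglongrightarrow> 1" for x using tendsto_power[OF cl, of x 2] by simp
    have 1: "(\<lambda>n. \<integral>x. (c n x)\<^sup>2 * k x \<partial>gaussian) \<longlonglongrightarrow> (\<integral>x. k x \<partial>gaussian)" if k: "integrable gaussian k" for k :: "'a \<Rightarrow> real"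
    proof (rule integral_dominated_convergence)
      show "integrable gaussian (\<lambda>x. \<bar>k x\<bar>)" using k by simp
      show "AE x in gaussian. (\<lambda>n. (c n x)\<^sup>2 * k x) \<longlonglongrightarrow> k x"
        using tendsto_mult[OF c2l tendsto_const] by (intro always_eventually allI) simp
      show "AE x in gaussian. norm ((c n x)\<^sup>2 * k x) \<le> \<bar>k x\<bar>" for n
        using c2 by (auto simp: abs_mult intro!: mult_left_le_one_le)
    qed (use k in auto)
    have "(\<lambda>n. (\<integral>x. (c n x)\<^sup>2 * (f x * h x) \<partial>gaussian) - (\<integral>x. (c n x)\<^sup>2 * f x \<partial>gaussian) * (\<integral>x. exp (h x) \<partial>gaussian) + (\<integral>x. (c n x)\<^sup>2 * f x \<partial>gaussian))
      \<longlonglongrightarrow> (\<integral>x. f x * h x \<partial>gaussian) - A * (\<integral>x. exp (h x) \<partial>gaussian) + A"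
      unfolding A by (intro tendsto_intros 1 ih[OF _ hB] i) measurable
    moreover have "(\<lambda>n. 1 / 2 * q n) \<longlonglongrightarrow> 1 / 2 * j" by (intro tendsto_intros ql)
    ultimately show ?thesis
      by (rule LIMSEQ_le) (use star_n[OF hc hB] in \<open>auto simp: mult.assoc\<close>)
  qed
  have star: "(\<integral>x. f x * h x \<partial>gaussian) - A * (\<integral>x. exp (h x) \<partial>gaussian) + A \<le> 1 / 2 * j"
    if [measurable]: "h \<in> borel_measurable borel" and hB: "\<And>x. \<bar>h x\<bar> \<le> B" for h :: "'a \<Rightarrow> real" and B
  proof -
    have "\<And>x. - B \<le> h x" "\<And>x. h x \<le> B" using hB by (simp_all add: abs_le_iff minus_le_iff)
    from continuous_approx_AE[OF that(1) this]
    obtain k where k: "\<And>n. continuous_on UNIV (k n)" "\<And>n x. - B \<le> k n x" "\<And>n x. k n x \<le> B"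
      and kl: "AE x in lborel. (\<lambda>n. k n x) \<longlonglongrightarrow> h x" by blast
    have [measurable]: "k n \<in> borel_measurable borel" for n using k(1) by (rule borel_measurable_continuous_onI)
    have kB: "\<bar>k n x\<bar> \<le> B" for n x using k(2,3)[of n x] by (simp add: abs_le_iff minus_le_iff)
    have kl': "AE x in gaussian. (\<lambda>n. k n x) \<longlonglongrightarrow> h x" using kl by (simp only: AE_gaussian_iff)
    have 1: "(\<lambda>n. \<integral>x. f x * k n x \<partial>gaussian) \<longlonglongrightarrow> (\<integral>x. f x * h x \<partial>gaussian)"
    proof (rule integral_dominated_convergence)
      show "integrable gaussian (\<lambda>x. B * f x)" using i by simp
      show "AE x in gaussian. (\<lambda>n. f x * k n x) \<longlonglongrightarrow> f x * h x" using kl' by eventually_elim (intro tendsto_intros)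
      show "AE x in gaussian. norm (f x * k n x) \<le> B * f x" for n
        using mult_right_mono[OF kB nn, of n] by (auto simp: abs_mult nn mult.commute)
    qed measurable
    have 2: "(\<lambda>n. \<integral>x. exp (k n x) \<partial>gaussian) \<longlonglongrightarrow> (\<integral>x. exp (h x) \<partial>gaussian)"
    proof (rule integral_dominated_convergence)
      show "integrable gaussian (\<lambda>x::'a. exp B)" by simp
      show "AE x in gaussian. (\<lambda>n. exp (k n x)) \<longlonglongrightarrow> exp (h x)" using kl' by eventually_elim (intro tendsto_intros)
      show "AE x in gaussian. norm (exp (k n x)) \<le> exp B" for n using k(3) by auto
    qed measurable
    have "(\<lambda>n. (\<integral>x. f x * k n x \<partial>gaussian) - A * (\<integral>x. exp (k n x) \<partial>gaussian) + A)
       \<longlonglongrightarrow> (\<integral>x. f x * h x \<partial>gaussian) - A * (\<integral>x. exp (h x) \<partial>gaussian) + A"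
      by (intro tendsto_intros 1 2)
    then show ?thesis by (rule LIMSEQ_le_const2) (use star_c[OF k(1) kB] in auto)
  qed
  \<comment> \<open>The maximiser \<open>ln (f x / A)\<close> of the dual form, truncated to
    \<open>[- n, n]\<close>. At zeros of \<open>f\<close> it would be minus infinity, so the lower
    bound \<open>- n\<close> is used there.\<close>
  define h where "h = (\<lambda>n x. if f x = 0 then - real n else max (- real n) (min (real n) (ln (f x / A))))"
  have [measurable]: "h n \<in> borel_measurable borel" for n unfolding h_def by measurable
  have hB: "\<bar>h n x\<bar> \<le> real n" for n x by (auto simp: h_def)
  define Q where "Q = (\<lambda>n x. f x * h n x - A * exp (h n x) + A)"
  have Q0: "Q n x \<ge> 0" for n x
  \<comment> \<open>Fatou's lemma needs a nonnegative integrand. As \<open>h n x\<close> lies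
    between 0 and \<open>ln (f x / A)\<close>, replacing \<open>f x\<close> by
    \<open>A * exp (h n x)\<close> in the product can only lower it, and
    \<open>t * exp t - exp t + 1\<close> is nonnegative.\<close>
  proof -
    have e: "exp t - 1 \<le> t * exp t" for t :: real
    proof -
      have "1 - t \<le> exp (- t)" using exp_ge_add_one_self[of "- t"] by simp
      then have "(1 - t) * exp t \<le> exp (- t) * exp t" by (intro mult_right_mono) auto
      then show ?thesis by (simp add: exp_minus algebra_simps)
    qed
    have "f x * h n x \<ge> A * (h n x * exp (h n x))"
    proof (cases "f x = 0")
      case True then show ?thesis using A by (simp add: h_def)
    next
      case False
      then have fx: "f x > 0" using nn[of x] by simp
      have fe: "f x = A * exp (ln (f x / A))" using fx A by simp
      have hx: "h n x = max (- real n) (min (real n) (ln (f x / A)))" using False by (simp add: h_def)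
      have "0 \<le> h n x \<and> h n x \<le> ln (f x / A) \<or> h n x \<le> 0 \<and> ln (f x / A) \<le> h n x"
        unfolding hx by linarith
      then consider "0 \<le> h n x \<and> h n x \<le> ln (f x / A)" | "h n x \<le> 0 \<and> ln (f x / A) \<le> h n x"
        by blast
      then show ?thesis
      proof cases
        case 1
        then have "A * exp (h n x) \<le> A * exp (ln (f x / A))" using A by (intro mult_left_mono) auto
        then have "A * exp (h n x) \<le> f x" using fe by simp
        then show ?thesis using 1 mult_right_mono[of "A * exp (h n x)" "f x" "h n x"] by (simp add: ac_simps)
      next
        case 2
        then have "A * exp (ln (f x / A)) \<le> A * exp (h n x)" using A by (intro mult_left_mono) auto
        then have "f x \<le> A * exp (h n x)" using fe by simp
        then show ?thesis using 2 mult_right_mono_neg[of "f x" "A * exp (h n x)" "h n x"] by (simp add: ac_simps)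
      qed
    qed
    moreover have "A * (exp (h n x) - 1) \<le> A * (h n x * exp (h n x))" using A by (intro mult_left_mono e) auto
    ultimately show ?thesis by (simp add: Q_def algebra_simps)
  qed
  have Ql: "(\<lambda>n. Q n x) \<longlonglongrightarrow> kent (f x) A" for x
  proof (cases "f x = 0")
    case True
    have "(\<lambda>n. exp (- 1 :: real) ^ n) \<longlonglongrightarrow> 0" by (rule LIMSEQ_power_zero) simp
    then have "(\<lambda>n. exp (- real n)) \<longlonglongrightarrow> 0" by (simp add: exp_of_nat_mult[symmetric])
    then have "(\<lambda>n. 0 - A * exp (- real n) + A) \<longlonglongrightarrow> 0 - A * 0 + A" by (intro tendsto_intros)
    then show ?thesis using True by (simp add: Q_def h_def)
  next
    case False
    then have fx: "f x > 0" using nn[of x] by simp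
    obtain N where N: "\<bar>ln (f x / A)\<bar> \<le> real N" using real_arch_simple by blast
    have "Q n x = kent (f x) A" if "n \<ge> N" for n
    proof -
      have "h n x = ln (f x / A)" using False N that by (auto simp: h_def max_def min_def abs_le_iff)
      then show ?thesis using fx A by (simp add: Q_def kent_def)
    qed
    then show ?thesis by (intro tendsto_eventually eventually_sequentiallyI[of N])
  qed
  have "(\<integral>\<^sup>+ x. ennreal (kent (f x) A) \<partial>gaussian) = (\<integral>\<^sup>+ x. liminf (\<lambda>n. ennreal (Q n x)) \<partial>gaussian)"
  proof (rule nn_integral_cong)
    fix x
    have "(\<lambda>n. ennreal (Q n x)) \<longlonglongrightarrow> ennreal (kent (f x) A)" by (intro tendsto_ennrealI Ql)
    then show "ennreal (kent (f x) A) = liminf (\<lambda>n. ennreal (Q n x))" by (intro lim_imp_Liminf[symmetric]) auto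
  qed
  also have "\<dots> \<le> liminf (\<lambda>n. \<integral>\<^sup>+ x. ennreal (Q n x) \<partial>gaussian)"
    by (rule nn_integral_liminf) (auto simp: Q_def)
  also have "\<dots> \<le> ennreal (1 / 2 * j)"
  proof (rule order_trans[OF Liminf_le_Limsup Limsup_bounded])
    show "\<forall>\<^sub>F n in sequentially. (\<integral>\<^sup>+ x. ennreal (Q n x) \<partial>gaussian) \<le> ennreal (1 / 2 * j)"
    proof (intro always_eventually allI)
    fix n
    have ie: "integrable gaussian (\<lambda>x. exp (h n x))"
    proof (rule integrable_gaussian_bounded[of _ "exp (real n)"])
      show "norm (exp (h n x)) \<le> exp (real n)" for x using hB[of n x] by (simp add: abs_le_iff)
    qed measurable
    have iQ: "integrable gaussian (Q n)" unfolding Q_def using ih[OF _ hB, of n] ie by simp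
    have "(\<integral>\<^sup>+ x. ennreal (Q n x) \<partial>gaussian) = ennreal (\<integral>x. Q n x \<partial>gaussian)"
      by (rule nn_integral_eq_integral[OF iQ]) (simp add: Q0)
    also have "(\<integral>x. Q n x \<partial>gaussian) = (\<integral>x. f x * h n x \<partial>gaussian) - A * (\<integral>x. exp (h n x) \<partial>gaussian) + A"
      unfolding Q_def using ih[OF _ hB, of n] ie by simp
    also have "\<dots> \<le> 1 / 2 * j" by (rule star[OF _ hB]) measurable
    finally show "(\<integral>\<^sup>+ x. ennreal (Q n x) \<partial>gaussian) \<le> ennreal (1 / 2 * j)" by (simp add: ennreal_leI)
    qed
  qed simp
  also have "\<dots> = ennreal (1 / 2) * (\<integral>\<^sup>+ x. ennreal ((norm (g x))\<^sup>2 / f x) \<partial>gaussian)"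
    using j by (simp only: ennreal_mult)
  finally show ?thesis .
qed

subsection \<open>Monotone transport on the line\<close>

interpretation std_normal: prob_space std_normal by (rule prob_space_std_normal)

interpretation std_normal: real_distribution std_normal
  by unfold_locales simp

definition cum :: "(real \<Rightarrow> real) \<Rightarrow> real \<Rightarrow> real" where
  "cum q z = (\<integral>x. q x * indicator {..z} x \<partial>std_normal)"

lemma integrable_cum:
  fixes q :: "real \<Rightarrow> real"
  assumes "A \<in> sets borel"
  shows "integrable std_normal q \<Longrightarrow> integrable std_normal (\<lambda>x. q x * indicator A x)"
  using assms integrable_real_mult_indicator[of A std_normal q] by simp

lemma cum_mono:
  assumes "integrable std_normal q" "\<And>x. q x \<ge> 0" "x \<le> y"
  shows "cum q x \<le> cum q y"
  unfolding cum_def using assms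
  by (intro integral_mono integrable_cum) (auto simp: indicator_def intro!: mult_left_mono)

lemma cum_deriv:
  assumes qc: "continuous_on UNIV q" and i: "integrable std_normal q"
  shows "(cum q has_real_derivative (q z * std_normal_density z)) (at z)"
proof -
  have [measurable]: "q \<in> borel_measurable borel" using qc by (rule borel_measurable_continuous_onI)
  let ?g = "\<lambda>t. q t * std_normal_density t"
  have cg: "continuous_on A ?g" for A
    unfolding std_normal_density_def by (intro continuous_intros continuous_on_subset[OF qc]) auto
  have il: "integrable lborel ?g" using i by (subst (asm) integrable_density) (auto simp: mult.commute)
  define a b where "a = z - 1" and "b = z + 1"
  have eq: "cum q x = cum q a + integral {a..x} ?g" if "x \<in> {a..b}" for x
  proof -
    have "cum q x - cum q a = (\<integral>t. q t * indicator {..x} t - q t * indicator {..a} t \<partial>std_normal)"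
      unfolding cum_def using i by (subst Bochner_Integration.integral_diff) (auto intro: integrable_cum)
    also have "\<dots> = (\<integral>t. q t * indicator {a<..x} t \<partial>std_normal)"
      using that by (intro Bochner_Integration.integral_cong) (auto simp: indicator_def)
    also have "\<dots> = (\<integral>t. ?g t * indicator {a<..x} t \<partial>lborel)"
      by (subst integral_density) (auto simp: ac_simps)
    also have "\<dots> = (\<integral>t. indicator {a..x} t *\<^sub>R ?g t \<partial>lborel)"
    proof (rule integral_cong_AE)
      show "AE t in lborel. ?g t * indicator {a<..x} t = indicator {a..x} t *\<^sub>R ?g t"
        using AE_lborel_singleton[of a] by eventually_elim (auto simp: indicator_def)
    qed auto
    also have "\<dots> = integral {a..x} ?g"
    proof -
      have "set_integrable lborel {a..x} ?g" unfolding set_integrable_def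
        by (rule integrable_mult_indicator[OF _ il]) simp
      from set_borel_integral_eq_integral(2)[OF this] show ?thesis by (simp add: set_lebesgue_integral_def)
    qed
    finally show ?thesis by simp
  qed
  have "((\<lambda>x. cum q a + integral {a..x} ?g) has_real_derivative (0 + ?g z)) (at z within {a..b})"
    by (intro DERIV_add DERIV_const integral_has_real_derivative cg) (auto simp: a_def b_def)
  then have "((\<lambda>x. cum q a + integral {a..x} ?g) has_real_derivative ?g z) (at z)"
    by (subst (asm) at_within_Icc_at) (auto simp: a_def b_def)
  then show ?thesis
  proof (rule has_field_derivative_transform_within_open[of _ _ _ "{a<..<b}"])
    show "cum q a + integral {a..x} ?g = cum q x" if "x \<in> {a<..<b}" for x
      using eq[of x] that by simp
  qed (auto simp: a_def b_def)
qed

section \<open>The normal distribution function and its inverse\<close>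

definition Phi :: "real \<Rightarrow> real" where "Phi = cum (\<lambda>_. 1)"

lemma Phi_eq_cdf: "Phi = cdf std_normal"
  by (auto simp: Phi_def cum_def cdf_def fun_eq_iff)

lemma Phi_deriv: "(Phi has_real_derivative std_normal_density z) (at z)"
  using cum_deriv[of "\<lambda>_. 1" z] by (simp add: Phi_def)

lemma Phi_isCont: "isCont Phi z"
  using Phi_deriv DERIV_isCont by blast

lemma Phi_strict_mono:
  assumes "x < y"
  shows "Phi x < Phi y"
proof (rule DERIV_pos_imp_increasing[OF assms])
  fix z
  have "std_normal_density z > 0" by (rule normal_density_pos) simp
  then show "\<exists>d. (Phi has_real_derivative d) (at z) \<and> d > 0" using Phi_deriv[of z] by blast
qed

lemma Phi_less_iff [simp]: "Phi x < Phi y \<longleftrightarrow> x < y"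
  using Phi_strict_mono[of x y] Phi_strict_mono[of y x] by (cases x y rule: linorder_cases) auto

lemma Phi_le_iff [simp]: "Phi x \<le> Phi y \<longleftrightarrow> x \<le> y"
  by (simp flip: not_less)

lemma Phi_eq_iff [simp]: "Phi x = Phi y \<longleftrightarrow> x = y"
  by (metis Phi_le_iff order_antisym order_refl)

lemma Phi_bounds: "0 < Phi z" "Phi z < 1"
proof -
  have "0 \<le> Phi (z - 1)" by (simp add: Phi_eq_cdf std_normal.cdf_nonneg)
  also have "\<dots> < Phi z" by simp
  finally show "0 < Phi z" .
  have "Phi z < Phi (z + 1)" by simp
  also have "\<dots> \<le> 1" by (simp add: Phi_eq_cdf cdf_def)
  finally show "Phi z < 1" .
qed

lemma Phi_surj:
  assumes "0 < p" "p < 1"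
  shows "\<exists>u. Phi u = p"
proof -
  have "eventually (\<lambda>x. Phi x < p) at_bot" using std_normal.cdf_lim_at_bot assms
    unfolding Phi_eq_cdf by (intro order_tendstoD) auto
  then obtain a where a: "Phi a < p" using eventually_happens trivial_limit_at_bot_linorder by blast
  have "eventually (\<lambda>x. Phi x > p) at_top" using std_normal.cdf_lim_at_top_prob assms
    unfolding Phi_eq_cdf by (intro order_tendstoD) auto
  then obtain b where b: "Phi b > p" using eventually_happens trivial_limit_at_top_linorder by blast
  have ab: "a \<le> b" using a b Phi_less_iff[of a b] by linarith
  obtain u where "a \<le> u" "u \<le> b" "Phi u = p"
    using IVT[of Phi a p b] a b ab Phi_isCont by auto
  then show ?thesis by blast
qed

text \<open>The default 0 outside the open unit interval only serves totality;
  \<open>G_interior\<close> shows that the transport reaches it with probability zero.\<close>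

definition Phinv :: "real \<Rightarrow> real" where
  "Phinv p = (if 0 < p \<and> p < 1 then (THE u. Phi u = p) else 0)"

lemma Phinv_Phi [simp]: "Phinv (Phi u) = u"
  using Phi_bounds[of u] by (auto simp: Phinv_def)

lemma Phi_Phinv: "0 < p \<Longrightarrow> p < 1 \<Longrightarrow> Phi (Phinv p) = p"
  using Phi_surj[of p] by (metis Phinv_Phi)

lemma Phinv_le_iff: "0 < p \<Longrightarrow> p < 1 \<Longrightarrow> Phinv p \<le> u \<longleftrightarrow> p \<le> Phi u"
  by (metis Phi_Phinv Phi_le_iff)

lemma Phinv_measurable [measurable]: "Phinv \<in> borel_measurable borel"
proof (rule borel_measurableI_le)
  fix u
  have "{x. Phinv x \<le> u} = ({0<..<1} \<inter> {..Phi u}) \<union> ((- {0<..<1}) \<inter> {x. 0 \<le> u})"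
    using Phinv_le_iff[of _ u] by (auto simp: Phinv_def)
  then show "{x \<in> space borel. Phinv x \<le> u} \<in> sets borel" by simp
qed

lemma Phinv_isCont:
  assumes "0 < p" "p < 1"
  shows "isCont Phinv p"
proof -
  have "isCont Phinv (Phi (Phinv p))"
    by (rule isCont_inverse_function[of 1]) (auto intro: Phi_isCont)
  then show ?thesis using Phi_Phinv[OF assms] by simp
qed

lemma Phinv_deriv:
  assumes "0 < p" "p < 1"
  shows "(Phinv has_real_derivative (1 / std_normal_density (Phinv p))) (at p)"
proof -
  have "(Phinv has_real_derivative (inverse (std_normal_density (Phinv p)))) (at p)"
    by (rule DERIV_inverse_function[OF Phi_deriv _ assms]) (use normal_density_pos[of 1 0 "Phinv p"] Phi_Phinv Phinv_isCont assms in auto)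
  then show ?thesis by (simp add: inverse_eq_divide)
qed

text \<open>The interval version: on \<open>[-M, M]\<close> the monotone map \<open>S\<close> fixes the endpoints, so all boundary terms vanish.\<close>

lemma transport_interval:
  fixes q :: "real \<Rightarrow> real"
  assumes qc: "continuous_on UNIV q" and c0: "c0 > 0" and ql: "\<And>x. c0 \<le> q x" and qu: "\<And>x. q x \<le> C" and M: "M > 0"
  defines "\<kappa> \<equiv> (cum q M - cum q (- M)) / (Phi M - Phi (- M))"
  defines "S \<equiv> \<lambda>z. Phinv (Phi (- M) + (cum q z - cum q (- M)) / \<kappa>)"
  shows "(\<integral>\<^sup>+ z. ennreal (q z * (z - S z)\<^sup>2 / 2) * indicator {- M..M} z \<partial>std_normal)
     \<le> (\<integral>\<^sup>+ z. ennreal (kent (q z) 1) * indicator {- M..M} z \<partial>std_normal)"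
proof -
  let ?\<phi> = std_normal_density
  have [measurable]: "q \<in> borel_measurable borel" using qc by (rule borel_measurable_continuous_onI)
  have q0: "q x > 0" for x using ql[of x] c0 by simp
  have iq: "integrable std_normal q"
    by (rule std_normal.integrable_const_bound[of _ C]) (use q0 qu in \<open>auto simp: less_imp_le abs_of_pos\<close>)
  have \<phi>0: "?\<phi> x > 0" for x by (simp add: normal_density_pos)
  have dQ: "(cum q has_real_derivative (q z * ?\<phi> z)) (at z)" for z by (rule cum_deriv[OF qc iq])
  have Qsm: "cum q x < cum q y" if "x < y" for x y
  proof (rule DERIV_pos_imp_increasing[OF that])
    fix z
    have "q z * ?\<phi> z > 0" using q0[of z] \<phi>0[of z] by simp
    then show "\<exists>d. (cum q has_real_derivative d) (at z) \<and> d > 0" using dQ[of z] by blast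
  qed
  have MM: "- M < M" using M by simp
  have PM: "Phi M - Phi (- M) > 0" using MM by simp
  have \<kappa>: "\<kappa> > 0" unfolding \<kappa>_def using Qsm[OF MM] PM by simp
  \<comment> \<open>\<open>\<kappa>\<close> is the ratio of the two masses of the interval, so after
    division by it \<open>Gi\<close> runs from \<open>Phi (- M)\<close> to \<open>Phi M\<close> and
    the map \<open>S\<close> fixes both endpoints.\<close>
  define Gi where "Gi = (\<lambda>z. Phi (- M) + (cum q z - cum q (- M)) / \<kappa>)"
  have GiM: "Gi M = Phi M" "Gi (- M) = Phi (- M)"
  proof -
    have "(cum q M - cum q (- M)) / \<kappa> = Phi M - Phi (- M)"
      using Qsm[OF MM] PM by (simp add: \<kappa>_def)
    then show "Gi M = Phi M" "Gi (- M) = Phi (- M)" by (auto simp: Gi_def)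
  qed
  have Gi01: "0 < Gi z" "Gi z < 1" if "- M \<le> z" "z \<le> M" for z
  proof -
    have m: "cum q x \<le> cum q y" if "x \<le> y" for x y using that Qsm[of x y] by (cases "x = y") auto
    have mono: "Gi x \<le> Gi y" if "x \<le> y" for x y
      using m[OF that] \<kappa> by (simp add: Gi_def divide_right_mono)
    show "0 < Gi z" using mono[OF that(1)] GiM Phi_bounds(1)[of "- M"] by linarith
    show "Gi z < 1" using mono[OF that(2)] GiM Phi_bounds(2)[of M] by linarith
  qed
  have S: "S z = Phinv (Gi z)" for z by (simp add: S_def Gi_def)
  have dGi: "(Gi has_real_derivative (q z * ?\<phi> z / \<kappa>)) (at z)" for z
    unfolding Gi_def using \<kappa> by (auto intro!: derivative_eq_intros dQ)
  have dS: "(S has_real_derivative (q z * ?\<phi> z / (\<kappa> * ?\<phi> (S z)))) (at z)" if "- M \<le> z" "z \<le> M" for z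
  proof -
    have "((\<lambda>z. Phinv (Gi z)) has_real_derivative (1 / ?\<phi> (Phinv (Gi z)) * (q z * ?\<phi> z / \<kappa>))) (at z)"
      by (rule DERIV_chain2[OF Phinv_deriv[OF Gi01[OF that]] dGi])
    then show ?thesis by (simp add: S[abs_def] mult.commute)
  qed
  have S_meas[measurable]: "S \<in> borel_measurable borel"
  proof -
    have "continuous_on UNIV (cum q)" using dQ by (intro continuous_at_imp_continuous_on) (auto intro: DERIV_isCont)
    then have [measurable]: "cum q \<in> borel_measurable borel" by (rule borel_measurable_continuous_onI)
    show ?thesis unfolding S_def by measurable
  qed
  have d\<phi>: "(?\<phi> has_real_derivative (- x * ?\<phi> x)) (at x)" for x
  proof -
    have "((\<lambda>x. exp (- x\<^sup>2 / 2)) has_real_derivative (- x * exp (- x\<^sup>2 / 2))) (at x)"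
      by (auto intro!: derivative_eq_intros)
    from DERIV_cmult[OF this, of "1 / sqrt (2 * pi)"] show ?thesis
      unfolding std_normal_density_def by (simp add: mult.commute)
  qed
  \<comment> \<open>A primitive that accounts for the difference between a lower bound of the
    entropy density and the cost density. Its first two summands vanish at both endpoints, where
    \<open>S z = z\<close> and \<open>Gi z = Phi z\<close>; the last one contributes
    \<open>(Phi M - Phi (- M)) * kent \<kappa> 1\<close>, which is nonnegative.\<close>
  define W where "W = (\<lambda>z. \<kappa> * ((S z - z) * ?\<phi> (S z)) + \<kappa> * (Phi z - Gi z) + (ln \<kappa> * cum q z + (1 - \<kappa>) * Phi z))"
  define W' where "W' = (\<lambda>z. - \<kappa> * ?\<phi> (S z) - (S z - z) * S z * (q z * ?\<phi> z) + \<kappa> * ?\<phi> z + (ln \<kappa> * (q z * ?\<phi> z) + (1 - \<kappa>) * ?\<phi> z))"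
  have dW: "(W has_real_derivative W' z) (at z)" if z: "- M \<le> z" "z \<le> M" for z
  proof -
    define S' where "S' = q z * ?\<phi> z / (\<kappa> * ?\<phi> (S z))"
    have S': "\<kappa> * S' * ?\<phi> (S z) = q z * ?\<phi> z" using \<kappa> \<phi>0[of "S z"] by (simp add: S'_def)
    have dS1: "(S has_real_derivative S') (at z)" using dS[OF z] by (simp add: S'_def)
    have d1: "((\<lambda>z. ?\<phi> (S z)) has_real_derivative (- S z * ?\<phi> (S z) * S')) (at z)"
      by (rule DERIV_chain2[OF d\<phi> dS1])
    have d2: "((\<lambda>z. S z - z) has_real_derivative (S' - 1)) (at z)" by (intro DERIV_diff dS1 DERIV_ident)
    have "(W has_real_derivative (\<kappa> * ((S' - 1) * ?\<phi> (S z) + (- S z * ?\<phi> (S z) * S') * (S z - z)) + \<kappa> * (?\<phi> z - q z * ?\<phi> z / \<kappa>)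
        + (ln \<kappa> * (q z * ?\<phi> z) + (1 - \<kappa>) * ?\<phi> z))) (at z)"
      unfolding W_def by (intro DERIV_add DERIV_cmult DERIV_mult d1 d2 DERIV_diff Phi_deriv dGi dQ)
    moreover have "W' z = \<kappa> * ((S' - 1) * ?\<phi> (S z) + (- S z * ?\<phi> (S z) * S') * (S z - z)) + \<kappa> * (?\<phi> z - q z * ?\<phi> z / \<kappa>)
        + (ln \<kappa> * (q z * ?\<phi> z) + (1 - \<kappa>) * ?\<phi> z)"
    proof -
      have gen: "- \<kappa> * \<phi>S - (Sz - z) * Sz * (\<kappa> * S' * \<phi>S) + \<kappa> * \<phi>z + L
         = \<kappa> * ((S' - 1) * \<phi>S + (- Sz * \<phi>S * S') * (Sz - z)) + \<kappa> * (\<phi>z - \<kappa> * S' * \<phi>S / \<kappa>) + L"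
        for \<phi>S Sz \<phi>z L using \<kappa> by (simp add: algebra_simps)
      show ?thesis unfolding W'_def S'[symmetric] by (rule gen)
    qed
    ultimately show ?thesis by simp
  qed
  have Scont: "continuous_on {- M..M} S"
    by (intro continuous_at_imp_continuous_on ballI DERIV_isCont[OF dS]) auto
  have \<phi>cont: "continuous_on A (\<lambda>z. ?\<phi> (k z))" if "continuous_on A k" for A k
    unfolding std_normal_density_def using that by (intro continuous_intros) auto
  have qcM: "continuous_on {- M..M} q" by (rule continuous_on_subset[OF qc]) simp
  have W'cont: "continuous_on {- M..M} W'"
    unfolding W'_def by (intro continuous_intros \<phi>cont Scont qcM)
  have FTC: "(\<integral>z. indicator {- M..M} z *\<^sub>R W' z \<partial>lborel) = W M - W (- M)"
    using MM dW W'cont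
    by (intro integral_FTC_atLeastAtMost)
      (auto simp: has_real_derivative_iff_has_vector_derivative[symmetric] intro: DERIV_subset)
  have W0: "W M - W (- M) \<ge> 0"
  proof -
    have SM: "S M = M" "S (- M) = - M" by (simp_all add: S GiM)
    have "W M - W (- M) = ln \<kappa> * (cum q M - cum q (- M)) + (1 - \<kappa>) * (Phi M - Phi (- M))"
      by (simp add: W_def SM GiM algebra_simps)
    also have "cum q M - cum q (- M) = \<kappa> * (Phi M - Phi (- M))" using PM by (simp add: \<kappa>_def)
    also have "ln \<kappa> * (\<kappa> * (Phi M - Phi (- M))) + (1 - \<kappa>) * (Phi M - Phi (- M)) = (Phi M - Phi (- M)) * kent \<kappa> 1"
      by (simp add: kent_def algebra_simps)
    also have "\<dots> \<ge> 0" using PM kent_nonneg[of \<kappa> 1] \<kappa> by simp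
    finally show ?thesis .
  qed
  have pt: "q z * (z - S z)\<^sup>2 / 2 * ?\<phi> z + W' z \<le> kent (q z) 1 * ?\<phi> z" if z: "- M \<le> z" "z \<le> M" for z
  proof -
    \<comment> \<open>\<open>r\<close> is the reciprocal of the derivative of \<open>S\<close>, by
      the change of variables formula. So \<open>ln r \<le> r - 1\<close> is the concavity of the
      logarithm of the Jacobian, the only inequality in the pointwise estimate.\<close>
    define r where "r = \<kappa> * ?\<phi> (S z) / (q z * ?\<phi> z)"
    have r: "r > 0" using \<kappa> \<phi>0 q0 by (simp add: r_def)
    have l\<phi>: "ln (?\<phi> x) = ln (1 / sqrt (2 * pi)) - x\<^sup>2 / 2" for x
      unfolding std_normal_density_def by (subst ln_mult) auto
    have "ln r = ln \<kappa> - ln (q z) + (z\<^sup>2 / 2 - (S z)\<^sup>2 / 2)"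
      using \<kappa> \<phi>0[of z] \<phi>0[of "S z"] q0[of z] unfolding r_def by (simp add: ln_div ln_mult l\<phi>)
    moreover have "ln r \<le> r - 1" using r by (intro ln_le_minus_one) auto
    ultimately have "ln (q z) - ln \<kappa> \<ge> (z\<^sup>2 - (S z)\<^sup>2) / 2 + 1 - r" by (simp add: field_simps)
    then have "(q z * ?\<phi> z) * (ln (q z) - ln \<kappa>) \<ge> (q z * ?\<phi> z) * ((z\<^sup>2 - (S z)\<^sup>2) / 2 + 1 - r)"
      using q0[of z] \<phi>0[of z] by (intro mult_left_mono) auto
    moreover have "(q z * ?\<phi> z) * r = \<kappa> * ?\<phi> (S z)" using q0[of z] \<phi>0[of z] by (simp add: r_def)
    ultimately have 1: "(q z * ?\<phi> z) * ln (q z) \<ge> (q z * ?\<phi> z) * ln \<kappa> + (q z * ?\<phi> z) * ((z\<^sup>2 - (S z)\<^sup>2) / 2 + 1) - \<kappa> * ?\<phi> (S z)"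
      by (simp add: right_diff_distrib)
    have 2: "kent (q z) 1 * ?\<phi> z = (q z * ?\<phi> z) * ln (q z) - q z * ?\<phi> z + ?\<phi> z" by (simp add: kent_def algebra_simps)
    have 3: "q z * (z - S z)\<^sup>2 / 2 * ?\<phi> z + W' z = (q z * ?\<phi> z) * ln \<kappa> + (q z * ?\<phi> z) * ((z\<^sup>2 - (S z)\<^sup>2) / 2 + 1) - \<kappa> * ?\<phi> (S z) - q z * ?\<phi> z + ?\<phi> z"
      by (simp add: W'_def power2_eq_square algebra_simps) (simp add: field_simps)
    show ?thesis using 1 unfolding 2 3 by linarith
  qed
  let ?I = "indicator {- M..M} :: real \<Rightarrow> real"
  let ?E1 = "\<lambda>z. q z * (z - S z)\<^sup>2 / 2 * ?\<phi> z" and ?E2 = "\<lambda>z. kent (q z) 1 * ?\<phi> z"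
  have i1: "integrable lborel (\<lambda>z. ?I z *\<^sub>R ?E1 z)"
    by (rule borel_integrable_compact) (auto intro!: continuous_intros \<phi>cont Scont qcM)
  have i2: "integrable lborel (\<lambda>z. ?I z *\<^sub>R ?E2 z)"
    by (rule borel_integrable_compact) (use q0 in \<open>auto intro!: continuous_intros \<phi>cont qcM simp: kent_def order_less_imp_not_eq2\<close>)
  have i3: "integrable lborel (\<lambda>z. ?I z *\<^sub>R W' z)"
    by (rule borel_integrable_compact) (auto intro!: W'cont)
  have "(\<integral>z. ?I z *\<^sub>R ?E1 z \<partial>lborel) + (\<integral>z. ?I z *\<^sub>R W' z \<partial>lborel) \<le> (\<integral>z. ?I z *\<^sub>R ?E2 z \<partial>lborel)"
  proof -
    have "(\<integral>z. ?I z *\<^sub>R ?E1 z \<partial>lborel) + (\<integral>z. ?I z *\<^sub>R W' z \<partial>lborel) = (\<integral>z. ?I z *\<^sub>R ?E1 z + ?I z *\<^sub>R W' z \<partial>lborel)"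
      by (rule Bochner_Integration.integral_add[OF i1 i3, symmetric])
    also have "\<dots> \<le> (\<integral>z. ?I z *\<^sub>R ?E2 z \<partial>lborel)"
    proof (rule integral_mono[OF Bochner_Integration.integrable_add[OF i1 i3] i2])
      fix z
      show "?I z *\<^sub>R ?E1 z + ?I z *\<^sub>R W' z \<le> ?I z *\<^sub>R ?E2 z"
        using pt[of z] by (cases "z \<in> {- M..M}") simp_all
    qed
    finally show ?thesis .
  qed
  then have le: "(\<integral>z. ?I z *\<^sub>R ?E1 z \<partial>lborel) \<le> (\<integral>z. ?I z *\<^sub>R ?E2 z \<partial>lborel)" using FTC W0 by linarith
  have k0: "kent (q z) 1 \<ge> 0" for z using kent_nonneg[of "q z" 1] q0[of z] by simp
  have conv: "(\<integral>\<^sup>+ z. ennreal (E z) * indicator {- M..M} z \<partial>std_normal) = ennreal (\<integral>z. ?I z *\<^sub>R (E z * ?\<phi> z) \<partial>lborel)"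
    if [measurable]: "E \<in> borel_measurable borel" and E0: "\<And>z. E z \<ge> 0" and iE: "integrable lborel (\<lambda>z. ?I z *\<^sub>R (E z * ?\<phi> z))" for E
  proof -
    have "(\<integral>\<^sup>+ z. ennreal (E z) * indicator {- M..M} z \<partial>std_normal) = (\<integral>\<^sup>+ z. ennreal (?I z *\<^sub>R (E z * ?\<phi> z)) \<partial>lborel)"
      using E0 by (subst nn_integral_density) (auto simp: ennreal_mult[symmetric] indicator_def ac_simps intro!: nn_integral_cong)
    also have "\<dots> = ennreal (\<integral>z. ?I z *\<^sub>R (E z * ?\<phi> z) \<partial>lborel)"
      using iE E0 by (intro nn_integral_eq_integral) auto
    finally show ?thesis .
  qed
  have "(\<integral>\<^sup>+ z. ennreal (q z * (z - S z)\<^sup>2 / 2) * indicator {- M..M} z \<partial>std_normal) = ennreal (\<integral>z. ?I z *\<^sub>R ?E1 z \<partial>lborel)"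
    using q0 by (intro conv i1) (auto simp: less_imp_le)
  also have "\<dots> \<le> ennreal (\<integral>z. ?I z *\<^sub>R ?E2 z \<partial>lborel)" using le by (rule ennreal_leI)
  also have "\<dots> = (\<integral>\<^sup>+ z. ennreal (kent (q z) 1) * indicator {- M..M} z \<partial>std_normal)"
    by (intro conv[symmetric] i2 k0) measurable
  finally show ?thesis .
qed

lemma AE_std_normal_iff: "(AE x in std_normal. P x) \<longleftrightarrow> (AE x in lborel. P x)"
proof -
  have "(AE x in std_normal. P x) \<longleftrightarrow> (AE x in lborel. ennreal (std_normal_density x) > 0 \<longrightarrow> P x)"
    by (rule AE_density) simp
  then show ?thesis by (simp add: normal_density_pos)
qed

lemma cum_measurable [measurable]:
  assumes [measurable]: "q \<in> borel_measurable borel"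
  shows "cum q \<in> borel_measurable borel"
proof -
  have "cum q = (\<lambda>z. \<integral>x. (if x \<le> z then q x else 0) \<partial>std_normal)"
    by (auto simp: cum_def fun_eq_iff indicator_def intro!: Bochner_Integration.integral_cong)
  then show ?thesis by simp
qed

lemma tendsto_kent:
  assumes "(q \<longlongrightarrow> u) F" "u > 0"
  shows "((\<lambda>x. kent (q x) 1) \<longlongrightarrow> kent u 1) F"
  using assms unfolding kent_def by (auto intro!: tendsto_intros)

text \<open>The divergence from 1 decreases below 1 and increases above it, and clipping moves
  \<open>u\<close> towards 1. In the proof this appears as the sign of
  \<open>(u - v) * ln v\<close>.\<close>

lemma kent_clip:
  assumes "0 < a" "a \<le> 1" "1 \<le> b" "u \<ge> 0"
  shows "kent (max a (min b u)) 1 \<le> kent u 1"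
proof -
  define v where "v = max a (min b u)"
  have v: "v > 0" using assms by (simp add: v_def)
  have c: "u \<le> v \<and> v \<le> 1 \<or> u \<ge> v \<and> v \<ge> 1 \<or> u = v" using assms unfolding v_def by linarith
  have "kent u 1 = kent u v + (u * ln v - v + 1)" using kent_change[of u 1 v] assms v by simp
  also have "\<dots> = kent v 1 + kent u v + (u - v) * ln v" by (simp add: kent_def algebra_simps)
  also have "\<dots> \<ge> kent v 1"
  proof -
    have "(u - v) * ln v \<ge> 0" using c v by (auto simp: zero_le_mult_iff)
    then show ?thesis using kent_nonneg[of u v] assms v by simp
  qed
  finally show ?thesis by (simp add: v_def)
qed

text \<open>Continuous approximations within the same bounds give convergence of the distribution
  functions, hence of the maps. Fatou's lemma handles the cost, and dominated convergence the
  entropy, which is bounded because \<open>q\<close> stays in \<open>[c0, C]\<close>.\<close>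

lemma transport_interval_measurable:
  fixes q :: "real \<Rightarrow> real"
  assumes [measurable]: "q \<in> borel_measurable borel" and c0: "c0 > 0" and ql: "\<And>x. c0 \<le> q x" and qu: "\<And>x. q x \<le> C" and M: "M > 0"
  defines "\<kappa> \<equiv> (cum q M - cum q (- M)) / (Phi M - Phi (- M))"
  defines "S \<equiv> \<lambda>z. Phinv (Phi (- M) + (cum q z - cum q (- M)) / \<kappa>)"
  shows "(\<integral>\<^sup>+ z. ennreal (q z * (z - S z)\<^sup>2 / 2) * indicator {- M..M} z \<partial>std_normal)
     \<le> (\<integral>\<^sup>+ z. ennreal (kent (q z) 1) * indicator {- M..M} z \<partial>std_normal)"
proof -
  obtain c where c: "\<And>n. continuous_on UNIV (c n)" "\<And>n x. c0 \<le> c n x" "\<And>n x. c n x \<le> C"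
    and cl: "AE x in lborel. (\<lambda>n. c n x) \<longlonglongrightarrow> q x"
    using continuous_approx_AE[of q c0 C] ql qu by auto
  have [measurable]: "c n \<in> borel_measurable borel" for n using c(1) by (rule borel_measurable_continuous_onI)
  have cl': "AE x in std_normal. (\<lambda>n. c n x) \<longlonglongrightarrow> q x" using cl by (simp only: AE_std_normal_iff)
  have q0: "q x > 0" for x using ql[of x] c0 by simp
  have bnd: "integrable std_normal g" if "g \<in> borel_measurable borel" "\<And>x. c0 \<le> g x" "\<And>x. g x \<le> C" for g
  proof (rule std_normal.integrable_const_bound[of _ C])
    have "0 \<le> g x" for x using that(2)[of x] c0 by simp
    then show "AE x in std_normal. norm (g x) \<le> C" using that(3) by simp
  qed (use that in simp)
  have iq: "integrable std_normal q" by (rule bnd) (use ql qu in auto)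
  have cuml: "(\<lambda>n. cum (c n) z) \<longlonglongrightarrow> cum q z" for z
    unfolding cum_def
  proof (rule integral_dominated_convergence)
    show "integrable std_normal (\<lambda>x. C)" by simp
    show "AE x in std_normal. (\<lambda>n. c n x * indicator {..z} x) \<longlonglongrightarrow> q x * indicator {..z} x"
      using cl' by eventually_elim (intro tendsto_intros)
    show "AE x in std_normal. norm (c n x * indicator {..z} x) \<le> C" for n
    proof (intro always_eventually allI)
      fix x
      have "0 \<le> c n x" "0 \<le> C" using c(2)[of n x] c(3)[of n x] c0 by auto
      then show "norm (c n x * indicator {..z} x) \<le> C" using c(3)[of n x] by (auto simp: indicator_def)
    qed
  qed measurable
  have MM: "- M < M" using M by simp
  have PM: "Phi M - Phi (- M) > 0" using MM by simp
  have Q: "cum q M - cum q (- M) > 0"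
  proof -
    have "c0 * (Phi M - Phi (- M)) = (\<integral>x. c0 * indicator {- M<..M} x \<partial>std_normal)"
    proof -
      have "Phi M - Phi (- M) = (\<integral>x. 1 * indicator {..M} x - 1 * indicator {..- M} x \<partial>std_normal)"
        unfolding Phi_def cum_def by (rule Bochner_Integration.integral_diff[symmetric]; rule integrable_cum; simp)
      also have "\<dots> = (\<integral>x. indicator {- M<..M} x \<partial>std_normal)"
        using MM by (intro Bochner_Integration.integral_cong) (auto simp: indicator_def)
      finally show ?thesis by simp
    qed
    also have "\<dots> \<le> (\<integral>x. q x * indicator {- M<..M} x \<partial>std_normal)"
      using iq ql by (intro integral_mono integrable_cum) (auto simp: indicator_def)
    also have "\<dots> = (\<integral>x. q x * indicator {..M} x - q x * indicator {..- M} x \<partial>std_normal)"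
      using MM by (intro Bochner_Integration.integral_cong) (auto simp: indicator_def)
    also have "\<dots> = cum q M - cum q (- M)"
      unfolding cum_def using iq by (subst Bochner_Integration.integral_diff) (auto intro!: integrable_cum)
    finally show ?thesis using c0 PM by (smt (verit) mult_pos_pos)
  qed
  have \<kappa>: "\<kappa> > 0" unfolding \<kappa>_def using Q PM by simp
  define \<kappa>n where "\<kappa>n = (\<lambda>n. (cum (c n) M - cum (c n) (- M)) / (Phi M - Phi (- M)))"
  define Sn where "Sn = (\<lambda>n z. Phinv (Phi (- M) + (cum (c n) z - cum (c n) (- M)) / \<kappa>n n))"
  have \<kappa>l: "\<kappa>n \<longlonglongrightarrow> \<kappa>" unfolding \<kappa>n_def \<kappa>_def using PM by (intro tendsto_intros cuml) auto
  have Sl: "(\<lambda>n. Sn n z) \<longlonglongrightarrow> S z" if z: "- M \<le> z" "z \<le> M" for z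
  proof -
    define p where "p = Phi (- M) + (cum q z - cum q (- M)) / \<kappa>"
    have q0': "\<And>x. 0 \<le> q x" using q0 by (simp add: less_imp_le)
    have "p \<ge> Phi (- M)" using cum_mono[OF iq q0' z(1)] \<kappa> by (simp add: p_def)
    then have p0: "0 < p" using Phi_bounds(1)[of "- M"] by linarith
    have "(cum q z - cum q (- M)) / \<kappa> \<le> (cum q M - cum q (- M)) / \<kappa>" using cum_mono[OF iq q0' z(2)] \<kappa> by (intro divide_right_mono) auto
    also have "\<dots> = Phi M - Phi (- M)" using Q PM by (simp add: \<kappa>_def)
    finally have "p \<le> Phi M" by (simp add: p_def)
    then have p1: "p < 1" using Phi_bounds(2)[of M] by linarith
    have "(\<lambda>n. Phi (- M) + (cum (c n) z - cum (c n) (- M)) / \<kappa>n n) \<longlonglongrightarrow> p"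
      unfolding p_def using \<kappa> by (intro tendsto_intros cuml \<kappa>l) auto
    then show ?thesis unfolding Sn_def S_def p_def[symmetric] by (rule isCont_tendsto_compose[OF Phinv_isCont[OF p0 p1]])
  qed
  have Sn_meas: "Sn n \<in> borel_measurable borel" for n unfolding Sn_def by measurable
  note [measurable] = Sn_meas
  obtain B where B: "\<And>u. c0 \<le> u \<Longrightarrow> u \<le> C \<Longrightarrow> kent u 1 \<le> B"
  proof (rule that)
    fix u assume u: "c0 \<le> u" "u \<le> C"
    have "u * ln (u / 1) \<le> u * (u - 1)" using u c0 by (intro mult_left_mono) (auto intro: ln_le_minus_one)
    also have "\<dots> \<le> C * C + C" using u c0 by (simp add: algebra_simps) (smt (verit) mult_mono)
    finally show "kent u 1 \<le> C * C + C + 1" using u c0 by (simp add: kent_def)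
  qed
  let ?I = "indicator {- M..M} :: real \<Rightarrow> ennreal"
  have "(\<integral>\<^sup>+ z. ennreal (q z * (z - S z)\<^sup>2 / 2) * ?I z \<partial>std_normal)
     = (\<integral>\<^sup>+ z. liminf (\<lambda>n. ennreal (c n z * (z - Sn n z)\<^sup>2 / 2) * ?I z) \<partial>std_normal)"
  proof (rule nn_integral_cong_AE, use cl' in eventually_elim)
    case (elim z)
    have "(\<lambda>n. ennreal (c n z * (z - Sn n z)\<^sup>2 / 2) * ?I z) \<longlonglongrightarrow> ennreal (q z * (z - S z)\<^sup>2 / 2) * ?I z"
    proof (cases "z \<in> {- M..M}")
      case True
      then have "(\<lambda>n. ennreal (c n z * (z - Sn n z)\<^sup>2 / 2)) \<longlonglongrightarrow> ennreal (q z * (z - S z)\<^sup>2 / 2)"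
        by (intro tendsto_ennrealI tendsto_intros elim Sl) auto
      then show ?thesis using True by simp
    qed simp
    then show ?case by (intro lim_imp_Liminf[symmetric]) auto
  qed
  also have "\<dots> \<le> liminf (\<lambda>n. \<integral>\<^sup>+ z. ennreal (c n z * (z - Sn n z)\<^sup>2 / 2) * ?I z \<partial>std_normal)"
    by (rule nn_integral_liminf) measurable
  also have "\<dots> \<le> liminf (\<lambda>n. \<integral>\<^sup>+ z. ennreal (kent (c n z) 1) * ?I z \<partial>std_normal)"
    unfolding Sn_def \<kappa>n_def by (intro Liminf_mono always_eventually allI transport_interval[OF c(1) c0 c(2) c(3) M])
  also have "\<dots> = (\<integral>\<^sup>+ z. ennreal (kent (q z) 1) * ?I z \<partial>std_normal)"
  proof (rule lim_imp_Liminf, simp)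
    show "(\<lambda>n. \<integral>\<^sup>+ z. ennreal (kent (c n z) 1) * ?I z \<partial>std_normal) \<longlonglongrightarrow> (\<integral>\<^sup>+ z. ennreal (kent (q z) 1) * ?I z \<partial>std_normal)"
    proof (rule nn_integral_dominated_convergence[where w = "\<lambda>_. ennreal B"])
      show "(\<integral>\<^sup>+ z. ennreal B \<partial>std_normal) < \<infinity>" by (simp add: ennreal_mult_less_top less_top[symmetric] std_normal.emeasure_space_1[simplified])
      show "AE z in std_normal. ennreal (kent (c n z) 1) * ?I z \<le> ennreal B" for n
        using B[OF c(2) c(3)] by (auto intro!: always_eventually simp: indicator_def ennreal_leI)
      show "AE z in std_normal. (\<lambda>n. ennreal (kent (c n z) 1) * ?I z) \<longlonglongrightarrow> ennreal (kent (q z) 1) * ?I z"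
        using cl'
      proof eventually_elim
        case (elim z)
        then have "(\<lambda>n. ennreal (kent (c n z) 1)) \<longlonglongrightarrow> ennreal (kent (q z) 1)"
          by (intro tendsto_ennrealI tendsto_kent q0)
        then show ?case by (cases "z \<in> {- M..M}") auto
      qed
    qed measurable
  qed
  finally show ?thesis .
qed

section \<open>Increasing rearrangement of a general density onto the normal law\<close>

locale line_density =
  fixes f :: "real \<Rightarrow> real" and A :: real
  assumes f_meas [measurable]: "f \<in> borel_measurable borel" and f0: "\<And>x. f x \<ge> 0"
    and i: "integrable std_normal f" and A: "A = (\<integral>x. f x \<partial>std_normal)" "A > 0"
begin

definition \<mu> where "\<mu> = density std_normal (\<lambda>x. ennreal (f x / A))"

lemma emeasure_\<mu>: "X \<in> sets borel \<Longrightarrow> emeasure \<mu> X = ennreal ((\<integral>x. f x * indicator X x \<partial>std_normal) / A)"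
proof -
  assume [measurable]: "X \<in> sets borel"
  have ix: "integrable std_normal (\<lambda>x. f x * indicator X x)" by (rule integrable_cum[OF _ i]) measurable
  have "emeasure \<mu> X = (\<integral>\<^sup>+ x. ennreal (f x / A) * indicator X x \<partial>std_normal)"
    unfolding \<mu>_def by (subst emeasure_density) auto
  also have "\<dots> = (\<integral>\<^sup>+ x. ennreal (f x * indicator X x / A) \<partial>std_normal)"
    by (intro nn_integral_cong) (auto simp: indicator_def)
  also have "\<dots> = ennreal (\<integral>x. f x * indicator X x / A \<partial>std_normal)"
    using ix f0 A(2) by (intro nn_integral_eq_integral) auto
  finally show ?thesis using ix by simp
qed

sublocale \<mu>: real_distribution \<mu>
proof (unfold real_distribution_def real_distribution_axioms_def, intro conjI prob_spaceI)
  show "emeasure \<mu> (space \<mu>) = 1" using emeasure_\<mu>[of UNIV] A(2) by (simp add: A(1)[symmetric] \<mu>_def)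
  show "sets \<mu> = sets borel" by (simp add: \<mu>_def)
qed

definition G where "G z = cum f z / A"
text \<open>The increasing rearrangement: distribution function of \<open>\<mu>\<close>, followed by
  the normal quantile function.\<close>

definition S where "S z = Phinv (G z)"

lemma G_cdf: "G = cdf \<mu>"
proof
  fix z
  have "0 \<le> (\<integral>x. f x * indicator {..z} x \<partial>std_normal)" using f0 by (intro integral_nonneg_AE) auto
  then show "G z = cdf \<mu> z"
    using A(2) emeasure_\<mu>[of "{..z}"] by (simp add: cdf_def G_def cum_def measure_def)
qed

lemma [measurable]: "G \<in> borel_measurable borel" "S \<in> borel_measurable borel"
  unfolding G_def[abs_def] S_def[abs_def] by measurable

lemma G_isCont: "isCont G z"
proof -
  have "(\<integral>x. f x * indicator {z} x \<partial>std_normal) = (\<integral>x. 0 \<partial>std_normal)"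
  proof (rule integral_cong_AE)
    have "AE x in std_normal. x \<noteq> z" unfolding AE_std_normal_iff by (rule AE_lborel_singleton)
    then show "AE x in std_normal. f x * indicator {z} x = 0" by eventually_elim (auto simp: indicator_def)
  qed auto
  then have "measure \<mu> {z} = 0" using emeasure_\<mu>[of "{z}"] by (simp add: measure_def)
  then show ?thesis unfolding G_cdf \<mu>.isCont_cdf .
qed

lemma G_mono: "x \<le> y \<Longrightarrow> G x \<le> G y"
  unfolding G_cdf by (rule \<mu>.cdf_nondecreasing)

text \<open>The probability integral transform. As \<open>G\<close> is continuous, its sublevel set
  is a closed half-line, and at the right end the intermediate value theorem forces the value
  \<open>p\<close>.\<close>

lemma measure_G_le:
  assumes p: "0 < p" "p < 1"
  shows "measure \<mu> {z. G z \<le> p} = p"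
proof -
  define X where "X = {z. G z \<le> p}"
  have "eventually (\<lambda>x. G x < p) at_bot" using \<mu>.cdf_lim_at_bot p
    unfolding G_cdf by (intro order_tendstoD) auto
  then obtain a where a: "G a < p" using eventually_happens trivial_limit_at_bot_linorder by blast
  have "eventually (\<lambda>x. G x > p) at_top" using \<mu>.cdf_lim_at_top_prob p
    unfolding G_cdf by (intro order_tendstoD) auto
  then obtain b where b: "G b > p" using eventually_happens trivial_limit_at_top_linorder by blast
  have ne: "X \<noteq> {}" using a by (auto simp: X_def intro!: exI[of _ a] less_imp_le)
  have ub: "x \<le> b" if "x \<in> X" for x using G_mono[of b x] b that by (force simp: X_def)
  then have bdd: "bdd_above X" by (auto simp: bdd_above_def)
  have "continuous_on UNIV G" using G_isCont by (simp add: continuous_at_imp_continuous_on)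
  then have "closed X" unfolding X_def by (intro closed_Collect_le) auto
  define z where "z = Sup X"
  have zX: "z \<in> X" unfolding z_def using ne bdd \<open>closed X\<close> by (rule closed_contains_Sup)
  have Xz: "X = {..z}"
  proof (intro set_eqI iffI)
    fix x assume "x \<in> X" then show "x \<in> {..z}" using bdd by (simp add: z_def cSup_upper)
  next
    fix x assume "x \<in> {..z}" then show "x \<in> X" using zX G_mono[of x z] by (auto simp: X_def)
  qed
  have "G z = p"
  proof (rule ccontr)
    assume "G z \<noteq> p"
    then have lt: "G z < p" using zX by (simp add: X_def)
    have zb: "z \<le> b" using ub[OF zX] .
    obtain y where y: "z \<le> y" "y \<le> b" "G y = p"
      using IVT[of G z p b] lt b zb G_isCont by auto
    then have "y \<in> X" by (simp add: X_def)
    then have "y = z" using y Xz by auto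
    then show False using y lt by simp
  qed
  moreover have "measure \<mu> X = G z" by (simp add: Xz G_cdf cdf_def)
  ultimately show ?thesis by (simp add: X_def)
qed

text \<open>Sets where \<open>G\<close> is at most 0 or at least 1 are squeezed by sublevel sets at
  levels close to 0 and 1, whose mass is known. Thus the default value of \<open>Phinv\<close> is
  not seen by \<open>\<mu>\<close>.\<close>

lemma G_interior: "AE z in \<mu>. 0 < G z \<and> G z < 1"
proof -
  have "measure \<mu> {z. G z \<le> 0} \<le> 0"
  proof (rule field_le_epsilon)
    fix e :: real assume e: "e > 0"
    define p where "p = min e (1/2)"
    have "measure \<mu> {z. G z \<le> 0} \<le> measure \<mu> {z. G z \<le> p}"
      using e by (intro \<mu>.finite_measure_mono) (auto simp: p_def)
    also have "\<dots> = p" using e by (intro measure_G_le) (auto simp: p_def)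
    finally show "measure \<mu> {z. G z \<le> 0} \<le> 0 + e" by (simp add: p_def)
  qed
  then have "measure \<mu> {z. G z \<le> 0} = 0" by (intro antisym) auto
  then have 1: "AE z in \<mu>. \<not> G z \<le> 0"
    by (subst (asm) \<mu>.prob_eq_0) auto
  have "measure \<mu> {z. 1 \<le> G z} \<le> 0"
  proof (rule field_le_epsilon)
    fix e :: real assume e: "e > 0"
    define p where "p = max (1 - e) (1/2)"
    have p: "0 < p" "p < 1" using e by (auto simp: p_def)
    have "measure \<mu> {z. 1 \<le> G z} \<le> measure \<mu> (space \<mu> - {z. G z \<le> p})"
      using p by (intro \<mu>.finite_measure_mono) (auto simp: \<mu>_def)
    also have "\<dots> = 1 - p" using p by (subst \<mu>.prob_compl) (auto simp: measure_G_le)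
    finally show "measure \<mu> {z. 1 \<le> G z} \<le> 0 + e" by (simp add: p_def)
  qed
  then have "measure \<mu> {z. 1 \<le> G z} = 0" by (intro antisym) auto
  then have 2: "AE z in \<mu>. \<not> 1 \<le> G z"
    by (subst (asm) \<mu>.prob_eq_0) auto
  from 1 2 show ?thesis by eventually_elim auto
qed

lemma distr_S: "distr \<mu> borel S = std_normal"
proof (rule cdf_unique)
  show "real_distribution (distr \<mu> borel S)" by (rule \<mu>.real_distribution_distr) measurable
  show "real_distribution std_normal" by (rule std_normal.real_distribution_axioms)
  show "cdf (distr \<mu> borel S) = cdf std_normal"
  proof
    fix u
    have "cdf (distr \<mu> borel S) u = measure \<mu> {z. S z \<le> u}"
      by (simp add: cdf_def measure_distr vimage_def \<mu>_def)
    also have "\<dots> = measure \<mu> {z. G z \<le> Phi u}"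
    proof (rule \<mu>.finite_measure_eq_AE)
      show "AE x in \<mu>. (x \<in> {z. S z \<le> u}) = (x \<in> {z. G z \<le> Phi u})"
        using G_interior by eventually_elim (auto simp: S_def Phinv_le_iff)
    qed auto
    also have "\<dots> = Phi u" by (rule measure_G_le) (auto intro: Phi_bounds)
    finally show "cdf (distr \<mu> borel S) u = cdf std_normal u" by (simp add: Phi_eq_cdf)
  qed
qed

lemma nn_integral_\<mu>:
  assumes [measurable]: "h \<in> borel_measurable borel"
  shows "(\<integral>\<^sup>+ z. ennreal (f z) * h z \<partial>std_normal) = ennreal A * (\<integral>\<^sup>+ z. h z \<partial>\<mu>)"
proof -
  have "ennreal A * (\<integral>\<^sup>+ z. h z \<partial>\<mu>) = (\<integral>\<^sup>+ z. ennreal A * (ennreal (f z / A) * h z) \<partial>std_normal)"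
    unfolding \<mu>_def by (subst nn_integral_density) (auto simp: nn_integral_cmult)
  also have "\<dots> = (\<integral>\<^sup>+ z. ennreal (f z) * h z \<partial>std_normal)"
    using A f0 by (intro nn_integral_cong) (simp add: mult.assoc[symmetric] ennreal_mult[symmetric])
  finally show ?thesis by simp
qed

lemma transport_push:
  assumes [measurable]: "h \<in> borel_measurable borel"
  shows "(\<integral>\<^sup>+ z. ennreal (f z) * h (S z) \<partial>std_normal) = ennreal A * (\<integral>\<^sup>+ z. h z \<partial>std_normal)"
proof -
  have "(\<integral>\<^sup>+ z. ennreal (f z) * h (S z) \<partial>std_normal) = ennreal A * (\<integral>\<^sup>+ z. h (S z) \<partial>\<mu>)"
    by (rule nn_integral_\<mu>) measurable
  also have "(\<integral>\<^sup>+ z. h (S z) \<partial>\<mu>) = (\<integral>\<^sup>+ z. h z \<partial>distr \<mu> borel S)" by (subst nn_integral_distr) auto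
  finally show ?thesis by (simp only: distr_S)
qed

text \<open>The density is clipped to \<open>[1 / (k + 1), k + 1]\<close> and the line to
  \<open>[- M k, M k]\<close>. Clipping does not increase the divergence from 1, which controls the
  right side for every \<open>k\<close>; Fatou's lemma passes to the limit in the cost.\<close>

lemma transport_cost_1:
  assumes A1: "A = 1"
  shows "(\<integral>\<^sup>+ z. ennreal (f z * (z - S z)\<^sup>2 / 2) \<partial>std_normal) \<le> (\<integral>\<^sup>+ z. ennreal (kent (f z) 1) \<partial>std_normal)"
proof -
  define q where "q = (\<lambda>k::nat. \<lambda>z. max (1 / real (Suc k)) (min (real (Suc k)) (f z)))"
  define M where "M = (\<lambda>k::nat. real (Suc k))"
  have M: "M k > 0" for k by (simp add: M_def)
  have [measurable]: "q k \<in> borel_measurable borel" for k unfolding q_def by measurable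
  have i0: "(\<lambda>k. 1 / real (Suc k)) \<longlonglongrightarrow> 0" using LIMSEQ_inverse_real_of_nat by (simp add: inverse_eq_divide)
  have Mtop: "filterlim M at_top sequentially" unfolding M_def
    by (intro filterlim_compose[OF filterlim_real_sequentially filterlim_Suc])
  have ql: "(\<lambda>k. q k z) \<longlonglongrightarrow> f z" for z
  proof -
    obtain N where N: "f z \<le> real N" using real_arch_simple by blast
    have "eventually (\<lambda>k. max (1 / real (Suc k)) (f z) = q k z) sequentially"
      using N by (intro eventually_sequentiallyI[of N]) (auto simp: q_def min_def)
    moreover have "(\<lambda>k. max (1 / real (Suc k)) (f z)) \<longlonglongrightarrow> max 0 (f z)" by (intro tendsto_intros i0)
    ultimately show ?thesis using f0[of z] Lim_transform_eventually by (force simp: max_def)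
  qed
  have q0: "q k z > 0" for k z by (simp add: q_def less_max_iff_disj)
  have qf: "q k z \<le> f z + 1" for k z
  proof -
    have "1 / real (Suc k) \<le> 1" by simp
    then show ?thesis using f0[of z] unfolding q_def by linarith
  qed
  \<comment> \<open>One dominated convergence statement, with bound \<open>f x + 1\<close>, serves
    all limits of \<open>cum\<close> and \<open>Phi\<close>, at a fixed point as well as at the
    moving endpoints.\<close>
  have lim: "(\<lambda>k. \<integral>x. g k x * indicator {..a k} x \<partial>std_normal) \<longlonglongrightarrow> (\<integral>x. h x * l x \<partial>std_normal)"
    if g: "\<And>x. (\<lambda>k. g k x) \<longlonglongrightarrow> h x" and al: "\<And>x. (\<lambda>k. indicator {..a k} x) \<longlonglongrightarrow> l x" and gb: "\<And>k x. 0 \<le> g k x \<and> g k x \<le> f x + 1"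
      and [measurable]: "\<And>k. g k \<in> borel_measurable borel" "h \<in> borel_measurable borel" "l \<in> borel_measurable borel"
    for g :: "nat \<Rightarrow> real \<Rightarrow> real" and h a and l :: "real \<Rightarrow> real"
  proof (rule integral_dominated_convergence)
    show "integrable std_normal (\<lambda>x. f x + 1)" using i by simp
    show "AE x in std_normal. (\<lambda>k. g k x * indicator {..a k} x) \<longlonglongrightarrow> h x * l x"
      by (intro always_eventually allI tendsto_mult g al)
    show "AE x in std_normal. norm (g k x * indicator {..a k} x) \<le> f x + 1" for k
    proof (intro always_eventually allI)
      fix x show "norm (g k x * indicator {..a k} x) \<le> f x + 1" using gb[of k x] f0[of x] by (auto simp: indicator_def)
    qed
  qed measurable
  have ac: "(\<lambda>k. indicator {..z} x :: real) \<longlonglongrightarrow> indicator {..z} x" for z x :: real by simp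
  have aM: "(\<lambda>k. indicator {..M k} x :: real) \<longlonglongrightarrow> 1" for x
  proof (rule tendsto_eventually)
    show "\<forall>\<^sub>F k in sequentially. indicator {..M k} x = (1::real)"
      using Mtop[unfolded filterlim_at_top, rule_format, of x] by eventually_elim (auto simp: indicator_def)
  qed
  have am: "(\<lambda>k. indicator {..- M k} x :: real) \<longlonglongrightarrow> 0" for x
  proof (rule tendsto_eventually)
    show "\<forall>\<^sub>F k in sequentially. indicator {..- M k} x = (0::real)"
      using Mtop[unfolded filterlim_at_top, rule_format, of "1 - x"] by eventually_elim (auto simp: indicator_def)
  qed
  have qb: "0 \<le> q k x \<and> q k x \<le> f x + 1" for k x using qf q0[of k x] by (auto simp: less_imp_le)
  have ob: "0 \<le> (1::real) \<and> 1 \<le> f x + 1" for x using f0 by simp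
  have L1: "(\<lambda>k. cum (q k) z) \<longlonglongrightarrow> cum f z" for z unfolding cum_def by (rule lim[OF ql ac qb]) measurable
  have L2: "(\<lambda>k. cum (q k) (M k)) \<longlonglongrightarrow> 1" using lim[OF ql aM qb] A A1 by (simp add: cum_def)
  have L3: "(\<lambda>k. cum (q k) (- M k)) \<longlonglongrightarrow> 0" using lim[OF ql am qb] by (simp add: cum_def)
  have L4: "(\<lambda>k. Phi (M k)) \<longlonglongrightarrow> 1"
    using lim[OF tendsto_const aM ob] unfolding Phi_def cum_def by (simp add: std_normal.prob_space[simplified])
  have L5: "(\<lambda>k. Phi (- M k)) \<longlonglongrightarrow> 0"
    using lim[OF tendsto_const am ob] unfolding Phi_def cum_def by simp
  define \<kappa> where "\<kappa> = (\<lambda>k. (cum (q k) (M k) - cum (q k) (- M k)) / (Phi (M k) - Phi (- M k)))"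
  define T where "T = (\<lambda>k z. Phinv (Phi (- M k) + (cum (q k) z - cum (q k) (- M k)) / \<kappa> k))"
  have "\<kappa> \<longlonglongrightarrow> (1 - 0) / (1 - 0)" unfolding \<kappa>_def by (intro tendsto_intros L2 L3 L4 L5) auto
  then have \<kappa>l: "\<kappa> \<longlonglongrightarrow> 1" by simp
  have Gl: "(\<lambda>k. Phi (- M k) + (cum (q k) z - cum (q k) (- M k)) / \<kappa> k) \<longlonglongrightarrow> 0 + (cum f z - 0) / 1" for z
    by (intro tendsto_intros L1 L3 L5 \<kappa>l) auto
  have Tl: "(\<lambda>k. T k z) \<longlonglongrightarrow> S z" if "0 < G z" "G z < 1" for z
  proof -
    have "(\<lambda>k. Phi (- M k) + (cum (q k) z - cum (q k) (- M k)) / \<kappa> k) \<longlonglongrightarrow> G z"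
      using Gl[of z] by (subst G_def, subst A1) simp
    then show ?thesis unfolding T_def S_def by (rule isCont_tendsto_compose[OF Phinv_isCont[OF that]])
  qed
  have [measurable]: "T k \<in> borel_measurable borel" for k unfolding T_def by measurable
  let ?I = "\<lambda>k. indicator {- M k..M k} :: real \<Rightarrow> ennreal"
  have Il: "\<forall>\<^sub>F k in sequentially. ?I k z = 1" for z
    using Mtop[unfolded filterlim_at_top, rule_format, of "\<bar>z\<bar>"] by eventually_elim (auto simp: indicator_def)
  have int: "AE z in std_normal. f z > 0 \<longrightarrow> 0 < G z \<and> G z < 1"
    using G_interior A unfolding \<mu>_def by (subst (asm) AE_density) (auto simp: zero_less_divide_iff)
  have "(\<integral>\<^sup>+ z. ennreal (f z * (z - S z)\<^sup>2 / 2) \<partial>std_normal)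
    \<le> (\<integral>\<^sup>+ z. liminf (\<lambda>k. ennreal (q k z * (z - T k z)\<^sup>2 / 2) * ?I k z) \<partial>std_normal)"
  proof (rule nn_integral_mono_AE, use int in eventually_elim)
    case (elim z)
    show ?case
    proof (cases "f z > 0")
      case True
      then have "(\<lambda>k. ennreal (q k z * (z - T k z)\<^sup>2 / 2)) \<longlonglongrightarrow> ennreal (f z * (z - S z)\<^sup>2 / 2)"
        using elim by (intro tendsto_ennrealI tendsto_intros ql Tl) auto
      then have "(\<lambda>k. ennreal (q k z * (z - T k z)\<^sup>2 / 2) * ?I k z) \<longlonglongrightarrow> ennreal (f z * (z - S z)\<^sup>2 / 2)"
        by (rule Lim_transform_eventually) (use Il[of z] in eventually_elim, simp)
      then have "liminf (\<lambda>k. ennreal (q k z * (z - T k z)\<^sup>2 / 2) * ?I k z) = ennreal (f z * (z - S z)\<^sup>2 / 2)"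
        by (intro lim_imp_Liminf) auto
      then show ?thesis by simp
    next
      case False
      then have "f z = 0" using f0[of z] by simp
      then show ?thesis by simp
    qed
  qed
  also have "\<dots> \<le> liminf (\<lambda>k. \<integral>\<^sup>+ z. ennreal (q k z * (z - T k z)\<^sup>2 / 2) * ?I k z \<partial>std_normal)"
    by (rule nn_integral_liminf) measurable
  also have "\<dots> \<le> (\<integral>\<^sup>+ z. ennreal (kent (f z) 1) \<partial>std_normal)"
  proof (rule order_trans[OF Liminf_le_Limsup Limsup_bounded])
    show "\<forall>\<^sub>F k in sequentially. (\<integral>\<^sup>+ z. ennreal (q k z * (z - T k z)\<^sup>2 / 2) * ?I k z \<partial>std_normal) \<le> (\<integral>\<^sup>+ z. ennreal (kent (f z) 1) \<partial>std_normal)"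
    proof (intro always_eventually allI)
      fix k
      have "1 / real (Suc k) \<le> real (Suc k)" by (simp add: field_simps)
      then have "(\<integral>\<^sup>+ z. ennreal (q k z * (z - T k z)\<^sup>2 / 2) * ?I k z \<partial>std_normal) \<le> (\<integral>\<^sup>+ z. ennreal (kent (q k z) 1) * ?I k z \<partial>std_normal)"
        unfolding T_def \<kappa>_def
        by (intro transport_interval_measurable[of _ "1 / real (Suc k)" "real (Suc k)"] M) (auto simp: q_def simp del: of_nat_Suc)
      also have "\<dots> \<le> (\<integral>\<^sup>+ z. ennreal (kent (f z) 1) \<partial>std_normal)"
      proof (intro nn_integral_mono)
        fix z
        have "kent (q k z) 1 \<le> kent (f z) 1" unfolding q_def by (rule kent_clip) (auto simp: f0)
        then show "ennreal (kent (q k z) 1) * ?I k z \<le> ennreal (kent (f z) 1)" by (auto simp: indicator_def ennreal_leI)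
      qed
      finally show "(\<integral>\<^sup>+ z. ennreal (q k z * (z - T k z)\<^sup>2 / 2) * ?I k z \<partial>std_normal) \<le> (\<integral>\<^sup>+ z. ennreal (kent (f z) 1) \<partial>std_normal)" .
    qed
  qed simp
  finally show ?thesis .
qed

end

text \<open>Cost and divergence are homogeneous of degree one in the density, while \<open>S\<close>
  depends only on the normalised density, so the case of mass 1 suffices.\<close>

lemma (in line_density) transport_cost:
  "(\<integral>\<^sup>+ z. ennreal (f z * (z - S z)\<^sup>2 / 2) \<partial>std_normal) \<le> (\<integral>\<^sup>+ z. ennreal (kent (f z) A) \<partial>std_normal)"
proof -
  interpret L: line_density "\<lambda>z. f z / A" 1
    by unfold_locales (use f0 i A in auto)
  have "cum (\<lambda>z. f z / A) z = cum f z / A" for z by (simp add: cum_def)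
  then have LS: "L.S = S" by (simp add: fun_eq_iff L.S_def S_def L.G_def G_def)
  have k: "kent (f z) A = A * kent (f z / A) 1" for z using kent_scale[OF A(2), of "f z / A" 1] A(2) by simp
  have "(\<integral>\<^sup>+ z. ennreal (f z * (z - S z)\<^sup>2 / 2) \<partial>std_normal) = (\<integral>\<^sup>+ z. ennreal A * ennreal (f z / A * (z - S z)\<^sup>2 / 2) \<partial>std_normal)"
    using A(2) f0 by (intro nn_integral_cong) (simp add: ennreal_mult[symmetric])
  also have "\<dots> = ennreal A * (\<integral>\<^sup>+ z. ennreal (f z / A * (z - S z)\<^sup>2 / 2) \<partial>std_normal)" by (rule nn_integral_cmult) measurable
  also have "\<dots> \<le> ennreal A * (\<integral>\<^sup>+ z. ennreal (kent (f z / A) 1) \<partial>std_normal)"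
    using L.transport_cost_1 unfolding LS by (intro mult_left_mono) auto
  also have "\<dots> = (\<integral>\<^sup>+ z. ennreal A * ennreal (kent (f z / A) 1) \<partial>std_normal)" by (rule nn_integral_cmult[symmetric]) measurable
  also have "\<dots> = (\<integral>\<^sup>+ z. ennreal (kent (f z) A) \<partial>std_normal)"
    using A(2) f0 kent_nonneg[of "f z / A" 1 for z] by (intro nn_integral_cong) (simp add: k ennreal_mult)
  finally show ?thesis .
qed

subsection \<open>Triangular transport\<close>

abbreviation normal_PiM :: "'i set \<Rightarrow> ('i \<Rightarrow> real) measure" where
  "normal_PiM I \<equiv> \<Pi>\<^sub>M i\<in>I. std_normal"

interpretation normal_PiM: product_sigma_finite "\<lambda>_. std_normal"
  by unfold_locales

text \<open>The mass \<open>b\<close> may be zero, as happens on fibres of a multivariate density.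
  The cost estimate leaves room for \<open>kent b a\<close>, the divergence of the marginal mass,
  which the remaining coordinates use up in the induction. The explicit formula for \<open>r\<close>
  keeps it measurable in parameters.\<close>

lemma line_transport:
  fixes F :: "real \<Rightarrow> real"
  assumes [measurable]: "F \<in> borel_measurable borel" and F0: "\<And>t. F t \<ge> 0"
    and fin: "(\<integral>\<^sup>+ t. ennreal (F t) \<partial>std_normal) < \<infinity>"
  defines "b \<equiv> \<integral>t. F t \<partial>std_normal"
  defines "r \<equiv> \<lambda>t. Phinv ((\<integral>y. F y * indicator {..t} y \<partial>std_normal) / b)"
  shows "ennreal b = (\<integral>\<^sup>+ t. ennreal (F t) \<partial>std_normal)" "b \<ge> 0"
    and "h \<in> borel_measurable borel \<Longrightarrow> (\<integral>\<^sup>+ t. ennreal (F t) * h (r t) \<partial>std_normal) = ennreal b * (\<integral>\<^sup>+ t. h t \<partial>std_normal)"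
    and "a > 0 \<Longrightarrow> (\<integral>\<^sup>+ t. ennreal (F t * (t - r t)\<^sup>2 / 2) \<partial>std_normal) + ennreal (kent b a) \<le> (\<integral>\<^sup>+ t. ennreal (kent (F t) a) \<partial>std_normal)"
proof -
  have i: "integrable std_normal F" using fin F0 by (intro integrableI_nonneg) auto
  show bb: "ennreal b = (\<integral>\<^sup>+ t. ennreal (F t) \<partial>std_normal)" unfolding b_def
    using i F0 by (intro nn_integral_eq_integral[symmetric]) auto
  show b0: "b \<ge> 0" unfolding b_def using F0 by (intro integral_nonneg_AE) auto
  have c: "r = (\<lambda>t. Phinv (cum F t / b))" by (simp add: r_def cum_def)
  show "(\<integral>\<^sup>+ t. ennreal (F t) * h (r t) \<partial>std_normal) = ennreal b * (\<integral>\<^sup>+ t. h t \<partial>std_normal)"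
    if [measurable]: "h \<in> borel_measurable borel"
  proof (cases "b = 0")
    case True
    then have "(\<integral>\<^sup>+ t. ennreal (F t) \<partial>std_normal) = 0" using bb by simp
    then have "AE t in std_normal. ennreal (F t) = 0" by (subst (asm) nn_integral_0_iff_AE) auto
    then have "(\<integral>\<^sup>+ t. ennreal (F t) * h (r t) \<partial>std_normal) = (\<integral>\<^sup>+ t. 0 \<partial>std_normal)"
      by (intro nn_integral_cong_AE) (auto elim: eventually_mono)
    then show ?thesis using True by simp
  next
    case False
    have bpos: "b > 0" using b0 False by simp
    interpret line_density F b by unfold_locales (use F0 i bpos in \<open>auto simp: b_def\<close>)
    have "S = r" by (simp add: c fun_eq_iff S_def G_def)
    then show ?thesis using transport_push[OF that] by simp
  qed
  show "(\<integral>\<^sup>+ t. ennreal (F t * (t - r t)\<^sup>2 / 2) \<partial>std_normal) + ennreal (kent b a) \<le> (\<integral>\<^sup>+ t. ennreal (kent (F t) a) \<partial>std_normal)"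
    if a: "a > 0"
  proof (cases "b = 0")
    case True
    then have "(\<integral>\<^sup>+ t. ennreal (F t) \<partial>std_normal) = 0" using bb by simp
    then have "AE t in std_normal. ennreal (F t) = 0" by (subst (asm) nn_integral_0_iff_AE) auto
    then have ae: "AE t in std_normal. F t = 0" by eventually_elim (use F0 in \<open>auto simp: ennreal_eq_0_iff intro: antisym\<close>)
    have "(\<integral>\<^sup>+ t. ennreal (F t * (t - r t)\<^sup>2 / 2) \<partial>std_normal) = (\<integral>\<^sup>+ t. 0 \<partial>std_normal)"
      by (rule nn_integral_cong_AE, use ae in eventually_elim) simp
    moreover have "(\<integral>\<^sup>+ t. ennreal (kent (F t) a) \<partial>std_normal) = (\<integral>\<^sup>+ t. ennreal a \<partial>std_normal)"
      by (rule nn_integral_cong_AE, use ae in eventually_elim) simp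
    ultimately show ?thesis using True std_normal.emeasure_space_1 by simp
  next
    case False
    have bpos: "b > 0" using b0 False by simp
    interpret line_density F b by unfold_locales (use F0 i bpos in \<open>auto simp: b_def\<close>)
    have "S = r" by (simp add: c fun_eq_iff S_def G_def)
    then have "(\<integral>\<^sup>+ t. ennreal (F t * (t - r t)\<^sup>2 / 2) \<partial>std_normal) + ennreal (kent b a) \<le> (\<integral>\<^sup>+ t. ennreal (kent (F t) b) \<partial>std_normal) + ennreal (kent b a)"
      using transport_cost by (intro add_right_mono) simp
    also have "\<dots> = (\<integral>\<^sup>+ t. ennreal (kent (F t) a) \<partial>std_normal)"
      by (rule nn_integral_kent_chain[OF prob_space_std_normal i F0 _ bpos a, symmetric]) (simp add: b_def)
    finally show ?thesis .
  qed
qed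

text \<open>The Knothe-Rosenblatt map: the new coordinate is rearranged conditionally on the old
  ones, and the old ones are transported by the map of the marginal density. The chain rule for the
  divergence matches the additivity of the squared cost. The parameter \<open>s\<close> is carried
  along to obtain one jointly measurable map.\<close>

lemma transport_PiM:
  fixes I :: "'i set" and M :: "'s measure" and F :: "'s \<times> ('i \<Rightarrow> real) \<Rightarrow> real"
  assumes "finite I" "F \<in> borel_measurable (M \<Otimes>\<^sub>M normal_PiM I)" "\<And>p. F p \<ge> 0"
  shows "\<exists>R \<in> measurable (M \<Otimes>\<^sub>M normal_PiM I) (normal_PiM I). \<forall>s\<in>space M. \<forall>a>0. (\<integral>\<^sup>+ z. ennreal (F (s, z)) \<partial>normal_PiM I) = ennreal a \<longrightarrow>
      (\<forall>h\<in>borel_measurable (normal_PiM I). (\<integral>\<^sup>+ z. ennreal (F (s, z)) * h (R (s, z)) \<partial>normal_PiM I) = ennreal a * (\<integral>\<^sup>+ z. h z \<partial>normal_PiM I)) \<and>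
      (\<integral>\<^sup>+ z. ennreal (F (s, z) * (\<Sum>i\<in>I. (z i - R (s, z) i)\<^sup>2) / 2) \<partial>normal_PiM I) \<le> (\<integral>\<^sup>+ z. ennreal (kent (F (s, z)) a) \<partial>normal_PiM I)"
  using assms
proof (induction I arbitrary: F rule: finite_induct)
  case empty
  have e: "space (normal_PiM ({}::'i set)) = {\<lambda>_. undefined}" by (simp add: space_PiM_empty)
  have n: "(\<integral>\<^sup>+ z. g z \<partial>normal_PiM ({}::'i set)) = g (\<lambda>_. undefined)" for g
    by (rule normal_PiM.nn_integral_empty) simp
  show ?case
  proof (intro bexI[of _ snd] ballI allI impI conjI)
    fix s and a :: real and h :: "('i \<Rightarrow> real) \<Rightarrow> ennreal"
    assume "(\<integral>\<^sup>+ z. ennreal (F (s, z)) \<partial>normal_PiM {}) = ennreal a"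
    then show "(\<integral>\<^sup>+ z. ennreal (F (s, z)) * h (snd (s, z)) \<partial>normal_PiM {}) = ennreal a * (\<integral>\<^sup>+ z. h z \<partial>normal_PiM {})"
      by (simp add: n)
  qed auto
next
  case (insert i I)
  note fin = insert.hyps(1) and iI = insert.hyps(2) and F0 = insert.prems(2)
  have Fm[measurable]: "F \<in> borel_measurable (M \<Otimes>\<^sub>M normal_PiM (insert i I))" by (rule insert.prems(1))
  let ?N = std_normal
  let ?MI = "M \<Otimes>\<^sub>M normal_PiM I"
  define F1 where "F1 = (\<lambda>q. F (fst (fst q), (snd (fst q))(i := snd q)))"
  have upd: "(\<lambda>q. (snd (fst q))(i := snd q)) \<in> measurable (?MI \<Otimes>\<^sub>M borel) (normal_PiM (insert i I))"
    by (rule measurable_fun_upd[where J = I]) (auto simp: iI)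
  have F1m[measurable]: "F1 \<in> borel_measurable (?MI \<Otimes>\<^sub>M borel)"
  proof -
    have "(\<lambda>q. (fst (fst q), (snd (fst q))(i := snd q))) \<in> measurable (?MI \<Otimes>\<^sub>M borel) (M \<Otimes>\<^sub>M normal_PiM (insert i I))"
      using upd by measurable
    from measurable_compose[OF this Fm] show ?thesis by (simp add: F1_def)
  qed
  define Fb where "Fb = (\<lambda>p. \<integral>t. F1 (p, t) \<partial>?N)"
  have Fbm[measurable]: "Fb \<in> borel_measurable ?MI" unfolding Fb_def by measurable
  have Fb0: "Fb p \<ge> 0" for p unfolding Fb_def F1_def using F0 by (intro integral_nonneg_AE) auto
  \<comment> \<open>The half-line indicator is written with \<open>if\<close>, so that joint
    measurability in base point and threshold reduces to that of the order relation.\<close>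
  define r where "r = (\<lambda>q. Phinv ((\<integral>y. F1 (fst q, y) * (if y \<le> snd q then 1 else 0) \<partial>?N) / Fb (fst q)))"
  have rm[measurable]: "r \<in> borel_measurable (?MI \<Otimes>\<^sub>M borel)" unfolding r_def by measurable
  obtain R0 where R0m[measurable]: "R0 \<in> measurable ?MI (normal_PiM I)" and
    R0: "\<And>s a. s \<in> space M \<Longrightarrow> a > 0 \<Longrightarrow> (\<integral>\<^sup>+ z. ennreal (Fb (s, z)) \<partial>normal_PiM I) = ennreal a \<Longrightarrow>
      (\<forall>h\<in>borel_measurable (normal_PiM I). (\<integral>\<^sup>+ z. ennreal (Fb (s, z)) * h (R0 (s, z)) \<partial>normal_PiM I) = ennreal a * (\<integral>\<^sup>+ z. h z \<partial>normal_PiM I)) \<and>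
      (\<integral>\<^sup>+ z. ennreal (Fb (s, z) * (\<Sum>i\<in>I. (z i - R0 (s, z) i)\<^sup>2) / 2) \<partial>normal_PiM I) \<le> (\<integral>\<^sup>+ z. ennreal (kent (Fb (s, z)) a) \<partial>normal_PiM I)"
    using insert.IH[OF Fbm Fb0] by blast
  define R where "R = (\<lambda>p. (R0 (fst p, restrict (snd p) I))(i := r ((fst p, restrict (snd p) I), snd p i)))"
  have resm: "(\<lambda>p. (fst p, restrict (snd p) I)) \<in> measurable (M \<Otimes>\<^sub>M normal_PiM (insert i I)) ?MI"
    by (intro measurable_Pair measurable_fst measurable_compose[OF measurable_snd] measurable_restrict_subset) auto
  have Rm: "R \<in> measurable (M \<Otimes>\<^sub>M normal_PiM (insert i I)) (normal_PiM (insert i I))"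
    unfolding R_def
  proof (rule measurable_fun_upd[where J = I])
    show "(\<lambda>p. R0 (fst p, restrict (snd p) I)) \<in> measurable (M \<Otimes>\<^sub>M normal_PiM (insert i I)) (normal_PiM I)"
      by (rule measurable_compose[OF resm R0m])
    have "(\<lambda>p. snd p i) \<in> borel_measurable (M \<Otimes>\<^sub>M normal_PiM (insert i I))"
      using measurable_compose[OF measurable_snd measurable_component_singleton[of i "insert i I" "\<lambda>_. std_normal"], of M] by simp
    then have "(\<lambda>p. ((fst p, restrict (snd p) I), snd p i)) \<in> measurable (M \<Otimes>\<^sub>M normal_PiM (insert i I)) (?MI \<Otimes>\<^sub>M borel)"
      using resm by (intro measurable_Pair) auto
    from measurable_compose[OF this rm]
    show "(\<lambda>p. r ((fst p, restrict (snd p) I), snd p i)) \<in> measurable (M \<Otimes>\<^sub>M normal_PiM (insert i I)) std_normal" by simp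
  qed auto
  show ?case
  proof (intro bexI[OF _ Rm] ballI allI impI)
    fix s and a :: real assume s: "s \<in> space M" and a: "a > 0"
      and Fa: "(\<integral>\<^sup>+ z. ennreal (F (s, z)) \<partial>normal_PiM (insert i I)) = ennreal a"
    have ins: "(\<integral>\<^sup>+ z. g z \<partial>normal_PiM (insert i I)) = (\<integral>\<^sup>+ x. \<integral>\<^sup>+ t. g (x(i := t)) \<partial>?N \<partial>normal_PiM I)"
      if "g \<in> borel_measurable (normal_PiM (insert i I))" for g :: "('i \<Rightarrow> real) \<Rightarrow> ennreal"
      by (rule normal_PiM.product_nn_integral_insert[OF fin iI that])
    have Pm: "(\<lambda>z. (s, z)) \<in> measurable (normal_PiM J) (M \<Otimes>\<^sub>M normal_PiM J)" for J :: "'i set"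
      using s by measurable
    have Fsm[measurable]: "(\<lambda>z. F (s, z)) \<in> borel_measurable (normal_PiM (insert i I))"
      by (rule measurable_compose[OF Pm Fm])
    have Rsm[measurable]: "(\<lambda>z. R (s, z)) \<in> measurable (normal_PiM (insert i I)) (normal_PiM (insert i I))"
      by (rule measurable_compose[OF Pm Rm])
    have Fbsm[measurable]: "(\<lambda>z. Fb (s, z)) \<in> borel_measurable (normal_PiM I)"
      by (rule measurable_compose[OF Pm Fbm])
    have R0sm[measurable]: "(\<lambda>z. R0 (s, z)) \<in> measurable (normal_PiM I) (normal_PiM I)"
      by (rule measurable_compose[OF Pm R0m])
    have Tm: "(\<lambda>q. ((s, fst q), snd q)) \<in> measurable (normal_PiM I \<Otimes>\<^sub>M borel) (?MI \<Otimes>\<^sub>M borel)"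
      by (intro measurable_Pair measurable_const s measurable_fst measurable_snd)
    have F1s[measurable]: "(\<lambda>q. F1 ((s, fst q), snd q)) \<in> borel_measurable (normal_PiM I \<Otimes>\<^sub>M borel)"
      by (rule measurable_compose[OF Tm F1m])
    have rs[measurable]: "(\<lambda>q. r ((s, fst q), snd q)) \<in> borel_measurable (normal_PiM I \<Otimes>\<^sub>M borel)"
      by (rule measurable_compose[OF Tm rm])
    have F1x: "(\<lambda>t. F1 ((s, x), t)) \<in> borel_measurable borel" if "x \<in> space (normal_PiM I)" for x
      using measurable_compose[OF measurable_Pair1'[OF that, of borel] F1s] by simp
    have rx: "(\<lambda>t. r ((s, x), t)) \<in> borel_measurable borel" if "x \<in> space (normal_PiM I)" for x
      using measurable_compose[OF measurable_Pair1'[OF that, of borel] rs] by simp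
    have F1F: "F1 ((s, x), t) = F (s, x(i := t))" for x t by (simp add: F1_def)
    have F10: "F1 p \<ge> 0" for p by (simp add: F1_def F0)
    have Rx: "R (s, x(i := t)) = (R0 (s, x))(i := r ((s, x), t))" if "x \<in> space (normal_PiM I)" for x t
    proof -
      have "restrict (x(i := t)) I = x"
        using that iI by (auto simp: space_PiM PiE_iff extensional_def fun_eq_iff restrict_def)
      then show ?thesis by (simp add: R_def)
    qed
    have bm: "(\<lambda>x. \<integral>\<^sup>+ t. ennreal (F1 ((s, x), t)) \<partial>?N) \<in> borel_measurable (normal_PiM I)"
      by measurable
    have Fa1: "(\<integral>\<^sup>+ x. \<integral>\<^sup>+ t. ennreal (F1 ((s, x), t)) \<partial>?N \<partial>normal_PiM I) = ennreal a"
      using Fa by (subst (asm) ins) (auto simp: F1F)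
    from Fa1 have fin_ae: "AE x in normal_PiM I. (\<integral>\<^sup>+ t. ennreal (F1 ((s, x), t)) \<partial>?N) < \<infinity>"
      using nn_integral_PInf_AE[OF bm] by (auto simp: top.not_eq_extremum)
    note L = line_transport[OF F1x F10]
    have rdef: "r ((s, x), t) = Phinv ((\<integral>y. F1 ((s, x), y) * indicator {..t} y \<partial>?N) / (\<integral>t. F1 ((s, x), t) \<partial>?N))" for x t
      by (auto simp: r_def Fb_def indicator_def intro!: arg_cong[where f = Phinv] arg_cong2[where f = "(/)"] Bochner_Integration.integral_cong)
    have ae_sp: "AE x in normal_PiM I. x \<in> space (normal_PiM I)" by simp
    have "(\<integral>\<^sup>+ x. ennreal (Fb (s, x)) \<partial>normal_PiM I) = (\<integral>\<^sup>+ x. \<integral>\<^sup>+ t. ennreal (F1 ((s, x), t)) \<partial>?N \<partial>normal_PiM I)"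
      by (rule nn_integral_cong_AE, use fin_ae ae_sp in eventually_elim) (simp add: Fb_def L(1))
    then have Fba: "(\<integral>\<^sup>+ x. ennreal (Fb (s, x)) \<partial>normal_PiM I) = ennreal a" using Fa1 by simp
    note R0s = R0[OF s a Fba]
    show "(\<forall>h\<in>borel_measurable (normal_PiM (insert i I)). (\<integral>\<^sup>+ z. ennreal (F (s, z)) * h (R (s, z)) \<partial>normal_PiM (insert i I)) = ennreal a * (\<integral>\<^sup>+ z. h z \<partial>normal_PiM (insert i I))) \<and>
      (\<integral>\<^sup>+ z. ennreal (F (s, z) * (\<Sum>j\<in>insert i I. (z j - R (s, z) j)\<^sup>2) / 2) \<partial>normal_PiM (insert i I)) \<le> (\<integral>\<^sup>+ z. ennreal (kent (F (s, z)) a) \<partial>normal_PiM (insert i I))"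
    proof (intro conjI ballI)
      fix h :: "('i \<Rightarrow> real) \<Rightarrow> ennreal" assume h[measurable]: "h \<in> borel_measurable (normal_PiM (insert i I))"
      have updm: "(\<lambda>q. (fst q)(i := snd q)) \<in> measurable (normal_PiM I \<Otimes>\<^sub>M borel) (normal_PiM (insert i I))"
        by (rule measurable_fun_upd[where J = I]) (auto simp: iI)
      have h2[measurable]: "(\<lambda>q. h ((fst q)(i := snd q))) \<in> borel_measurable (normal_PiM I \<Otimes>\<^sub>M borel)"
        by (rule measurable_compose[OF updm h])
      define h' where "h' = (\<lambda>x. \<integral>\<^sup>+ t. h (x(i := t)) \<partial>?N)"
      have h'm: "h' \<in> borel_measurable (normal_PiM I)" unfolding h'_def using h2 by measurable
      have hx: "(\<lambda>t. h (x(i := t))) \<in> borel_measurable borel" if "x \<in> space (normal_PiM I)" for x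
        using measurable_compose[OF measurable_Pair1'[OF that, of borel] h2] by simp
      have "(\<integral>\<^sup>+ z. ennreal (F (s, z)) * h (R (s, z)) \<partial>normal_PiM (insert i I))
        = (\<integral>\<^sup>+ x. \<integral>\<^sup>+ t. ennreal (F (s, x(i := t))) * h (R (s, x(i := t))) \<partial>?N \<partial>normal_PiM I)"
        by (rule ins) measurable
      also have "\<dots> = (\<integral>\<^sup>+ x. ennreal (Fb (s, x)) * h' (R0 (s, x)) \<partial>normal_PiM I)"
      proof (rule nn_integral_cong_AE, use fin_ae ae_sp in eventually_elim)
        case (elim x)
        have R0x: "R0 (s, x) \<in> space (normal_PiM I)" using measurable_space[OF R0sm elim(2)] .
        have "(\<integral>\<^sup>+ t. ennreal (F (s, x(i := t))) * h (R (s, x(i := t))) \<partial>?N) = (\<integral>\<^sup>+ t. ennreal (F1 ((s, x), t)) * h ((R0 (s, x))(i := r ((s, x), t))) \<partial>?N)"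
          by (simp add: F1F Rx[OF elim(2)])
        also have "\<dots> = ennreal (Fb (s, x)) * (\<integral>\<^sup>+ t. h ((R0 (s, x))(i := t)) \<partial>?N)"
          unfolding rdef Fb_def by (rule L(3)[OF elim(2) elim(1) hx[OF R0x]])
        finally show ?case by (simp add: h'_def)
      qed
      also have "\<dots> = ennreal a * (\<integral>\<^sup>+ x. h' x \<partial>normal_PiM I)" using R0s h'm by blast
      also have "(\<integral>\<^sup>+ x. h' x \<partial>normal_PiM I) = (\<integral>\<^sup>+ z. h z \<partial>normal_PiM (insert i I))"
        unfolding h'_def by (rule ins[symmetric]) measurable
      finally show "(\<integral>\<^sup>+ z. ennreal (F (s, z)) * h (R (s, z)) \<partial>normal_PiM (insert i I)) = ennreal a * (\<integral>\<^sup>+ z. h z \<partial>normal_PiM (insert i I))" .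
    next
      define c where "c = (\<lambda>x. \<Sum>j\<in>I. (x j - R0 (s, x) j)\<^sup>2)"
      have cm[measurable]: "c \<in> borel_measurable (normal_PiM I)"
      proof -
        have "(\<lambda>x. R0 (s, x) j) \<in> borel_measurable (normal_PiM I)" if "j \<in> I" for j
          using measurable_compose[OF R0sm measurable_component_singleton[OF that]] by simp
        then show ?thesis unfolding c_def
          by (intro borel_measurable_sum borel_measurable_power borel_measurable_diff)
            (use measurable_component_singleton[of _ I "\<lambda>_. std_normal"] in auto)
      qed
      have c0: "c x \<ge> 0" for x by (simp add: c_def sum_nonneg)
      have Fcm: "(\<lambda>z. ennreal (F (s, z) * (\<Sum>j\<in>insert i I. (z j - R (s, z) j)\<^sup>2) / 2)) \<in> borel_measurable (normal_PiM (insert i I))"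
      proof -
        have rj: "(\<lambda>z. R (s, z) j) \<in> borel_measurable (normal_PiM (insert i I))" if "j \<in> insert i I" for j
          using measurable_compose[OF Rsm measurable_component_singleton[OF that]] by simp
        have zj: "(\<lambda>z. z j) \<in> borel_measurable (normal_PiM (insert i I))" if "j \<in> insert i I" for j
          using measurable_component_singleton[OF that, of "\<lambda>_. std_normal"] by simp
        have "(\<lambda>z. \<Sum>j\<in>insert i I. (z j - R (s, z) j)\<^sup>2) \<in> borel_measurable (normal_PiM (insert i I))"
          by (intro borel_measurable_sum borel_measurable_power borel_measurable_diff rj zj)
        then show ?thesis by measurable
      qed
      have "(\<integral>\<^sup>+ z. ennreal (F (s, z) * (\<Sum>j\<in>insert i I. (z j - R (s, z) j)\<^sup>2) / 2) \<partial>normal_PiM (insert i I))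
        = (\<integral>\<^sup>+ x. \<integral>\<^sup>+ t. ennreal (F (s, x(i := t)) * (\<Sum>j\<in>insert i I. ((x(i := t)) j - R (s, x(i := t)) j)\<^sup>2) / 2) \<partial>?N \<partial>normal_PiM I)"
        by (rule ins[OF Fcm])
      also have "\<dots> = (\<integral>\<^sup>+ x. (\<integral>\<^sup>+ t. ennreal (F1 ((s, x), t) * (t - r ((s, x), t))\<^sup>2 / 2) \<partial>?N) + ennreal (Fb (s, x) * c x / 2) \<partial>normal_PiM I)"
      proof (rule nn_integral_cong_AE, use fin_ae ae_sp in eventually_elim)
        case (elim x)
        note [measurable] = F1x[OF elim(2)] rx[OF elim(2)]
        have sm: "(\<Sum>j\<in>insert i I. ((x(i := t)) j - R (s, x(i := t)) j)\<^sup>2) = (t - r ((s, x), t))\<^sup>2 + c x" for t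
        proof -
          have "(\<Sum>j\<in>I. ((x(i := t)) j - R (s, x(i := t)) j)\<^sup>2) = c x"
            unfolding c_def Rx[OF elim(2)] using iI by (intro sum.cong) auto
          then show ?thesis using fin iI by (simp add: Rx[OF elim(2)])
        qed
        have "(\<integral>\<^sup>+ t. ennreal (F (s, x(i := t)) * (\<Sum>j\<in>insert i I. ((x(i := t)) j - R (s, x(i := t)) j)\<^sup>2) / 2) \<partial>?N)
          = (\<integral>\<^sup>+ t. ennreal (F1 ((s, x), t) * (t - r ((s, x), t))\<^sup>2 / 2) + ennreal (F1 ((s, x), t)) * ennreal (c x / 2) \<partial>?N)"
        proof (rule nn_integral_cong)
          fix t
          have "F (s, x(i := t)) * ((t - r ((s, x), t))\<^sup>2 + c x) / 2 = F1 ((s, x), t) * (t - r ((s, x), t))\<^sup>2 / 2 + F1 ((s, x), t) * (c x / 2)"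
            by (simp add: F1F algebra_simps add_divide_distrib)
          then show "ennreal (F (s, x(i := t)) * (\<Sum>j\<in>insert i I. ((x(i := t)) j - R (s, x(i := t)) j)\<^sup>2) / 2)
            = ennreal (F1 ((s, x), t) * (t - r ((s, x), t))\<^sup>2 / 2) + ennreal (F1 ((s, x), t)) * ennreal (c x / 2)"
            unfolding sm using F10[of "((s, x), t)"] c0[of x] by (simp add: ennreal_plus[symmetric] ennreal_mult[symmetric] del: ennreal_plus)
        qed
        also have "\<dots> = (\<integral>\<^sup>+ t. ennreal (F1 ((s, x), t) * (t - r ((s, x), t))\<^sup>2 / 2) \<partial>?N) + (\<integral>\<^sup>+ t. ennreal (F1 ((s, x), t)) \<partial>?N) * ennreal (c x / 2)"
          by (subst nn_integral_add) (auto simp: nn_integral_multc)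
        also have "(\<integral>\<^sup>+ t. ennreal (F1 ((s, x), t)) \<partial>?N) * ennreal (c x / 2) = ennreal (Fb (s, x) * c x / 2)"
        proof -
          have e: "(\<integral>\<^sup>+ t. ennreal (F1 ((s, x), t)) \<partial>?N) = ennreal (Fb (s, x))"
            using L(1)[OF elim(2) elim(1)] by (simp add: Fb_def)
          show ?thesis unfolding e using Fb0[of "(s, x)"] c0[of x] by (simp add: ennreal_mult[symmetric])
        qed
        finally show ?case .
      qed
      also have "\<dots> = (\<integral>\<^sup>+ x. (\<integral>\<^sup>+ t. ennreal (F1 ((s, x), t) * (t - r ((s, x), t))\<^sup>2 / 2) \<partial>?N) \<partial>normal_PiM I) + (\<integral>\<^sup>+ x. ennreal (Fb (s, x) * c x / 2) \<partial>normal_PiM I)"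
        by (rule nn_integral_add) measurable
      \<comment> \<open>The induction hypothesis bounds the cost of the old coordinates by the
        divergence of the marginal, which the one-dimensional estimate then absorbs fibre by
        fibre.\<close>
      also have "\<dots> \<le> (\<integral>\<^sup>+ x. (\<integral>\<^sup>+ t. ennreal (F1 ((s, x), t) * (t - r ((s, x), t))\<^sup>2 / 2) \<partial>?N) \<partial>normal_PiM I) + (\<integral>\<^sup>+ x. ennreal (kent (Fb (s, x)) a) \<partial>normal_PiM I)"
        using R0s unfolding c_def by (intro add_left_mono) blast
      also have "\<dots> = (\<integral>\<^sup>+ x. (\<integral>\<^sup>+ t. ennreal (F1 ((s, x), t) * (t - r ((s, x), t))\<^sup>2 / 2) \<partial>?N) + ennreal (kent (Fb (s, x)) a) \<partial>normal_PiM I)"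
        by (rule nn_integral_add[symmetric]) measurable
      also have "\<dots> \<le> (\<integral>\<^sup>+ x. \<integral>\<^sup>+ t. ennreal (kent (F1 ((s, x), t)) a) \<partial>?N \<partial>normal_PiM I)"
      proof (rule nn_integral_mono_AE, use fin_ae ae_sp in eventually_elim)
        case (elim x)
        show ?case unfolding rdef Fb_def by (rule L(4)[OF elim(2) elim(1) a])
      qed
      also have "\<dots> = (\<integral>\<^sup>+ z. ennreal (kent (F (s, z)) a) \<partial>normal_PiM (insert i I))"
        unfolding F1F by (rule ins[symmetric]) measurable
      finally show "(\<integral>\<^sup>+ z. ennreal (F (s, z) * (\<Sum>j\<in>insert i I. (z j - R (s, z) j)\<^sup>2) / 2) \<partial>normal_PiM (insert i I)) \<le> (\<integral>\<^sup>+ z. ennreal (kent (F (s, z)) a) \<partial>normal_PiM (insert i I))" .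
    qed
  qed
qed

text \<open>The coordinate map and its inverse carry the triangular transport to the Euclidean
  space; the sum of squared coordinate differences becomes the squared norm.\<close>

lemma transport_gaussian:
  fixes M :: "'s measure" and F :: "'s \<times> 'a::euclidean_space \<Rightarrow> real"
  assumes Fm[measurable]: "F \<in> borel_measurable (M \<Otimes>\<^sub>M borel)" and F0: "\<And>p. F p \<ge> 0"
  obtains R where "R \<in> measurable (M \<Otimes>\<^sub>M borel) borel"
    "\<And>s a h. s \<in> space M \<Longrightarrow> a > 0 \<Longrightarrow> (\<integral>\<^sup>+ z. ennreal (F (s, z)) \<partial>gaussian) = ennreal a \<Longrightarrow> h \<in> borel_measurable borel \<Longrightarrow>
      (\<integral>\<^sup>+ z. ennreal (F (s, z)) * h (R (s, z)) \<partial>gaussian) = ennreal a * (\<integral>\<^sup>+ z. h z \<partial>gaussian)"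
    "\<And>s a. s \<in> space M \<Longrightarrow> a > 0 \<Longrightarrow> (\<integral>\<^sup>+ z. ennreal (F (s, z)) \<partial>gaussian) = ennreal a \<Longrightarrow>
      (\<integral>\<^sup>+ z. ennreal (F (s, z) * (norm (z - R (s, z)))\<^sup>2 / 2) \<partial>gaussian) \<le> (\<integral>\<^sup>+ z. ennreal (kent (F (s, z)) a) \<partial>gaussian)"
proof -
  let ?P = "normal_PiM (Basis :: 'a set)"
  define T where "T = (\<lambda>f::'a \<Rightarrow> real. \<Sum>b\<in>Basis. f b *\<^sub>R b)"
  define U where "U = (\<lambda>z::'a. \<lambda>b\<in>Basis. z \<bullet> b)"
  have Tm[measurable]: "T \<in> borel_measurable ?P"
  proof -
    have "(\<lambda>f. f b) \<in> borel_measurable ?P" if "b \<in> Basis" for b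
      using measurable_component_singleton[OF that, of "\<lambda>_. std_normal"] by simp
    then show ?thesis unfolding T_def by (intro borel_measurable_sum borel_measurable_scaleR) auto
  qed
  have Um[measurable]: "U \<in> measurable borel ?P" unfolding U_def by (rule measurable_restrict) simp
  have UT: "U (T f) = f" if "f \<in> space ?P" for f
  proof
    fix b
    show "U (T f) b = f b" using that
      by (auto simp: U_def T_def space_PiM PiE_iff extensional_def inner_sum_left inner_Basis if_distrib sum.delta cong: if_cong)
  qed
  have g: "(\<integral>\<^sup>+ z. k z \<partial>gaussian) = (\<integral>\<^sup>+ f. k (T f) \<partial>?P)" if "k \<in> borel_measurable borel" for k
    unfolding gaussian_eq_distr_PiM T_def[symmetric] using that by (subst nn_integral_distr) auto
  define F' where "F' = (\<lambda>p. F (fst p, T (snd p)))"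
  have F'm: "F' \<in> borel_measurable (M \<Otimes>\<^sub>M ?P)"
  proof -
    have "(\<lambda>p. (fst p, T (snd p))) \<in> measurable (M \<Otimes>\<^sub>M ?P) (M \<Otimes>\<^sub>M borel)"
      by (intro measurable_Pair measurable_fst measurable_compose[OF measurable_snd Tm])
    from measurable_compose[OF this Fm] show ?thesis by (simp add: F'_def)
  qed
  have F'0: "F' p \<ge> 0" for p by (simp add: F'_def F0)
  obtain R' where R'm: "R' \<in> measurable (M \<Otimes>\<^sub>M ?P) ?P" and
    R': "\<And>s a. s \<in> space M \<Longrightarrow> a > 0 \<Longrightarrow> (\<integral>\<^sup>+ z. ennreal (F' (s, z)) \<partial>?P) = ennreal a \<Longrightarrow>
      (\<forall>h\<in>borel_measurable ?P. (\<integral>\<^sup>+ z. ennreal (F' (s, z)) * h (R' (s, z)) \<partial>?P) = ennreal a * (\<integral>\<^sup>+ z. h z \<partial>?P)) \<and>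
      (\<integral>\<^sup>+ z. ennreal (F' (s, z) * (\<Sum>i\<in>Basis. (z i - R' (s, z) i)\<^sup>2) / 2) \<partial>?P) \<le> (\<integral>\<^sup>+ z. ennreal (kent (F' (s, z)) a) \<partial>?P)"
    using transport_PiM[OF finite_Basis F'm F'0] by blast
  define R where "R = (\<lambda>p. T (R' (fst p, U (snd p))))"
  have Rm: "R \<in> measurable (M \<Otimes>\<^sub>M borel) borel"
  proof -
    have "(\<lambda>p. (fst p, U (snd p))) \<in> measurable (M \<Otimes>\<^sub>M borel) (M \<Otimes>\<^sub>M ?P)"
      by (intro measurable_Pair measurable_fst measurable_compose[OF measurable_snd Um])
    from measurable_compose[OF measurable_compose[OF this R'm] Tm] show ?thesis by (simp add: R_def)
  qed
  have RT: "R (s, T f) = T (R' (s, f))" if "f \<in> space ?P" for s f by (simp add: R_def UT[OF that])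
  have Fs[measurable]: "(\<lambda>z. F (s, z)) \<in> borel_measurable borel" if "s \<in> space M" for s
    using measurable_compose[OF measurable_Pair1'[OF that, of borel] Fm] by simp
  have Rs[measurable]: "(\<lambda>z. R (s, z)) \<in> borel_measurable borel" if "s \<in> space M" for s
    using measurable_compose[OF measurable_Pair1'[OF that, of borel] Rm] by simp
  have nT: "(norm (T f - T k))\<^sup>2 = (\<Sum>i\<in>Basis. (f i - k i)\<^sup>2)" for f k
  proof -
    have "T f - T k = (\<Sum>b\<in>Basis. (f b - k b) *\<^sub>R b)" by (simp add: T_def sum_subtractf algebra_simps)
    then show ?thesis by (simp only:) (subst power2_norm_eq_inner, subst euclidean_inner, simp add: power2_eq_square)
  qed
  show ?thesis
  proof (rule that[OF Rm])
    fix s and a :: real and h :: "'a \<Rightarrow> ennreal"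
    assume s: "s \<in> space M" and a: "a > 0" and Fa: "(\<integral>\<^sup>+ z. ennreal (F (s, z)) \<partial>gaussian) = ennreal a" and h[measurable]: "h \<in> borel_measurable borel"
    note [measurable] = Fs[OF s] Rs[OF s]
    have Fa': "(\<integral>\<^sup>+ z. ennreal (F' (s, z)) \<partial>?P) = ennreal a" using Fa by (subst (asm) g) (auto simp: F'_def)
    have "(\<integral>\<^sup>+ z. ennreal (F (s, z)) * h (R (s, z)) \<partial>gaussian) = (\<integral>\<^sup>+ f. ennreal (F (s, T f)) * h (R (s, T f)) \<partial>?P)"
      by (rule g) measurable
    also have "\<dots> = (\<integral>\<^sup>+ f. ennreal (F' (s, f)) * h (T (R' (s, f))) \<partial>?P)"
      by (rule nn_integral_cong) (simp add: RT F'_def)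
    also have "\<dots> = ennreal a * (\<integral>\<^sup>+ f. h (T f) \<partial>?P)"
      using R'[OF s a Fa'] measurable_compose[OF Tm h] by (auto dest!: bspec[where x = "\<lambda>f. h (T f)"])
    also have "(\<integral>\<^sup>+ f. h (T f) \<partial>?P) = (\<integral>\<^sup>+ z. h z \<partial>gaussian)" by (rule g[symmetric]) measurable
    finally show "(\<integral>\<^sup>+ z. ennreal (F (s, z)) * h (R (s, z)) \<partial>gaussian) = ennreal a * (\<integral>\<^sup>+ z. h z \<partial>gaussian)" .
  next
    fix s and a :: real
    assume s: "s \<in> space M" and a: "a > 0" and Fa: "(\<integral>\<^sup>+ z. ennreal (F (s, z)) \<partial>gaussian) = ennreal a"
    note [measurable] = Fs[OF s] Rs[OF s]
    have Fa': "(\<integral>\<^sup>+ z. ennreal (F' (s, z)) \<partial>?P) = ennreal a" using Fa by (subst (asm) g) (auto simp: F'_def)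
    have "(\<integral>\<^sup>+ z. ennreal (F (s, z) * (norm (z - R (s, z)))\<^sup>2 / 2) \<partial>gaussian) = (\<integral>\<^sup>+ f. ennreal (F (s, T f) * (norm (T f - R (s, T f)))\<^sup>2 / 2) \<partial>?P)"
      by (rule g) measurable
    also have "\<dots> = (\<integral>\<^sup>+ f. ennreal (F' (s, f) * (\<Sum>i\<in>Basis. (f i - R' (s, f) i)\<^sup>2) / 2) \<partial>?P)"
      by (rule nn_integral_cong) (simp add: RT F'_def nT)
    also have "\<dots> \<le> (\<integral>\<^sup>+ f. ennreal (kent (F' (s, f)) a) \<partial>?P)" using R'[OF s a Fa'] by blast
    also have "\<dots> = (\<integral>\<^sup>+ z. ennreal (kent (F (s, z)) a) \<partial>gaussian)"
      unfolding F'_def fst_conv snd_conv by (rule g[symmetric]) measurable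
    finally show "(\<integral>\<^sup>+ z. ennreal (F (s, z) * (norm (z - R (s, z)))\<^sup>2 / 2) \<partial>gaussian) \<le> (\<integral>\<^sup>+ z. ennreal (kent (F (s, z)) a) \<partial>gaussian)" .
  qed
qed

subsection \<open>Weak gradients under affine maps and Gaussian averaging\<close>

lemma ctest_affine:
  fixes \<phi> :: "'a::euclidean_space \<Rightarrow> real"
  assumes c: "ctest \<phi> G R" and k: "k \<noteq> 0"
  shows "ctest (\<lambda>y. \<phi> (a + k *\<^sub>R y)) (\<lambda>y. k *\<^sub>R G (a + k *\<^sub>R y)) ((R + norm a) / \<bar>k\<bar>)"
proof (rule ctestI)
  show "((\<lambda>y. \<phi> (a + k *\<^sub>R y)) has_derivative (\<lambda>v. (k *\<^sub>R G (a + k *\<^sub>R y)) \<bullet> v)) (at y)" for y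
    by (rule has_derivative_eq_rhs[OF has_derivative_compose[OF _ ctestD(1)[OF c]]]) (auto intro!: derivative_eq_intros)
  show "continuous_on UNIV (\<lambda>y. k *\<^sub>R G (a + k *\<^sub>R y))"
    by (intro continuous_intros continuous_on_compose2[OF ctestD(2)[OF c]]) auto
  fix y :: 'a assume "norm y > (R + norm a) / \<bar>k\<bar>"
  then have "norm (k *\<^sub>R y) > R + norm a" using k by (simp add: field_simps)
  then have "norm (a + k *\<^sub>R y) > R" using norm_triangle_ineq2[of "k *\<^sub>R y" "- a"] by (simp add: add.commute)
  then show "\<phi> (a + k *\<^sub>R y) = 0" by (rule ctestD(3)[OF c])
qed

lemma locally_integrable_affine:
  fixes f :: "'a::euclidean_space \<Rightarrow> 'b::euclidean_space"
  assumes f: "locally_integrable f" and c: "c > 0"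
  shows "locally_integrable (\<lambda>z. f (a + c *\<^sub>R z))"
  unfolding locally_integrable_def
proof (intro conjI allI)
  have [measurable]: "f \<in> borel_measurable borel" using f by (simp add: locally_integrable_def)
  show "(\<lambda>z. f (a + c *\<^sub>R z)) \<in> borel_measurable borel" by measurable
  fix r
  let ?k = "\<lambda>y. indicator (cball 0 r) ((1 / c) *\<^sub>R (y - a)) :: real"
  have "integrable lborel (\<lambda>y. ?k y *\<^sub>R f y)"
  proof (rule locally_integrable_mult[OF f, of _ 1 "norm a + c * r"])
    show "?k y = 0" if "norm y > norm a + c * r" for y
    proof -
      have "norm (y - a) > c * r" using that norm_triangle_ineq2[of y a] by simp
      moreover have "norm ((1 / c) *\<^sub>R (y - a)) = norm (y - a) / c" using c by (simp only: norm_scaleR) simp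
      ultimately have "norm ((1 / c) *\<^sub>R (y - a)) > r" using c by (simp only: pos_less_divide_eq mult.commute)
      then show ?thesis by (simp add: indicator_def)
    qed
  qed auto
  then have "integrable lborel (\<lambda>z. ?k (a + c *\<^sub>R z) *\<^sub>R f (a + c *\<^sub>R z))"
    by (subst (asm) integral_lborel_affine(2)[OF _ c, of _ a]) auto
  then show "integrable lborel (\<lambda>z. indicator (cball 0 r) z *\<^sub>R f (a + c *\<^sub>R z))" using c by simp
qed

lemma locally_integrable_scaleR:
  fixes f :: "'a::euclidean_space \<Rightarrow> 'b::euclidean_space"
  assumes "locally_integrable f"
  shows "locally_integrable (\<lambda>z. c *\<^sub>R f z)"
  unfolding locally_integrable_def
proof (intro conjI allI)
  show "(\<lambda>z. c *\<^sub>R f z) \<in> borel_measurable borel" using assms by (auto simp: locally_integrable_def)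
  fix r
  have "integrable lborel (\<lambda>x. c *\<^sub>R (indicator (cball 0 r) x *\<^sub>R f x))"
    using assms unfolding locally_integrable_def by (intro integrable_scaleR_right) blast
  then show "integrable lborel (\<lambda>x. indicator (cball 0 r) x *\<^sub>R c *\<^sub>R f x)" by (simp add: mult.commute)
qed

text \<open>The test function is pulled back by the inverse affine map and the integrals are
  transformed by scaling. It is used on the fibres \<open>z \<mapsto> c x + s z\<close> of the
  mixture.\<close>

lemma weak_gradient_affine:
  fixes f :: "'a::euclidean_space \<Rightarrow> real"
  assumes wg: "weak_gradient f g" and c: "c > 0"
  shows "weak_gradient (\<lambda>z. f (a + c *\<^sub>R z)) (\<lambda>z. c *\<^sub>R g (a + c *\<^sub>R z))"
proof (rule weak_gradientI)
  note lf = weak_gradientD(1)[OF wg] and lg = weak_gradientD(2)[OF wg]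
  show "locally_integrable (\<lambda>z. f (a + c *\<^sub>R z))" by (rule locally_integrable_affine[OF lf c])
  show "locally_integrable (\<lambda>z. c *\<^sub>R g (a + c *\<^sub>R z))" by (rule locally_integrable_scaleR[OF locally_integrable_affine[OF lg c]])
  have [measurable]: "f \<in> borel_measurable borel" "g \<in> borel_measurable borel" using lf lg by (auto simp: locally_integrable_def)
  fix \<phi> :: "'a \<Rightarrow> real" and G R b assume ct: "ctest \<phi> G R"
  note [measurable] = ctest_measurable[OF ct]
  let ?i = "\<lambda>y. - ((1 / c) *\<^sub>R a) + (1 / c) *\<^sub>R y"
  have ci: "1 / c \<noteq> 0" using c by simp
  note ct' = ctest_affine[OF ct ci, of "- ((1 / c) *\<^sub>R a)"]
  have inv: "?i (a + c *\<^sub>R z) = z" for z using c by (simp add: scaleR_add_right)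
  have "(\<integral>y. f y * (((1 / c) *\<^sub>R G (?i y)) \<bullet> b) \<partial>lborel) = - (\<integral>y. (g y \<bullet> b) * \<phi> (?i y) \<partial>lborel)"
    by (rule weak_gradientD(3)[OF wg ct'])
  also have "(\<integral>y. f y * (((1 / c) *\<^sub>R G (?i y)) \<bullet> b) \<partial>lborel) = (c ^ DIM('a)) *\<^sub>R (\<integral>z. f (a + c *\<^sub>R z) * (((1 / c) *\<^sub>R G z) \<bullet> b) \<partial>lborel)"
    by (subst integral_lborel_affine(1)[OF _ c, of _ a]) (simp_all only: inv, measurable)
  also have "(\<integral>y. (g y \<bullet> b) * \<phi> (?i y) \<partial>lborel) = (c ^ DIM('a)) *\<^sub>R (\<integral>z. (g (a + c *\<^sub>R z) \<bullet> b) * \<phi> z \<partial>lborel)"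
    by (subst integral_lborel_affine(1)[OF _ c, of _ a]) (simp_all only: inv, measurable)
  finally have "c ^ DIM('a) * (\<integral>z. f (a + c *\<^sub>R z) * (((1 / c) *\<^sub>R G z) \<bullet> b) \<partial>lborel) = c ^ DIM('a) * - (\<integral>z. (g (a + c *\<^sub>R z) \<bullet> b) * \<phi> z \<partial>lborel)"
    by (simp only: real_scaleR_def mult_minus_right)
  then have "(\<integral>z. f (a + c *\<^sub>R z) * (((1 / c) *\<^sub>R G z) \<bullet> b) \<partial>lborel) = - (\<integral>z. (g (a + c *\<^sub>R z) \<bullet> b) * \<phi> z \<partial>lborel)"
    by (rule mult_left_cancel[THEN iffD1, rotated]) (use c in simp)
  moreover have "(\<integral>z. f (a + c *\<^sub>R z) * (((1 / c) *\<^sub>R G z) \<bullet> b) \<partial>lborel) = (1 / c) * (\<integral>z. f (a + c *\<^sub>R z) * (G z \<bullet> b) \<partial>lborel)"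
    by (subst integral_mult_right_zero[symmetric]) (simp add: ac_simps)
  moreover have "(\<integral>z. ((c *\<^sub>R g (a + c *\<^sub>R z)) \<bullet> b) * \<phi> z \<partial>lborel) = c * (\<integral>z. (g (a + c *\<^sub>R z) \<bullet> b) * \<phi> z \<partial>lborel)"
    by (subst integral_mult_right_zero[symmetric]) (simp add: ac_simps)
  ultimately show "(\<integral>z. f (a + c *\<^sub>R z) * (G z \<bullet> b) \<partial>lborel) = - (\<integral>z. ((c *\<^sub>R g (a + c *\<^sub>R z)) \<bullet> b) * \<phi> z \<partial>lborel)"
    using c by (simp add: field_simps)
qed

lemma gauss_density_deriv:
  "((gauss_density :: 'a::euclidean_space \<Rightarrow> real) has_derivative (\<lambda>v. - gauss_density x * (x \<bullet> v))) (at x)"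
proof -
  have e: "gauss_density = (gker 1 :: 'a \<Rightarrow> real)" by (simp add: fun_eq_iff gker_def)
  show ?thesis unfolding e by (rule has_derivative_eq_rhs[OF gker_deriv]) (auto simp: e)
qed

lemma integrable_gaussian_locally_integrable:
  fixes f :: "'a::euclidean_space \<Rightarrow> 'b::euclidean_space"
  assumes f: "integrable gaussian f"
  shows "locally_integrable f"
  unfolding locally_integrable_def
proof (intro conjI allI)
  show [measurable]: "f \<in> borel_measurable borel" using borel_measurable_integrable[OF f] by simp
  fix r
  have i: "integrable lborel (\<lambda>x. gauss_density x *\<^sub>R f x)" using f by (subst (asm) integral_gaussian(2)) auto
  define m where "m = (2 * pi) powr (- real DIM('a) / 2) * exp (- r\<^sup>2 / 2)"
  have m: "m > 0" by (simp add: m_def)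
  show "integrable lborel (\<lambda>x. indicator (cball 0 r) x *\<^sub>R f x)"
  proof (rule Bochner_Integration.integrable_bound)
    show "integrable lborel (\<lambda>x. (1 / m) *\<^sub>R (gauss_density x *\<^sub>R f x))" using i by (rule integrable_scaleR_right)
    have "norm (indicator (cball 0 r) x *\<^sub>R f x) \<le> norm ((1 / m) *\<^sub>R (gauss_density x *\<^sub>R f x))" for x
    proof (cases "norm x \<le> r")
      case True
      then have "(norm x)\<^sup>2 \<le> r\<^sup>2" by (intro power_mono) auto
      then have "m \<le> gauss_density x" by (simp add: m_def gauss_density_def)
      then have "1 * norm (f x) \<le> gauss_density x / m * norm (f x)" using m by (intro mult_right_mono) auto
      then show ?thesis using True m by (simp add: indicator_def)
    qed (simp add: indicator_def)
    then show "AE x in lborel. norm (indicator (cball 0 r) x *\<^sub>R f x) \<le> norm ((1 / m) *\<^sub>R (gauss_density x *\<^sub>R f x))" by simp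
  qed measurable
qed

lemma integral_gaussian_gi:
  fixes h :: "'a::euclidean_space \<Rightarrow> real"
  assumes [measurable]: "h \<in> borel_measurable borel"
  shows "(\<integral>x. h x / gauss_density x \<partial>gaussian) = (\<integral>x. h x \<partial>lborel)"
proof -
  have "(\<integral>x. h x / gauss_density x \<partial>gaussian) = (\<integral>x. gauss_density x *\<^sub>R (h x / gauss_density x) \<partial>lborel)"
    by (rule integral_gaussian(1)) measurable
  moreover have "gauss_density x \<noteq> 0" for x :: 'a using gauss_density_pos[of x] by simp
  ultimately show ?thesis by simp
qed

locale gauss_mix =
  fixes f :: "'a::euclidean_space \<Rightarrow> real" and c s :: real
  assumes f_meas [measurable]: "f \<in> borel_measurable borel" and f0: "\<And>x. f x \<ge> 0"
    and f_int: "integrable gaussian f" and f2: "integrable gaussian (\<lambda>x. (norm x)\<^sup>2 * f x)"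
    and c: "c > 0" and s: "s > 0" and cs: "c\<^sup>2 + s\<^sup>2 = 1"
begin

definition K where "K p = f (c *\<^sub>R fst p + s *\<^sub>R snd p)"

lemma K_meas [measurable]: "K \<in> borel_measurable (borel \<Otimes>\<^sub>M borel)" unfolding K_def[abs_def] by measurable

lemma K0: "K p \<ge> 0" by (simp add: K_def f0)

definition ub where "ub x = (\<integral>z. K (x, z) \<partial>gaussian)"
definition Mv where "Mv x = (\<integral>z. K (x, z) *\<^sub>R z \<partial>gaussian)"

lemma ub_meas [measurable]: "ub \<in> borel_measurable borel" unfolding ub_def[abs_def] by measurable
lemma Mv_meas [measurable]: "Mv \<in> borel_measurable borel" unfolding Mv_def[abs_def] by measurable

text \<open>Rotating back gives \<open>z = s y + c y'\<close>, so the weight is at most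
  \<open>2 + (norm y)\<^sup>2 + norm y'\<close>, and the second moment of \<open>f\<close> suffices.
  The weight \<open>1 + norm z\<close> dominates both the mass and the barycentre integrand.\<close>

lemma integrable_K1: "integrable (gaussian \<Otimes>\<^sub>M (gaussian :: 'a measure)) (\<lambda>p. K p * (1 + norm (snd p)))"
proof (rule integrableI_bounded)
  show "(\<lambda>p. K p * (1 + norm (snd p))) \<in> borel_measurable (gaussian \<Otimes>\<^sub>M gaussian)" by measurable
  have inv: "s *\<^sub>R (c *\<^sub>R x + s *\<^sub>R z) + c *\<^sub>R (c *\<^sub>R z - s *\<^sub>R x) = z" for x z :: 'a
  proof -
    have "s *\<^sub>R (c *\<^sub>R x + s *\<^sub>R z) + c *\<^sub>R (c *\<^sub>R z - s *\<^sub>R x) = (c\<^sup>2 + s\<^sup>2) *\<^sub>R z" by (simp add: algebra_simps power2_eq_square)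
    then show ?thesis using cs by simp
  qed
  have "s\<^sup>2 \<le> 1" "c\<^sup>2 \<le> 1" using cs zero_le_power2[of c] zero_le_power2[of s] by linarith+
  then have s1: "s \<le> 1" "c \<le> 1" using s c by (simp_all add: abs_square_le_1)
  have "(\<integral>\<^sup>+ p. ennreal (norm (K p * (1 + norm (snd p)))) \<partial>(gaussian \<Otimes>\<^sub>M gaussian))
    = (\<integral>\<^sup>+ x. \<integral>\<^sup>+ z. ennreal (K (x, z) * (1 + norm z)) \<partial>gaussian \<partial>gaussian)"
    using K0 by (subst gaussian.nn_integral_fst[symmetric]) auto
  also have "\<dots> = (\<integral>\<^sup>+ x. \<integral>\<^sup>+ z. (\<lambda>(y, y'). ennreal (f y * (1 + norm (s *\<^sub>R y + c *\<^sub>R y')))) (c *\<^sub>R x + s *\<^sub>R z, c *\<^sub>R z - s *\<^sub>R x) \<partial>gaussian \<partial>gaussian)"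
    by (simp add: inv K_def)
  also have "\<dots> = (\<integral>\<^sup>+ y. \<integral>\<^sup>+ y'. (\<lambda>(y, y'). ennreal (f y * (1 + norm (s *\<^sub>R y + c *\<^sub>R y')))) (y, y') \<partial>gaussian \<partial>gaussian)"
    by (rule nn_integral_gaussian_rotate[OF _ cs]) (use s in auto)
  also have "\<dots> \<le> (\<integral>\<^sup>+ y. \<integral>\<^sup>+ y'. ennreal (f y * (2 + (norm y)\<^sup>2)) + ennreal (f y) * ennreal (norm y') \<partial>(gaussian :: 'a measure) \<partial>gaussian)"
  proof (intro nn_integral_mono)
    fix y y' :: 'a
    have "norm (s *\<^sub>R y + c *\<^sub>R y') \<le> s * norm y + c * norm y'" using norm_triangle_ineq[of "s *\<^sub>R y" "c *\<^sub>R y'"] s c by simp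
    also have "\<dots> \<le> 1 * norm y + 1 * norm y'" using s1 by (intro add_mono mult_right_mono) auto
    finally have "1 + norm (s *\<^sub>R y + c *\<^sub>R y') \<le> (2 + (norm y)\<^sup>2) + norm y'"
      using le_one_plus_square[of "norm y"] by simp
    then have "f y * (1 + norm (s *\<^sub>R y + c *\<^sub>R y')) \<le> f y * ((2 + (norm y)\<^sup>2) + norm y')" using f0 by (intro mult_left_mono)
    then show "(\<lambda>(y, y'). ennreal (f y * (1 + norm (s *\<^sub>R y + c *\<^sub>R y')))) (y, y') \<le> ennreal (f y * (2 + (norm y)\<^sup>2)) + ennreal (f y) * ennreal (norm y')"
      using f0[of y] by (simp add: ennreal_plus[symmetric] ennreal_mult[symmetric] distrib_left ennreal_leI del: ennreal_plus)
  qed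
  also have "\<dots> = (\<integral>\<^sup>+ y. ennreal (f y * (2 + (norm y)\<^sup>2)) + ennreal (f y) * (\<integral>\<^sup>+ y'. ennreal (norm y') \<partial>(gaussian :: 'a measure)) \<partial>gaussian)"
    by (intro nn_integral_cong) (simp add: nn_integral_add nn_integral_cmult)
  also have "\<dots> = (\<integral>\<^sup>+ y. ennreal (f y * (2 + (norm y)\<^sup>2)) \<partial>gaussian) + (\<integral>\<^sup>+ y. ennreal (f y) \<partial>gaussian) * (\<integral>\<^sup>+ y'. ennreal (norm y') \<partial>(gaussian :: 'a measure))"
    by (simp add: nn_integral_add nn_integral_multc)
  also have "\<dots> < \<infinity>"
  proof -
    have 1: "integrable gaussian (\<lambda>y. f y * (2 + (norm y)\<^sup>2))"
      using Bochner_Integration.integrable_add[OF integrable_mult_left[OF f_int, of 2] f2] by (simp add: distrib_left mult.commute)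
    have 2: "integrable gaussian (\<lambda>y::'a. norm y)" using integrable_gaussian_norm_power[of 1] by simp
    show ?thesis using 1 2 f_int f0
      by (simp add: nn_integral_eq_integral ennreal_mult_less_top)
  qed
  finally show "(\<integral>\<^sup>+ p. ennreal (norm (K p * (1 + norm (snd p)))) \<partial>(gaussian \<Otimes>\<^sub>M gaussian)) < \<infinity>" .
qed

lemma norm_K_le: "norm (K p) \<le> norm (K p * (1 + norm (snd p)))" "norm (K p *\<^sub>R snd p) \<le> norm (K p * (1 + norm (snd p)))"
proof -
  have "K p * 1 \<le> K p * (1 + norm (snd p))" "K p * norm (snd p) \<le> K p * (1 + norm (snd p))"
    by (intro mult_left_mono K0; simp)+
  then show "norm (K p) \<le> norm (K p * (1 + norm (snd p)))" "norm (K p *\<^sub>R snd p) \<le> norm (K p * (1 + norm (snd p)))"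
    by (simp_all add: K0 abs_mult)
qed

lemma AE_integrable_K1: "AE x in gaussian. integrable gaussian (\<lambda>z. K (x, z) * (1 + norm z))"
  using gaussian_pair.AE_integrable_fst'[OF integrable_K1] by simp

lemma integrable_KD:
  assumes "integrable gaussian (\<lambda>z. K (x, z) * (1 + norm z))"
  shows "integrable gaussian (\<lambda>z. K (x, z))" "integrable gaussian (\<lambda>z. K (x, z) *\<^sub>R z)"
proof -
  show "integrable gaussian (\<lambda>z. K (x, z))"
    by (rule Bochner_Integration.integrable_bound[OF assms]) (use norm_K_le(1)[of "(x, _)"] in \<open>auto simp del: real_norm_def\<close>)
  show "integrable gaussian (\<lambda>z. K (x, z) *\<^sub>R z)"
    by (rule Bochner_Integration.integrable_bound[OF assms]) (use norm_K_le(2)[of "(x, _)"] in \<open>auto simp del: real_norm_def norm_scaleR\<close>)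
qed

text \<open>Gaussian integration by parts without any derivative of \<open>f\<close>. In the rotated
  coordinates \<open>f\<close> depends on \<open>y\<close> alone, and for fixed \<open>y\<close> the
  rest of the integrand is a divergence in \<open>y'\<close>, whose integral is zero.\<close>

lemma weak_gradient_ub: "weak_gradient ub (\<lambda>x. (c / s) *\<^sub>R Mv x)"
proof (rule weak_gradientI)
  have iK: "integrable (gaussian \<Otimes>\<^sub>M (gaussian :: 'a measure)) K"
    by (rule Bochner_Integration.integrable_bound[OF integrable_K1]) (auto intro!: always_eventually norm_K_le(1) simp del: real_norm_def)
  have "integrable (gaussian \<Otimes>\<^sub>M (gaussian :: 'a measure)) (\<lambda>(x, z). K (x, z))" using iK by (simp add: split_beta)
  from gaussian_pair.integrable_fst'[OF this[unfolded split_beta]] have "integrable gaussian ub" by (simp add: ub_def[abs_def])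
  then show "locally_integrable ub" by (rule integrable_gaussian_locally_integrable)
  have iKz: "integrable (gaussian \<Otimes>\<^sub>M (gaussian :: 'a measure)) (\<lambda>p. K p *\<^sub>R snd p)"
    by (rule Bochner_Integration.integrable_bound[OF integrable_K1]) (auto intro!: always_eventually norm_K_le(2) simp del: real_norm_def norm_scaleR)
  from gaussian_pair.integrable_fst'[OF this] have "integrable gaussian Mv" by (simp add: Mv_def[abs_def])
  then show "locally_integrable (\<lambda>x. (c / s) *\<^sub>R Mv x)" by (intro locally_integrable_scaleR integrable_gaussian_locally_integrable)
  fix \<phi> :: "'a \<Rightarrow> real" and G R and b :: 'a assume ct: "ctest \<phi> G R" and b: "b \<in> Basis"
  note [measurable] = ctest_measurable[OF ct]
  obtain B where B: "B \<ge> 0" "\<And>x. \<bar>\<phi> x\<bar> \<le> B" "\<And>x. norm (G x) \<le> B" using ctest_bounded[OF ct] by blast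
  \<comment> \<open>The integrand of the identity to be shown, both sides collected and divided by
    the density in the first variable, so that the Lebesgue integral in \<open>x\<close> becomes
    Gaussian.\<close>
  define k0 where "k0 = (\<lambda>p. ((G (fst p) \<bullet> b) + (c / s) * (snd p \<bullet> b) * \<phi> (fst p)) / gauss_density (fst p))"
  define m where "m = (2 * pi) powr (- real DIM('a) / 2) * exp (- R\<^sup>2 / 2)"
  have m: "m > 0" by (simp add: m_def)
  have k0b: "\<bar>k0 p\<bar> \<le> (B * (1 + c / s) / m) * (1 + norm (snd p))" for p
  proof (cases "norm (fst p) \<le> R")
    case True
    have "(norm (fst p))\<^sup>2 \<le> R\<^sup>2" using True by (intro power_mono) auto
    then have gm: "m \<le> gauss_density (fst p)" by (simp add: m_def gauss_density_def)
    have 1: "\<bar>G (fst p) \<bullet> b\<bar> \<le> B" using B(3)[of "fst p"] Basis_le_norm[OF b, of "G (fst p)"] by linarith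
    have "\<bar>(c / s) * (snd p \<bullet> b) * \<phi> (fst p)\<bar> = (c / s) * (\<bar>snd p \<bullet> b\<bar> * \<bar>\<phi> (fst p)\<bar>)" using c s by (simp add: abs_mult)
    also have "\<dots> \<le> (c / s) * (norm (snd p) * B)"
      using c s B Basis_le_norm[OF b, of "snd p"] by (intro mult_left_mono mult_mono) auto
    finally have 2: "\<bar>(c / s) * (snd p \<bullet> b) * \<phi> (fst p)\<bar> \<le> (c / s) * (norm (snd p) * B)" .
    have "\<bar>(G (fst p) \<bullet> b) + (c / s) * (snd p \<bullet> b) * \<phi> (fst p)\<bar> \<le> B + (c / s) * (norm (snd p) * B)"
      using 1 2 by linarith
    also have "\<dots> \<le> B * (1 + c / s) * (1 + norm (snd p))"
    proof -
      have "B + k * (N * B) \<le> B * (1 + k) * (1 + N)" if "k \<ge> 0" "N \<ge> 0" for k N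
        using mult_nonneg_nonneg[OF B(1) that(2)] mult_nonneg_nonneg[OF B(1) that(1)] by (simp add: algebra_simps)
      from this[of "c / s" "norm (snd p)"] show ?thesis using c s by auto
    qed
    finally have "\<bar>k0 p\<bar> \<le> (B * (1 + c / s) * (1 + norm (snd p))) / gauss_density (fst p)"
      unfolding k0_def using gauss_density_pos[of "fst p"] by (simp add: divide_right_mono)
    also have "\<dots> \<le> (B * (1 + c / s) * (1 + norm (snd p))) / m"
      using B(1) c s m gm by (intro divide_left_mono mult_pos_pos gauss_density_pos) auto
    finally show ?thesis by simp
  next
    case False
    then have "k0 p = 0" using ctestD(3,4)[OF ct, of "fst p"] by (simp add: k0_def)
    then show ?thesis using B(1) c s m by simp
  qed
  have [measurable]: "k0 \<in> borel_measurable (borel \<Otimes>\<^sub>M borel)" unfolding k0_def by measurable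
  have iKk: "integrable (gaussian \<Otimes>\<^sub>M (gaussian :: 'a measure)) (\<lambda>p. K p * k0 p)"
  proof (rule Bochner_Integration.integrable_bound)
    show "integrable (gaussian \<Otimes>\<^sub>M (gaussian :: 'a measure)) (\<lambda>p. (B * (1 + c / s) / m) * (K p * (1 + norm (snd p))))"
      by (rule integrable_mult_right[OF integrable_K1])
    show "AE p in gaussian \<Otimes>\<^sub>M gaussian. norm (K p * k0 p) \<le> norm ((B * (1 + c / s) / m) * (K p * (1 + norm (snd p))))"
    proof (intro always_eventually allI)
      fix p
      have "norm (K p * k0 p) = K p * \<bar>k0 p\<bar>" by (simp add: abs_mult K0)
      also have "\<dots> \<le> K p * ((B * (1 + c / s) / m) * (1 + norm (snd p)))" by (intro mult_left_mono k0b K0)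
      also have "\<dots> = norm ((B * (1 + c / s) / m) * (K p * (1 + norm (snd p))))"
        using B(1) c s m K0[of p] by (simp add: abs_mult)
      finally show "norm (K p * k0 p) \<le> norm ((B * (1 + c / s) / m) * (K p * (1 + norm (snd p))))" .
    qed
  qed measurable
  \<comment> \<open>The heart of the integration by parts: \<open>k0\<close>, in rotated coordinates
    and for fixed \<open>y\<close>, is up to the factor \<open>- s\<close> the derivative of a
    compactly supported function in the direction \<open>b\<close>.\<close>
  have inner0: "(\<integral>y'. k0 (c *\<^sub>R y - s *\<^sub>R y', s *\<^sub>R y + c *\<^sub>R y') \<partial>gaussian) = 0" for y :: 'a
  proof -
    let ?x = "\<lambda>y'. c *\<^sub>R y + (- s) *\<^sub>R y'"
    have ms: "- s \<noteq> 0" using s by simp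
    note ca = ctest_affine[OF ct ms, of "c *\<^sub>R y"]
    \<comment> \<open>The quotient of densities serves two purposes: it undoes the division in
      \<open>k0\<close>, and its logarithmic derivative produces the term linear in the noise
      \<open>s y + c y'\<close>.\<close>
    define H where "H = (\<lambda>y'. \<phi> (?x y') * (gauss_density y' / gauss_density (?x y')))"
    define GH where "GH = (\<lambda>y'. (gauss_density y' / gauss_density (?x y')) *\<^sub>R ((- s) *\<^sub>R G (?x y') + \<phi> (?x y') *\<^sub>R ((- s) *\<^sub>R ?x y' - y')))"
    have gdc: "continuous_on A (\<lambda>x. gauss_density (k x))" if "continuous_on A k" for A :: "'a set" and k :: "'a \<Rightarrow> 'a"
      unfolding gauss_density_def using that by (intro continuous_intros) auto
    have gdn: "gauss_density z \<noteq> 0" for z :: 'a using gauss_density_pos[of z] by simp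
    have cH: "ctest H GH ((R + norm (c *\<^sub>R y)) / \<bar>- s\<bar>)"
    proof (rule ctestI)
      fix y'
      have d1: "((\<lambda>y'. gauss_density (?x y')) has_derivative (\<lambda>v. - gauss_density (?x y') * (?x y' \<bullet> ((- s) *\<^sub>R v)))) (at y')"
        by (rule has_derivative_compose[OF _ gauss_density_deriv]) (auto intro!: derivative_eq_intros)
      have d2: "((\<lambda>y'. gauss_density y' / gauss_density (?x y')) has_derivative (\<lambda>v. (gauss_density y' / gauss_density (?x y')) * (((- s) *\<^sub>R ?x y' - y') \<bullet> v))) (at y')"
        by (rule has_derivative_eq_rhs[OF has_derivative_divide[OF gauss_density_deriv d1 gdn]])
          (use gdn[of "?x y'"] in \<open>simp add: fun_eq_iff field_simps inner_diff_left inner_add_left\<close>)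
      show "(H has_derivative (\<lambda>v. GH y' \<bullet> v)) (at y')"
        unfolding H_def
        by (rule has_derivative_eq_rhs[OF has_derivative_mult[OF ctestD(1)[OF ca] d2]])
          (simp add: fun_eq_iff GH_def inner_add_left inner_diff_left algebra_simps add_divide_distrib diff_divide_distrib)
    next
      show "continuous_on UNIV GH" unfolding GH_def
        by (intro continuous_intros gdc continuous_on_compose2[OF ctestD(2)[OF ct]] continuous_on_compose2[OF ctestD(5)[OF ct]]) (auto simp: gdn)
      show "H y' = 0" if "norm y' > (R + norm (c *\<^sub>R y)) / \<bar>- s\<bar>" for y'
        using ctestD(3)[OF ca that] by (simp add: H_def)
    qed
    have pt: "GH y' \<bullet> b = - s * (gauss_density y' *\<^sub>R k0 (c *\<^sub>R y - s *\<^sub>R y', s *\<^sub>R y + c *\<^sub>R y'))" for y'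
    proof -
      let ?X = "?x y'"
      have e: "(c / s) *\<^sub>R (s *\<^sub>R y + c *\<^sub>R y') = ?X + (1 / s) *\<^sub>R y'"
      proof -
        have "c\<^sup>2 = 1 - s\<^sup>2" using cs by simp
        then have "c * c / s = 1 / s - s" using s by (simp add: field_simps power2_eq_square)
        then have "(c / s) *\<^sub>R (s *\<^sub>R y + c *\<^sub>R y') = c *\<^sub>R y + (1 / s - s) *\<^sub>R y'" using s by (simp add: scaleR_add_right)
        then show ?thesis by (simp add: algebra_simps)
      qed
      have e': "(c / s) * ((s *\<^sub>R y + c *\<^sub>R y') \<bullet> b) = ?X \<bullet> b + (1 / s) * (y' \<bullet> b)"
        using arg_cong[OF e, of "\<lambda>v. v \<bullet> b"] by (simp only: inner_scaleR_left inner_add_left)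
      have x: "c *\<^sub>R y - s *\<^sub>R y' = ?X" by simp
      define q X Y g where "q = gauss_density y' / gauss_density ?X" and "X = ?X \<bullet> b" and "Y = y' \<bullet> b" and "g = G ?X \<bullet> b"
      have "GH y' \<bullet> b = q * (- s * g + \<phi> ?X * (- s * X - Y))"
        unfolding GH_def q_def X_def Y_def g_def by (simp only: inner_scaleR_left inner_add_left inner_diff_left)
      also have "\<dots> = - s * (q * (g + (X + (1 / s) * Y) * \<phi> ?X))" using s by (simp add: algebra_simps)
      also have "\<dots> = - s * (gauss_density y' *\<^sub>R k0 (c *\<^sub>R y - s *\<^sub>R y', s *\<^sub>R y + c *\<^sub>R y'))"
        unfolding k0_def fst_conv snd_conv x e' by (simp add: q_def X_def Y_def g_def)
      finally show ?thesis .
    qed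
    have "0 = (\<integral>y'. GH y' \<bullet> b \<partial>lborel)" using integral_ctest_deriv[OF cH] by simp
    also have "\<dots> = - s * (\<integral>y'. gauss_density y' *\<^sub>R k0 (c *\<^sub>R y - s *\<^sub>R y', s *\<^sub>R y + c *\<^sub>R y') \<partial>lborel)"
      unfolding pt by (rule integral_mult_right_zero)
    also have "(\<integral>y'. gauss_density y' *\<^sub>R k0 (c *\<^sub>R y - s *\<^sub>R y', s *\<^sub>R y + c *\<^sub>R y') \<partial>lborel) = (\<integral>y'. k0 (c *\<^sub>R y - s *\<^sub>R y', s *\<^sub>R y + c *\<^sub>R y') \<partial>gaussian)"
      by (rule integral_gaussian(1)[symmetric]) measurable
    finally show ?thesis using s by simp
  qed
  have cs': "c\<^sup>2 + (- s)\<^sup>2 = 1" "- s \<noteq> 0" using cs s by auto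
  have rot: "c *\<^sub>R (c *\<^sub>R y - s *\<^sub>R y') + s *\<^sub>R (c *\<^sub>R y' + s *\<^sub>R y) = y" for y y' :: 'a
  proof -
    have "c *\<^sub>R (c *\<^sub>R y - s *\<^sub>R y') + s *\<^sub>R (c *\<^sub>R y' + s *\<^sub>R y) = (c\<^sup>2 + s\<^sup>2) *\<^sub>R y" by (simp add: algebra_simps power2_eq_square)
    then show ?thesis using cs by simp
  qed
  let ?R = "\<lambda>(x, z). (c *\<^sub>R x + (- s) *\<^sub>R z, c *\<^sub>R z - (- s) *\<^sub>R x :: 'a)"
  have Rm: "?R \<in> measurable (gaussian \<Otimes>\<^sub>M gaussian) (borel \<Otimes>\<^sub>M borel)" by measurable
  have iR: "integrable (gaussian \<Otimes>\<^sub>M (gaussian :: 'a measure)) (\<lambda>p. K (?R p) * k0 (?R p))"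
    using iKk by (subst (asm) distr_gaussian_rotate[OF cs', symmetric], subst (asm) integrable_distr_eq[OF Rm]) auto
  have "(\<integral>p. K p * k0 p \<partial>(gaussian \<Otimes>\<^sub>M (gaussian :: 'a measure))) = (\<integral>p. K p * k0 p \<partial>distr (gaussian \<Otimes>\<^sub>M gaussian) (borel \<Otimes>\<^sub>M borel) ?R)"
    by (simp only: distr_gaussian_rotate[OF cs'])
  also have "\<dots> = (\<integral>p. K (?R p) * k0 (?R p) \<partial>(gaussian \<Otimes>\<^sub>M (gaussian :: 'a measure)))"
    by (rule integral_distr[OF Rm]) measurable
  also have "\<dots> = (\<integral>y. \<integral>y'. K (?R (y, y')) * k0 (?R (y, y')) \<partial>gaussian \<partial>gaussian)"
    by (rule gaussian_pair.integral_fst'[OF iR, symmetric])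
  also have "\<dots> = (\<integral>y. f y * (\<integral>y'. k0 (c *\<^sub>R y - s *\<^sub>R y', s *\<^sub>R y + c *\<^sub>R y') \<partial>gaussian) \<partial>gaussian)"
  proof -
    have "K (?R (y, y')) = f y" for y y' using rot[of y y'] by (simp add: K_def)
    then show ?thesis by (simp add: add.commute)
  qed
  also have "\<dots> = 0" by (simp add: inner0)
  finally have z: "(\<integral>p. K p * k0 p \<partial>(gaussian \<Otimes>\<^sub>M (gaussian :: 'a measure))) = 0" .
  have "0 = (\<integral>x. \<integral>z. K (x, z) * k0 (x, z) \<partial>gaussian \<partial>gaussian)"
    using gaussian_pair.integral_fst'[OF iKk] z by simp
  also have "\<dots> = (\<integral>x. (ub x * (G x \<bullet> b) + (c / s) * (Mv x \<bullet> b) * \<phi> x) / gauss_density x \<partial>gaussian)"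
  proof (rule integral_cong_AE)
    show "AE x in gaussian. (\<integral>z. K (x, z) * k0 (x, z) \<partial>gaussian) = (ub x * (G x \<bullet> b) + (c / s) * (Mv x \<bullet> b) * \<phi> x) / gauss_density x"
      using AE_integrable_K1
    proof eventually_elim
      case (elim x)
      note i = integrable_KD[OF elim]
      have "(\<integral>z. K (x, z) * k0 (x, z) \<partial>gaussian) = (\<integral>z. (G x \<bullet> b) / gauss_density x * K (x, z) + (c / s) * \<phi> x / gauss_density x * ((K (x, z) *\<^sub>R z) \<bullet> b) \<partial>gaussian)"
        by (intro Bochner_Integration.integral_cong refl) (simp add: k0_def add_divide_distrib algebra_simps)
      also have "\<dots> = (G x \<bullet> b) / gauss_density x * ub x + (c / s) * \<phi> x / gauss_density x * (Mv x \<bullet> b)"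
        unfolding ub_def Mv_def integral_inner_left[OF i(2), symmetric] using i integrable_inner_left[OF i(2), of b]
        by (subst Bochner_Integration.integral_add) auto
      finally show ?case by (simp add: add_divide_distrib algebra_simps)
    qed
  qed measurable
  also have "\<dots> = (\<integral>x. ub x * (G x \<bullet> b) + (c / s) * (Mv x \<bullet> b) * \<phi> x \<partial>lborel)"
    by (rule integral_gaussian_gi) measurable
  also have "\<dots> = (\<integral>x. ub x * (G x \<bullet> b) \<partial>lborel) + (\<integral>x. (((c / s) *\<^sub>R Mv x) \<bullet> b) * \<phi> x \<partial>lborel)"
  proof -
    have i1: "integrable lborel (\<lambda>x. (G x \<bullet> b) *\<^sub>R ub x)"
    proof (rule locally_integrable_mult[OF \<open>locally_integrable ub\<close>])
      show "\<bar>G x \<bullet> b\<bar> \<le> B" for x using B(3)[of x] Basis_le_norm[OF b, of "G x"] by linarith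
      show "G x \<bullet> b = 0" if "norm x > R" for x using ctestD(4)[OF ct that] by simp
    qed measurable
    have i2: "integrable lborel (\<lambda>x. \<phi> x *\<^sub>R ((c / s) *\<^sub>R Mv x))"
      by (rule locally_integrable_mult[OF \<open>locally_integrable (\<lambda>x. (c / s) *\<^sub>R Mv x)\<close> _ B(2)]) (use ctestD(3)[OF ct] in auto)
    have i3: "integrable lborel (\<lambda>x. (c / s) * (Mv x \<bullet> b) * \<phi> x)"
      using integrable_inner_left[OF i2, of b] by (simp add: ac_simps)
    show ?thesis using i1 i3 by (subst Bochner_Integration.integral_add) (auto simp: mult.commute)
  qed
  finally show "(\<integral>x. ub x * (G x \<bullet> b) \<partial>lborel) = - (\<integral>x. (((c / s) *\<^sub>R Mv x) \<bullet> b) * \<phi> x \<partial>lborel)" by linarith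
qed

end

subsection \<open>Entropy decomposition for the Gaussian mixture\<close>

lemma measure_eqI_nn_integral:
  fixes M N :: "'a::euclidean_space measure"
  assumes s: "sets M = sets borel" "sets N = sets borel"
    and i: "\<And>h. h \<in> borel_measurable borel \<Longrightarrow> (\<integral>\<^sup>+ x. h x \<partial>M) = (\<integral>\<^sup>+ x. h x \<partial>N)"
  shows "M = N"
proof (rule measure_eqI)
  show "sets M = sets N" using s by simp
  fix A assume "A \<in> sets M"
  then show "emeasure M A = emeasure N A" using i[of "indicator A"] s by simp
qed

text \<open>Gaussian and Lebesgue null sets coincide, and scaling preserves the latter. Hence what
  is known almost everywhere on one fibre \<open>a + s z\<close> holds almost everywhere in
  space.\<close>

lemma AE_gaussian_affineD:
  fixes a :: "'a::euclidean_space"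
  assumes [measurable]: "Measurable.pred borel P" and s: "s > 0"
    and ae: "AE z in gaussian. P (a + s *\<^sub>R z)"
  shows "AE x in gaussian. P x"
proof -
  let ?i = "\<lambda>x. indicator {x. \<not> P x} x :: ennreal"
  have "(\<integral>\<^sup>+ x. ?i x \<partial>lborel) = ennreal (s ^ DIM('a)) * (\<integral>\<^sup>+ x. ?i (a + s *\<^sub>R x) \<partial>lborel)"
    by (rule nn_integral_lborel_affine) (use s in auto)
  also have "(\<integral>\<^sup>+ x. ?i (a + s *\<^sub>R x) \<partial>lborel) = (\<integral>\<^sup>+ x. 0 \<partial>(lborel :: 'a measure))"
    using ae unfolding AE_gaussian_iff by (intro nn_integral_cong_AE) (auto simp: indicator_def elim!: eventually_mono)
  finally have "(\<integral>\<^sup>+ x. ?i x \<partial>lborel) = 0" by simp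
  then have "AE x in lborel. ?i x = 0" by (subst (asm) nn_integral_0_iff_AE) auto
  then show ?thesis unfolding AE_gaussian_iff by (auto simp: indicator_def split: if_splits elim!: eventually_mono)
qed

lemma cameron_martin:
  fixes m :: "'a::euclidean_space"
  assumes [measurable]: "h \<in> borel_measurable borel"
  shows "(\<integral>\<^sup>+ z. h (z + m) * ennreal (exp (- (z \<bullet> m) - (norm m)\<^sup>2 / 2)) \<partial>gaussian) = (\<integral>\<^sup>+ z. h z \<partial>gaussian)"
proof -
  have g: "gauss_density (m + z) = gauss_density z * exp (- (z \<bullet> m) - (norm m)\<^sup>2 / 2)" for z
  proof -
    have "(norm (m + z))\<^sup>2 = (norm z)\<^sup>2 + 2 * (z \<bullet> m) + (norm m)\<^sup>2"
      by (simp add: power2_norm_eq_inner inner_add_left inner_add_right inner_commute)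
    then have "- (norm (m + z))\<^sup>2 / 2 = - (norm z)\<^sup>2 / 2 + (- (z \<bullet> m) - (norm m)\<^sup>2 / 2)" by simp
    then show ?thesis unfolding gauss_density_def by (simp only: exp_add mult.assoc)
  qed
  have "(\<integral>\<^sup>+ z. h z \<partial>gaussian) = (\<integral>\<^sup>+ z. ennreal (gauss_density (m + z)) * h (m + z) \<partial>lborel)"
    unfolding nn_integral_gaussian[OF assms]
    by (rule nn_integral_lborel_translate[symmetric, where f = "\<lambda>z. ennreal (gauss_density z) * h z"]) measurable
  also have "\<dots> = (\<integral>\<^sup>+ z. ennreal (gauss_density z) * (h (z + m) * ennreal (exp (- (z \<bullet> m) - (norm m)\<^sup>2 / 2))) \<partial>lborel)"
    by (simp only: g) (simp add: ennreal_mult' ac_simps)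
  also have "\<dots> = (\<integral>\<^sup>+ z. h (z + m) * ennreal (exp (- (z \<bullet> m) - (norm m)\<^sup>2 / 2)) \<partial>gaussian)"
    by (rule nn_integral_gaussian[symmetric]) measurable
  finally show ?thesis by simp
qed

lemma ennreal_mult_assoc: "a \<ge> 0 \<Longrightarrow> ennreal a * (ennreal b * X) = ennreal (a * b) * X"
  by (simp add: ennreal_mult' mult.assoc)

locale gauss_mix_prob = gauss_mix +
  assumes f1: "(\<integral>x. f x \<partial>gaussian) = 1"
begin

definition good where "good x \<longleftrightarrow> integrable gaussian (\<lambda>z. K (x, z) * (1 + norm z))"

lemma AE_good: "AE x in gaussian. good x"
  unfolding good_def by (rule AE_integrable_K1)

lemma ub_nonneg: "ub x \<ge> 0"
  unfolding ub_def by (simp add: K0)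

lemma nn_integral_f: "(\<integral>\<^sup>+ x. ennreal (f x) \<partial>gaussian) = 1"
  using f_int f0 f1 by (simp add: nn_integral_eq_integral)

lemma nn_integral_K:
  assumes "good x" shows "(\<integral>\<^sup>+ z. ennreal (K (x, z)) \<partial>gaussian) = ennreal (ub x)"
  unfolding ub_def using integrable_KD(1)[OF assms[unfolded good_def]] K0 by (simp add: nn_integral_eq_integral)

text \<open>If the mean over the noise vanished at one point, \<open>f\<close> would vanish almost
  everywhere, because the noise of scale \<open>s > 0\<close> reaches the whole space. So the
  conditional laws exist at every good point.\<close>

lemma ub_pos:
  assumes g: "good x" shows "ub x > 0"
proof (rule ccontr)
  assume "\<not> ub x > 0"
  then have "ub x = 0" using ub_nonneg[of x] by simp
  then have "AE z in gaussian. K (x, z) = 0"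
    unfolding ub_def using integrable_KD(1)[OF g[unfolded good_def]] K0
    by (subst (asm) integral_nonneg_eq_0_iff_AE) auto
  then have "AE z in gaussian. f (c *\<^sub>R x + s *\<^sub>R z) = 0" by (simp add: K_def)
  then have "AE y in gaussian. f y = 0" using s by (intro AE_gaussian_affineD[where P = "\<lambda>y. f y = 0"]) auto
  then have "(\<integral>x. f x \<partial>gaussian) = (\<integral>x. 0 \<partial>(gaussian :: 'a measure))" by (intro integral_cong_AE) auto
  then show False using f1 by simp
qed

lemma nn_integral_ub_mult:
  assumes [measurable]: "h \<in> borel_measurable borel"
  shows "(\<integral>\<^sup>+ x. \<integral>\<^sup>+ z. ennreal (K (x, z)) * h (c *\<^sub>R x + s *\<^sub>R z) \<partial>gaussian \<partial>gaussian) = (\<integral>\<^sup>+ y. ennreal (f y) * h y \<partial>gaussian)"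
  unfolding K_def fst_conv snd_conv
  by (rule nn_integral_gaussian_conv[where h = "\<lambda>y. ennreal (f y) * h y", OF _ cs]) measurable

lemma nn_integral_ub: "(\<integral>\<^sup>+ x. ennreal (ub x) \<partial>gaussian) = 1"
proof -
  have "(\<integral>\<^sup>+ x. ennreal (ub x) \<partial>gaussian) = (\<integral>\<^sup>+ x. \<integral>\<^sup>+ z. ennreal (K (x, z)) * 1 \<partial>gaussian \<partial>gaussian)"
    by (intro nn_integral_cong_AE eventually_mono[OF AE_good]) (simp add: nn_integral_K)
  also have "\<dots> = 1" by (subst nn_integral_ub_mult[where h = "\<lambda>_. 1"]) (simp_all add: nn_integral_f)
  finally show ?thesis .
qed

lemma integrable_ub: "integrable gaussian ub" and integral_ub: "(\<integral>x. ub x \<partial>gaussian) = 1"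
proof -
  show "integrable gaussian ub" by (rule integrableI_nonneg) (auto simp: ub_nonneg nn_integral_ub)
  show "(\<integral>x. ub x \<partial>gaussian) = 1" by (subst integral_eq_nn_integral) (auto simp: ub_nonneg nn_integral_ub)
qed

section \<open>Conditional laws compared with translated Gaussians\<close>

definition m where "m x = (1 / ub x) *\<^sub>R Mv x"
text \<open>The density, relative to \<open>gaussian\<close>, of the standard Gaussian translated by
  \<open>m x\<close>.\<close>

definition E where "E x z = exp (m x \<bullet> z - (norm (m x))\<^sup>2 / 2)"

lemma m_meas [measurable]: "m \<in> borel_measurable borel" unfolding m_def[abs_def] by measurable

lemma E_meas [measurable]: "(\<lambda>p. E (fst p) (snd p)) \<in> borel_measurable (borel \<Otimes>\<^sub>M borel)"
  unfolding E_def by measurable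

lemma E_meas' [measurable (raw)]:
  assumes [measurable]: "k \<in> borel_measurable N" "l \<in> borel_measurable N"
  shows "(\<lambda>y. E (k y) (l y)) \<in> borel_measurable N"
  unfolding E_def by measurable

lemma E_pos: "E x z > 0" by (simp add: E_def)

lemma nn_integral_E: "(\<integral>\<^sup>+ z. ennreal (E x z) \<partial>gaussian) = 1"
  using cameron_martin[of "\<lambda>_. 1" "- m x"] by (simp add: E_def inner_commute)

text \<open>Mean relative entropies of the conditional laws, to \<open>gaussian\<close> in
  \<open>B\<close> and to the Gaussian translated by \<open>m x\<close> in \<open>D\<close>. By
  homogeneity of \<open>kent\<close> the inner integrals carry the weight \<open>ub x\<close>
  already.\<close>

definition B where "B = (\<integral>\<^sup>+ x. \<integral>\<^sup>+ z. ennreal (kent (K (x, z)) (ub x)) \<partial>gaussian \<partial>(gaussian :: 'a measure))"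
definition D where "D = (\<integral>\<^sup>+ x. \<integral>\<^sup>+ z. ennreal (kent (K (x, z)) (ub x * E x z)) \<partial>gaussian \<partial>(gaussian :: 'a measure))"
definition Q where "Q = (\<integral>\<^sup>+ x. ennreal ((norm (Mv x))\<^sup>2 / ub x) \<partial>gaussian)"
definition H where "H = (\<integral>\<^sup>+ x. ennreal (kent (f x) 1) \<partial>gaussian)"

text \<open>On each fibre the chain rule multiplies the gradient by \<open>s\<close>, hence its
  square by \<open>s\<^sup>2\<close>. Averaging over the fibres gives back a single Gaussian
  integral.\<close>

lemma B_le:
  assumes wg: "weak_gradient f g"
  shows "B \<le> ennreal (s\<^sup>2 / 2) * (\<integral>\<^sup>+ x. ennreal ((norm (g x))\<^sup>2 / f x) \<partial>gaussian)"
proof -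
  have [measurable]: "g \<in> borel_measurable borel" using weak_gradientD(2)[OF wg] by (simp add: locally_integrable_def)
  let ?J = "\<lambda>y. ennreal ((norm (g y))\<^sup>2 / f y)"
  have "B \<le> (\<integral>\<^sup>+ x. ennreal (s\<^sup>2 / 2) * (\<integral>\<^sup>+ z. ?J (c *\<^sub>R x + s *\<^sub>R z) \<partial>gaussian) \<partial>gaussian)"
    unfolding B_def
  proof (rule nn_integral_mono_AE, rule eventually_mono[OF AE_good])
    fix x assume g: "good x"
    have "(\<integral>\<^sup>+ z. ennreal (kent (K (x, z)) (ub x)) \<partial>gaussian)
      \<le> ennreal (1/2) * (\<integral>\<^sup>+ z. ennreal ((norm (s *\<^sub>R g (c *\<^sub>R x + s *\<^sub>R z)))\<^sup>2 / K (x, z)) \<partial>gaussian)"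
      using lsi_weak[OF weak_gradient_affine[OF wg s, of "c *\<^sub>R x"], of "ub x"] f0 ub_pos[OF g]
        integrable_KD(1)[OF g[unfolded good_def]] by (simp add: K_def ub_def)
    also have "\<dots> = ennreal (1/2) * (\<integral>\<^sup>+ z. ennreal (s\<^sup>2) * ?J (c *\<^sub>R x + s *\<^sub>R z) \<partial>gaussian)"
      by (simp add: K_def ennreal_mult'[symmetric] power_mult_distrib)
    also have "\<dots> = ennreal (1/2 * s\<^sup>2) * (\<integral>\<^sup>+ z. ?J (c *\<^sub>R x + s *\<^sub>R z) \<partial>gaussian)"
      by (subst nn_integral_cmult, measurable) (rule ennreal_mult_assoc, simp)
    finally show "(\<integral>\<^sup>+ z. ennreal (kent (K (x, z)) (ub x)) \<partial>gaussian)
      \<le> ennreal (s\<^sup>2 / 2) * (\<integral>\<^sup>+ z. ?J (c *\<^sub>R x + s *\<^sub>R z) \<partial>gaussian)" by simp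
  qed
  also have "\<dots> = ennreal (s\<^sup>2 / 2) * (\<integral>\<^sup>+ x. ?J x \<partial>gaussian)"
    using nn_integral_gaussian_conv[of ?J, OF _ cs] by (subst nn_integral_cmult) auto
  finally show ?thesis .
qed

lemma ub_entropy_le: "(\<integral>\<^sup>+ x. ennreal (kent (ub x) 1) \<partial>gaussian) \<le> ennreal (c\<^sup>2 / (2 * s\<^sup>2)) * Q"
proof -
  have "(\<integral>\<^sup>+ x. ennreal (kent (ub x) 1) \<partial>gaussian) \<le> ennreal (1/2) * (\<integral>\<^sup>+ x. ennreal ((norm ((c / s) *\<^sub>R Mv x))\<^sup>2 / ub x) \<partial>gaussian)"
    by (rule lsi_weak[OF weak_gradient_ub]) (auto simp: ub_nonneg integrable_ub integral_ub)
  also have "(\<integral>\<^sup>+ x. ennreal ((norm ((c / s) *\<^sub>R Mv x))\<^sup>2 / ub x) \<partial>gaussian) = (\<integral>\<^sup>+ x. ennreal ((c / s)\<^sup>2) * ennreal ((norm (Mv x))\<^sup>2 / ub x) \<partial>gaussian)"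
    by (simp add: ennreal_mult'[symmetric] power_mult_distrib power_divide)
  also have "\<dots> = ennreal ((c / s)\<^sup>2) * Q" unfolding Q_def by (rule nn_integral_cmult) measurable
  also have "ennreal (1/2) * (ennreal ((c / s)\<^sup>2) * Q) = ennreal (1/2 * (c / s)\<^sup>2) * Q"
    by (rule ennreal_mult_assoc) simp
  finally show ?thesis by (simp add: power_divide)
qed

lemma H_eq: "H = B + (\<integral>\<^sup>+ x. ennreal (kent (ub x) 1) \<partial>gaussian)"
proof -
  have "H = (\<integral>\<^sup>+ x. \<integral>\<^sup>+ z. ennreal (kent (K (x, z)) 1) \<partial>gaussian \<partial>gaussian)"
    unfolding H_def K_def fst_conv snd_conv
    by (rule nn_integral_gaussian_conv[where h = "\<lambda>y. ennreal (kent (f y) 1)", OF _ cs, symmetric]) measurable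
  also have "\<dots> = (\<integral>\<^sup>+ x. (\<integral>\<^sup>+ z. ennreal (kent (K (x, z)) (ub x)) \<partial>gaussian) + ennreal (kent (ub x) 1) \<partial>gaussian)"
  proof (rule nn_integral_cong_AE, rule eventually_mono[OF AE_good])
    fix x assume g: "good x"
    show "(\<integral>\<^sup>+ z. ennreal (kent (K (x, z)) 1) \<partial>gaussian) = (\<integral>\<^sup>+ z. ennreal (kent (K (x, z)) (ub x)) \<partial>gaussian) + ennreal (kent (ub x) 1)"
      by (rule nn_integral_kent_chain[OF prob_space_gaussian integrable_KD(1)[OF g[unfolded good_def]] _ ub_def ub_pos[OF g]]) (auto simp: K0)
  qed
  also have "\<dots> = B + (\<integral>\<^sup>+ x. ennreal (kent (ub x) 1) \<partial>gaussian)"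
    unfolding B_def by (rule nn_integral_add) measurable
  finally show ?thesis .
qed

text \<open>The logarithm of \<open>E\<close> is affine in \<open>z\<close>, so the two divergences
  differ by a function whose integral involves only the mass and the barycentre, and equals
  \<open>(norm (Mv x))\<^sup>2 / ub x / 2\<close>. There is equality when the right side is
  finite.\<close>

lemma tilt_le:
  assumes g: "good x"
  shows "(\<integral>\<^sup>+ z. ennreal (kent (K (x, z)) (ub x * E x z)) \<partial>gaussian) + ennreal (1/2) * ennreal ((norm (Mv x))\<^sup>2 / ub x)
    \<le> (\<integral>\<^sup>+ z. ennreal (kent (K (x, z)) (ub x)) \<partial>gaussian)" (is "_ \<le> ?R")
proof (cases "?R = \<infinity>")
  case False
  note up = ub_pos[OF g] and iK = integrable_KD[OF g[unfolded good_def]]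
  have k0: "kent (K (x, z)) (ub x) \<ge> 0" "kent (K (x, z)) (ub x * E x z) \<ge> 0" for z
    using K0 up E_pos by (auto intro!: kent_nonneg)
  have i1: "integrable gaussian (\<lambda>z. kent (K (x, z)) (ub x))"
    using False k0 by (intro integrableI_nonneg) (auto simp: top.not_eq_extremum)
  have iE: "integrable gaussian (E x)" by (rule integrableI_nonneg) (auto simp: E_pos less_imp_le nn_integral_E)
  have E1: "(\<integral>z. E x z \<partial>gaussian) = 1" by (subst integral_eq_nn_integral) (auto simp: E_pos less_imp_le nn_integral_E)
  define l where "l = (\<lambda>z. (K (x, z) *\<^sub>R z) \<bullet> m x - K (x, z) * ((norm (m x))\<^sup>2 / 2) + ub x - ub x * E x z)"
  have il: "integrable gaussian l" unfolding l_def using iK iE integrable_inner_left[OF iK(2), of "m x"] by simp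
  have ll: "(\<integral>z. l z \<partial>gaussian) = (norm (Mv x))\<^sup>2 / ub x / 2"
  proof -
    have "(\<integral>z. l z \<partial>gaussian) = Mv x \<bullet> m x - ub x * ((norm (m x))\<^sup>2 / 2)"
      unfolding l_def using iK iE integrable_inner_left[OF iK(2), of "m x"] integral_inner_left[OF iK(2), of "m x"]
      by (simp add: E1 ub_def[symmetric] Mv_def[symmetric])
    also have "Mv x \<bullet> m x = (norm (Mv x))\<^sup>2 / ub x" by (simp add: m_def power2_norm_eq_inner)
    also have "ub x * ((norm (m x))\<^sup>2 / 2) = (norm (Mv x))\<^sup>2 / ub x / 2"
      using up by (simp add: m_def power_divide power2_eq_square)
    finally show ?thesis by simp
  qed
  have k: "kent (K (x, z)) (ub x * E x z) = kent (K (x, z)) (ub x) - l z" for z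
  proof -
    have 1: "ln (ub x / (ub x * E x z)) = - (m x \<bullet> z - (norm (m x))\<^sup>2 / 2)"
    proof -
      have "ub x / (ub x * E x z) = inverse (E x z)" using up by (simp add: divide_inverse)
      then have "ln (ub x / (ub x * E x z)) = - ln (E x z)" using E_pos[of x z] by (simp add: ln_inverse)
      then show ?thesis by (simp add: E_def)
    qed
    have 2: "kent (K (x, z)) (ub x * E x z) = kent (K (x, z)) (ub x) + (K (x, z) * ln (ub x / (ub x * E x z)) - ub x + ub x * E x z)"
      by (rule kent_change) (use K0 up E_pos in auto)
    show ?thesis unfolding 2[unfolded 1] l_def by (simp add: algebra_simps inner_commute)
  qed
  have "(\<integral>\<^sup>+ z. ennreal (kent (K (x, z)) (ub x * E x z)) \<partial>gaussian) = ennreal (\<integral>z. kent (K (x, z)) (ub x * E x z) \<partial>gaussian)"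
    by (rule nn_integral_eq_integral) (use k0 i1 il in \<open>auto simp: k\<close>)
  also have "(\<integral>z. kent (K (x, z)) (ub x * E x z) \<partial>gaussian) = (\<integral>z. kent (K (x, z)) (ub x) \<partial>gaussian) - (norm (Mv x))\<^sup>2 / ub x / 2"
    unfolding k using i1 il by (simp add: ll)
  finally have 1: "(\<integral>\<^sup>+ z. ennreal (kent (K (x, z)) (ub x * E x z)) \<partial>gaussian) = ennreal ((\<integral>z. kent (K (x, z)) (ub x) \<partial>gaussian) - (norm (Mv x))\<^sup>2 / ub x / 2)" .
  have "(\<integral>z. kent (K (x, z)) (ub x * E x z) \<partial>gaussian) \<ge> 0" using k0 by simp
  then have p: "(\<integral>z. kent (K (x, z)) (ub x) \<partial>gaussian) - (norm (Mv x))\<^sup>2 / ub x / 2 \<ge> 0"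
    unfolding k using i1 il by (simp add: ll)
  have "?R = ennreal (\<integral>z. kent (K (x, z)) (ub x) \<partial>gaussian)" by (rule nn_integral_eq_integral) (use k0 i1 in auto)
  also have "\<dots> = (\<integral>\<^sup>+ z. ennreal (kent (K (x, z)) (ub x * E x z)) \<partial>gaussian) + ennreal ((norm (Mv x))\<^sup>2 / ub x / 2)"
    unfolding 1 using p up by (subst ennreal_plus[symmetric]) auto
  also have "ennreal ((norm (Mv x))\<^sup>2 / ub x / 2) = ennreal (1/2) * ennreal ((norm (Mv x))\<^sup>2 / ub x)"
    by (subst ennreal_mult'[symmetric]) (auto simp: mult.commute)
  finally show ?thesis by simp
qed simp

lemma D_add_Q_le: "D + ennreal (1/2) * Q \<le> B"
proof -
  have "D + ennreal (1/2) * Q = (\<integral>\<^sup>+ x. (\<integral>\<^sup>+ z. ennreal (kent (K (x, z)) (ub x * E x z)) \<partial>gaussian) + ennreal (1/2) * ennreal ((norm (Mv x))\<^sup>2 / ub x) \<partial>gaussian)"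
    unfolding D_def Q_def by (subst nn_integral_add) (auto simp: nn_integral_cmult)
  also have "\<dots> \<le> B"
    unfolding B_def by (rule nn_integral_mono_AE, rule eventually_mono[OF AE_good]) (rule tilt_le)
  finally show ?thesis .
qed

text \<open>Multiplying the entropy splitting by \<open>s\<^sup>2\<close> turns the bound for
  \<open>ub\<close> into \<open>c\<^sup>2\<close> times half of \<open>Q\<close>. Together with
  \<open>c\<^sup>2\<close> times \<open>D\<close> this is at most \<open>c\<^sup>2\<close> times
  \<open>B\<close>, and the weights of \<open>B\<close> add up to 1.\<close>

lemma deficit_bound:
  assumes wg: "weak_gradient f g"
  shows "ennreal (c\<^sup>2) * D + ennreal (s\<^sup>2) * H \<le> ennreal (s\<^sup>2 / 2) * (\<integral>\<^sup>+ x. ennreal ((norm (g x))\<^sup>2 / f x) \<partial>gaussian)"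
proof -
  have "ennreal (s\<^sup>2) * H \<le> ennreal (s\<^sup>2) * B + ennreal (s\<^sup>2) * (ennreal (c\<^sup>2 / (2 * s\<^sup>2)) * Q)"
    unfolding H_eq distrib_left using ub_entropy_le by (intro add_mono mult_left_mono) auto
  also have "ennreal (s\<^sup>2) * (ennreal (c\<^sup>2 / (2 * s\<^sup>2)) * Q) = ennreal (c\<^sup>2) * (ennreal (1/2) * Q)"
    using s by (subst (1 2) ennreal_mult_assoc) auto
  finally have "ennreal (c\<^sup>2) * D + ennreal (s\<^sup>2) * H \<le> ennreal (c\<^sup>2) * (D + ennreal (1/2) * Q) + ennreal (s\<^sup>2) * B"
    by (simp add: distrib_left add.assoc add_left_mono add.commute[of "ennreal (s\<^sup>2) * B"])
  also have "\<dots> \<le> ennreal (c\<^sup>2) * B + ennreal (s\<^sup>2) * B"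
    using D_add_Q_le by (intro add_mono mult_left_mono) auto
  also have "\<dots> = ennreal (c\<^sup>2 + s\<^sup>2) * B" by (subst ennreal_plus) (auto simp: distrib_right)
  also have "\<dots> = B" by (simp add: cs)
  also have "\<dots> \<le> ennreal (s\<^sup>2 / 2) * (\<integral>\<^sup>+ x. ennreal ((norm (g x))\<^sup>2 / f x) \<partial>gaussian)" by (rule B_le[OF wg])
  finally show ?thesis .
qed

text \<open>The conditional density recentred: \<open>F (x, z)\<close> is the density, relative to
  \<open>gaussian\<close>, of the conditional noise minus its mean \<open>m x\<close>, still
  carrying the total mass \<open>ub x\<close>.\<close>

definition F where "F p = K (fst p, snd p + m (fst p)) * exp (- (snd p \<bullet> m (fst p)) - (norm (m (fst p)))\<^sup>2 / 2)"

lemma F_meas [measurable]: "F \<in> borel_measurable (borel \<Otimes>\<^sub>M borel)" unfolding F_def[abs_def] by measurable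

lemma F0: "F p \<ge> 0" by (simp add: F_def K0)

lemma nn_integral_F_mult:
  assumes [measurable]: "h \<in> borel_measurable borel"
  shows "(\<integral>\<^sup>+ z. ennreal (F (x, z)) * h (z + m x) \<partial>gaussian) = (\<integral>\<^sup>+ z. ennreal (K (x, z)) * h z \<partial>gaussian)"
  using cameron_martin[of "\<lambda>z. ennreal (K (x, z)) * h z" "m x"]
  by (simp add: F_def ennreal_mult' K0 ac_simps)

lemma nn_integral_F:
  assumes "good x" shows "(\<integral>\<^sup>+ z. ennreal (F (x, z)) \<partial>gaussian) = ennreal (ub x)"
  using nn_integral_F_mult[of "\<lambda>_. 1" x] nn_integral_K[OF assms] by simp

text \<open>Relative entropy is invariant under translation: recentring turns the translated
  Gaussian into the standard one, and the common factor of both densities comes out of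
  \<open>kent\<close>.\<close>

lemma nn_integral_kent_F:
  "(\<integral>\<^sup>+ z. ennreal (kent (F (x, z)) (ub x)) \<partial>gaussian) = (\<integral>\<^sup>+ z. ennreal (kent (K (x, z)) (ub x * E x z)) \<partial>gaussian)"
proof -
  have "kent (F (x, z)) (ub x) = kent (K (x, z + m x)) (ub x * E x (z + m x)) * exp (- (z \<bullet> m x) - (norm (m x))\<^sup>2 / 2)" for z
  proof -
    let ?e = "exp (- (z \<bullet> m x) - (norm (m x))\<^sup>2 / 2)"
    have "E x (z + m x) * ?e = 1"
      unfolding E_def exp_add[symmetric] by (simp add: inner_add_right inner_commute power2_norm_eq_inner)
    then have "?e * (ub x * E x (z + m x)) = ub x" by (simp add: ac_simps)
    moreover have "F (x, z) = ?e * K (x, z + m x)" by (simp add: F_def)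
    ultimately have "kent (F (x, z)) (ub x) = kent (?e * K (x, z + m x)) (?e * (ub x * E x (z + m x)))" by (simp only:)
    also have "\<dots> = ?e * kent (K (x, z + m x)) (ub x * E x (z + m x))" by (rule kent_scale) simp
    finally show ?thesis by (simp only: mult.commute)
  qed
  then show ?thesis
    using cameron_martin[of "\<lambda>z. ennreal (kent (K (x, z)) (ub x * E x z))" "m x"] by (simp add: ennreal_mult'')
qed

definition \<nu> where "\<nu> = distr (density gaussian (\<lambda>x. ennreal (ub x))) borel (\<lambda>x. c *\<^sub>R x + s *\<^sub>R m x)"

lemma prob_space_\<nu>: "prob_space \<nu>"
  unfolding \<nu>_def by (intro prob_space.prob_space_distr prob_spaceI) (auto simp: emeasure_density nn_integral_ub)

lemma sets_\<nu>: "sets \<nu> = sets borel" by (simp add: \<nu>_def)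

end

lemma nn_integral_conv_measure:
  fixes N :: "'a::euclidean_space measure"
  assumes N: "prob_space N" "sets N = sets borel" and [measurable]: "h \<in> borel_measurable borel"
  shows "(\<integral>\<^sup>+ x. h x \<partial>conv_measure N gaussian) = (\<integral>\<^sup>+ y. \<integral>\<^sup>+ z. h (y + z) \<partial>gaussian \<partial>N)"
proof -
  interpret N: prob_space N by fact
  note [measurable_cong] = N(2)
  show ?thesis unfolding conv_measure_def
    by (subst nn_integral_distr, measurable) (subst gaussian.nn_integral_fst[symmetric], auto)
qed

text \<open>Given \<open>x\<close>, the recentred noise \<open>z\<close> is transported to a
  standard Gaussian \<open>R\<close>. Its law does not depend on \<open>x\<close>, so adding it to
  the point \<open>c x + s (m x)\<close> produces the convolution. Talagrand's inequality on the
  fibres bounds the cost of the transport by \<open>D\<close>.\<close>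

lemma (in gauss_mix_prob) wasserstein_le:
  "wasserstein2_sq (density gaussian (\<lambda>x. ennreal (f x))) (conv_measure \<nu> gaussian)
    \<le> ennreal (4 * s\<^sup>2) * D + ennreal (2 * (1 - s)\<^sup>2 * real DIM('a))"
proof -
  obtain R where Rm [measurable]: "R \<in> measurable (borel \<Otimes>\<^sub>M borel) borel"
    and push': "\<And>x a h. x \<in> space (borel :: 'a measure) \<Longrightarrow> a > 0 \<Longrightarrow> (\<integral>\<^sup>+ z. ennreal (F (x, z)) \<partial>gaussian) = ennreal a \<Longrightarrow> h \<in> borel_measurable borel \<Longrightarrow>
      (\<integral>\<^sup>+ z. ennreal (F (x, z)) * h (R (x, z)) \<partial>gaussian) = ennreal a * (\<integral>\<^sup>+ z. h z \<partial>gaussian)"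
    and cost': "\<And>x a. x \<in> space (borel :: 'a measure) \<Longrightarrow> a > 0 \<Longrightarrow> (\<integral>\<^sup>+ z. ennreal (F (x, z)) \<partial>gaussian) = ennreal a \<Longrightarrow>
      (\<integral>\<^sup>+ z. ennreal (F (x, z) * (norm (z - R (x, z)))\<^sup>2 / 2) \<partial>gaussian) \<le> (\<integral>\<^sup>+ z. ennreal (kent (F (x, z)) a) \<partial>gaussian)"
  proof (rule transport_gaussian[OF F_meas F0], goal_cases)
    case (1 R)
    show ?case by (rule 1(1)[OF 1(2) 1(3) 1(4)])
  qed
  have sp: "x \<in> space (borel :: 'a measure)" for x by simp
  note push = push'[OF sp] and cost = cost'[OF sp]
  \<comment> \<open>The first component restores \<open>c x + s z\<close> in the original variables
    and has law \<open>f\<close>. The second keeps the centre but uses noise of scale 1 instead of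
    \<open>s\<close>.\<close>
  define XY where "XY = (\<lambda>p. (c *\<^sub>R fst p + s *\<^sub>R (snd p + m (fst p)), c *\<^sub>R fst p + s *\<^sub>R m (fst p) + R p))"
  have XYm [measurable]: "XY \<in> measurable (borel \<Otimes>\<^sub>M borel) (borel \<Otimes>\<^sub>M borel)" unfolding XY_def by measurable
  define \<pi>0 where "\<pi>0 = density (gaussian \<Otimes>\<^sub>M (gaussian :: 'a measure)) (\<lambda>p. ennreal (F p))"
  define \<pi> where "\<pi> = distr \<pi>0 (borel \<Otimes>\<^sub>M borel) XY"
  have int: "(\<integral>\<^sup>+ p. h p \<partial>\<pi>) = (\<integral>\<^sup>+ x. \<integral>\<^sup>+ z. ennreal (F (x, z)) * h (XY (x, z)) \<partial>gaussian \<partial>gaussian)"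
    if [measurable]: "h \<in> borel_measurable (borel \<Otimes>\<^sub>M borel)" for h
  proof -
    have "(\<integral>\<^sup>+ p. h p \<partial>\<pi>) = (\<integral>\<^sup>+ p. h (XY p) \<partial>\<pi>0)" unfolding \<pi>_def \<pi>0_def by (rule nn_integral_distr) measurable
    also have "\<dots> = (\<integral>\<^sup>+ p. ennreal (F p) * h (XY p) \<partial>(gaussian \<Otimes>\<^sub>M (gaussian :: 'a measure)))" unfolding \<pi>0_def by (rule nn_integral_density) measurable
    also have "\<dots> = (\<integral>\<^sup>+ x. \<integral>\<^sup>+ z. ennreal (F (x, z)) * h (XY (x, z)) \<partial>gaussian \<partial>gaussian)"
      by (rule gaussian.nn_integral_fst[symmetric]) measurable
    finally show ?thesis .
  qed
  have X: "(\<integral>\<^sup>+ x. \<integral>\<^sup>+ z. ennreal (F (x, z)) * h (fst (XY (x, z))) \<partial>gaussian \<partial>gaussian) = (\<integral>\<^sup>+ y. ennreal (f y) * h y \<partial>gaussian)"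
    if [measurable]: "h \<in> borel_measurable borel" for h
    using nn_integral_F_mult[of "\<lambda>z. h (c *\<^sub>R _ + s *\<^sub>R z)"] nn_integral_ub_mult[OF that] by (simp add: XY_def)
  have Y: "(\<integral>\<^sup>+ x. \<integral>\<^sup>+ z. ennreal (F (x, z)) * h (snd (XY (x, z))) \<partial>gaussian \<partial>gaussian)
      = (\<integral>\<^sup>+ x. ennreal (ub x) * (\<integral>\<^sup>+ z. h ((c *\<^sub>R x + s *\<^sub>R m x) + z) \<partial>gaussian) \<partial>gaussian)"
    if [measurable]: "h \<in> borel_measurable borel" for h
  proof (rule nn_integral_cong_AE, rule eventually_mono[OF AE_good])
    fix x assume g: "good x"
    show "(\<integral>\<^sup>+ z. ennreal (F (x, z)) * h (snd (XY (x, z))) \<partial>gaussian) = ennreal (ub x) * (\<integral>\<^sup>+ z. h ((c *\<^sub>R x + s *\<^sub>R m x) + z) \<partial>gaussian)"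
      unfolding XY_def snd_conv fst_conv by (rule push[OF ub_pos[OF g] nn_integral_F[OF g]]) measurable
  qed
  have "\<pi> \<in> couplings (density gaussian (\<lambda>x. ennreal (f x))) (conv_measure \<nu> gaussian)"
    unfolding couplings_def
  proof (intro CollectI conjI)
    have "emeasure \<pi> (space \<pi>) = (\<integral>\<^sup>+ p. 1 \<partial>\<pi>)" by simp
    also have "\<dots> = 1" unfolding int[OF borel_measurable_const] using X[of "\<lambda>_. 1"] by (simp add: nn_integral_f)
    finally show "prob_space \<pi>" by (rule prob_spaceI)
    show sp: "sets \<pi> = sets (borel \<Otimes>\<^sub>M borel)" by (simp add: \<pi>_def)
    note [measurable_cong] = sp
    show "distr \<pi> borel fst = density gaussian (\<lambda>x. ennreal (f x))"
    proof (rule measure_eqI_nn_integral)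
      fix h :: "'a \<Rightarrow> ennreal" assume [measurable]: "h \<in> borel_measurable borel"
      have "(\<integral>\<^sup>+ x. h x \<partial>distr \<pi> borel fst) = (\<integral>\<^sup>+ p. h (fst p) \<partial>\<pi>)" by (rule nn_integral_distr) measurable
      also have "\<dots> = (\<integral>\<^sup>+ y. ennreal (f y) * h y \<partial>gaussian)" by (subst int) (auto simp: X)
      also have "\<dots> = (\<integral>\<^sup>+ x. h x \<partial>density gaussian (\<lambda>x. ennreal (f x)))" by (rule nn_integral_density[symmetric]) measurable
      finally show "(\<integral>\<^sup>+ x. h x \<partial>distr \<pi> borel fst) = (\<integral>\<^sup>+ x. h x \<partial>density gaussian (\<lambda>x. ennreal (f x)))" .
    qed auto
    show "distr \<pi> borel snd = conv_measure \<nu> gaussian"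
    proof (rule measure_eqI_nn_integral)
      fix h :: "'a \<Rightarrow> ennreal" assume [measurable]: "h \<in> borel_measurable borel"
      have "(\<integral>\<^sup>+ x. h x \<partial>distr \<pi> borel snd) = (\<integral>\<^sup>+ p. h (snd p) \<partial>\<pi>)" by (rule nn_integral_distr) measurable
      also have "\<dots> = (\<integral>\<^sup>+ x. ennreal (ub x) * (\<integral>\<^sup>+ z. h ((c *\<^sub>R x + s *\<^sub>R m x) + z) \<partial>gaussian) \<partial>gaussian)" by (subst int) (auto simp: Y)
      also have "\<dots> = (\<integral>\<^sup>+ x. (\<integral>\<^sup>+ z. h ((c *\<^sub>R x + s *\<^sub>R m x) + z) \<partial>gaussian) \<partial>density gaussian (\<lambda>x. ennreal (ub x)))"
        by (rule nn_integral_density[symmetric]) measurable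
      also have "\<dots> = (\<integral>\<^sup>+ y. \<integral>\<^sup>+ z. h (y + z) \<partial>gaussian \<partial>\<nu>)"
        unfolding \<nu>_def by (rule nn_integral_distr[symmetric]) measurable
      also have "\<dots> = (\<integral>\<^sup>+ x. h x \<partial>conv_measure \<nu> gaussian)"
        by (rule nn_integral_conv_measure[OF prob_space_\<nu> sets_\<nu>, symmetric]) measurable
      finally show "(\<integral>\<^sup>+ x. h x \<partial>distr \<pi> borel snd) = (\<integral>\<^sup>+ x. h x \<partial>conv_measure \<nu> gaussian)" .
    qed (auto simp: conv_measure_def)
  qed
  then have "wasserstein2_sq (density gaussian (\<lambda>x. ennreal (f x))) (conv_measure \<nu> gaussian) \<le> (\<integral>\<^sup>+ p. ennreal ((dist (fst p) (snd p))\<^sup>2) \<partial>\<pi>)"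
    unfolding wasserstein2_sq_def by (rule INF_lower)
  also have "\<dots> = (\<integral>\<^sup>+ x. \<integral>\<^sup>+ z. ennreal (F (x, z)) * ennreal ((dist (fst (XY (x, z))) (snd (XY (x, z))))\<^sup>2) \<partial>gaussian \<partial>gaussian)"
    by (rule int) measurable
  also have "\<dots> \<le> (\<integral>\<^sup>+ x. ennreal (4 * s\<^sup>2) * (\<integral>\<^sup>+ z. ennreal (kent (K (x, z)) (ub x * E x z)) \<partial>gaussian) + ennreal (2 * (1 - s)\<^sup>2 * real DIM('a)) * ennreal (ub x) \<partial>gaussian)"
  proof (rule nn_integral_mono_AE, rule eventually_mono[OF AE_good])
    fix x assume g: "good x"
    have "(\<integral>\<^sup>+ z. ennreal (F (x, z)) * ennreal ((dist (fst (XY (x, z))) (snd (XY (x, z))))\<^sup>2) \<partial>gaussian)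
      \<le> (\<integral>\<^sup>+ z. ennreal (4 * s\<^sup>2) * ennreal (F (x, z) * (norm (z - R (x, z)))\<^sup>2 / 2) + ennreal (2 * (1 - s)\<^sup>2) * (ennreal (F (x, z)) * ennreal ((norm (R (x, z)))\<^sup>2)) \<partial>gaussian)"
    proof (rule nn_integral_mono)
      fix z
      let ?r = "R (x, z)"
      have "fst (XY (x, z)) - snd (XY (x, z)) = s *\<^sub>R (z - ?r) - (1 - s) *\<^sub>R ?r" by (simp add: XY_def algebra_simps)
      then have "(dist (fst (XY (x, z))) (snd (XY (x, z))))\<^sup>2 = (norm (s *\<^sub>R (z - ?r) - (1 - s) *\<^sub>R ?r))\<^sup>2" by (simp add: dist_norm)
      \<comment> \<open>The difference splits into the transport displacement, scaled by
        \<open>s\<close>, and the change of noise scale. The parallelogram identity gives the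
        factors 2; the first becomes 4 because the transport bound is for half the squared
        distance.\<close>
      also have "\<dots> \<le> 2 * (norm (s *\<^sub>R (z - ?r)))\<^sup>2 + 2 * (norm ((1 - s) *\<^sub>R ?r))\<^sup>2"
      proof -
        have "(norm (u - v))\<^sup>2 + (norm (u + v))\<^sup>2 = 2 * (norm u)\<^sup>2 + 2 * (norm v)\<^sup>2" for u v :: 'a
          by (simp add: power2_norm_eq_inner inner_add_left inner_add_right inner_diff_left inner_diff_right)
        then show ?thesis using zero_le_power2 by (smt (verit))
      qed
      also have "\<dots> = 2 * s\<^sup>2 * (norm (z - ?r))\<^sup>2 + 2 * (1 - s)\<^sup>2 * (norm ?r)\<^sup>2" by (simp add: power_mult_distrib)
      finally have "F (x, z) * (dist (fst (XY (x, z))) (snd (XY (x, z))))\<^sup>2 \<le> F (x, z) * (2 * s\<^sup>2 * (norm (z - ?r))\<^sup>2 + 2 * (1 - s)\<^sup>2 * (norm ?r)\<^sup>2)"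
        using F0 by (intro mult_left_mono)
      also have "\<dots> = 4 * s\<^sup>2 * (F (x, z) * (norm (z - ?r))\<^sup>2 / 2) + 2 * (1 - s)\<^sup>2 * (F (x, z) * (norm ?r)\<^sup>2)" by (simp add: algebra_simps)
      finally have "ennreal (F (x, z) * (dist (fst (XY (x, z))) (snd (XY (x, z))))\<^sup>2) \<le> ennreal (4 * s\<^sup>2 * (F (x, z) * (norm (z - ?r))\<^sup>2 / 2) + 2 * (1 - s)\<^sup>2 * (F (x, z) * (norm ?r)\<^sup>2))"
        by (rule ennreal_leI)
      then show "ennreal (F (x, z)) * ennreal ((dist (fst (XY (x, z))) (snd (XY (x, z))))\<^sup>2)
        \<le> ennreal (4 * s\<^sup>2) * ennreal (F (x, z) * (norm (z - ?r))\<^sup>2 / 2) + ennreal (2 * (1 - s)\<^sup>2) * (ennreal (F (x, z)) * ennreal ((norm ?r)\<^sup>2))"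
        by (simp only: ennreal_mult ennreal_plus F0 zero_le_power2 mult_nonneg_nonneg divide_nonneg_nonneg zero_le_numeral)
    qed
    also have "\<dots> = ennreal (4 * s\<^sup>2) * (\<integral>\<^sup>+ z. ennreal (F (x, z) * (norm (z - R (x, z)))\<^sup>2 / 2) \<partial>gaussian) + ennreal (2 * (1 - s)\<^sup>2) * (\<integral>\<^sup>+ z. ennreal (F (x, z)) * ennreal ((norm (R (x, z)))\<^sup>2) \<partial>gaussian)"
      by (subst nn_integral_add) (auto simp: nn_integral_cmult)
    also have "(\<integral>\<^sup>+ z. ennreal (F (x, z)) * ennreal ((norm (R (x, z)))\<^sup>2) \<partial>gaussian) = ennreal (ub x) * (\<integral>\<^sup>+ z. ennreal ((norm z)\<^sup>2) \<partial>(gaussian :: 'a measure))"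
      by (rule push[OF ub_pos[OF g] nn_integral_F[OF g]]) measurable
    also have "(\<integral>\<^sup>+ z. ennreal ((norm z)\<^sup>2) \<partial>(gaussian :: 'a measure)) = ennreal (real DIM('a))"
      using integrable_gaussian_norm_power[of 2] by (subst nn_integral_eq_integral) (auto simp: integral_gaussian_norm_sq)
    also have "ennreal (4 * s\<^sup>2) * (\<integral>\<^sup>+ z. ennreal (F (x, z) * (norm (z - R (x, z)))\<^sup>2 / 2) \<partial>gaussian)
      \<le> ennreal (4 * s\<^sup>2) * (\<integral>\<^sup>+ z. ennreal (kent (K (x, z)) (ub x * E x z)) \<partial>gaussian)"
      unfolding nn_integral_kent_F[symmetric] by (intro mult_left_mono cost ub_pos[OF g] nn_integral_F[OF g]) auto
    also have "ennreal (2 * (1 - s)\<^sup>2) * (ennreal (ub x) * ennreal (real DIM('a))) = ennreal (2 * (1 - s)\<^sup>2 * real DIM('a)) * ennreal (ub x)"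
      by (subst ennreal_mult[of "2 * (1 - s)\<^sup>2" "real DIM('a)"]) (auto simp: ac_simps)
    finally show "(\<integral>\<^sup>+ z. ennreal (F (x, z)) * ennreal ((dist (fst (XY (x, z))) (snd (XY (x, z))))\<^sup>2) \<partial>gaussian)
      \<le> ennreal (4 * s\<^sup>2) * (\<integral>\<^sup>+ z. ennreal (kent (K (x, z)) (ub x * E x z)) \<partial>gaussian) + ennreal (2 * (1 - s)\<^sup>2 * real DIM('a)) * ennreal (ub x)"
      by (simp add: add_right_mono)
  qed
  also have "\<dots> = ennreal (4 * s\<^sup>2) * D + ennreal (2 * (1 - s)\<^sup>2 * real DIM('a))"
    unfolding D_def by (subst nn_integral_add) (auto simp: nn_integral_cmult nn_integral_ub)
  finally show ?thesis .
qed

subsection \<open>The deficit inequality\<close>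

lemma nn_integral_exp_gaussian: "(\<integral>\<^sup>+ y. ennreal (exp (a \<bullet> y - (norm a)\<^sup>2 / 2)) \<partial>(gaussian :: 'a::euclidean_space measure)) = 1"
  using cameron_martin[of "\<lambda>_. 1" "- a"] by (simp add: inner_commute)

lemma density_exp_gaussian:
  fixes a :: "'a::euclidean_space"
  shows "density gaussian (\<lambda>y. ennreal (exp (a \<bullet> y - (norm a)\<^sup>2 / 2))) = conv_measure (return borel a) gaussian"
proof (rule measure_eqI_nn_integral)
  fix h :: "'a \<Rightarrow> ennreal" assume [measurable]: "h \<in> borel_measurable borel"
  have "(\<integral>\<^sup>+ y. h y \<partial>density gaussian (\<lambda>y. ennreal (exp (a \<bullet> y - (norm a)\<^sup>2 / 2))))
    = (\<integral>\<^sup>+ y. ennreal (exp (a \<bullet> y - (norm a)\<^sup>2 / 2)) * h y \<partial>gaussian)"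
    by (rule nn_integral_density) measurable
  also have "\<dots> = (\<integral>\<^sup>+ z. h (a + z) \<partial>gaussian)"
    using cameron_martin[of "\<lambda>z. h (a + z)" "- a"] by (simp add: inner_commute mult.commute)
  also have "\<dots> = (\<integral>\<^sup>+ y. \<integral>\<^sup>+ z. h (y + z) \<partial>gaussian \<partial>return borel a)"
    by (rule nn_integral_return[symmetric, where g = "\<lambda>y. \<integral>\<^sup>+ z. h (y + z) \<partial>gaussian"]) simp_all
  also have "\<dots> = (\<integral>\<^sup>+ x. h x \<partial>conv_measure (return borel a) gaussian)"
    by (rule nn_integral_conv_measure[symmetric]) (auto intro: prob_space_return)
  finally show "(\<integral>\<^sup>+ x. h x \<partial>density gaussian (\<lambda>y. ennreal (exp (a \<bullet> y - (norm a)\<^sup>2 / 2)))) = (\<integral>\<^sup>+ x. h x \<partial>conv_measure (return borel a) gaussian)" .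
qed (auto simp: conv_measure_def)

text \<open>A single fibre suffices: if its divergence vanishes, then \<open>f\<close> on that fibre
  is an exponential of an affine function, and since \<open>c x + s z\<close> runs through the whole
  space this determines \<open>f\<close> almost everywhere.\<close>

lemma (in gauss_mix_prob) D_eq_0D:
  assumes "D = 0"
  obtains a where "density gaussian (\<lambda>x. ennreal (f x)) = conv_measure (return borel a) gaussian"
proof -
  have "AE x in gaussian. (\<integral>\<^sup>+ z. ennreal (kent (K (x, z)) (ub x * E x z)) \<partial>gaussian) = 0"
    using assms unfolding D_def by (subst (asm) nn_integral_0_iff_AE) auto
  with AE_good have ae: "AE x in gaussian. good x \<and> (\<integral>\<^sup>+ z. ennreal (kent (K (x, z)) (ub x * E x z)) \<partial>gaussian) = 0"
    by (rule AE_conjI)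
  have "\<exists>x. good x \<and> (\<integral>\<^sup>+ z. ennreal (kent (K (x, z)) (ub x * E x z)) \<partial>gaussian) = 0"
  proof (rule ccontr)
    assume nex: "\<nexists>x. good x \<and> (\<integral>\<^sup>+ z. ennreal (kent (K (x, z)) (ub x * E x z)) \<partial>gaussian) = 0"
    have "AE x in (gaussian :: 'a measure). False" using ae by eventually_elim (use nex in blast)
    then show False using gaussian.AE_False by blast
  qed
  then obtain x where g: "good x" and z: "(\<integral>\<^sup>+ z. ennreal (kent (K (x, z)) (ub x * E x z)) \<partial>gaussian) = 0" by blast
  note up = ub_pos[OF g]
  \<comment> \<open>Substituting \<open>z = (y - c x) / s\<close> into the exponent of
    \<open>E\<close> gives the slope \<open>m x / s\<close> in \<open>y\<close>.\<close>
  define a where "a = (1 / s) *\<^sub>R m x"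
  define C where "C = ub x * exp (- (m x \<bullet> ((c / s) *\<^sub>R x)) - (norm (m x))\<^sup>2 / 2)"
  have C: "C > 0" using up by (simp add: C_def)
  have fe: "ub x * E x w = C * exp (a \<bullet> (c *\<^sub>R x + s *\<^sub>R w))" for w
  proof -
    have "a \<bullet> (c *\<^sub>R x + s *\<^sub>R w) = m x \<bullet> ((c / s) *\<^sub>R x) + m x \<bullet> w" using s by (simp add: a_def inner_add_right)
    then show ?thesis unfolding C_def E_def by (simp add: exp_add[symmetric] algebra_simps)
  qed
  have "AE z in gaussian. ennreal (kent (K (x, z)) (ub x * E x z)) = 0" using z by (subst (asm) nn_integral_0_iff_AE) auto
  then have "AE z in gaussian. f (c *\<^sub>R x + s *\<^sub>R z) = C * exp (a \<bullet> (c *\<^sub>R x + s *\<^sub>R z))"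
  proof eventually_elim
    case (elim z)
    have "kent (K (x, z)) (ub x * E x z) \<ge> 0" using K0 up E_pos by (intro kent_nonneg) auto
    then have k: "kent (K (x, z)) (ub x * E x z) = 0" using elim by (simp add: ennreal_eq_0_iff)
    have "K (x, z) = ub x * E x z" by (rule kent_eq_0D[OF K0 mult_pos_pos[OF up E_pos] k])
    then show ?case by (simp add: fe K_def)
  qed
  then have fC: "AE y in gaussian. f y = C * exp (a \<bullet> y)"
    using s by (intro AE_gaussian_affineD[where P = "\<lambda>y. f y = C * exp (a \<bullet> y)"]) auto
  \<comment> \<open>The constant relative to the normalised exponential density; as \<open>f\<close>
    has mass 1, it must be 1.\<close>
  define k where "k = C * exp ((norm a)\<^sup>2 / 2)"
  have k: "C * exp (a \<bullet> y) = k * exp (a \<bullet> y - (norm a)\<^sup>2 / 2)" for y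
    unfolding k_def by (simp add: exp_diff)
  have k0: "k \<ge> 0" using C by (simp add: k_def)
  have "1 = (\<integral>\<^sup>+ y. ennreal (f y) \<partial>gaussian)" by (simp add: nn_integral_f)
  also have "\<dots> = (\<integral>\<^sup>+ y. ennreal k * ennreal (exp (a \<bullet> y - (norm a)\<^sup>2 / 2)) \<partial>gaussian)"
    using fC by (intro nn_integral_cong_AE) (auto simp: k ennreal_mult'' elim!: eventually_mono)
  also have "\<dots> = ennreal k" by (subst nn_integral_cmult) (simp_all add: nn_integral_exp_gaussian)
  finally have k1: "k = 1" using k0 by simp
  have "density gaussian (\<lambda>x. ennreal (f x)) = density gaussian (\<lambda>y. ennreal (exp (a \<bullet> y - (norm a)\<^sup>2 / 2)))"
    by (rule density_cong) (use fC in \<open>auto simp: k k1 elim!: eventually_mono\<close>)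
  then show thesis using that[of a] by (simp add: density_exp_gaussian)
qed

text \<open>The deficit inequality is exported after multiplication by \<open>2 / s\<^sup>2\<close>,
  so that the Fisher integral stands alone on the right and the infimum over weak gradients can be
  taken.\<close>

lemma gaussian_mixture_bound:
  fixes f :: "'a::euclidean_space \<Rightarrow> real"
  assumes "f \<in> borel_measurable borel" "\<And>x. f x \<ge> 0" "integrable gaussian f" "integrable gaussian (\<lambda>x. (norm x)\<^sup>2 * f x)"
    and "(\<integral>x. f x \<partial>gaussian) = 1" and c: "c > 0" and s: "s > 0" and "c\<^sup>2 + s\<^sup>2 = 1"
  obtains \<nu> D where "prob_space \<nu>" "sets \<nu> = sets borel"
    "wasserstein2_sq (density gaussian (\<lambda>x. ennreal (f x))) (conv_measure \<nu> gaussian) \<le> ennreal (4 * s\<^sup>2) * D + ennreal (2 * (1 - s)\<^sup>2 * real DIM('a))"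
    "\<And>g. weak_gradient f g \<Longrightarrow> ennreal (2 * c\<^sup>2 / s\<^sup>2) * D + ennreal 2 * (\<integral>\<^sup>+ x. ennreal (kent (f x) 1) \<partial>gaussian) \<le> (\<integral>\<^sup>+ x. ennreal ((norm (g x))\<^sup>2 / f x) \<partial>gaussian)"
    "D = 0 \<Longrightarrow> \<exists>a. density gaussian (\<lambda>x. ennreal (f x)) = conv_measure (return borel a) gaussian"
proof -
  interpret gauss_mix_prob f c s by unfold_locales fact+
  show thesis
  proof (rule that)
    show "prob_space \<nu>" by (rule prob_space_\<nu>)
    show "sets \<nu> = sets borel" by (rule sets_\<nu>)
    show "wasserstein2_sq (density gaussian (\<lambda>x. ennreal (f x))) (conv_measure \<nu> gaussian) \<le> ennreal (4 * s\<^sup>2) * D + ennreal (2 * (1 - s)\<^sup>2 * real DIM('a))"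
      by (rule wasserstein_le)
    show "\<exists>a. density gaussian (\<lambda>x. ennreal (f x)) = conv_measure (return borel a) gaussian" if "D = 0"
      using D_eq_0D[OF that] by blast
    fix g assume "weak_gradient f g"
    from mult_left_mono[OF deficit_bound[OF this], of "ennreal (2 / s\<^sup>2)"]
    have le: "ennreal (2 / s\<^sup>2) * (ennreal (c\<^sup>2) * D + ennreal (s\<^sup>2) * H) \<le> ennreal (2 / s\<^sup>2) * (ennreal (s\<^sup>2 / 2) * (\<integral>\<^sup>+ x. ennreal ((norm (g x))\<^sup>2 / f x) \<partial>gaussian))" by simp
    show "ennreal (2 * c\<^sup>2 / s\<^sup>2) * D + ennreal 2 * (\<integral>\<^sup>+ x. ennreal (kent (f x) 1) \<partial>gaussian) \<le> (\<integral>\<^sup>+ x. ennreal ((norm (g x))\<^sup>2 / f x) \<partial>gaussian)"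
    proof -
      have e: "0 \<le> 2 / s\<^sup>2" by simp
      have "2 / s\<^sup>2 * c\<^sup>2 = 2 * c\<^sup>2 / s\<^sup>2" "2 / s\<^sup>2 * s\<^sup>2 = 2" "2 / s\<^sup>2 * (s\<^sup>2 / 2) = 1" using s by simp_all
      then show ?thesis using le unfolding distrib_left ennreal_mult_assoc[OF e] H_def by (simp only: ennreal_1 mult_1)
    qed
  qed
qed

section \<open>Explicit couplings and numerical constants\<close>

lemma wasserstein2_sq_refl:
  fixes M :: "'a::euclidean_space measure"
  assumes M: "prob_space M" "sets M = sets borel"
  shows "wasserstein2_sq M M = 0"
proof -
  interpret M: prob_space M by fact
  note [measurable_cong] = M(2)
  define \<pi> where "\<pi> = distr M (borel \<Otimes>\<^sub>M borel) (\<lambda>x. (x, x))"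
  have "\<pi> \<in> couplings M M"
    unfolding couplings_def \<pi>_def using M(2)
    by (auto simp: distr_distr comp_def distr_id2 intro!: M.prob_space_distr)
  then have "wasserstein2_sq M M \<le> (\<integral>\<^sup>+ p. ennreal ((dist (fst p) (snd p))\<^sup>2) \<partial>\<pi>)"
    unfolding wasserstein2_sq_def by (rule INF_lower)
  also have "\<dots> = 0" unfolding \<pi>_def by (subst nn_integral_distr) auto
  finally show ?thesis by simp
qed

text \<open>The coupling adds an independent standard Gaussian to the first variable, whose mean
  squared norm is the dimension. It serves the regime of large deficit.\<close>

lemma wasserstein2_sq_conv_gaussian:
  fixes M :: "'a::euclidean_space measure"
  assumes M: "prob_space M" "sets M = sets borel"
  shows "wasserstein2_sq M (conv_measure M gaussian) \<le> ennreal (real DIM('a))"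
proof -
  interpret M: prob_space M by fact
  interpret P: pair_prob_space M "(gaussian :: 'a measure)" ..
  note [measurable_cong] = M(2)
  define \<pi> where "\<pi> = distr (M \<Otimes>\<^sub>M (gaussian :: 'a measure)) (borel \<Otimes>\<^sub>M borel) (\<lambda>p. (fst p, fst p + snd p))"
  have "distr \<pi> borel fst = M"
  proof (rule measure_eqI_nn_integral)
    fix h :: "'a \<Rightarrow> ennreal" assume [measurable]: "h \<in> borel_measurable borel"
    have "(\<integral>\<^sup>+ x. h x \<partial>distr \<pi> borel fst) = (\<integral>\<^sup>+ p. h (fst p) \<partial>(M \<Otimes>\<^sub>M (gaussian :: 'a measure)))"
      unfolding \<pi>_def by (simp add: nn_integral_distr)
    also have "\<dots> = (\<integral>\<^sup>+ x. h x \<partial>M)" by (subst gaussian.nn_integral_fst[symmetric]) simp_all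
    finally show "(\<integral>\<^sup>+ x. h x \<partial>distr \<pi> borel fst) = (\<integral>\<^sup>+ x. h x \<partial>M)" .
  qed (auto simp: M(2))
  moreover have "distr \<pi> borel snd = conv_measure M gaussian"
    unfolding \<pi>_def conv_measure_def by (simp add: distr_distr comp_def case_prod_beta')
  moreover have "prob_space \<pi>" unfolding \<pi>_def by (rule P.prob_space_distr) measurable
  ultimately have "\<pi> \<in> couplings M (conv_measure M gaussian)"
    unfolding couplings_def by (simp add: \<pi>_def)
  then have "wasserstein2_sq M (conv_measure M gaussian) \<le> (\<integral>\<^sup>+ p. ennreal ((dist (fst p) (snd p))\<^sup>2) \<partial>\<pi>)"
    unfolding wasserstein2_sq_def by (rule INF_lower)
  also have "\<dots> = (\<integral>\<^sup>+ p. ennreal ((norm (snd p))\<^sup>2) \<partial>(M \<Otimes>\<^sub>M (gaussian :: 'a measure)))"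
    unfolding \<pi>_def by (subst nn_integral_distr) (auto simp: dist_norm)
  also have "\<dots> = (\<integral>\<^sup>+ x. \<integral>\<^sup>+ z. ennreal ((norm z)\<^sup>2) \<partial>(gaussian :: 'a measure) \<partial>M)"
    by (subst gaussian.nn_integral_fst[symmetric]) simp_all
  also have "(\<integral>\<^sup>+ z. ennreal ((norm z)\<^sup>2) \<partial>(gaussian :: 'a measure)) = ennreal (real DIM('a))"
    using integrable_gaussian_norm_power[of 2] by (subst nn_integral_eq_integral) (auto simp: integral_gaussian_norm_sq)
  finally show ?thesis by (simp add: M.emeasure_space_1)
qed

text \<open>With \<open>s = sqrt (1 - t)\<close> the left side is
  \<open>2 * n * (s ^ 4 * t\<^sup>2 + (1 - s)\<^sup>2)\<close>. Since
  \<open>t = (1 - s) * (1 + s)\<close>, the last square is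
  \<open>t\<^sup>2 / (1 + s)\<^sup>2\<close>, at most \<open>t\<^sup>2 * (5/4 - s)\<close>. Bounding
  \<open>s ^ 4\<close> by \<open>s\<close> cancels the \<open>- s\<close> and leaves
  \<open>2.5 * n * t\<^sup>2\<close>, just below the square of
  \<open>1.6 * sqrt n * t\<close>.\<close>

lemma mixture_constant:
  assumes t: "0 < t" "t < 1" and n: "n \<ge> (0::real)"
  shows "4 * (1 - t) * ((1 - t) / t * (n * t ^ 3 / 2)) + 2 * (1 - sqrt (1 - t))\<^sup>2 * n \<le> (1.6 * sqrt n * t)\<^sup>2"
proof -
  define s where "s = sqrt (1 - t)"
  have s: "0 < s" "s \<le> 1" "s\<^sup>2 = 1 - t" using t by (simp_all add: s_def)
  have ts: "t = (1 - s) * (1 + s)" using s(3) by (simp add: algebra_simps power2_eq_square)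
  have p: "s\<^sup>2 \<le> s" "s ^ 3 \<le> s" "s ^ 4 \<le> s" using power_decreasing[of 1 2 s] power_decreasing[of 1 3 s] power_decreasing[of 1 4 s] s(1,2) by auto
  have "(5 - 4 * s) * (1 + s)\<^sup>2 = 5 + 6 * s - 3 * s\<^sup>2 - 4 * s ^ 3" by (simp add: algebra_simps power2_eq_square power3_eq_cube)
  then have q4: "4 \<le> (5 - 4 * s) * (1 + s)\<^sup>2" using p s(2) by linarith
  have "(5/4 - s) * X = ((5 - 4 * s) * X) / 4" for X by (simp add: field_simps)
  from this[of "(1 + s)\<^sup>2"] q4 have q: "1 \<le> (5/4 - s) * (1 + s)\<^sup>2" by linarith
  then have r: "1 / (1 + s)\<^sup>2 \<le> 5/4 - s" using s(1) by (simp add: divide_le_eq)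
  have "(1 - s)\<^sup>2 = t\<^sup>2 * (1 / (1 + s)\<^sup>2)" using s(1) by (simp add: ts power_mult_distrib)
  also have "\<dots> \<le> t\<^sup>2 * (5/4 - s)" using r by (rule mult_left_mono) simp
  finally have "(1 - s)\<^sup>2 \<le> t\<^sup>2 * (5/4 - s)" .
  moreover have "s ^ 4 * t\<^sup>2 \<le> s * t\<^sup>2" using p(3) by (rule mult_right_mono) simp
  ultimately have "s ^ 4 * t\<^sup>2 + (1 - s)\<^sup>2 \<le> 5/4 * t\<^sup>2" by (simp add: algebra_simps)
  then have "2 * n * (s ^ 4 * t\<^sup>2 + (1 - s)\<^sup>2) \<le> 2 * n * (5/4 * t\<^sup>2)" using n by (intro mult_left_mono) auto
  also have "\<dots> \<le> (1.6 * sqrt n * t)\<^sup>2"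
  proof -
    have "2.5 * (n * t\<^sup>2) \<le> 2.56 * (n * t\<^sup>2)" using n by (intro mult_right_mono) auto
    then show ?thesis using n by (simp add: power_mult_distrib power_divide)
  qed
  finally have "2 * n * (s ^ 4 * t\<^sup>2 + (1 - s)\<^sup>2) \<le> (1.6 * sqrt n * t)\<^sup>2" .
  moreover have "4 * (1 - t) * ((1 - t) / t * (n * t ^ 3 / 2)) + 2 * (1 - s)\<^sup>2 * n = 2 * n * (s ^ 4 * t\<^sup>2 + (1 - s)\<^sup>2)"
  proof -
    have s4: "s ^ 4 = (1 - t)\<^sup>2" unfolding s(3)[symmetric] by simp
    show ?thesis unfolding s4 using t by (simp add: field_simps power2_eq_square power3_eq_cube)
  qed
  ultimately show ?thesis by (simp add: s_def)
qed

text \<open>The cube of 1.6 is 4.096, and 4.096 / 15 is below 1/2; the factor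
  \<open>n * sqrt n\<close> loses its root to the denominator.\<close>

lemma wasserstein_cube_le:
  assumes w: "w \<le> (1.6 * sqrt n * t)\<^sup>2" and t: "t \<ge> 0" and n: "n > (0::real)"
  shows "1 / 15 * sqrt w ^ 3 / sqrt n \<le> n * t ^ 3 / 2"
proof -
  have "sqrt w \<le> 1.6 * sqrt n * t" using w t n by (intro real_le_lsqrt) auto
  moreover have "- (1.6 * sqrt n * t) \<le> 0" using t n by simp
  ultimately have "sqrt w ^ 3 \<le> (1.6 * sqrt n * t) ^ 3"
    by (intro power_mono_odd) auto
  also have "\<dots> = 4.096 * (n * sqrt n) * t ^ 3" using n by (simp add: power_mult_distrib power3_eq_cube)
  finally have "1 / 15 * sqrt w ^ 3 / sqrt n \<le> 1 / 15 * (4.096 * (n * sqrt n) * t ^ 3) / sqrt n"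
    using n by (intro divide_right_mono mult_left_mono) auto
  also have "\<dots> = 4.096 / 15 * (n * t ^ 3)" using n by simp
  also have "\<dots> \<le> 1 / 2 * (n * t ^ 3)" using n t by (intro mult_right_mono) auto
  finally show ?thesis by simp
qed

text \<open>The finiteness clause protects the inequality from the convention that
  \<open>enn2real\<close> sends infinity to 0. Finite Fisher information forces finite entropy along
  the way, so the Bochner integral behind \<open>rel_entropy\<close> has its intended value.\<close>

theorem theorem4:
  fixes \<mu> :: "'a::euclidean_space measure"
  assumes "prob_space \<mu>" and "sets \<mu> = sets borel"
    and "(\<integral>\<^sup>+ x. ennreal ((norm x)\<^sup>2) \<partial>\<mu>) < \<infinity>"
    and "fisher_information \<mu> < \<infinity>"
  shows "\<exists>\<nu> :: 'a measure. prob_space \<nu> \<and> sets \<nu> = sets borel \<and>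
           wasserstein2_sq \<mu> (conv_measure \<nu> gaussian) < \<infinity> \<and>
           lsi_deficit \<mu> \<ge> (1/15) * (sqrt (enn2real (wasserstein2_sq \<mu> (conv_measure \<nu> gaussian)))) ^ 3
                               / sqrt (real DIM('a)) \<and>
           (lsi_deficit \<mu> = 0 \<longrightarrow> (\<exists>a. \<nu> = return borel a))"
proof -
  interpret \<mu>: prob_space \<mu> by fact
  define f where "f = (\<lambda>x. enn2real (RN_deriv gaussian \<mu> x))"
  define I where "I = fisher_information \<mu>"
  have ac: "absolutely_continuous gaussian \<mu>"
    using assms(4) unfolding fisher_information_def by (auto split: if_splits)
  then have Ieq: "I = (INF g \<in> {g. weak_gradient f g}. \<integral>\<^sup>+ x. ennreal ((norm (g x))\<^sup>2 / (f x)\<^sup>2) \<partial>\<mu>)"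
    using assms(2) by (simp add: I_def fisher_information_def f_def)
  have fm [measurable]: "f \<in> borel_measurable borel" unfolding f_def using borel_measurable_RN_deriv[of "(gaussian :: 'a measure)" \<mu>] by simp
  have f0: "f x \<ge> 0" for x by (simp add: f_def)
  have dr: "density gaussian (RN_deriv gaussian \<mu>) = \<mu>" using gaussian.density_RN_deriv[OF ac] assms(2) by simp
  have rm [measurable]: "RN_deriv gaussian \<mu> \<in> borel_measurable (gaussian :: 'a measure)" by simp
  have r1: "(\<integral>\<^sup>+ x. RN_deriv gaussian \<mu> x \<partial>gaussian) = 1"
  proof -
    have "(\<integral>\<^sup>+ x. RN_deriv gaussian \<mu> x \<partial>gaussian) = emeasure (density gaussian (RN_deriv gaussian \<mu>)) UNIV"
      by (subst emeasure_density) auto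
    then show ?thesis using \<mu>.emeasure_space_1 assms(2) by (simp add: dr sets_eq_imp_space_eq[OF assms(2)])
  qed
  have "AE x in gaussian. RN_deriv gaussian \<mu> x \<noteq> \<infinity>" by (rule nn_integral_PInf_AE[OF rm]) (simp add: r1)
  then have fr: "AE x in gaussian. ennreal (f x) = RN_deriv gaussian \<mu> x"
    by eventually_elim (simp add: f_def ennreal_enn2real_if)
  have \<mu>eq: "density gaussian (\<lambda>x. ennreal (f x)) = \<mu>"
    using fr by (subst dr[symmetric], intro density_cong) auto
  have int\<mu>: "(\<integral>\<^sup>+ x. h x \<partial>\<mu>) = (\<integral>\<^sup>+ x. ennreal (f x) * h x \<partial>gaussian)" if "h \<in> borel_measurable borel" for h
    unfolding \<mu>eq[symmetric] using that by (intro nn_integral_density) auto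
  have nf: "(\<integral>\<^sup>+ x. ennreal (f x) \<partial>gaussian) = 1" using r1 nn_integral_cong_AE[OF fr] by simp
  have fi: "integrable gaussian f" by (rule integrableI_nonneg) (auto simp: f0 nf)
  have f1: "(\<integral>x. f x \<partial>gaussian) = 1" by (subst integral_eq_nn_integral) (auto simp: f0 nf)
  have f2: "integrable gaussian (\<lambda>x. (norm x)\<^sup>2 * f x)"
    using assms(3) by (intro integrableI_nonneg) (auto simp: f0 int\<mu> ennreal_mult'' mult.commute)
  define H where "H = (\<integral>\<^sup>+ x. ennreal (kent (f x) 1) \<partial>gaussian)"
  \<comment> \<open>Integration against \<open>\<mu>\<close> supplies a factor \<open>f\<close>,
    which cancels one power in \<open>(f x)\<^sup>2\<close>. A bound valid for every weak gradient
    passes to the infimum.\<close>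
  have Ige: "X \<le> I" if "\<And>g. weak_gradient f g \<Longrightarrow> X \<le> (\<integral>\<^sup>+ x. ennreal ((norm (g x))\<^sup>2 / f x) \<partial>gaussian)" for X
    unfolding Ieq
  proof (rule INF_greatest, clarsimp)
    fix g assume wg: "weak_gradient f g"
    have [measurable]: "g \<in> borel_measurable borel" using weak_gradientD(2)[OF wg] by (simp add: locally_integrable_def)
    have "(\<integral>\<^sup>+ x. ennreal ((norm (g x))\<^sup>2 / (f x)\<^sup>2) \<partial>\<mu>) = (\<integral>\<^sup>+ x. ennreal ((norm (g x))\<^sup>2 / f x) \<partial>gaussian)"
      by (subst int\<mu>) (auto simp: ennreal_mult''[symmetric] power2_eq_square f0 intro!: nn_integral_cong)
    then show "X \<le> (\<integral>\<^sup>+ x. ennreal ((norm (g x))\<^sup>2 / (f x)\<^sup>2) \<partial>\<mu>)" using that[OF wg] by simp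
  qed
  have Ifin: "I < \<infinity>" using assms(4) by (simp add: I_def)
  let ?\<delta> = "lsi_deficit \<mu>" and ?n = "real DIM('a)"
  \<comment> \<open>Here \<open>t\<close> stands for \<open>c\<^sup>2\<close> and
    \<open>1 - t\<close> for \<open>s\<^sup>2\<close>, and the extended numbers have been replaced
    by reals, which is possible because the Fisher information is finite.\<close>
  have mix: "\<exists>\<nu> D. prob_space \<nu> \<and> sets \<nu> = sets borel \<and> D \<ge> 0 \<and>
      wasserstein2_sq \<mu> (conv_measure \<nu> gaussian) \<le> ennreal (4 * (1 - t) * D + 2 * (1 - sqrt (1 - t))\<^sup>2 * ?n) \<and>
      2 * t / (1 - t) * D + 2 * enn2real H \<le> enn2real I \<and> H < \<infinity> \<and>
      (D = 0 \<longrightarrow> (\<exists>a. \<mu> = conv_measure (return borel a) gaussian))" if t: "0 < t" "t < 1" for t :: real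
  proof -
    have t': "sqrt t > 0" "sqrt (1 - t) > 0" "(sqrt t)\<^sup>2 + (sqrt (1 - t))\<^sup>2 = 1" and sq: "(sqrt (1 - t))\<^sup>2 = 1 - t" "(sqrt t)\<^sup>2 = t"
      using t by simp_all
    obtain \<nu> D where \<nu>: "prob_space \<nu>" "sets \<nu> = sets (borel :: 'a measure)"
      and W: "wasserstein2_sq \<mu> (conv_measure \<nu> gaussian) \<le> ennreal (4 * (1 - t)) * D + ennreal (2 * (1 - sqrt (1 - t))\<^sup>2 * ?n)"
      and DH: "\<And>g. weak_gradient f g \<Longrightarrow> ennreal (2 * t / (1 - t)) * D + ennreal 2 * H \<le> (\<integral>\<^sup>+ x. ennreal ((norm (g x))\<^sup>2 / f x) \<partial>gaussian)"
      and D0: "D = 0 \<Longrightarrow> \<exists>a. \<mu> = conv_measure (return borel a) gaussian"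
      using gaussian_mixture_bound[OF fm f0 fi f2 f1 t', unfolded \<mu>eq sq H_def[symmetric]] by blast
    have le: "ennreal (2 * t / (1 - t)) * D + ennreal 2 * H \<le> I" by (rule Ige[OF DH])
    then have "ennreal (2 * t / (1 - t)) * D + ennreal 2 * H < \<infinity>" using Ifin by (rule le_less_trans)
    then have p: "ennreal (2 * t / (1 - t)) * D < \<infinity>" "ennreal 2 * H < \<infinity>" by auto
    have fk: "X < \<infinity>" if "ennreal k * X < \<infinity>" "k > 0" for k X
      using that by (auto simp: ennreal_mult_less_top ennreal_eq_0_iff)
    have fin: "D < \<infinity>" "H < \<infinity>" using fk[OF p(1)] fk[OF p(2)] t by simp_all
    obtain d where d: "D = ennreal d" "d \<ge> 0" using fin(1) by (cases D) auto
    obtain h where h: "H = ennreal h" "h \<ge> 0" using fin(2) by (cases H) auto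
    obtain i where i: "I = ennreal i" "i \<ge> 0" using Ifin by (cases I) auto
    have c0: "0 \<le> 2 * t / (1 - t)" using t by simp
    have "ennreal (2 * t / (1 - t) * d + 2 * h) \<le> ennreal i"
      using le unfolding d(1) h(1) i(1)
      by (simp only: ennreal_plus[OF mult_nonneg_nonneg[OF c0 d(2)] mult_nonneg_nonneg[OF zero_le_numeral h(2)]]
        ennreal_mult'[OF c0] ennreal_mult'[OF zero_le_numeral])
    then have ineq: "2 * t / (1 - t) * d + 2 * h \<le> i" using i by (simp add: ennreal_le_iff)
    have "ennreal (4 * (1 - t)) * D + ennreal (2 * (1 - sqrt (1 - t))\<^sup>2 * ?n) = ennreal (4 * (1 - t) * d + 2 * (1 - sqrt (1 - t))\<^sup>2 * ?n)"
      using d t by (simp add: ennreal_mult ennreal_plus)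
    then show ?thesis using \<nu> W D0 d h i fin ineq by (intro exI[of _ \<nu>] exI[of _ d]) simp
  qed
  have Hfin: "H < \<infinity>" using mix[of "1/2"] by auto
  have KL: "rel_entropy \<mu> = enn2real H"
  proof -
    have k0: "kent (f x) 1 \<ge> 0" for x using f0 by (intro kent_nonneg) auto
    have ik: "integrable gaussian (\<lambda>x. kent (f x) 1)" using Hfin k0 by (intro integrableI_nonneg) (auto simp: H_def)
    have "rel_entropy \<mu> = (\<integral>x. f x * log (exp 1) (f x) \<partial>gaussian)"
      unfolding rel_entropy_def \<mu>eq[symmetric] by (rule gaussian.KL_density) (auto simp: f0)
    \<comment> \<open>The correction \<open>f x - 1\<close> integrates to zero since
      \<open>f\<close> has mass 1.\<close>
    also have "\<dots> = (\<integral>x. kent (f x) 1 + (f x - 1) \<partial>gaussian)"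
      by (intro Bochner_Integration.integral_cong) (auto simp: kent_def log_def)
    also have "\<dots> = (\<integral>x. kent (f x) 1 \<partial>gaussian)" using ik fi by (simp add: f1)
    also have "\<dots> = enn2real H" unfolding H_def using k0 by (intro integral_eq_nn_integral) auto
    finally show ?thesis .
  qed
  have \<delta>: "?\<delta> = enn2real I / 2 - enn2real H" by (simp add: lsi_deficit_def KL I_def)
  have Dle: "d \<le> (1 - t) / t * ?\<delta>" if "0 < t" "t < 1" "2 * t / (1 - t) * d + 2 * enn2real H \<le> enn2real I" for t d
  proof -
    have "t / (1 - t) * d \<le> ?\<delta>" using that(3) unfolding \<delta> by simp
    then have "(1 - t) / t * (t / (1 - t) * d) \<le> (1 - t) / t * ?\<delta>" using that by (intro mult_left_mono) auto
    then show ?thesis using that by simp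
  qed
  \<comment> \<open>Any admissible parameter proves the deficit nonnegative, as \<open>d\<close> is;
    \<open>1/2\<close> is a convenient choice.\<close>
  obtain d where "d \<ge> 0" "2 * (1/2) / (1 - 1/2) * d + 2 * enn2real H \<le> enn2real I" using mix[of "1/2"] by auto
  then have \<delta>0: "?\<delta> \<ge> 0" unfolding \<delta> by simp
  have n: "?n \<ge> 1" using DIM_positive[where 'a='a] by linarith
  \<comment> \<open>The choice of \<open>t\<close> below requires \<open>0 < t\<close> and
    \<open>t < 1\<close>, that is a deficit strictly between 0 and \<open>?n / 2\<close>. The two
    excluded ranges are treated separately.\<close>
  consider "?\<delta> \<ge> ?n / 2" | "?\<delta> = 0" | "0 < ?\<delta>" "?\<delta> < ?n / 2" using \<delta>0 by linarith
  then show ?thesis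
  proof cases
    case 1
    have W: "wasserstein2_sq \<mu> (conv_measure \<mu> gaussian) \<le> ennreal ?n" by (rule wasserstein2_sq_conv_gaussian) fact+
    then have "enn2real (wasserstein2_sq \<mu> (conv_measure \<mu> gaussian)) \<le> ?n" by (intro enn2real_leI) auto
    then have "enn2real (wasserstein2_sq \<mu> (conv_measure \<mu> gaussian)) \<le> (1.6 * sqrt ?n * 1)\<^sup>2"
      by (rule order_trans) (simp add: power_mult_distrib power_divide)
    from wasserstein_cube_le[OF this] have "1 / 15 * sqrt (enn2real (wasserstein2_sq \<mu> (conv_measure \<mu> gaussian))) ^ 3 / sqrt ?n \<le> ?\<delta>"
      using n 1 by simp
    then show ?thesis using assms(1,2) W 1 n by (intro exI[of _ \<mu>]) (auto intro: le_less_trans)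
  next
    case 2
    obtain d where d: "d \<ge> 0" "2 * (1/2) / (1 - 1/2) * d + 2 * enn2real H \<le> enn2real I"
      "d = 0 \<longrightarrow> (\<exists>a. \<mu> = conv_measure (return borel a) gaussian)" using mix[of "1/2"] by auto
    \<comment> \<open>At a fixed \<open>t\<close> the bound
      \<open>d \<le> (1 - t) / t * ?\<delta>\<close> forces \<open>d\<close> to vanish with the
      deficit, so \<open>\<mu>\<close> is a translated Gaussian and the distance is 0.\<close>
    have "d = 0" using Dle[of "1/2" d] d 2 by simp
    then obtain a where a: "\<mu> = conv_measure (return borel a) gaussian" using d by blast
    have "wasserstein2_sq \<mu> (conv_measure (return borel a) gaussian) = 0"
      unfolding a[symmetric] by (rule wasserstein2_sq_refl) fact+
    then show ?thesis using 2 by (intro exI[of _ "return borel a"]) (auto intro: prob_space_return)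
  next
    case 3
    \<comment> \<open>This balances the two error terms: with
      \<open>?\<delta> = ?n * t ^ 3 / 2\<close>, the transport term
      \<open>(1 - t)\<^sup>2 / t * ?\<delta>\<close> and the rescaling term
      \<open>(1 - sqrt (1 - t))\<^sup>2 * ?n\<close> are both of order \<open>?n * t\<^sup>2\<close>
      for small \<open>t\<close>.\<close>
    define t where "t = root 3 (2 * ?\<delta> / ?n)"
    have t: "0 < t" "t < 1" using 3 n by (auto simp: t_def)
    have "t ^ 3 = 2 * ?\<delta> / ?n" unfolding t_def using 3 n by (intro real_root_pow_pos2) auto
    then have \<delta>t: "?\<delta> = ?n * t ^ 3 / 2" using n by simp
    obtain \<nu> d where \<nu>: "prob_space \<nu>" "sets \<nu> = sets borel" "d \<ge> 0"
      and W: "wasserstein2_sq \<mu> (conv_measure \<nu> gaussian) \<le> ennreal (4 * (1 - t) * d + 2 * (1 - sqrt (1 - t))\<^sup>2 * ?n)"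
      and d: "2 * t / (1 - t) * d + 2 * enn2real H \<le> enn2real I" using mix[OF t] by blast
    have "enn2real (wasserstein2_sq \<mu> (conv_measure \<nu> gaussian)) \<le> 4 * (1 - t) * d + 2 * (1 - sqrt (1 - t))\<^sup>2 * ?n"
      using W t \<nu>(3) by (intro enn2real_leI) auto
    also have "\<dots> \<le> 4 * (1 - t) * ((1 - t) / t * ?\<delta>) + 2 * (1 - sqrt (1 - t))\<^sup>2 * ?n"
      using Dle[OF t d] t by (intro add_mono mult_left_mono) auto
    also have "\<dots> \<le> (1.6 * sqrt ?n * t)\<^sup>2" unfolding \<delta>t by (rule mixture_constant[OF t]) simp
    finally have "1 / 15 * sqrt (enn2real (wasserstein2_sq \<mu> (conv_measure \<nu> gaussian))) ^ 3 / sqrt ?n \<le> ?\<delta>"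
      unfolding \<delta>t using t n by (intro wasserstein_cube_le) auto
    then show ?thesis using \<nu> W 3 by (intro exI[of _ \<nu>]) (auto intro: le_less_trans)
  qed
qed

end
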